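(* The ladder shifts in $N$ and the deformation equations are compatible (with $K=1,\dots,d_1+1$, $J=1,\dots,d_2+1$) in each of the following cases: (1) the shifts $N\mapsto N+1$ given by $\mathbf\Psi_{N+1}=\mathbf a_N\mathbf\Psi_N$ and the sequence of equations $$\partial_{u_K}\mathbf\Psi_N=\mathbf U_K^{N,\Psi}\mathbf\Psi_N,\qquad \partial_{v_J}\mathbf\Psi_N=-\mathbf V_J^{N,\Psi}\mathbf\Psi_N,\qquad N\ge d_2+1;$$ (2) the shifts $N\mapsto N-1$ given by $\underline{\mathbf\Psi}^{N-1}=\underline{\mathbf\Psi}^N\underline{\mathbf b}^N$ and the sequence of equations $$\partial_{u_K}\underline{\mathbf\Psi}^{N-1}=\underline{\mathbf\Psi}^{N-1}\underline{\mathbf U}_K^{N,\Psi},\qquad \partial_{v_J}\underline{\mathbf\Psi}^{N-1}=-\underline{\mathbf\Psi}^{N-1}\underline{\mathbf V}_J^{N,\Psi},\qquad N\ge1;$$ (3) the shifts $N\mapsto N+1$ given by $\mathbf\Phi_{N+1}=\mathbf b_N\mathbf\Phi_N$ and the sequence of equations $$\partial_{u_K}\mathbf\Phi_N=-\mathbf U_K^{N,\Phi}\mathbf\Phi_N,\qquad \partial_{v_J}\mathbf\Phi_N=\mathbf V_J^{N,\Phi}\mathbf\Phi_N,\qquad N\ge d_1+1;$$ (4) the shifts $N\mapsto N-1$ given by $\underline{\mathbf\Phi}^{N-1}=\underline{\mathbf\Phi}^N\underline{\mathbf a}^N$ and the sequence of equations $$\partial_{u_K}\underline{\mathbf\Phi}^{N-1}=-\underline{\mathbf\Phi}^{N-1}\underline{\mathbf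 U}_K^{N,\Phi},\qquad \partial_{v_J}\underline{\mathbf\Phi}^{N-1}=\underline{\mathbf\Phi}^{N-1}\underline{\mathbf V}_J^{N,\Phi},\qquad N\ge1.$$ Here $\mathbf\Psi_N,\underline{\mathbf\Phi}^{N-1}$ are $(d_2+1)\times(d_2+1)$ and $\mathbf\Phi_N,\underline{\mathbf\Psi}^{N-1}$ are $(d_1+1)\times(d_1+1)$.
   Context: **Setting.** Fix integers $d_1,d_2\ge1$ and $V_1(x)=\sum_{K=1}^{d_1+1}\frac{u_K}{K}x^K$, $V_2(y)=\sum_{J=1}^{d_2+1}\frac{v_J}{J}y^J$ with $u_{d_1+1}\ne0$, $v_{d_2+1}\ne0$, and contours $\Gamma_x,\Gamma_y$ such that all integrals below converge and integrations by parts produce no boundary terms. Assume there are monic polynomials $\pi_n,\sigma_n$ of degree $n$ ($n\ge0$) with $\int_{\Gamma_x}\int_{\Gamma_y}\pi_n(x)\sigma_m(y)e^{-V_1(x)-V_2(y)+xy}\,dy\,dx=h_n\delta_{nm}$, $h_n\neq0$. The coefficients $u_K,v_J$ are regarded as smoothly varying deformation parameters. Put $\psi_n(x)=\pi_n(x)e^{-V_1(x)}/\sqrt{h_n}$. **Compatible** means: admitting a basis of simultaneous solutions, i.e. a sequence of simultaneous fundamental (invertible matrix) solutions. **Recursion coefficients.** There are unique numbers $\alpha_j(n)$ ($-1\le j\le d_2$), $\beta_j(n)$ ($-1\le j\le d_1$), with $\alpha_{-1}(n)=\beta_{-1}(n)=\gamma(n)=\sqrt{h_{n+1}/h_n}$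 and $\alpha_j(n)=\beta_j(n)=0$ for $n<j$, such that (terms with negative index omitted) $x\psi_n=\sum_{j=-1}^{d_2}\alpha_j(n)\psi_{n-j}$ and $\partial_x\psi_n=-\sum_{j=-1}^{d_1}\beta_j(n+j)\psi_{n+j}$. Moreover $\alpha_{d_2}(n)\ne0$ ($n\ge d_2$) and $\beta_{d_1}(n)\neq0$ ($n\ge d_1$). Let $Q,P$ be the (finite band) semi-infinite matrices (indices $\ge0$) with $x\psi_n=\sum_mQ_{nm}\psi_m$, $\partial_x\psi_n=\sum_mP_{nm}\psi_m$. **Ladder matrices.** $\mathbf a_N(x)$ ($N\ge d_2$) is the $(d_2+1)\times(d_2+1)$ matrix with $1$'s on the first superdiagonal, last row $\frac1{\gamma(N)}(-\alpha_{d_2}(N),\dots,-\alpha_1(N),x-\alpha_0(N))$, other entries $0$; $\mathbf b_N(y)$ ($N\ge d_1$) is the $(d_1+1)\times(d_1+1)$ matrix with $1$'s on the first superdiagonal, last row $\frac1{\gamma(N)}(-\beta_{d_1}(N),\dots,-\beta_1(N),y-\beta_0(N))$, other entries $0$. Write $\mathbf a^N=\mathbf a_N^{-1}$, $\mathbf b^N=\mathbf b_N^{-1}$. $\underline{\mathbf a}^N(x)$ is the $(d_2+1)\times(d_2+1)$ matrix with $1$'s on the first superdiagonal, first column $\frac1{\gamma(N-1)}(x-\alpha_0(N),-\alpha_1(N+1),\dots,-\alpha_{d_2}(N+d_2))^t$, other entries $0$; $\underline{\mathbf b}^N(y)$ is the $(d_1+1)\times(d_1+1)$ matrix with $1$'s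 on the first superdiagonal, first column $\frac1{\gamma(N-1)}(y-\beta_0(N),-\beta_1(N+1),\dots,-\beta_{d_1}(N+d_1))^t$, other entries $0$. Write $\underline{\mathbf a}_N=(\underline{\mathbf a}^N)^{-1}$, $\underline{\mathbf b}_N=(\underline{\mathbf b}^N)^{-1}$. **Deformation matrices.** $U^K:=-\frac1K\{(Q^K)_{>0}+\frac12(Q^K)_0\}$, $V^J:=-\frac1J\{((-P^t)^J)_{>0}+\frac12((-P^t)^J)_0\}$ ($>0$: strictly upper triangular part; $0$: diagonal part), $U^K_j(n)=(U^K)_{n,n+j}$, $V^J_j(n)=(V^J)_{n,n+j}$. Write $U^K_j[p;d]=\mathrm{diag}(U^K_j(p),\dots,U^K_j(p+d))$ and similarly $V^J_j[p;d]$. Empty products are $\mathbf 1$. Then $\mathbf U_K^{N,\Psi}=\sum_{j=0}^KU^K_j[N-d_2;d_2]\,\mathbf a_{N+j-1}\cdots\mathbf a_N$; $\mathbf V_J^{N,\Psi}=\sum_{j=0}^JV^J_j[N-d_2-j;d_2]\,\mathbf a^{N-j}\cdots\mathbf a^{N-1}$; $\underline{\mathbf U}_K^{N,\Psi}=\sum_{j=0}^K\underline{\mathbf b}_N\cdots\underline{\mathbf b}_{N+j-1}\,U^K_j[N-1;d_1]$; $\underline{\mathbf V}_J^{N,\Psi}=\sum_{j=0}^J\underline{\mathbf b}^{N-1}\cdots\underline{\mathbf b}^{N-j}\,V^J_j[N-1-j;d_1]$; $\mathbf U_K^{N,\Phi}=\sum_{j=0}^KU^K_j[N-j-d_1;d_1]\,\mathbf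 b^{N-j}\cdots\mathbf b^{N-1}$; $\mathbf V_J^{N,\Phi}=\sum_{j=0}^JV^J_j[N-d_1;d_1]\,\mathbf b_{N+j-1}\cdots\mathbf b_N$; $\underline{\mathbf U}_K^{N,\Phi}=\sum_{j=0}^K\underline{\mathbf a}^{N-1}\cdots\underline{\mathbf a}^{N-j}\,U^K_j[N-1-j;d_2]$; $\underline{\mathbf V}_J^{N,\Phi}=\sum_{j=0}^J\underline{\mathbf a}_N\cdots\underline{\mathbf a}_{N+j-1}\,V^J_j[N-1;d_2]$.
   Formalization: The equations with V_J^{N,Ψ}, U_K^{N,Φ} and underlined V_J^{N,Ψ}, U_K^{N,Φ} are claimed for N≥d_2+J, N≥d_1+K, N≥J+1, N≥K+1 only; for smaller N these matrices are undefined (singular a_M, b_M or negative indices). Parameters range over a simply connected open domain. *)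

theory Defs
  imports
    "HOL-Analysis.Analysis"
    "HOL-Computational_Algebra.Polynomial"
    "Jordan_Normal_Form.Gauss_Jordan_Elimination"
begin

section \<open>Deformation parameters\<close>

text \<open>A parameter point is a pair \<open>(u, v)\<close> of coefficient families. Only \<open>u K\<close> with
  \<open>1 \<le> K \<le> d1 + 1\<close> and \<open>v J\<close> with \<open>1 \<le> J \<le> d2 + 1\<close> are parameters; all other entries
  are pinned to \<open>0\<close>, so that \<open>param_space d1 d2\<close>, as a subspace of the product topology,
  is a copy of \<open>\<complex>\<^sup>d\<^sup>1\<^sup>+\<^sup>1 \<times> \<complex>\<^sup>d\<^sup>2\<^sup>+\<^sup>1\<close>.\<close>

type_synonym params = "(nat \<Rightarrow> complex) \<times> (nat \<Rightarrow> complex)"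

definition param_space :: "nat \<Rightarrow> nat \<Rightarrow> params set" where
  "param_space d1 d2 =
    {(u, v). (\<forall>k. k \<notin> {1..d1 + 1} \<longrightarrow> u k = 0) \<and> (\<forall>k. k \<notin> {1..d2 + 1} \<longrightarrow> v k = 0)}"

definition param_domain :: "nat \<Rightarrow> nat \<Rightarrow> params set \<Rightarrow> bool" where
  "param_domain d1 d2 D \<longleftrightarrow>
     openin (top_of_set (param_space d1 d2)) D \<and> simply_connected D \<and>
     (\<forall>(u, v)\<in>D. u (d1 + 1) \<noteq> 0 \<and> v (d2 + 1) \<noteq> 0)"

definition potential :: "nat \<Rightarrow> (nat \<Rightarrow> complex) \<Rightarrow> complex \<Rightarrow> complex" where
  "potential d c z = (\<Sum>k = 1..d + 1. c k / of_nat k * z ^ k)"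

section \<open>Contours, bilinear pairing and biorthogonal polynomials\<close>

text \<open>Contours may run to infinity, so they are parametrised by the whole real line.\<close>

definition contour :: "(real \<Rightarrow> complex) \<Rightarrow> bool" where
  "contour \<Gamma> \<longleftrightarrow> (\<forall>a b. a < b \<longrightarrow> \<Gamma> piecewise_C1_differentiable_on {a..b})"

definition contour_int :: "(real \<Rightarrow> complex) \<Rightarrow> (complex \<Rightarrow> complex) \<Rightarrow> complex" where
  "contour_int \<Gamma> f = (LINT s|lborel. f (\<Gamma> s) * vector_derivative \<Gamma> (at s))"

definition weight :: "nat \<Rightarrow> nat \<Rightarrow> params \<Rightarrow> complex \<Rightarrow> complex \<Rightarrow> complex" where
  "weight d1 d2 w x y = exp (- potential d1 (fst w) x - potential d2 (snd w) y + x * y)"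

definition pairing ::
  "nat \<Rightarrow> nat \<Rightarrow> (real \<Rightarrow> complex) \<Rightarrow> (real \<Rightarrow> complex) \<Rightarrow> params
     \<Rightarrow> complex poly \<Rightarrow> complex poly \<Rightarrow> complex" where
  "pairing d1 d2 \<Gamma>x \<Gamma>y w p q =
     contour_int \<Gamma>x (\<lambda>x. contour_int \<Gamma>y (\<lambda>y. poly p x * poly q y * weight d1 d2 w x y))"

definition convergent_integrals ::
  "nat \<Rightarrow> nat \<Rightarrow> (real \<Rightarrow> complex) \<Rightarrow> (real \<Rightarrow> complex) \<Rightarrow> params \<Rightarrow> bool" where
  "convergent_integrals d1 d2 \<Gamma>x \<Gamma>y w \<longleftrightarrow>
     (\<forall>p q :: complex poly. integrable (lborel \<Otimes>\<^sub>M lborel)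
        (\<lambda>(s, t). poly p (\<Gamma>x s) * poly q (\<Gamma>y t) * weight d1 d2 w (\<Gamma>x s) (\<Gamma>y t)
           * vector_derivative \<Gamma>x (at s) * vector_derivative \<Gamma>y (at t)))"

text \<open>The integral of a total derivative along either contour vanishes.\<close>

definition no_boundary_terms ::
  "nat \<Rightarrow> nat \<Rightarrow> (real \<Rightarrow> complex) \<Rightarrow> (real \<Rightarrow> complex) \<Rightarrow> params \<Rightarrow> bool" where
  "no_boundary_terms d1 d2 \<Gamma>x \<Gamma>y w \<longleftrightarrow> (\<forall>p q :: complex poly.
     contour_int \<Gamma>x (\<lambda>x. contour_int \<Gamma>y (\<lambda>y.
       deriv (\<lambda>\<xi>. poly p \<xi> * poly q y * weight d1 d2 w \<xi> y) x)) = 0 \<and>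
     contour_int \<Gamma>x (\<lambda>x. contour_int \<Gamma>y (\<lambda>y.
       deriv (\<lambda>\<eta>. poly p x * poly q \<eta> * weight d1 d2 w x \<eta>) y)) = 0)"

definition monic_biorthogonal ::
  "nat \<Rightarrow> nat \<Rightarrow> (real \<Rightarrow> complex) \<Rightarrow> (real \<Rightarrow> complex) \<Rightarrow> params
     \<Rightarrow> (nat \<Rightarrow> complex poly) \<Rightarrow> (nat \<Rightarrow> complex poly) \<Rightarrow> (nat \<Rightarrow> complex) \<Rightarrow> bool" where
  "monic_biorthogonal d1 d2 \<Gamma>x \<Gamma>y w \<pi> \<sigma> h \<longleftrightarrow>
     (\<forall>n. degree (\<pi> n) = n \<and> lead_coeff (\<pi> n) = 1 \<and>
          degree (\<sigma> n) = n \<and> lead_coeff (\<sigma> n) = 1 \<and> h n \<noteq> 0) \<and>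
     (\<forall>n m. pairing d1 d2 \<Gamma>x \<Gamma>y w (\<pi> n) (\<sigma> m) = (if n = m then h n else 0))"

text \<open>Here \<open>r n\<close> stands for the chosen square root of \<open>h n\<close>.\<close>

definition quasi_poly ::
  "nat \<Rightarrow> params \<Rightarrow> (nat \<Rightarrow> complex poly) \<Rightarrow> (nat \<Rightarrow> complex) \<Rightarrow> nat \<Rightarrow> complex \<Rightarrow> complex" where
  "quasi_poly d1 w \<pi> r n x = poly (\<pi> n) x * exp (- potential d1 (fst w) x) / r n"

section \<open>Recursion coefficients\<close>

text \<open>The coefficients \<open>\<alpha>\<^sub>j(n)\<close>, \<open>\<beta>\<^sub>j(n)\<close> are \<open>\<alpha> j n\<close>, \<open>\<beta> j n\<close> with an integer index
  \<open>j \<ge> -1\<close>. The ratio \<open>r (n + 1) / r n\<close> is \<open>\<gamma>(n)\<close>.\<close>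

definition recursion_coeffs ::
  "nat \<Rightarrow> nat \<Rightarrow> (nat \<Rightarrow> complex \<Rightarrow> complex) \<Rightarrow> (nat \<Rightarrow> complex)
     \<Rightarrow> (int \<Rightarrow> nat \<Rightarrow> complex) \<Rightarrow> (int \<Rightarrow> nat \<Rightarrow> complex) \<Rightarrow> bool" where
  "recursion_coeffs d1 d2 \<psi> r \<alpha> \<beta> \<longleftrightarrow>
     (\<forall>n. \<alpha> (-1) n = r (n + 1) / r n \<and> \<beta> (-1) n = r (n + 1) / r n) \<and>
     (\<forall>n. \<forall>j\<in>{0..int d2}. int n < j \<longrightarrow> \<alpha> j n = 0) \<and>
     (\<forall>n. \<forall>j\<in>{0..int d1}. int n < j \<longrightarrow> \<beta> j n = 0) \<and>
     (\<forall>n x. x * \<psi> n x = (\<Sum>j | j \<in> {-1..int d2} \<and> 0 \<le> int n - j.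
                           \<alpha> j n * \<psi> (nat (int n - j)) x)) \<and>
     (\<forall>n x. (\<psi> n has_field_derivative
               - (\<Sum>j | j \<in> {-1..int d1} \<and> 0 \<le> int n + j.
                     \<beta> j (nat (int n + j)) * \<psi> (nat (int n + j)) x)) (at x))"

text \<open>Since \<open>\<psi>\<close> is linearly independent, the recursions determine the semi-infinite matrices
  \<open>Q\<close> and \<open>P\<close>.\<close>

definition Q_mat :: "nat \<Rightarrow> (int \<Rightarrow> nat \<Rightarrow> complex) \<Rightarrow> nat \<Rightarrow> nat \<Rightarrow> complex" where
  "Q_mat d2 \<alpha> n m = (if int n - int m \<in> {-1..int d2} then \<alpha> (int n - int m) n else 0)"

definition P_mat :: "nat \<Rightarrow> (int \<Rightarrow> nat \<Rightarrow> complex) \<Rightarrow> nat \<Rightarrow> nat \<Rightarrow> complex" where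
  "P_mat d1 \<beta> n m = (if int m - int n \<in> {-1..int d1} then - \<beta> (int m - int n) m else 0)"

text \<open>Powers of a row-finite semi-infinite matrix.\<close>

fun semi_inf_pow :: "(nat \<Rightarrow> nat \<Rightarrow> complex) \<Rightarrow> nat \<Rightarrow> nat \<Rightarrow> nat \<Rightarrow> complex" where
  "semi_inf_pow A 0 n m = (if n = m then 1 else 0)"
| "semi_inf_pow A (Suc k) n m = (\<Sum>l | A n l \<noteq> 0. A n l * semi_inf_pow A k l m)"

definition upper_half :: "(nat \<Rightarrow> nat \<Rightarrow> complex) \<Rightarrow> nat \<Rightarrow> nat \<Rightarrow> complex" where
  "upper_half A n m = (if n < m then A n m else if n = m then A n n / 2 else 0)"

definition U_mat :: "nat \<Rightarrow> (int \<Rightarrow> nat \<Rightarrow> complex) \<Rightarrow> nat \<Rightarrow> nat \<Rightarrow> nat \<Rightarrow> complex" where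
  "U_mat d2 \<alpha> K n m = - (1 / of_nat K) * upper_half (semi_inf_pow (Q_mat d2 \<alpha>) K) n m"

definition V_mat :: "nat \<Rightarrow> (int \<Rightarrow> nat \<Rightarrow> complex) \<Rightarrow> nat \<Rightarrow> nat \<Rightarrow> nat \<Rightarrow> complex" where
  "V_mat d1 \<beta> J n m =
     - (1 / of_nat J) * upper_half (semi_inf_pow (\<lambda>i k. - P_mat d1 \<beta> k i) J) n m"

section \<open>Ladder matrices\<close>

text \<open>Both ladder matrices have the same shape: \<open>\<a>\<^sub>N(x) = ladder d2 \<alpha> N x\<close> and
  \<open>\<b>\<^sub>N(y) = ladder d1 \<beta> N y\<close>; likewise for the underlined matrices with upper index \<open>N\<close>
  and \<open>dual_ladder\<close>. The factor \<open>\<gamma>(N)\<close> is read off as \<open>c (-1) N\<close>. The ladder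
  matrices are meaningful only for \<open>N \<ge> d\<close> (\<open>ladder\<close>) and \<open>N \<ge> 1\<close> (\<open>dual_ladder\<close>).\<close>

definition ladder :: "nat \<Rightarrow> (int \<Rightarrow> nat \<Rightarrow> complex) \<Rightarrow> nat \<Rightarrow> complex \<Rightarrow> complex mat" where
  "ladder d c N z = Matrix.mat (d + 1) (d + 1) (\<lambda>(i, j).
     if i = d then (if j = d then z - c 0 N else - c (int d - int j) N) / c (-1) N
     else if j = i + 1 then 1 else 0)"

definition dual_ladder :: "nat \<Rightarrow> (int \<Rightarrow> nat \<Rightarrow> complex) \<Rightarrow> nat \<Rightarrow> complex \<Rightarrow> complex mat" where
  "dual_ladder d c N z = Matrix.mat (d + 1) (d + 1) (\<lambda>(i, j).
     if j = 0 then (if i = 0 then z - c 0 N else - c (int i) (N + i)) / c (-1) (N - 1)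
     else if j = i + 1 then 1 else 0)"

definition mat_inv :: "complex mat \<Rightarrow> complex mat" where
  "mat_inv A = the (mat_inverse A)"

section \<open>Deformation matrices\<close>

definition mat_prod :: "nat \<Rightarrow> complex mat list \<Rightarrow> complex mat" where
  "mat_prod n As = foldr (*) As (1\<^sub>m n)"

definition mat_sum :: "nat \<Rightarrow> (nat \<Rightarrow> complex mat) \<Rightarrow> nat \<Rightarrow> complex mat" where
  "mat_sum n F K = Matrix.mat n n (\<lambda>(i, k). \<Sum>j\<le>K. F j $$ (i, k))"

text \<open>\<open>diag_block W j p d\<close> is \<open>W\<^sub>j[p; d]\<close> where \<open>W\<^sub>j(n)\<close> is the entry of \<open>W\<close> at \<open>(n, n + j)\<close>.\<close>

definition diag_block :: "(nat \<Rightarrow> nat \<Rightarrow> complex) \<Rightarrow> nat \<Rightarrow> nat \<Rightarrow> nat \<Rightarrow> complex mat" where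
  "diag_block W j p d = mat_diag (d + 1) (\<lambda>i. W (p + i) (p + i + j))"

text \<open>In the sums below \<open>[N..<N + j]\<close> lists the indices \<open>N, \<dots>, N + j - 1\<close> and \<open>[N - j..<N]\<close>
  lists \<open>N - j, \<dots>, N - 1\<close>. Subtraction of natural numbers is exact for the values of \<open>N\<close> for
  which all occurring ladder matrices are defined: \<open>V_Psi\<close> requires \<open>N \<ge> d2 + J\<close>,
  \<open>U_Phi\<close> requires \<open>N \<ge> d1 + K\<close>, \<open>V_Psi_dual\<close> requires \<open>N \<ge> J + 1\<close> and \<open>U_Phi_dual\<close>
  requires \<open>N \<ge> K + 1\<close>.\<close>

definition U_Psi ::
  "nat \<Rightarrow> nat \<Rightarrow> (int \<Rightarrow> nat \<Rightarrow> complex) \<Rightarrow> (int \<Rightarrow> nat \<Rightarrow> complex) \<Rightarrow> nat \<Rightarrow> nat \<Rightarrow> complex \<Rightarrow> complex mat"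
  where "U_Psi d1 d2 \<alpha> \<beta> K N x = mat_sum (d2 + 1) (\<lambda>j.
    diag_block (U_mat d2 \<alpha> K) j (N - d2) d2
      * mat_prod (d2 + 1) (map (\<lambda>n. ladder d2 \<alpha> n x) (rev [N..<N + j]))) K"

definition V_Psi ::
  "nat \<Rightarrow> nat \<Rightarrow> (int \<Rightarrow> nat \<Rightarrow> complex) \<Rightarrow> (int \<Rightarrow> nat \<Rightarrow> complex) \<Rightarrow> nat \<Rightarrow> nat \<Rightarrow> complex \<Rightarrow> complex mat"
  where "V_Psi d1 d2 \<alpha> \<beta> J N x = mat_sum (d2 + 1) (\<lambda>j.
    diag_block (V_mat d1 \<beta> J) j (N - d2 - j) d2
      * mat_prod (d2 + 1) (map (\<lambda>n. mat_inv (ladder d2 \<alpha> n x)) [N - j..<N])) J"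

definition U_Psi_dual ::
  "nat \<Rightarrow> nat \<Rightarrow> (int \<Rightarrow> nat \<Rightarrow> complex) \<Rightarrow> (int \<Rightarrow> nat \<Rightarrow> complex) \<Rightarrow> nat \<Rightarrow> nat \<Rightarrow> complex \<Rightarrow> complex mat"
  where "U_Psi_dual d1 d2 \<alpha> \<beta> K N y = mat_sum (d1 + 1) (\<lambda>j.
    mat_prod (d1 + 1) (map (\<lambda>n. mat_inv (dual_ladder d1 \<beta> n y)) [N..<N + j])
      * diag_block (U_mat d2 \<alpha> K) j (N - 1) d1) K"

definition V_Psi_dual ::
  "nat \<Rightarrow> nat \<Rightarrow> (int \<Rightarrow> nat \<Rightarrow> complex) \<Rightarrow> (int \<Rightarrow> nat \<Rightarrow> complex) \<Rightarrow> nat \<Rightarrow> nat \<Rightarrow> complex \<Rightarrow> complex mat"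
  where "V_Psi_dual d1 d2 \<alpha> \<beta> J N y = mat_sum (d1 + 1) (\<lambda>j.
    mat_prod (d1 + 1) (map (\<lambda>n. dual_ladder d1 \<beta> n y) (rev [N - j..<N]))
      * diag_block (V_mat d1 \<beta> J) j (N - 1 - j) d1) J"

definition U_Phi ::
  "nat \<Rightarrow> nat \<Rightarrow> (int \<Rightarrow> nat \<Rightarrow> complex) \<Rightarrow> (int \<Rightarrow> nat \<Rightarrow> complex) \<Rightarrow> nat \<Rightarrow> nat \<Rightarrow> complex \<Rightarrow> complex mat"
  where "U_Phi d1 d2 \<alpha> \<beta> K N y = mat_sum (d1 + 1) (\<lambda>j.
    diag_block (U_mat d2 \<alpha> K) j (N - j - d1) d1
      * mat_prod (d1 + 1) (map (\<lambda>n. mat_inv (ladder d1 \<beta> n y)) [N - j..<N])) K"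

definition V_Phi ::
  "nat \<Rightarrow> nat \<Rightarrow> (int \<Rightarrow> nat \<Rightarrow> complex) \<Rightarrow> (int \<Rightarrow> nat \<Rightarrow> complex) \<Rightarrow> nat \<Rightarrow> nat \<Rightarrow> complex \<Rightarrow> complex mat"
  where "V_Phi d1 d2 \<alpha> \<beta> J N y = mat_sum (d1 + 1) (\<lambda>j.
    diag_block (V_mat d1 \<beta> J) j (N - d1) d1
      * mat_prod (d1 + 1) (map (\<lambda>n. ladder d1 \<beta> n y) (rev [N..<N + j]))) J"

definition U_Phi_dual ::
  "nat \<Rightarrow> nat \<Rightarrow> (int \<Rightarrow> nat \<Rightarrow> complex) \<Rightarrow> (int \<Rightarrow> nat \<Rightarrow> complex) \<Rightarrow> nat \<Rightarrow> nat \<Rightarrow> complex \<Rightarrow> complex mat"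
  where "U_Phi_dual d1 d2 \<alpha> \<beta> K N x = mat_sum (d2 + 1) (\<lambda>j.
    mat_prod (d2 + 1) (map (\<lambda>n. dual_ladder d2 \<alpha> n x) (rev [N - j..<N]))
      * diag_block (U_mat d2 \<alpha> K) j (N - 1 - j) d2) K"

definition V_Phi_dual ::
  "nat \<Rightarrow> nat \<Rightarrow> (int \<Rightarrow> nat \<Rightarrow> complex) \<Rightarrow> (int \<Rightarrow> nat \<Rightarrow> complex) \<Rightarrow> nat \<Rightarrow> nat \<Rightarrow> complex \<Rightarrow> complex mat"
  where "V_Phi_dual d1 d2 \<alpha> \<beta> J N x = mat_sum (d2 + 1) (\<lambda>j.
    mat_prod (d2 + 1) (map (\<lambda>n. mat_inv (dual_ladder d2 \<alpha> n x)) [N..<N + j])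
      * diag_block (V_mat d1 \<beta> J) j (N - 1) d2) J"

section \<open>Fundamental matrix solutions\<close>

text \<open>Continuity is joint in all parameters; together with the entrywise complex partial
  derivatives imposed by the deformation equations it makes a solution holomorphic.\<close>

definition fundamental :: "nat \<Rightarrow> params set \<Rightarrow> (params \<Rightarrow> complex mat) \<Rightarrow> bool" where
  "fundamental n D F \<longleftrightarrow>
     (\<forall>w\<in>D. F w \<in> carrier_mat n n \<and> invertible_mat (F w)) \<and>
     (\<forall>i<n. \<forall>k<n. continuous_on D (\<lambda>w. F w $$ (i, k)))"

definition has_u_partial ::
  "nat \<Rightarrow> (params \<Rightarrow> complex mat) \<Rightarrow> nat \<Rightarrow> params \<Rightarrow> complex mat \<Rightarrow> bool" where
  "has_u_partial n F K w F' \<longleftrightarrow> F' \<in> carrier_mat n n \<and> (\<forall>i<n. \<forall>k<n.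
     ((\<lambda>z. F ((fst w)(K := z), snd w) $$ (i, k)) has_field_derivative F' $$ (i, k)) (at (fst w K)))"

definition has_v_partial ::
  "nat \<Rightarrow> (params \<Rightarrow> complex mat) \<Rightarrow> nat \<Rightarrow> params \<Rightarrow> complex mat \<Rightarrow> bool" where
  "has_v_partial n F J w F' \<longleftrightarrow> F' \<in> carrier_mat n n \<and> (\<forall>i<n. \<forall>k<n.
     ((\<lambda>z. F (fst w, (snd w)(J := z)) $$ (i, k)) has_field_derivative F' $$ (i, k)) (at (snd w J)))"

end

theory Submission
  imports
    Defs
    "HOL-Complex_Analysis.Complex_Analysis"
    "HOL-Real_Asymp.Real_Asymp"
    "Jordan_Normal_Form.Determinant"
begin

text \<open>The normalised polynomials \<open>p\<^sub>n = \<pi>\<^sub>n / \<surd>h\<^sub>n\<close>, \<open>s\<^sub>n = \<sigma>\<^sub>n / \<surd>h\<^sub>n\<close> depend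
  holomorphically on the potentials (dominated convergence and Gram-Schmidt), and differentiating
  orthonormality gives Lax equations for \<open>Q\<close> together with zero curvature equations for the
  deformation matrices. The same identities show that the deformation flow preserves the space of
  sequences annihilated by the rows of \<open>Q - x\<close> (or, dually, by its columns) beyond the first few
  indices. The leading and trailing coefficients of these \<open>(d + 2)\<close>-term relations do not vanish,
  so a solution is determined by any \<open>d + 1\<close> consecutive entries; on such a window far enough
  to the right the flow becomes a flat holomorphic connection. A flat connection on a simply
  connected domain has a global fundamental system, and extending it by the recursion to all
  indices yields solutions whose windows are the required matrices: the ladder matrices shift
  windows, and reading off an entry at distance \<open>j\<close> is multiplication by \<open>j\<close> ladder
  matrices.\<close>

section \<open>Holomorphic functions of several parameters\<close>

text \<open>How \<open>\<pi>\<close>, \<open>\<sigma>\<close> and \<open>h\<close> depend on the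
  parameters is not prescribed, and \<open>r\<close> is merely continuous; all smoothness has to
  come from convergence of the integrals at every parameter of an open set. The matrix systems are
  never checked by multiplying ladder and deformation matrices: curvature identities are read off
  from commuting mixed derivatives of the wave functions, which are linearly independent, and the
  rest is done on scalar sequences. The obstacle is the boundary at index 0. The recursion must
  discard the first rows (or column 0) to have a (d + 1)-dimensional solution space, whereas a
  deformation whose rows reach back \<open>s i\<close> places would call on discarded relations; it
  respects the recursion only from \<open>s i\<close> on. Two deformations can be composed only on a
  window beyond \<open>s i + s j\<close>, which fixes the choice of \<open>base\<close>, and the
  equations that step downwards hold only for large enough \<open>N\<close>. Exchanging the
  arguments of the pairing exchanges \<open>x\<close> and \<open>y\<close>, so that two recursions
  settle four cases.\<close>

definition pball :: "'i set \<Rightarrow> ('i \<Rightarrow> complex) \<Rightarrow> real \<Rightarrow> ('i \<Rightarrow> complex) set" where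
  "pball I w \<rho> = {w'. (\<forall>i. i \<notin> I \<longrightarrow> w' i = w i) \<and> (\<forall>i\<in>I. norm (w' i - w i) < \<rho>)}"

text \<open>The points of \<open>D\<close> agree off the finite set \<open>I\<close>, so
  \<open>D\<close> is an open part of an affine copy of C^I sitting inside a function space with its
  product topology.\<close>

definition pdom :: "'i set \<Rightarrow> ('i \<Rightarrow> complex) set \<Rightarrow> bool" where
  "pdom I D \<longleftrightarrow> finite I \<and> (\<forall>w\<in>D. \<exists>\<rho>>0. pball I w \<rho> \<subseteq> D) \<and>
     (\<forall>w\<in>D. \<forall>w'\<in>D. \<forall>i. i \<notin> I \<longrightarrow> w' i = w i)"

definition pd :: "'i \<Rightarrow> (('i \<Rightarrow> complex) \<Rightarrow> complex) \<Rightarrow> ('i \<Rightarrow> complex) \<Rightarrow> complex" where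
  "pd i f w = deriv (\<lambda>z. f (w(i := z))) (w i)"

text \<open>Joint continuity plus separate differentiability is Osgood's description of holomorphy;
  arguments run in one variable at a time, and continuity supplies uniformity in the others.\<close>

definition hol :: "'i set \<Rightarrow> ('i \<Rightarrow> complex) set \<Rightarrow> (('i \<Rightarrow> complex) \<Rightarrow> complex) \<Rightarrow> bool" where
  "hol I D f \<longleftrightarrow> continuous_on D f \<and>
     (\<forall>w\<in>D. \<forall>i\<in>I. (\<lambda>z. f (w(i := z))) field_differentiable at (w i))"

lemma pball_self: "\<rho> > 0 \<Longrightarrow> w \<in> pball I w \<rho>"
  by (simp add: pball_def)

lemma pball_mono: "\<rho> \<le> \<rho>' \<Longrightarrow> pball I w \<rho> \<subseteq> pball I w \<rho>'"
  by (force simp: pball_def)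

lemma pball_subset_pball:
  assumes "w' \<in> pball I w \<rho>"
  shows "pball I w' \<rho>' \<subseteq> pball I w (\<rho> + \<rho>')"
proof
  fix w'' assume w'': "w'' \<in> pball I w' \<rho>'"
  have "norm (w'' i - w i) < \<rho> + \<rho>'" if "i \<in> I" for i
  proof -
    have "norm (w'' i - w i) \<le> norm (w'' i - w' i) + norm (w' i - w i)"
      by (metis diff_add_cancel add_diff_eq norm_triangle_ineq)
    then show ?thesis using assms w'' that by (force simp: pball_def)
  qed
  then show "w'' \<in> pball I w (\<rho> + \<rho>')" using assms w'' by (auto simp: pball_def)
qed

lemma pball_upd: "i \<in> I \<Longrightarrow> w' \<in> pball I w \<rho> \<Longrightarrow> norm (z - w i) < \<rho> \<Longrightarrow> w'(i := z) \<in> pball I w \<rho>"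
  by (auto simp: pball_def)

section \<open>Polydiscs and the product topology\<close>

text \<open>A basic open set of the product allows some radius in each coordinate; finiteness of
  \<open>I\<close> makes the minimum over \<open>I\<close> positive, and coordinates off
  \<open>I\<close> do not move.\<close>

lemma pball_sub_nbhd:
  assumes "finite I" "open U" "w \<in> U"
  obtains \<rho> where "\<rho> > 0" "pball I w \<rho> \<subseteq> U"
proof -
  obtain X where X: "w \<in> (\<Pi>\<^sub>E i\<in>UNIV. X i)" "\<And>i. open (X i)" "(\<Pi>\<^sub>E i\<in>UNIV. X i) \<subseteq> U"
    using product_topology_open_contains_basis[of "\<lambda>i. euclidean" UNIV U w] assms(2,3)
    by (auto simp: open_fun_def)
  have "\<exists>r>0. ball (w i) r \<subseteq> X i" for i
    using X(1,2) open_contains_ball by (metis PiE_E UNIV_I)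
  then obtain r where r: "\<And>i. r i > 0" "\<And>i. ball (w i) (r i) \<subseteq> X i"
    by metis
  \<comment> \<open>The inserted 1 keeps the minimum defined when \<open>I\<close> is empty.\<close>
  define \<rho> where "\<rho> = Min (insert 1 (r ` I))"
  have "\<rho> > 0" using assms(1) r(1) by (auto simp: \<rho>_def)
  moreover have "pball I w \<rho> \<subseteq> U"
  proof
    fix w' assume w': "w' \<in> pball I w \<rho>"
    have "w' i \<in> X i" for i
    proof (cases "i \<in> I")
      case True
      then have "\<rho> \<le> r i" using assms(1) by (auto simp: \<rho>_def)
      then have "w' i \<in> ball (w i) (r i)" using w' True
        by (fastforce simp: pball_def dist_norm norm_minus_commute)
      then show ?thesis using r(2) by blast
    next
      case False
      then show ?thesis using w' X(1) by (auto simp: pball_def)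
    qed
    then show "w' \<in> U" using X(3) by auto
  qed
  ultimately show ?thesis using that by blast
qed

text \<open>A polydisc freezes the coordinates off \<open>I\<close> and so is in general not open in
  the product; inside \<open>D\<close> they are frozen anyway, and dropping that condition gives an
  open set with the same trace.\<close>

lemma open_pball_pdom:
  assumes "pdom I D" "w \<in> D"
  obtains U where "open U" "U \<inter> D = pball I w \<rho> \<inter> D"
proof -
  have fin: "finite I" using assms(1) by (simp add: pdom_def)
  have eq: "{w'. \<forall>i\<in>I. norm (w' i - w i) < \<rho>} = (\<Inter>i\<in>I. {w'. norm (w' i - w i) < \<rho>})" by auto
  have "open {w'::'a \<Rightarrow> complex. norm (w' i - w i) < \<rho>}" for i
    by (intro open_Collect_less continuous_intros) (auto intro: continuous_on_product_coordinates)
  then have "open {w'. \<forall>i\<in>I. norm (w' i - w i) < \<rho>}"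
    unfolding eq using fin by auto
  moreover have "{w'. \<forall>i\<in>I. norm (w' i - w i) < \<rho>} \<inter> D = pball I w \<rho> \<inter> D"
    using assms by (auto simp: pball_def pdom_def)
  ultimately show ?thesis using that by blast
qed

text \<open>The index type is arbitrary, so the function space need not be metrizable; polydiscs
  take the place of balls in the epsilon-delta criterion.\<close>

lemma continuous_on_pdom_iff:
  fixes f :: "('i \<Rightarrow> complex) \<Rightarrow> 'b::metric_space"
  assumes "pdom I D"
  shows "continuous_on D f \<longleftrightarrow> (\<forall>w\<in>D. \<forall>e>0. \<exists>\<delta>>0. \<forall>w'\<in>pball I w \<delta> \<inter> D. dist (f w') (f w) < e)"
proof
  have fin: "finite I" using assms by (simp add: pdom_def)
  assume c: "continuous_on D f"
  show "\<forall>w\<in>D. \<forall>e>0. \<exists>\<delta>>0. \<forall>w'\<in>pball I w \<delta> \<inter> D. dist (f w') (f w) < e"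
  proof (intro ballI allI impI)
    fix w and e :: real assume w: "w \<in> D" "e > 0"
    obtain A where A: "open A" "w \<in> A" "\<forall>y\<in>D. y \<in> A \<longrightarrow> f y \<in> ball (f w) e"
      using c w unfolding continuous_on_topological by (metis centre_in_ball open_ball)
    obtain \<rho> where "\<rho> > 0" "pball I w \<rho> \<subseteq> A" using pball_sub_nbhd[OF fin A(1,2)] by blast
    then show "\<exists>\<delta>>0. \<forall>w'\<in>pball I w \<delta> \<inter> D. dist (f w') (f w) < e"
      using A(3) by (intro exI[of _ \<rho>]) (auto simp: dist_commute)
  qed
next
  assume *: "\<forall>w\<in>D. \<forall>e>0. \<exists>\<delta>>0. \<forall>w'\<in>pball I w \<delta> \<inter> D. dist (f w') (f w) < e"
  show "continuous_on D f"
    unfolding continuous_on_topological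
  proof (intro ballI allI impI)
    fix w B assume w: "w \<in> D" "open B" "f w \<in> B"
    obtain e where e: "e > 0" "ball (f w) e \<subseteq> B" using w open_contains_ball by blast
    obtain \<delta> where \<delta>: "\<delta> > 0" "\<forall>w'\<in>pball I w \<delta> \<inter> D. dist (f w') (f w) < e" using * w e by blast
    obtain U where U: "open U" "U \<inter> D = pball I w \<delta> \<inter> D" using open_pball_pdom[OF assms w(1)] by blast
    show "\<exists>A. open A \<and> w \<in> A \<and> (\<forall>y\<in>D. y \<in> A \<longrightarrow> f y \<in> B)"
    proof (intro exI conjI ballI impI)
      show "w \<in> U" using U(2) w(1) \<delta>(1) pball_self by blast
      fix y assume "y \<in> D" "y \<in> U"
      then have "dist (f y) (f w) < e" using U(2) \<delta>(2) by blast
      then show "f y \<in> B" using e(2) by (auto simp: dist_commute)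
    qed fact
  qed
qed

lemma pdom_finite: "pdom I D \<Longrightarrow> finite I"
  by (simp add: pdom_def)

lemma pdom_pball:
  assumes "pdom I D" "w \<in> D"
  obtains \<rho> where "\<rho> > 0" "pball I w \<rho> \<subseteq> D"
  using assms by (auto simp: pdom_def)

lemma pball_pdom: "finite I \<Longrightarrow> pdom I (pball I w \<rho>)"
  unfolding pdom_def
proof (intro conjI ballI)
  fix w' assume fin: "finite I" and w': "w' \<in> pball I w \<rho>"
  define \<delta> where "\<delta> = Min (insert 1 ((\<lambda>i. \<rho> - norm (w' i - w i)) ` I))"
  have "\<delta> > 0" using fin w' by (auto simp: \<delta>_def pball_def)
  moreover have "pball I w' \<delta> \<subseteq> pball I w \<rho>"
  proof
    fix w'' assume w'': "w'' \<in> pball I w' \<delta>"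
    have "norm (w'' i - w i) < \<rho>" if "i \<in> I" for i
    proof -
      have "\<delta> \<le> \<rho> - norm (w' i - w i)" using fin that by (auto simp: \<delta>_def)
      moreover have "norm (w'' i - w' i) < \<delta>" using w'' that by (auto simp: pball_def)
      moreover have "norm (w'' i - w i) \<le> norm (w'' i - w' i) + norm (w' i - w i)"
        by (metis diff_add_cancel add_diff_eq norm_triangle_ineq)
      ultimately show ?thesis by linarith
    qed
    then show "w'' \<in> pball I w \<rho>" using w' w'' by (auto simp: pball_def)
  qed
  ultimately show "\<exists>\<rho>'>0. pball I w' \<rho>' \<subseteq> pball I w \<rho>" by blast
qed (auto simp: pball_def)

section \<open>Calculus of separately holomorphic functions\<close>

lemma hol_subset:
  "hol I D f \<Longrightarrow> D' \<subseteq> D \<Longrightarrow> hol I D' f"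
  unfolding hol_def using continuous_on_subset by blast

lemma hol_continuous: "hol I D f \<Longrightarrow> continuous_on D f"
  by (simp add: hol_def)

lemma hol_pd_DERIV:
  assumes "hol I D f" "w \<in> D" "i \<in> I"
  shows "((\<lambda>z. f (w(i := z))) has_field_derivative pd i f w) (at (w i))"
  using assms by (simp add: hol_def pd_def DERIV_deriv_iff_field_differentiable)

lemma pd_eqI:
  "((\<lambda>z. f (w(i := z))) has_field_derivative c) (at (w i)) \<Longrightarrow> pd i f w = c"
  by (simp add: pd_def DERIV_imp_deriv)

lemma hol_pd_DERIV_upd:
  assumes "hol I D f" "w(i := z) \<in> D" "i \<in> I"
  shows "((\<lambda>z. f (w(i := z))) has_field_derivative pd i f (w(i := z))) (at z)"
  using hol_pd_DERIV[OF assms] by simp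

lemma holI:
  assumes "continuous_on D f"
    and "\<And>w i. w \<in> D \<Longrightarrow> i \<in> I \<Longrightarrow> \<exists>c. ((\<lambda>z. f (w(i := z))) has_field_derivative c) (at (w i))"
  shows "hol I D f"
  using assms unfolding hol_def field_differentiable_def by blast

lemma pdom_upd:
  assumes "pdom I D" "w \<in> D" "i \<in> I"
  obtains \<rho> where "\<rho> > 0" "\<And>z. norm (z - w i) < \<rho> \<Longrightarrow> w(i := z) \<in> D"
proof -
  obtain \<rho> where "\<rho> > 0" "pball I w \<rho> \<subseteq> D" using pdom_pball[OF assms(1,2)] .
  then show ?thesis using that[of \<rho>] pball_upd[OF assms(3)] pball_self by blast
qed

lemma eventually_upd_in:
  assumes "pdom I D" "w \<in> D" "i \<in> I"
  shows "eventually (\<lambda>z. w(i := z) \<in> D) (nhds (w i))"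
proof -
  obtain \<rho> where "\<rho> > 0" "\<And>z. norm (z - w i) < \<rho> \<Longrightarrow> w(i := z) \<in> D" using pdom_upd[OF assms] by blast
  then show ?thesis unfolding eventually_nhds_metric by (metis dist_norm)
qed

lemma pd_cong:
  assumes "pdom I D" "w \<in> D" "i \<in> I" "\<And>w. w \<in> D \<Longrightarrow> f w = g w"
  shows "pd i f w = pd i g w"
  unfolding pd_def
proof (rule deriv_cong_ev)
  show "\<forall>\<^sub>F x in nhds (w i). f (w(i := x)) = g (w(i := x))"
    using eventually_upd_in[OF assms(1-3)] by eventually_elim (use assms(4) in auto)
qed simp

lemma hol_cong:
  assumes "pdom I D" "\<And>w. w \<in> D \<Longrightarrow> f w = g w" "hol I D f"
  shows "hol I D g"
proof (rule holI)
  show "continuous_on D g" using assms(2,3) continuous_on_cong unfolding hol_def by metis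
  fix w i assume wi: "w \<in> D" "i \<in> I"
  obtain \<rho> where \<rho>: "\<rho> > 0" "\<And>z. norm (z - w i) < \<rho> \<Longrightarrow> w(i := z) \<in> D"
    using pdom_upd[OF assms(1) wi] by blast
  have "((\<lambda>z. g (w(i := z))) has_field_derivative pd i f w) (at (w i))"
    by (rule has_field_derivative_transform_within_open[OF hol_pd_DERIV[OF assms(3) wi], of "ball (w i) \<rho>"])
       (use \<rho> assms(2) in \<open>auto simp: dist_norm norm_minus_commute\<close>)
  then show "\<exists>c. ((\<lambda>z. g (w(i := z))) has_field_derivative c) (at (w i))" by blast
qed

lemma hol_const [intro, simp]: "hol I D (\<lambda>w. c)"
  by (auto simp: hol_def)

lemma pd_const [simp]: "pd i (\<lambda>w. c) w = 0"
  by (simp add: pd_def)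

lemma hol_coord [intro]: "hol I D (\<lambda>w. w k)"
proof (rule holI)
  show "continuous_on D (\<lambda>w. w k)"
    by (rule continuous_on_subset[OF continuous_on_product_coordinates]) simp
  fix w i assume "w \<in> D" "i \<in> I"
  have "((\<lambda>z. (w(i := z)) k) has_field_derivative (if k = i then 1 else 0)) (at (w i))"
    by auto
  then show "\<exists>c. ((\<lambda>z. (w(i := z)) k) has_field_derivative c) (at (w i))" by blast
qed

lemma pd_coord: "pd i (\<lambda>w. w k) w = (if k = i then 1 else 0)"
  by (rule pd_eqI) auto

lemma
  assumes f: "hol I D f" and g: "hol I D g"
  shows hol_add [intro]: "hol I D (\<lambda>w. f w + g w)"
    and pd_add: "w \<in> D \<Longrightarrow> i \<in> I \<Longrightarrow> pd i (\<lambda>w. f w + g w) w = pd i f w + pd i g w"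
proof -
  have *: "((\<lambda>z. f (w(i := z)) + g (w(i := z))) has_field_derivative pd i f w + pd i g w) (at (w i))"
    if "w \<in> D" "i \<in> I" for w i
    by (intro DERIV_add hol_pd_DERIV[OF f that] hol_pd_DERIV[OF g that])
  show "hol I D (\<lambda>w. f w + g w)"
    by (rule holI) (use * f g in \<open>auto intro: continuous_intros simp: hol_def\<close>)
  show "pd i (\<lambda>w. f w + g w) w = pd i f w + pd i g w" if "w \<in> D" "i \<in> I"
    using pd_eqI[OF *[OF that]] .
qed

lemma
  assumes f: "hol I D f" and g: "hol I D g"
  shows hol_mult [intro]: "hol I D (\<lambda>w. f w * g w)"
    and pd_mult: "w \<in> D \<Longrightarrow> i \<in> I \<Longrightarrow> pd i (\<lambda>w. f w * g w) w = pd i f w * g w + f w * pd i g w"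
proof -
  have *: "((\<lambda>z. f (w(i := z)) * g (w(i := z))) has_field_derivative pd i f w * g w + f w * pd i g w) (at (w i))"
    if "w \<in> D" "i \<in> I" for w i
    using DERIV_mult[OF hol_pd_DERIV[OF f that] hol_pd_DERIV[OF g that]]
    by (simp add: mult.commute)
  show "hol I D (\<lambda>w. f w * g w)"
    by (rule holI) (use * f g in \<open>auto intro: continuous_intros simp: hol_def\<close>)
  show "pd i (\<lambda>w. f w * g w) w = pd i f w * g w + f w * pd i g w" if "w \<in> D" "i \<in> I"
    using pd_eqI[OF *[OF that]] .
qed

lemma
  assumes f: "hol I D f"
  shows hol_cmult [intro]: "hol I D (\<lambda>w. c * f w)"
    and pd_cmult: "w \<in> D \<Longrightarrow> i \<in> I \<Longrightarrow> pd i (\<lambda>w. c * f w) w = c * pd i f w"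
  using hol_mult[OF hol_const f, of c] pd_mult[OF hol_const f, of w i c] by auto

lemma
  assumes f: "hol I D f"
  shows hol_minus [intro]: "hol I D (\<lambda>w. - f w)"
    and pd_minus: "w \<in> D \<Longrightarrow> i \<in> I \<Longrightarrow> pd i (\<lambda>w. - f w) w = - pd i f w"
  using hol_cmult[OF f, of "-1"] pd_cmult[OF f, of w i "-1"] by auto

lemma
  assumes f: "hol I D f" and g: "hol I D g"
  shows hol_diff [intro]: "hol I D (\<lambda>w. f w - g w)"
    and pd_diff: "w \<in> D \<Longrightarrow> i \<in> I \<Longrightarrow> pd i (\<lambda>w. f w - g w) w = pd i f w - pd i g w"
  using hol_add[OF f hol_minus[OF g]] pd_add[OF f hol_minus[OF g], of w i] pd_minus[OF g, of w i]
  by auto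

lemma hol_sum [intro]:
  assumes "\<And>a. a \<in> A \<Longrightarrow> hol I D (f a)"
  shows "hol I D (\<lambda>w. \<Sum>a\<in>A. f a w)"
  using assms by (induction A rule: infinite_finite_induct) auto

lemma pd_sum:
  assumes "\<And>a. a \<in> A \<Longrightarrow> hol I D (f a)" "w \<in> D" "i \<in> I"
  shows "pd i (\<lambda>w. \<Sum>a\<in>A. f a w) w = (\<Sum>a\<in>A. pd i (f a) w)"
  using assms
proof (induction A rule: infinite_finite_induct)
  case (insert x F)
  have "pd i (\<lambda>w. f x w + (\<Sum>a\<in>F. f a w)) w = pd i (f x) w + pd i (\<lambda>w. \<Sum>a\<in>F. f a w) w"
    using insert by (intro pd_add[of I D]) auto
  then show ?case using insert by auto
qed auto

lemma hol_inverse [intro]: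
  assumes f: "hol I D f" and nz: "\<And>w. w \<in> D \<Longrightarrow> f w \<noteq> 0"
  shows "hol I D (\<lambda>w. inverse (f w))"
proof (rule holI)
  show "continuous_on D (\<lambda>w. inverse (f w))"
    using f nz by (auto intro!: continuous_intros simp: hol_def)
  fix w i assume wi: "w \<in> D" "i \<in> I"
  have "f (w(i := w i)) \<noteq> 0" using nz wi by simp
  from DERIV_inverse_fun[OF hol_pd_DERIV[OF f wi] this]
  show "\<exists>c. ((\<lambda>z. inverse (f (w(i := z)))) has_field_derivative c) (at (w i))" by blast
qed

lemma hol_divide [intro]:
  assumes "hol I D f" "hol I D g" "\<And>w. w \<in> D \<Longrightarrow> g w \<noteq> 0"
  shows "hol I D (\<lambda>w. f w / g w)"
  unfolding divide_inverse using assms by (intro hol_mult hol_inverse)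

lemma
  assumes f: "hol I D f"
  shows hol_exp [intro]: "hol I D (\<lambda>w. exp (f w))"
    and pd_exp: "w \<in> D \<Longrightarrow> i \<in> I \<Longrightarrow> pd i (\<lambda>w. exp (f w)) w = exp (f w) * pd i f w"
proof -
  have *: "((\<lambda>z. exp (f (w(i := z)))) has_field_derivative exp (f w) * pd i f w) (at (w i))"
    if "w \<in> D" "i \<in> I" for w i
    using DERIV_chain2[OF DERIV_exp hol_pd_DERIV[OF f that]] by simp
  show "hol I D (\<lambda>w. exp (f w))"
    by (rule holI) (use * f in \<open>auto intro: continuous_intros simp: hol_def\<close>)
  show "pd i (\<lambda>w. exp (f w)) w = exp (f w) * pd i f w" if "w \<in> D" "i \<in> I"
    using pd_eqI[OF *[OF that]] .
qed

text \<open>A continuous square root of a nonvanishing holomorphic function is holomorphic: the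
  difference quotient of \<open>r\<close> is that of \<open>h\<close> divided by
  \<open>r (w(i := z)) + r w\<close>, and continuity alone gives the divisor its nonzero limit
  \<open>2 * r w\<close>.\<close>

lemma hol_sqrt:
  assumes dom: "pdom I D" and h: "hol I D h" and r: "continuous_on D r"
    and sq: "\<And>w. w \<in> D \<Longrightarrow> (r w)\<^sup>2 = h w" and nz: "\<And>w. w \<in> D \<Longrightarrow> h w \<noteq> 0"
  shows "hol I D r"
proof (rule holI)
  fix w i assume wi: "w \<in> D" "i \<in> I"
  obtain \<rho> where \<rho>: "\<rho> > 0" "\<And>z. norm (z - w i) < \<rho> \<Longrightarrow> w(i := z) \<in> D"
    using pdom_upd[OF dom wi] by blast
  have sub: "(\<lambda>z. w(i := z)) ` ball (w i) \<rho> \<subseteq> D"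
    using \<rho>(2) by (auto simp: dist_norm norm_minus_commute)
  have upd: "continuous_on A (\<lambda>z. w(i := z))" for A
    by (rule continuous_on_coordinatewise_then_product, rename_tac k, case_tac "k = i") auto
  have "continuous_on (ball (w i) \<rho>) (\<lambda>z. r (w(i := z)))"
    by (rule continuous_on_compose2[OF r upd sub])
  then have "((\<lambda>z. r (w(i := z))) \<longlongrightarrow> r (w(i := w i))) (at (w i))"
    using \<rho>(1) by (metis centre_in_ball continuous_on_def open_ball at_within_open)
  then have rl: "((\<lambda>z. r (w(i := z)) + r w) \<longlongrightarrow> r w + r w) (at (w i))"
    by (intro tendsto_intros) simp
  have rnz: "r w + r w \<noteq> 0" using nz[OF wi(1)] sq[OF wi(1)] by auto
  have "((\<lambda>z. (h (w(i := z)) - h w) / (z - w i)) \<longlongrightarrow> pd i h w) (at (w i))"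
    using hol_pd_DERIV[OF h wi] by (simp add: has_field_derivative_iff)
  from tendsto_divide[OF this rl rnz]
  have lim: "((\<lambda>z. (h (w(i := z)) - h w) / (z - w i) / (r (w(i := z)) + r w)) \<longlongrightarrow> pd i h w / (r w + r w)) (at (w i))" .
  have "eventually (\<lambda>z. r (w(i := z)) + r w \<noteq> 0) (at (w i))"
    using rl rnz by (rule tendsto_imp_eventually_ne)
  moreover have "eventually (\<lambda>z. w(i := z) \<in> D) (at (w i))"
    using eventually_upd_in[OF dom wi] by (simp add: eventually_nhds_conv_at)
  ultimately have "eventually (\<lambda>z. (h (w(i := z)) - h w) / (z - w i) / (r (w(i := z)) + r w)
       = (r (w(i := z)) - r w) / (z - w i)) (at (w i))"
  proof eventually_elim
    case (elim z)
    have "h (w(i := z)) - h w = (r (w(i := z)) - r w) * (r (w(i := z)) + r w)"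
      using sq[OF elim(2)] sq[OF wi(1)] by (simp add: algebra_simps power2_eq_square)
    then show ?case using elim(1) by simp
  qed
  with lim have "((\<lambda>z. (r (w(i := z)) - r w) / (z - w i)) \<longlongrightarrow> pd i h w / (r w + r w)) (at (w i))"
    using tendsto_cong by force
  then show "\<exists>c. ((\<lambda>z. r (w(i := z))) has_field_derivative c) (at (w i))"
    by (auto simp: has_field_derivative_iff)
qed (fact r)

section \<open>Regularity and symmetry of partial derivatives\<close>

lemma DERIV_shift_left:
  fixes f :: "complex \<Rightarrow> complex"
  assumes "(f has_field_derivative y) (at (z + x))"
  shows "((\<lambda>x. f (z + x)) has_field_derivative y) (at x)"
  using DERIV_at_within_shift[of f y z x UNIV] assms by simp

lemma hol_upd_holomorphic:
  assumes "hol I D f" "i \<in> I" "\<And>z. z \<in> S \<Longrightarrow> w(i := z) \<in> D"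
  shows "(\<lambda>z. f (w(i := z))) holomorphic_on S"
  unfolding holomorphic_on_def
  using hol_pd_DERIV_upd[OF assms(1) assms(3) assms(2)] field_differentiable_at_within
    field_differentiable_def by blast

lemma continuous_on_upd: "continuous_on A g \<Longrightarrow> continuous_on A h \<Longrightarrow> continuous_on A (\<lambda>x. (g x :: 'i \<Rightarrow> complex)(i := h x))"
proof (rule continuous_on_coordinatewise_then_product)
  fix k assume "continuous_on A g" "continuous_on A h"
  then show "continuous_on A (\<lambda>x. ((g x)(i := h x)) k)"
    by (cases "k = i") (auto intro: continuous_on_product_then_coordinatewise)
qed

lemma continuous_on_app: "continuous_on A g \<Longrightarrow> continuous_on A (\<lambda>x. (g x :: 'i \<Rightarrow> complex) k)"
  by (rule continuous_on_product_then_coordinatewise)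

text \<open>Cauchy's estimate, applied to the difference of the slices of \<open>f\<close> through
  \<open>w\<close> and \<open>w0\<close>, turns closeness of the slices, uniform on a compact disc,
  into closeness of their derivatives at the centre.\<close>

lemma pd_continuous:
  assumes dom: "pdom I D" and f: "hol I D f" and i: "i \<in> I"
  shows "continuous_on D (pd i f)"
  unfolding continuous_on_pdom_iff[OF dom]
proof (intro ballI allI impI)
  fix w0 and e :: real assume w0: "w0 \<in> D" and e: "e > 0"
  note fin = pdom_finite[OF dom]
  obtain \<rho>' where \<rho>': "\<rho>' > 0" "pball I w0 \<rho>' \<subseteq> D" using pdom_pball[OF dom w0] .
  define \<rho> where "\<rho> = \<rho>' / 3"
  have \<rho>: "\<rho> > 0" "pball I w0 (3 * \<rho>) \<subseteq> D" using \<rho>' by (auto simp: \<rho>_def)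
  have inD: "w(i := w i + \<zeta>) \<in> D" if "w \<in> pball I w0 \<rho>" "norm \<zeta> \<le> \<rho>" for w \<zeta>
  proof -
    have "w(i := w i + \<zeta>) \<in> pball I w (2 * \<rho>)" using that \<rho>(1) i by (auto simp: pball_def)
    then show ?thesis using pball_subset_pball[OF that(1), of "2 * \<rho>"] \<rho>(2) by (auto simp: algebra_simps)
  qed
  define g where "g = (\<lambda>(w, \<zeta>). f (w(i := w i + \<zeta>)))"
  have cg: "continuous_on (pball I w0 \<rho> \<times> cball 0 \<rho>) g"
    unfolding g_def case_prod_unfold
    by (rule continuous_on_compose2[OF hol_continuous[OF f]])
       (auto intro!: continuous_on_upd continuous_on_add continuous_on_fst
          continuous_on_app[OF continuous_on_fst[OF continuous_on_id]]
          continuous_on_snd continuous_on_id inD)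
  \<comment> \<open>Division by the radius in Cauchy's estimate turns this tolerance into
    \<open>e / 2\<close>.\<close>
  have "e * \<rho> / 2 > 0" using e \<rho> by simp
  then obtain X0 where X0: "w0 \<in> X0" "open X0"
    "\<forall>w\<in>X0 \<inter> pball I w0 \<rho>. \<forall>\<zeta>\<in>cball 0 \<rho>. dist (g (w, \<zeta>)) (g (w0, \<zeta>)) \<le> e * \<rho> / 2"
    by (rule continuous_on_prod_compactE[OF cg compact_cball pball_self[OF \<rho>(1)]]) (rule that)
  obtain \<delta> where \<delta>: "\<delta> > 0" "pball I w0 \<delta> \<subseteq> X0" using pball_sub_nbhd[OF fin X0(2,1)] .
  have "dist (pd i f w) (pd i f w0) < e" if w: "w \<in> pball I w0 (min \<delta> \<rho>)" for w
  proof -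
    have w1: "w \<in> X0" "w \<in> pball I w0 \<rho>"
      using w \<delta>(2) pball_mono[of "min \<delta> \<rho>" \<delta> I w0] pball_mono[of "min \<delta> \<rho>" \<rho> I w0] by auto
    have der: "((\<lambda>\<zeta>. g (v, \<zeta>)) has_field_derivative pd i f (v(i := v i + \<zeta>))) (at \<zeta>)"
      if "v \<in> pball I w0 \<rho>" "norm \<zeta> \<le> \<rho>" for v \<zeta>
    proof -
      have "v(i := v i + \<zeta>) \<in> D" using inD that by blast
      from hol_pd_DERIV_upd[OF f this i]
      have "((\<lambda>z. f (v(i := z))) has_field_derivative pd i f (v(i := v i + \<zeta>))) (at (v i + \<zeta>))" .
      from DERIV_shift_left[OF this]
      show ?thesis by (simp add: g_def)
    qed
    define \<phi> where "\<phi> = (\<lambda>\<zeta>. g (w, \<zeta>) - g (w0, \<zeta>))"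
    have d\<phi>: "(\<phi> has_field_derivative pd i f (w(i := w i + \<zeta>)) - pd i f (w0(i := w0 i + \<zeta>))) (at \<zeta>)"
      if "norm \<zeta> \<le> \<rho>" for \<zeta>
      unfolding \<phi>_def using that w1 pball_self[OF \<rho>(1)] by (intro DERIV_diff der) auto
    have c: "continuous_on (cball 0 \<rho>) \<phi>"
      by (rule DERIV_continuous_on, rule has_field_derivative_at_within, rule d\<phi>) auto
    have h: "\<phi> holomorphic_on ball 0 \<rho>"
      unfolding holomorphic_on_open[OF open_ball]
      by (intro ballI exI, rule d\<phi>) auto
    have "norm ((deriv ^^ 1) \<phi> 0) \<le> fact 1 * (e * \<rho> / 2) / \<rho> ^ 1"
      by (rule Cauchy_inequality[OF h c \<rho>(1)])
         (use X0(3) w1 in \<open>auto simp: \<phi>_def dist_norm\<close>)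
    moreover have "deriv \<phi> 0 = pd i f w - pd i f w0"
      using DERIV_imp_deriv[OF d\<phi>[of 0]] \<rho>(1) by simp
    ultimately have "norm (pd i f w - pd i f w0) \<le> e / 2" using \<rho>(1) by simp
    then show ?thesis using e by (simp add: dist_norm)
  qed
  then show "\<exists>\<delta>>0. \<forall>w\<in>pball I w0 \<delta> \<inter> D. dist (pd i f w) (pd i f w0) < e"
    using \<delta>(1) \<rho>(1) by (intro exI[of _ "min \<delta> \<rho>"]) auto
qed

text \<open>Both mixed derivatives are obtained as limits of one and the same sequence: difference
  quotients in the direction \<open>i\<close> converge uniformly in the coordinate \<open>j\<close>.\<close>

lemma pd_differentiable_aux:
  assumes dom: "pdom I D" and f: "hol I D f" and w: "w \<in> D" and i: "i \<in> I" and j: "j \<in> I" and ij: "i \<noteq> j"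
  obtains c h where "((\<lambda>z. pd i f (w(j := z))) has_field_derivative c) (at (w j))"
    "h \<longlonglongrightarrow> 0" "\<And>n. h n \<noteq> 0"
    "(\<lambda>n. (pd j f (w(i := w i + h n)) - pd j f w) / h n) \<longlonglongrightarrow> c"
proof -
  obtain \<rho>' where \<rho>': "\<rho>' > 0" "pball I w \<rho>' \<subseteq> D" using pdom_pball[OF dom w] .
  define \<rho> where "\<rho> = \<rho>' / 2"
  have \<rho>: "\<rho> > 0" using \<rho>' by (simp add: \<rho>_def)
  have inD: "w(j := w j + z, i := w i + \<zeta>) \<in> D" if "norm z \<le> \<rho>" "norm \<zeta> \<le> \<rho>" for z \<zeta>
    using that \<rho> \<rho>' i j by (intro subsetD[OF \<rho>'(2)]) (auto simp: pball_def \<rho>_def)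
  define g where "g = (\<lambda>z \<zeta>. f (w(j := w j + z, i := w i + \<zeta>)))"
  have der_i: "((\<lambda>\<zeta>. g z \<zeta>) has_field_derivative pd i f (w(j := w j + z, i := w i + \<zeta>))) (at \<zeta>)"
    if "norm z \<le> \<rho>" "norm \<zeta> \<le> \<rho>" for z \<zeta>
  proof -
    have "w(j := w j + z, i := w i + \<zeta>) \<in> D" using inD that by blast
    from DERIV_shift_left[OF hol_pd_DERIV_upd[OF f this i]]
    show ?thesis by (simp add: g_def)
  qed
  have der_j: "((\<lambda>z. g z \<zeta>) has_field_derivative pd j f (w(i := w i + \<zeta>, j := w j + z))) (at z)"
    if "norm z \<le> \<rho>" "norm \<zeta> \<le> \<rho>" for z \<zeta>
  proof -
    have "w(i := w i + \<zeta>, j := w j + z) \<in> D" using inD that ij by (simp add: fun_upd_twist)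
    from DERIV_shift_left[OF hol_pd_DERIV_upd[OF f this j]]
    have "((\<lambda>z. f (w(i := w i + \<zeta>, j := w j + z))) has_field_derivative pd j f (w(i := w i + \<zeta>, j := w j + z))) (at z)"
      by simp
    then show ?thesis using ij by (simp add: g_def fun_upd_twist)
  qed
  have "continuous_on (cball 0 \<rho> \<times> cball 0 \<rho>) (\<lambda>(z, \<zeta>). g z \<zeta>)"
    unfolding g_def case_prod_unfold
    by (rule continuous_on_compose2[OF hol_continuous[OF f]])
       (auto intro!: continuous_on_upd continuous_on_add continuous_on_fst continuous_on_snd continuous_on_id inD)
  then have "compact ((\<lambda>(z, \<zeta>). g z \<zeta>) ` (cball 0 \<rho> \<times> cball 0 \<rho>))"
    by (intro compact_continuous_image compact_Times) auto
  then obtain M where "\<forall>x\<in>(\<lambda>(z, \<zeta>). g z \<zeta>) ` (cball 0 \<rho> \<times> cball 0 \<rho>). norm x \<le> M"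
    using compact_imp_bounded bounded_iff by blast
  then have M: "\<And>z \<zeta>. norm z \<le> \<rho> \<Longrightarrow> norm \<zeta> \<le> \<rho> \<Longrightarrow> norm (g z \<zeta>) \<le> M"
    by auto
  have M0: "M \<ge> 0" using M[of 0 0] \<rho> by (auto intro: order_trans[OF norm_ge_zero])
  \<comment> \<open>The shift by 2 keeps \<open>norm (h n)\<close> at most
    \<open>\<rho> / 2\<close>, where the Taylor bound below is valid.\<close>
  define h where "h = (\<lambda>n. complex_of_real (\<rho> / (real n + 2)))"
  have hnz: "h n \<noteq> 0" for n
  proof -
    have "\<rho> / (real n + 2) \<noteq> 0" using \<rho> by simp
    then show ?thesis unfolding h_def of_real_eq_0_iff .
  qed
  have hnorm: "norm (h n) \<le> \<rho> / 2" for n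
  proof -
    have "\<rho> / (real n + 2) \<le> \<rho> / 2" using \<rho> by (intro divide_left_mono) auto
    moreover have "norm (h n) = \<rho> / (real n + 2)" using \<rho> unfolding h_def norm_of_real by simp
    ultimately show ?thesis by simp
  qed
  have "(\<lambda>n. \<rho> / (real n + 2)) \<longlonglongrightarrow> 0" by real_asymp
  from tendsto_of_real[OF this, where 'a = complex]
  have hlim: "h \<longlonglongrightarrow> 0" unfolding h_def by simp
  \<comment> \<open>Cauchy bound for second derivatives: discs of radius \<open>\<rho> / 2\<close>
    around points of norm at most \<open>\<rho> / 2\<close> stay where \<open>g\<close> is bounded
    by \<open>M\<close>.\<close>
  define C where "C = 2 * M / (\<rho> / 2)^2"
  have taylor: "norm (g z \<eta> - g z 0 - pd i f (w(j := w j + z)) * \<eta>) \<le> C * norm \<eta> ^ 2"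
    if z: "norm z \<le> \<rho>" and \<eta>: "norm \<eta> \<le> \<rho> / 2" for z \<eta>
  proof -
    have hl: "(\<lambda>\<zeta>. g z \<zeta>) holomorphic_on ball 0 \<rho>"
      unfolding holomorphic_on_open[OF open_ball] by (intro ballI exI, rule der_i) (use z in auto)
    have B: "norm ((deriv ^^ 2) (g z) \<zeta>) \<le> C" if \<zeta>: "\<zeta> \<in> cball 0 (\<rho> / 2)" for \<zeta>
    proof -
      have sub: "norm x \<le> \<rho>" if "x \<in> cball \<zeta> (\<rho> / 2)" for x
        using that \<zeta> norm_triangle_sub[of x \<zeta>] by (auto simp: dist_norm norm_minus_commute)
      have h2: "(\<lambda>\<zeta>. g z \<zeta>) holomorphic_on ball \<zeta> (\<rho>/2)"
        unfolding holomorphic_on_open[OF open_ball] by (intro ballI exI, rule der_i) (use z sub in auto)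
      have c2: "continuous_on (cball \<zeta> (\<rho>/2)) (\<lambda>\<zeta>. g z \<zeta>)"
        by (rule DERIV_continuous_on, rule has_field_derivative_at_within, rule der_i) (use z sub in auto)
      have "norm ((deriv ^^ 2) (g z) \<zeta>) \<le> fact 2 * M / (\<rho> / 2) ^ 2"
        by (rule Cauchy_inequality[OF h2 c2]) (use \<rho> M z sub in \<open>auto simp: dist_norm\<close>)
      then show ?thesis by (simp add: C_def)
    qed
    have "norm ((deriv ^^ 0) (g z) \<eta> - (\<Sum>k\<le>1. (deriv ^^ k) (g z) 0 * (\<eta> - 0) ^ k / fact k))
        \<le> C * norm (\<eta> - 0) ^ Suc 1 / fact 1"
    proof (rule complex_Taylor[where S = "cball 0 (\<rho>/2)"])
      fix k and x :: complex assume "x \<in> cball 0 (\<rho> / 2)"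
      then have "x \<in> ball 0 \<rho>" using \<rho> by auto
      then show "((deriv ^^ k) (g z) has_field_derivative (deriv ^^ Suc k) (g z) x) (at x within cball 0 (\<rho> / 2))"
        using has_field_derivative_higher_deriv[OF hl open_ball] has_field_derivative_at_within by blast
    qed (use \<eta> \<rho> B in \<open>auto simp: numeral_2_eq_2\<close>)
    moreover have "deriv (g z) 0 = pd i f (w(j := w j + z))"
      using DERIV_imp_deriv[OF der_i[OF z, of 0]] \<rho> ij fun_upd_idem[of "w(j := w j + z)" i "w i"]
      by simp
    ultimately show ?thesis by (simp add: algebra_simps power2_eq_square)
  qed
  define q where "q = (\<lambda>n z. (g z (h n) - g z 0) / h n)"
  define q' where "q' = (\<lambda>n z. (pd j f (w(i := w i + h n, j := w j + z)) - pd j f (w(j := w j + z))) / h n)"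
  have upd0: "w(i := w i, j := x) = w(j := x)" for x by simp
  have dq: "(q n has_field_derivative q' n z) (at z)" if "norm z \<le> \<rho>" for n z
  proof -
    have "norm (h n) \<le> \<rho>" using hnorm[of n] \<rho> by linarith
    then show ?thesis
      unfolding q_def q'_def
      using der_j[OF that, of "h n"] der_j[OF that, of 0] \<rho>
      by (auto intro!: DERIV_cdivide DERIV_diff simp: upd0)
  qed
  have cont: "eventually (\<lambda>n. continuous_on (cball 0 \<rho>) (q n) \<and>
       (\<forall>z\<in>ball 0 \<rho>. (q n has_field_derivative q' n z) (at z))) sequentially"
  proof (intro always_eventually allI conjI ballI)
    fix n show "continuous_on (cball 0 \<rho>) (q n)"
      by (rule DERIV_continuous_on, rule has_field_derivative_at_within, rule dq) auto
  qed (use dq in auto)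
  have ulim: "uniform_limit (cball 0 \<rho>) q (\<lambda>z. pd i f (w(j := w j + z))) sequentially"
    unfolding uniform_limit_iff
  proof (intro allI impI)
    fix e :: real assume e: "e > 0"
    have "(\<lambda>n. C * norm (h n)) \<longlonglongrightarrow> C * norm (0::complex)"
      by (intro tendsto_intros hlim)
    then have "eventually (\<lambda>n. C * norm (h n) < e) sequentially"
      using e by (auto dest: order_tendstoD(2))
    then show "\<forall>\<^sub>F n in sequentially. \<forall>z\<in>cball 0 \<rho>. dist (q n z) (pd i f (w(j := w j + z))) < e"
    proof eventually_elim
      case (elim n)
      show ?case
      proof
        fix z :: complex assume "z \<in> cball 0 \<rho>"
        then have "norm (g z (h n) - g z 0 - pd i f (w(j := w j + z)) * h n) \<le> C * norm (h n) ^ 2"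
          by (intro taylor hnorm) auto
        moreover have "q n z - pd i f (w(j := w j + z)) =
            (g z (h n) - g z 0 - pd i f (w(j := w j + z)) * h n) / h n"
          using hnz[of n] by (simp add: q_def field_simps)
        ultimately have "norm (q n z - pd i f (w(j := w j + z))) \<le> C * norm (h n) ^ 2 / norm (h n)"
          by (simp add: norm_divide divide_right_mono)
        also have "\<dots> = C * norm (h n)" using hnz[of n] by (simp add: power2_eq_square)
        finally show "dist (q n z) (pd i f (w(j := w j + z))) < e"
          using elim by (simp add: dist_norm)
      qed
    qed
  qed
  \<comment> \<open>Weierstrass' theorem gives differentiability of the limit in direction
    \<open>j\<close> and convergence of the derivatives \<open>q'\<close> at once; at 0 the latter
    are difference quotients of \<open>pd j f\<close> in direction \<open>i\<close>.\<close>
  obtain g' where g': "\<And>z. z \<in> ball 0 \<rho> \<Longrightarrow>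
      ((\<lambda>z. pd i f (w(j := w j + z))) has_field_derivative g' z) (at z) \<and> (\<lambda>n. q' n z) \<longlonglongrightarrow> g' z"
    by (rule has_complex_derivative_uniform_limit[OF cont ulim sequentially_bot \<rho>]) (rule that, blast)
  have "((\<lambda>z. pd i f (w(j := w j + z))) has_field_derivative g' 0) (at 0)" using g' \<rho> by auto
  then have 1: "((\<lambda>z. pd i f (w(j := z))) has_field_derivative g' 0) (at (w j))"
    using DERIV_at_within_shift[of "\<lambda>z. pd i f (w(j := z))" "g' 0" "w j" 0 UNIV] by simp
  have "(\<lambda>n. q' n 0) \<longlonglongrightarrow> g' 0" using g' \<rho> by auto
  moreover have "q' n 0 = (pd j f (w(i := w i + h n)) - pd j f w) / h n" for n
    using fun_upd_idem[of "w(i := w i + h n)" j "w j"] ij by (simp add: q'_def)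
  ultimately have "(\<lambda>n. (pd j f (w(i := w i + h n)) - pd j f w) / h n) \<longlonglongrightarrow> g' 0" by simp
  from that[OF 1 hlim hnz this] show ?thesis .
qed

lemma hol_pd:
  assumes dom: "pdom I D" and f: "hol I D f" and i: "i \<in> I"
  shows "hol I D (pd i f)"
proof (rule holI)
  fix w j assume w: "w \<in> D" "j \<in> I"
  show "\<exists>c. ((\<lambda>z. pd i f (w(j := z))) has_field_derivative c) (at (w j))"
  proof (cases "i = j")
    case True
    obtain \<rho> where \<rho>: "\<rho> > 0" "\<And>z. norm (z - w i) < \<rho> \<Longrightarrow> w(i := z) \<in> D"
      using pdom_upd[OF dom w(1) i] by blast
    have "(\<lambda>z. f (w(i := z))) holomorphic_on ball (w i) \<rho>"
      by (rule hol_upd_holomorphic[OF f i]) (use \<rho> in \<open>auto simp: dist_norm norm_minus_commute\<close>)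
    then have "deriv (\<lambda>z. f (w(i := z))) holomorphic_on ball (w i) \<rho>"
      by (intro holomorphic_deriv) auto
    then have "(deriv (\<lambda>z. f (w(i := z)))) field_differentiable (at (w i))"
      using \<rho>(1) by (meson centre_in_ball holomorphic_on_imp_differentiable_at open_ball)
    moreover have "deriv (\<lambda>z. f (w(i := z))) = (\<lambda>z. pd i f (w(i := z)))"
      by (auto simp: pd_def)
    ultimately show ?thesis using True by (auto simp: field_differentiable_def)
  next
    case False
    show ?thesis by (rule pd_differentiable_aux[OF dom f w(1) i w(2) False]) (rule exI)
  qed
qed (rule pd_continuous[OF assms])

text \<open>The auxiliary sequence already computes \<open>pd j (pd i f)\<close>. Since
  \<open>pd j f\<close> is known to be differentiable in direction \<open>i\<close>, its quotients
  along this one sequence must converge to \<open>pd i (pd j f)\<close> as well.\<close>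

lemma pd_commute:
  assumes dom: "pdom I D" and f: "hol I D f" and w: "w \<in> D" and i: "i \<in> I" and j: "j \<in> I"
  shows "pd i (pd j f) w = pd j (pd i f) w"
proof (cases "i = j")
  case False
  obtain c h where c: "((\<lambda>z. pd i f (w(j := z))) has_field_derivative c) (at (w j))"
    "h \<longlonglongrightarrow> 0" "\<And>n. h n \<noteq> 0"
    "(\<lambda>n. (pd j f (w(i := w i + h n)) - pd j f w) / h n) \<longlonglongrightarrow> c"
    by (rule pd_differentiable_aux[OF dom f w i j False]) (rule that)
  have "((\<lambda>z. pd j f (w(i := z))) has_field_derivative pd i (pd j f) w) (at (w i))"
    by (rule hol_pd_DERIV[OF hol_pd[OF dom f j] w i])
  then have "((\<lambda>\<eta>. (pd j f (w(i := w i + \<eta>)) - pd j f w) / \<eta>) \<longlongrightarrow> pd i (pd j f) w) (at 0)"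
    by (simp add: DERIV_def)
  moreover have "filterlim h (at 0) sequentially"
    using c(2,3) by (simp add: filterlim_at)
  ultimately have "(\<lambda>n. (pd j f (w(i := w i + h n)) - pd j f w) / h n) \<longlonglongrightarrow> pd i (pd j f) w"
    by (rule filterlim_compose[where f = h])
  then have "pd i (pd j f) w = c" using c(4) LIMSEQ_unique by blast
  moreover have "pd j (pd i f) w = c" using c(1) by (rule pd_eqI)
  ultimately show ?thesis by simp
qed simp

section \<open>Continuation of solutions over simply connected domains\<close>

lemma continuous_on_open_nbhd:
  assumes "continuous_on A k" "a \<in> A" "open U" "k a \<in> U"
  obtains W where "open W" "a \<in> W" "\<And>y. y \<in> A \<Longrightarrow> y \<in> W \<Longrightarrow> k y \<in> U"
proof -
  have "\<exists>W. open W \<and> a \<in> W \<and> (\<forall>y\<in>A. y \<in> W \<longrightarrow> k y \<in> U)"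
    using assms(1)[unfolded continuous_on_topological] assms(2-4) by (elim ballE allE impE) auto
  then show ?thesis using that by blast
qed

text \<open>A local system given by charts: over \<open>T p\<close> the sections are indexed by
  \<open>c\<close> in \<open>V\<close>, and \<open>F p c w\<close> is the value at \<open>w\<close>.
  By \<open>F_bij\<close> a section over a chart is determined by its value at any point and every
  value occurs, so germs can be coded by their values.\<close>

locale locally_constant_sheaf =
  fixes D :: "'p::topological_space set" and T :: "'p \<Rightarrow> 'p set"
    and F :: "'p \<Rightarrow> 'v \<Rightarrow> 'p \<Rightarrow> 'v" and V :: "'v set"
  assumes T_self: "p \<in> D \<Longrightarrow> p \<in> T p"
    and T_sub: "p \<in> D \<Longrightarrow> T p \<subseteq> D"
    and T_open: "p \<in> D \<Longrightarrow> openin (top_of_set D) (T p)"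
    and T_connected: "p \<in> D \<Longrightarrow> path_connected (T p)"
    and F_bij: "p \<in> D \<Longrightarrow> w \<in> T p \<Longrightarrow> bij_betw (\<lambda>c. F p c w) V V"
    and F_compat: "p \<in> D \<Longrightarrow> p' \<in> D \<Longrightarrow> w \<in> T p \<Longrightarrow> w \<in> T p' \<Longrightarrow> c \<in> V \<Longrightarrow> c' \<in> V \<Longrightarrow>
       F p c w = F p' c' w \<Longrightarrow> \<exists>U. open U \<and> w \<in> U \<and> (\<forall>w'\<in>U \<inter> T p \<inter> T p'. F p c w' = F p' c' w')"
begin

text \<open>\<open>G\<close> is a continuous lift of \<open>h\<close> to the covering space of
  germs. The condition is imposed in every chart around \<open>h a\<close>, not just in one, so that
  two lifts can always be compared in a common chart.\<close>

definition lifts :: "('a::topological_space \<Rightarrow> 'p) \<Rightarrow> 'a set \<Rightarrow> ('a \<Rightarrow> 'v) \<Rightarrow> bool" where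
  "lifts h A G \<longleftrightarrow> (\<forall>a\<in>A. G a \<in> V \<and> (\<forall>p\<in>D. h a \<in> T p \<longrightarrow>
     (\<exists>c\<in>V. \<exists>U. open U \<and> a \<in> U \<and> (\<forall>b\<in>U \<inter> A. h b \<in> T p \<and> G b = F p c (h b)))))"

text \<open>The value may be prescribed at any point instead of at a base point; this is what makes
  the property stable under gluing.\<close>

definition liftable :: "('a::topological_space \<Rightarrow> 'p) \<Rightarrow> 'a set \<Rightarrow> bool" where
  "liftable h A \<longleftrightarrow> (\<forall>a\<in>A. \<forall>v\<in>V. \<exists>G. lifts h A G \<and> G a = v)"

lemma F_inj: "p \<in> D \<Longrightarrow> w \<in> T p \<Longrightarrow> c \<in> V \<Longrightarrow> c' \<in> V \<Longrightarrow> F p c w = F p c' w \<Longrightarrow> c = c'"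
  using F_bij[of p w] unfolding bij_betw_def inj_on_def by blast

lemma F_in: "p \<in> D \<Longrightarrow> w \<in> T p \<Longrightarrow> c \<in> V \<Longrightarrow> F p c w \<in> V"
  using F_bij[of p w] unfolding bij_betw_def by blast

lemma F_surj:
  assumes "p \<in> D" "w \<in> T p" "v \<in> V"
  obtains c where "c \<in> V" "F p c w = v"
proof -
  have "v \<in> (\<lambda>c. F p c w) ` V" using F_bij[OF assms(1,2)] assms(3) by (simp add: bij_betw_def)
  then show ?thesis using that by auto
qed

lemma lifts_in: "lifts h A G \<Longrightarrow> a \<in> A \<Longrightarrow> G a \<in> V"
  by (simp add: lifts_def)

lemma lifts_at:
  assumes "lifts h A G" "a \<in> A" "p \<in> D" "h a \<in> T p"
  obtains c U where "c \<in> V" "open U" "a \<in> U" "\<And>b. b \<in> U \<Longrightarrow> b \<in> A \<Longrightarrow> h b \<in> T p \<and> G b = F p c (h b)"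
proof -
  have "\<exists>c\<in>V. \<exists>U. open U \<and> a \<in> U \<and> (\<forall>b\<in>U \<inter> A. h b \<in> T p \<and> G b = F p c (h b))"
    using assms by (simp add: lifts_def)
  then show ?thesis by (elim bexE exE conjE) (rule that, auto)
qed

text \<open>Near each point both lifts are given by constants in one chart, and agreement at a
  single nearby point forces equal constants. Agreement is thus locally all or nothing, and
  connectedness spreads it.\<close>

lemma lifts_unique:
  assumes "connected A" "lifts h A G" "lifts h A G'" "h ` A \<subseteq> D" "a \<in> A" "b \<in> A" "G a = G' a"
  shows "G b = G' b"
proof (rule connected_induction_simple[OF assms(1,5,6), where P = "\<lambda>x. G x = G' x"])
  fix x assume x: "x \<in> A"
  then have p: "h x \<in> D" "h x \<in> T (h x)" using assms(4) T_self by auto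
  obtain c U where c: "c \<in> V" "open U" "x \<in> U" "\<And>b. b \<in> U \<Longrightarrow> b \<in> A \<Longrightarrow> h b \<in> T (h x) \<and> G b = F (h x) c (h b)"
    by (rule lifts_at[OF assms(2) x p]) (rule that)
  obtain c' U' where c': "c' \<in> V" "open U'" "x \<in> U'" "\<And>b. b \<in> U' \<Longrightarrow> b \<in> A \<Longrightarrow> h b \<in> T (h x) \<and> G' b = F (h x) c' (h b)"
    by (rule lifts_at[OF assms(3) x p]) (rule that)
  show "\<exists>S. openin (top_of_set A) S \<and> x \<in> S \<and> (\<forall>x\<in>S. \<forall>y\<in>S. G x = G' x \<longrightarrow> G y = G' y)"
  proof (intro exI[of _ "A \<inter> (U \<inter> U')"] conjI ballI impI)
    show "openin (top_of_set A) (A \<inter> (U \<inter> U'))" using c c' by (intro openin_open_Int) auto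
    show "x \<in> A \<inter> (U \<inter> U')" using x c c' by blast
    fix y z assume y: "y \<in> A \<inter> (U \<inter> U')" and z: "z \<in> A \<inter> (U \<inter> U')" and "G y = G' y"
    then have "F (h x) c (h y) = F (h x) c' (h y)" "h y \<in> T (h x)" using c(4) c'(4) by auto
    then have "c = c'" using F_inj[OF p(1) _ c(1) c'(1)] by blast
    then show "G z = G' z" using z c(4) c'(4) by auto
  qed
qed (use assms in auto)

lemma lifts_compose:
  assumes "lifts h A G" "continuous_on B k" "k ` B \<subseteq> A"
  shows "lifts (\<lambda>x. h (k x)) B (\<lambda>x. G (k x))"
  unfolding lifts_def
proof (intro ballI conjI impI)
  fix b assume b: "b \<in> B"
  then have kb: "k b \<in> A" using assms(3) by blast
  then show "G (k b) \<in> V" using lifts_in[OF assms(1)] by blast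
  fix p assume p: "p \<in> D" "h (k b) \<in> T p"
  obtain c U where c: "c \<in> V" "open U" "k b \<in> U" "\<And>b. b \<in> U \<Longrightarrow> b \<in> A \<Longrightarrow> h b \<in> T p \<and> G b = F p c (h b)"
    by (rule lifts_at[OF assms(1) kb p]) (rule that)
  obtain W where W: "open W" "b \<in> W" "\<And>y. y \<in> B \<Longrightarrow> y \<in> W \<Longrightarrow> k y \<in> U"
    by (rule continuous_on_open_nbhd[OF assms(2) b c(2,3)]) (rule that)
  show "\<exists>c\<in>V. \<exists>U. open U \<and> b \<in> U \<and> (\<forall>b\<in>U \<inter> B. h (k b) \<in> T p \<and> G (k b) = F p c (h (k b)))"
    by (rule bexI[OF _ c(1)], rule exI[of _ W]) (use W c(4) assms(3) in blast)
qed

lemma lifts_subset: "lifts h A G \<Longrightarrow> B \<subseteq> A \<Longrightarrow> lifts h B G"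
  using lifts_compose[of h A G B "\<lambda>x. x"] by simp

lemma lifts_cong:
  assumes "lifts h A G" "\<And>a. a \<in> A \<Longrightarrow> h a = h' a" "\<And>a. a \<in> A \<Longrightarrow> G a = G' a"
  shows "lifts h' A G'"
  unfolding lifts_def
proof (intro ballI conjI impI)
  fix a assume a: "a \<in> A"
  then show "G' a \<in> V" using lifts_in[OF assms(1) a] assms(3) by simp
  fix p assume p: "p \<in> D" "h' a \<in> T p"
  then have hap: "h a \<in> T p" using a assms(2) by simp
  obtain c U where
    "c \<in> V" "open U" "a \<in> U" "\<And>b. b \<in> U \<Longrightarrow> b \<in> A \<Longrightarrow> h b \<in> T p \<and> G b = F p c (h b)"
    by (rule lifts_at[OF assms(1) a p(1) hap]) (rule that)
  then show "\<exists>c\<in>V. \<exists>U. open U \<and> a \<in> U \<and> (\<forall>b\<in>U \<inter> A. h' b \<in> T p \<and> G' b = F p c (h' b))"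
    using assms(2,3) by (intro bexI[of _ c] exI[of _ U]) auto
qed

text \<open>In any other chart around \<open>h a\<close> the constant with the same value there
  gives the same section nearby, by \<open>F_compat\<close>.\<close>

lemma lifts_local:
  assumes p: "p \<in> D" and hA: "h ` A \<subseteq> T p" and cont: "continuous_on A h" and c: "c \<in> V"
  shows "lifts h A (\<lambda>a. F p c (h a))"
  unfolding lifts_def
proof (intro ballI conjI impI)
  fix a assume a: "a \<in> A"
  then have ha: "h a \<in> T p" using hA by blast
  then show in_V: "F p c (h a) \<in> V" using F_in p c by blast
  fix p' assume p': "p' \<in> D" "h a \<in> T p'"
  obtain c' where c': "c' \<in> V" "F p' c' (h a) = F p c (h a)" using F_surj[OF p' in_V] .
  obtain U where U: "open U" "h a \<in> U" "\<forall>w'\<in>U \<inter> T p' \<inter> T p. F p' c' w' = F p c w'"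
    using F_compat[OF p'(1) p p'(2) ha c'(1) c c'(2)] by blast
  obtain T' where T': "open T'" "T p' = D \<inter> T'"
    using T_open[OF p'(1)] by (auto simp: openin_open)
  have "open (U \<inter> T')" "h a \<in> U \<inter> T'" using U T' p' by auto
  then obtain W where W: "open W" "a \<in> W" "\<And>y. y \<in> A \<Longrightarrow> y \<in> W \<Longrightarrow> h y \<in> U \<inter> T'"
    by (rule continuous_on_open_nbhd[OF cont a]) (rule that)
  show "\<exists>c'\<in>V. \<exists>U. open U \<and> a \<in> U \<and> (\<forall>b\<in>U \<inter> A. h b \<in> T p' \<and> F p c (h b) = F p' c' (h b))"
  proof (intro bexI[OF _ c'(1)] exI[of _ W] conjI ballI)
    fix b assume b: "b \<in> W \<inter> A"
    then have "h b \<in> T p" "h b \<in> U" "h b \<in> T'" using W hA by auto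
    moreover then show "h b \<in> T p'" using T'(2) T_sub[OF p] by blast
    ultimately show "F p c (h b) = F p' c' (h b)" using U(3) by auto
  qed (use W in auto)
qed

lemma liftable_local:
  assumes "p \<in> D" "h ` A \<subseteq> T p" "continuous_on A h"
  shows "liftable h A"
  unfolding liftable_def
proof (intro ballI)
  fix a v assume "a \<in> A" "v \<in> V"
  then obtain c where "c \<in> V" "F p c (h a) = v" using F_surj[OF assms(1)] assms(2) by blast
  then show "\<exists>G. lifts h A G \<and> G a = v" using lifts_local[OF assms] by blast
qed

text \<open>The two lifts are matched at one point of the overlap and hence, by connectedness, on
  all of it. Closedness of \<open>A\<close> and \<open>B\<close> gives a point of only one of them a
  neighbourhood that misses the other.\<close>

lemma liftable_union_aux:
  assumes A: "liftable h A" and B: "liftable h B" and cl: "closed A" "closed B"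
    and conn: "connected (A \<inter> B)" "A \<inter> B \<noteq> {}" and hD: "h ` (A \<union> B) \<subseteq> D"
    and a: "a \<in> A" and v: "v \<in> V"
  shows "\<exists>G. lifts h (A \<union> B) G \<and> G a = v"
proof -
  obtain G1 where G1: "lifts h A G1" "G1 a = v" using A a v unfolding liftable_def by blast
  obtain b where b: "b \<in> A" "b \<in> B" using conn(2) by blast
  obtain G2 where G2: "lifts h B G2" "G2 b = G1 b"
    using B b lifts_in[OF G1(1) b(1)] unfolding liftable_def by blast
  have eq: "G1 x = G2 x" if "x \<in> A" "x \<in> B" for x
    by (rule lifts_unique[OF conn(1), of h G1 G2 b])
       (use that b G1 G2 hD in \<open>auto intro: lifts_subset\<close>)
  define G where "G = (\<lambda>x. if x \<in> A then G1 x else G2 x)"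
  have GB: "G x = G2 x" if "x \<in> B" for x using that eq by (auto simp: G_def)
  have GA: "G x = G1 x" if "x \<in> A" for x using that by (auto simp: G_def)
  have "lifts h (A \<union> B) G"
    unfolding lifts_def
  proof (intro ballI conjI impI)
    fix x assume x: "x \<in> A \<union> B"
    then show "G x \<in> V" using lifts_in[OF G1(1)] lifts_in[OF G2(1)] GA GB by auto
    fix p assume p: "p \<in> D" "h x \<in> T p"
    consider "x \<notin> B" | "x \<notin> A" | "x \<in> A" "x \<in> B" by blast
    then show "\<exists>c\<in>V. \<exists>U. open U \<and> x \<in> U \<and> (\<forall>b\<in>U \<inter> (A \<union> B). h b \<in> T p \<and> G b = F p c (h b))"
    proof cases
      case 1
      then have xA: "x \<in> A" using x by blast
      obtain c U where
        "c \<in> V" "open U" "x \<in> U" "\<And>b. b \<in> U \<Longrightarrow> b \<in> A \<Longrightarrow> h b \<in> T p \<and> G1 b = F p c (h b)"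
        by (rule lifts_at[OF G1(1) xA p]) (rule that)
      then show ?thesis using 1 cl GA
        by (intro bexI[of _ c] exI[of _ "U \<inter> - B"]) (auto simp: open_Compl)
    next
      case 2
      then have xB: "x \<in> B" using x by blast
      obtain c U where
        "c \<in> V" "open U" "x \<in> U" "\<And>b. b \<in> U \<Longrightarrow> b \<in> B \<Longrightarrow> h b \<in> T p \<and> G2 b = F p c (h b)"
        by (rule lifts_at[OF G2(1) xB p]) (rule that)
      then show ?thesis using 2 cl GB
        by (intro bexI[of _ c] exI[of _ "U \<inter> - A"]) (auto simp: open_Compl)
    next
      case 3
      obtain c U where c: "c \<in> V" "open U" "x \<in> U" "\<And>b. b \<in> U \<Longrightarrow> b \<in> A \<Longrightarrow> h b \<in> T p \<and> G1 b = F p c (h b)"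
        by (rule lifts_at[OF G1(1) 3(1) p]) (rule that)
      obtain c' U' where c': "c' \<in> V" "open U'" "x \<in> U'" "\<And>b. b \<in> U' \<Longrightarrow> b \<in> B \<Longrightarrow> h b \<in> T p \<and> G2 b = F p c' (h b)"
        by (rule lifts_at[OF G2(1) 3(2) p]) (rule that)
      have "F p c (h x) = F p c' (h x)" using c(3,4) c'(3,4) 3 eq by fastforce
      then have "c = c'" using F_inj[OF p c(1) c'(1)] by blast
      then show ?thesis using c c' GA GB
        by (intro bexI[of _ c] exI[of _ "U \<inter> U'"]) auto
    qed
  qed
  moreover have "G a = v" using GA a G1 by simp
  ultimately show ?thesis by blast
qed

lemma liftable_union:
  assumes "liftable h A" "liftable h B" "closed A" "closed B"
    "connected (A \<inter> B)" "A \<inter> B \<noteq> {}" "h ` (A \<union> B) \<subseteq> D"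
  shows "liftable h (A \<union> B)"
  unfolding liftable_def
proof (intro ballI)
  fix a v assume a: "a \<in> A \<union> B" and v: "v \<in> V"
  show "\<exists>G. lifts h (A \<union> B) G \<and> G a = v"
  proof (cases "a \<in> A")
    case True
    then show ?thesis using liftable_union_aux[OF assms _ v] by blast
  next
    case False
    then have "a \<in> B" using a by blast
    with liftable_union_aux[OF assms(2,1,4,3), of a v] assms v show ?thesis
      by (simp add: Int_commute Un_commute)
  qed
qed

text \<open>Bisection takes the place of a Lebesgue number: small rectangles are mapped into one
  chart, and neighbouring rectangles meet in a segment, which is connected. It is applied to the
  first coordinate and, within that, to the second.\<close>

lemma liftable_square:
  fixes h :: "real \<times> real \<Rightarrow> 'p"
  assumes cont: "continuous_on ({0..1} \<times> {0..1}) h" and hD: "h ` ({0..1} \<times> {0..1}) \<subseteq> D"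
  shows "liftable h ({0..1} \<times> {0..1})"
proof -
  define P where "P = (\<lambda>a b::real. 0 \<le> a \<longrightarrow> b \<le> 1 \<longrightarrow> liftable h ({a..b} \<times> {0..1}))"
  have "P 0 1"
  proof (rule Bolzano[where P = P])
    show "(0::real) \<le> 1" by simp
  next
    fix a b c assume ab: "P a b" "P b c" "a \<le> b" "b \<le> c"
    show "P a c" unfolding P_def
    proof (intro impI)
      assume 0: "0 \<le> a" "c \<le> 1"
      have eq: "{a..c} \<times> {0..1} = {a..b} \<times> {0..1::real} \<union> {b..c} \<times> {0..1}" using ab by auto
      have int: "{a..b} \<times> {0..1} \<inter> {b..c} \<times> {0..1} = {b} \<times> {0..1::real}" using ab by auto
      show "liftable h ({a..c} \<times> {0..1})"
        unfolding eq
      proof (rule liftable_union)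
        show "liftable h ({a..b} \<times> {0..1})" "liftable h ({b..c} \<times> {0..1})"
          using ab 0 by (auto simp: P_def)
        show "connected ({a..b} \<times> {0..1} \<inter> {b..c} \<times> {0..1::real})" "{a..b} \<times> {0..1} \<inter> {b..c} \<times> {0..1::real} \<noteq> {}"
          unfolding int by (auto intro: connected_Times)
        show "h ` ({a..b} \<times> {0..1} \<union> {b..c} \<times> {0..1}) \<subseteq> D"
          unfolding eq[symmetric] using 0 by (intro order_trans[OF image_mono hD]) auto
      qed (auto intro: closed_Times)
    qed
  next
    fix s :: real assume s: "0 \<le> s" "s \<le> 1"
    \<comment> \<open>The admissible width \<open>d\<close> is existential, so it may shrink
      whenever two height intervals are joined.\<close>
    define R where "R = (\<lambda>t1 t2::real. 0 \<le> t1 \<longrightarrow> t2 \<le> 1 \<longrightarrow>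
       (\<exists>d>0. \<forall>a b. 0 \<le> a \<and> a \<le> s \<and> s \<le> b \<and> b \<le> 1 \<and> b - a < d \<longrightarrow> liftable h ({a..b} \<times> {t1..t2})))"
    have "R 0 1"
    proof (rule Bolzano[where P = R])
      show "(0::real) \<le> 1" by simp
    next
      fix t1 t2 t3 assume t: "R t1 t2" "R t2 t3" "t1 \<le> t2" "t2 \<le> t3"
      show "R t1 t3" unfolding R_def
      proof (intro impI)
        assume 0: "0 \<le> t1" "t3 \<le> 1"
        obtain d1 where d1: "d1 > 0" "\<forall>a b. 0 \<le> a \<and> a \<le> s \<and> s \<le> b \<and> b \<le> 1 \<and> b - a < d1 \<longrightarrow> liftable h ({a..b} \<times> {t1..t2})"
          using t 0 by (auto simp: R_def)
        obtain d2 where d2: "d2 > 0" "\<forall>a b. 0 \<le> a \<and> a \<le> s \<and> s \<le> b \<and> b \<le> 1 \<and> b - a < d2 \<longrightarrow> liftable h ({a..b} \<times> {t2..t3})"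
          using t 0 by (auto simp: R_def)
        show "\<exists>d>0. \<forall>a b. 0 \<le> a \<and> a \<le> s \<and> s \<le> b \<and> b \<le> 1 \<and> b - a < d \<longrightarrow> liftable h ({a..b} \<times> {t1..t3})"
        proof (intro exI[of _ "min d1 d2"] conjI allI impI)
          fix a b assume ab: "0 \<le> a \<and> a \<le> s \<and> s \<le> b \<and> b \<le> 1 \<and> b - a < min d1 d2"
          have eq: "{a..b} \<times> {t1..t3} = {a..b} \<times> {t1..t2} \<union> {a..b} \<times> {t2..t3}" using t by auto
          have int: "{a..b} \<times> {t1..t2} \<inter> {a..b} \<times> {t2..t3} = {a..b} \<times> {t2}" using t by auto
          show "liftable h ({a..b} \<times> {t1..t3})"
            unfolding eq
          proof (rule liftable_union)
            show "liftable h ({a..b} \<times> {t1..t2})" "liftable h ({a..b} \<times> {t2..t3})"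
              using ab d1(2) d2(2) by auto
            show "connected ({a..b} \<times> {t1..t2} \<inter> {a..b} \<times> {t2..t3})" "{a..b} \<times> {t1..t2} \<inter> {a..b} \<times> {t2..t3} \<noteq> {}"
              unfolding int using ab by (auto intro: connected_Times)
            show "h ` ({a..b} \<times> {t1..t2} \<union> {a..b} \<times> {t2..t3}) \<subseteq> D"
              unfolding eq[symmetric] using 0 ab by (intro order_trans[OF image_mono hD]) auto
          qed (auto intro: closed_Times)
        qed (use d1 d2 in auto)
      qed
    next
      fix t :: real assume t: "0 \<le> t" "t \<le> 1"
      define p where "p = h (s, t)"
      have st: "(s, t) \<in> {0..1} \<times> {0..1}" using s t by auto
      have p: "p \<in> D" using hD st unfolding p_def by blast
      obtain T' where T': "open T'" "T p = D \<inter> T'" using T_open[OF p] by (auto simp: openin_open)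
      have "h (s, t) \<in> T'" using T_self[OF p] T'(2) by (auto simp: p_def)
      then obtain W where W: "open W" "(s, t) \<in> W" "\<And>y. y \<in> {0..1} \<times> {0..1} \<Longrightarrow> y \<in> W \<Longrightarrow> h y \<in> T'"
        by (rule continuous_on_open_nbhd[OF cont st T'(1)]) (rule that)
      obtain \<epsilon> where \<epsilon>: "\<epsilon> > 0" "ball (s, t) \<epsilon> \<subseteq> W" using W open_contains_ball by blast
      show "\<exists>d>0. \<forall>a b. a \<le> t \<and> t \<le> b \<and> b - a < d \<longrightarrow> R a b"
      \<comment> \<open>Sides below \<open>\<epsilon> / 2\<close> keep the rectangle inside the ball
        of radius \<open>\<epsilon>\<close> around \<open>(s, t)\<close>.\<close>
      proof (intro exI[of _ "\<epsilon> / 2"] conjI allI impI)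
        fix t1 t2 assume t12: "t1 \<le> t \<and> t \<le> t2 \<and> t2 - t1 < \<epsilon> / 2"
        show "R t1 t2" unfolding R_def
        proof (intro impI exI[of _ "\<epsilon> / 2"] conjI allI)
          fix a b assume 0: "0 \<le> t1" "t2 \<le> 1" and ab: "0 \<le> a \<and> a \<le> s \<and> s \<le> b \<and> b \<le> 1 \<and> b - a < \<epsilon> / 2"
          have sub: "{a..b} \<times> {t1..t2} \<subseteq> {0..1} \<times> {0..1}" using ab 0 by auto
          show "liftable h ({a..b} \<times> {t1..t2})"
          proof (rule liftable_local[OF p])
            show "continuous_on ({a..b} \<times> {t1..t2}) h" using cont sub continuous_on_subset by blast
            show "h ` ({a..b} \<times> {t1..t2}) \<subseteq> T p"
            proof
              fix w assume "w \<in> h ` ({a..b} \<times> {t1..t2})"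
              then obtain x y where xy: "w = h (x, y)" "x \<in> {a..b}" "y \<in> {t1..t2}" by auto
              have "dist (x, y) (s, t) \<le> dist x s + dist y t"
                unfolding dist_prod_def by (simp add: sqrt_sum_squares_le_sum)
              also have "\<dots> < \<epsilon>" using xy ab t12 by (auto simp: dist_real_def)
              finally have "(x, y) \<in> W" using \<epsilon>(2) by (auto simp: dist_commute)
              moreover have "(x, y) \<in> {0..1} \<times> {0..1}" using xy sub by blast
              ultimately have "h (x, y) \<in> T'" "h (x, y) \<in> D" using W(3) hD by blast+
              then show "w \<in> T p" using T'(2) xy(1) by blast
            qed
          qed
        qed (use \<epsilon> in auto)
      qed (use \<epsilon> in auto)
    qed
    then obtain d where "d > 0" "\<forall>a b. 0 \<le> a \<and> a \<le> s \<and> s \<le> b \<and> b \<le> 1 \<and> b - a < d \<longrightarrow> liftable h ({a..b} \<times> {0..1})"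
      by (auto simp: R_def)
    then show "\<exists>d>0. \<forall>a b. a \<le> s \<and> s \<le> b \<and> b - a < d \<longrightarrow> P a b"
      unfolding P_def by (intro exI[of _ d]) auto
  qed
  then show ?thesis by (simp add: P_def)
qed

section \<open>Monodromy and global sections\<close>

lemma lifts_square_ex:
  fixes h :: "real \<times> real \<Rightarrow> 'p"
  assumes "continuous_on ({0..1} \<times> {0..1}) h" "h ` ({0..1} \<times> {0..1}) \<subseteq> D" "v \<in> V"
  obtains G where "lifts h ({0..1} \<times> {0..1}) G" "G (0, 0) = v"
proof -
  have "(0, 0) \<in> {0..1::real} \<times> {0..1::real}" by simp
  then show ?thesis
    using liftable_square[OF assms(1,2)] assms(3) that unfolding liftable_def by blast
qed

text \<open>A path is regarded as a square that is constant in the first coordinate.\<close>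

lemma lifts_path_ex:
  assumes g: "path g" "path_image g \<subseteq> D" and v: "v \<in> V"
  obtains G where "lifts g {0..1} G" "G 0 = v"
proof -
  have "continuous_on ({0..1} \<times> {0..1}) (\<lambda>x::real\<times>real. g (snd x))"
    using g(1) unfolding path_def
    by (rule continuous_on_compose2) (auto intro: continuous_intros)
  moreover have "(\<lambda>x::real\<times>real. g (snd x)) ` ({0..1} \<times> {0..1}) \<subseteq> D"
    using g(2) by (auto simp: path_image_def)
  ultimately obtain G where G: "lifts (\<lambda>x::real\<times>real. g (snd x)) ({0..1} \<times> {0..1}) G" "G (0, 0) = v"
    by (rule lifts_square_ex[OF _ _ v]) (rule that)
  have "lifts (\<lambda>t. g (snd (0::real, t))) {0..1} (\<lambda>t. G (0, t))"
    by (rule lifts_compose[OF G(1)]) (auto intro: continuous_intros)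
  then show ?thesis using that[of "\<lambda>t. G (0, t)"] G(2) by simp
qed

lemma lifts_const:
  assumes "a \<in> D" "v \<in> V"
  shows "lifts (\<lambda>_. a) A (\<lambda>_. v)"
proof -
  obtain c where c: "c \<in> V" "F a c a = v" using F_surj[OF assms(1) T_self[OF assms(1)] assms(2)] .
  have "lifts (\<lambda>_. a) A (\<lambda>x. F a c a)"
    using lifts_local[OF assms(1), of "\<lambda>_. a" A c] c T_self[OF assms(1)] by auto
  then show ?thesis using c by simp
qed

text \<open>A free homotopy contracts the loop to a constant one. Its lift has two edges over the
  same trace \<open>h (t, 0) = h (t, 1)\<close> of the base point; they agree where the loop has
  become constant, hence also at the start.\<close>

lemma lifts_loop:
  assumes sc: "simply_connected D" and g: "path g" "path_image g \<subseteq> D" "pathfinish g = pathstart g"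
    and G: "lifts g {0..1} G"
  shows "G 1 = G 0"
proof -
  define a where "a = g 0"
  have gD: "g t \<in> D" if "t \<in> {0..1}" for t using g(2) that by (auto simp: path_image_def)
  have a: "a \<in> D" using gD by (simp add: a_def)
  have "homotopic_loops D g (\<lambda>_. a)"
    using sc[unfolded simply_connected_def, rule_format, of g "\<lambda>_. a"] g a
    by (auto simp: path_def path_image_def pathfinish_def pathstart_def)
  then obtain h where h: "continuous_on ({0..1::real} \<times> {0..1::real}) h" "h ` ({0..1} \<times> {0..1}) \<subseteq> D"
    "\<And>x. x \<in> {0..1} \<Longrightarrow> h (0, x) = g x" "\<And>x. x \<in> {0..1} \<Longrightarrow> h (1, x) = a"
    "\<And>t. t \<in> {0..1} \<Longrightarrow> h (t, 1) = h (t, 0)"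
    unfolding homotopic_loops by (auto simp: pathfinish_def pathstart_def image_subset_iff_funcset)
  have G0: "G 0 \<in> V" using lifts_in[OF G] by simp
  obtain H where H: "lifts h ({0..1} \<times> {0..1}) H" "H (0, 0) = G 0"
    using lifts_square_ex[OF h(1,2) G0] .
  have restr: "lifts (\<lambda>t. h (k t)) {0..1} (\<lambda>t. H (k t))"
    if "continuous_on {0..1} k" "k ` {0..1} \<subseteq> {0..1} \<times> {0..1}" for k :: "real \<Rightarrow> real \<times> real"
    by (rule lifts_compose[OF H(1) that])
  have "lifts (\<lambda>t. h (0, t)) {0..1} (\<lambda>t. H (0, t))" by (rule restr) (auto intro: continuous_intros)
  then have l1: "lifts g {0..1} (\<lambda>t. H (0, t))" by (rule lifts_cong) (auto simp: h)
  have e1: "H (0, 1) = G 1"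
    by (rule lifts_unique[OF _ l1 G, of 0]) (use gD H(2) in auto)
  have "lifts (\<lambda>t. h (1, t)) {0..1} (\<lambda>t. H (1, t))" by (rule restr) (auto intro: continuous_intros)
  then have l2: "lifts (\<lambda>_. a) {0..1} (\<lambda>t. H (1, t))" by (rule lifts_cong) (auto simp: h)
  have H10: "H (1, 0) \<in> V" using lifts_in[OF H(1)] by simp
  have e2: "H (1, 1) = H (1, 0)"
    by (rule lifts_unique[OF _ l2 lifts_const[OF a H10], of 0]) (use a in auto)
  have l3: "lifts (\<lambda>t. h (t, 0)) {0..1} (\<lambda>t. H (t, 0))" by (rule restr) (auto intro: continuous_intros)
  have "lifts (\<lambda>t. h (t, 1)) {0..1} (\<lambda>t. H (t, 1))" by (rule restr) (auto intro: continuous_intros)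
  then have l4: "lifts (\<lambda>t. h (t, 0)) {0..1} (\<lambda>t. H (t, 1))" by (rule lifts_cong) (auto simp: h)
  \<comment> \<open>Uniqueness is run backwards, from the constant loop at 1 to the given loop at
    0.\<close>
  have "H (0, 1) = H (0, 0)"
    by (rule lifts_unique[OF _ l4 l3, of 1]) (use e2 h(2) in auto)
  then show ?thesis using e1 H(2) by simp
qed

text \<open>Simple connectedness is phrased through loops. The homotopy between two constant loops,
  followed at one point of the loop, is a path between their values.\<close>

lemma simply_connected_path:
  assumes sc: "simply_connected D" and "w0 \<in> D" "w \<in> D"
  obtains g where "path g" "path_image g \<subseteq> D" "pathstart g = w0" "pathfinish g = w"
proof -
  have "homotopic_loops D (\<lambda>_. w0) (\<lambda>_. w)"
    using sc[unfolded simply_connected_def, rule_format, of "\<lambda>_. w0" "\<lambda>_. w"] assms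
    by (auto simp: path_def path_image_def pathfinish_def pathstart_def)
  then obtain h where h: "continuous_on ({0..1::real} \<times> {0..1::real}) h" "h ` ({0..1} \<times> {0..1}) \<subseteq> D"
    "\<And>x. x \<in> {0..1} \<Longrightarrow> h (0, x) = w0" "\<And>x. x \<in> {0..1} \<Longrightarrow> h (1, x) = w"
    unfolding homotopic_loops by (auto simp: pathfinish_def pathstart_def image_subset_iff_funcset)
  show ?thesis
  proof (rule that[of "\<lambda>s. h (s, 0)"])
    show "path (\<lambda>s. h (s, 0))" unfolding path_def
      by (rule continuous_on_compose2[OF h(1)]) (auto intro: continuous_intros)
  qed (use h in \<open>auto simp: path_image_def pathstart_def pathfinish_def\<close>)
qed

text \<open>The value at \<open>w\<close> is the end of the lift along any path from
  \<open>w0\<close>. Independence of the path is absence of monodromy, and appending a path inside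
  \<open>T p\<close> shows that the section is given by one constant there.\<close>

theorem global_section:
  assumes sc: "simply_connected D" and w0: "w0 \<in> D" and v0: "v0 \<in> V"
  obtains f where "f w0 = v0" "\<And>p. p \<in> D \<Longrightarrow> \<exists>c\<in>V. \<forall>w\<in>T p. f w = F p c w"
proof -
  \<comment> \<open>A relation before it is known to be a function: some path carries the value
    \<open>v0\<close> at \<open>w0\<close> to \<open>v\<close> at \<open>w\<close>.\<close>
  define tr where "tr = (\<lambda>w v. \<exists>g G. path g \<and> path_image g \<subseteq> D \<and> pathstart g = w0 \<and> pathfinish g = w \<and>
     lifts g {0..1} G \<and> G 0 = v0 \<and> G 1 = v)"
  have first_half: "lifts g1 {0..1} (\<lambda>t. G (t/2))" if "lifts (g1 +++ g2) {0..1} G" for g1 g2 G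
  proof -
    have "lifts (\<lambda>t. (g1 +++ g2) (t/2)) {0..1} (\<lambda>t. G (t/2))"
      by (rule lifts_compose[OF that]) (auto intro!: continuous_intros)
    then show ?thesis by (rule lifts_cong) (auto simp: joinpaths_def)
  qed
  have ex: "\<exists>v. tr w v" if wD: "w \<in> D" for w
  proof -
    obtain g where g: "path g" "path_image g \<subseteq> D" "pathstart g = w0" "pathfinish g = w"
      by (rule simply_connected_path[OF sc w0 wD]) (rule that)
    obtain G where "lifts g {0..1} G" "G 0 = v0" using lifts_path_ex[OF g(1,2) v0] .
    then have "tr w (G 1)" unfolding tr_def by (intro exI conjI) (rule g refl | assumption)+
    then show ?thesis by blast
  qed
  have uniq: "v = v'" if vv: "tr w v" "tr w v'" for w v v'
  proof -
    obtain g1 G1 where 1: "path g1" "path_image g1 \<subseteq> D" "pathstart g1 = w0" "pathfinish g1 = w"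
      "lifts g1 {0..1} G1" "G1 0 = v0" "G1 1 = v" using vv(1) unfolding tr_def by (elim exE conjE) (rule that)
    obtain g2 G2 where 2: "path g2" "path_image g2 \<subseteq> D" "pathstart g2 = w0" "pathfinish g2 = w"
      "lifts g2 {0..1} G2" "G2 0 = v0" "G2 1 = v'" using vv(2) unfolding tr_def by (elim exE conjE) (rule that)
    define l where "l = g1 +++ reversepath g2"
    have l: "path l" "path_image l \<subseteq> D" "pathfinish l = pathstart l"
      using 1 2 by (auto simp: l_def path_image_join)
    obtain G where G: "lifts l {0..1} G" "G 0 = v0" using lifts_path_ex[OF l(1,2) v0] .
    have G10: "G 1 = G 0" by (rule lifts_loop[OF sc l G(1)])
    have a: "lifts g1 {0..1} (\<lambda>t. G (t/2))" using first_half G(1) unfolding l_def by blast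
    have "(\<lambda>t. G (t/2)) 1 = G1 1"
      by (rule lifts_unique[OF _ a 1(5), of 0]) (use 1 G in \<open>auto simp: path_image_def\<close>)
    \<comment> \<open>The second half of the loop, run backwards, is \<open>g2\<close>; its lift
      starts at \<open>G 1\<close>, which equals \<open>G 0\<close> as loops have no
      monodromy.\<close>
    moreover have "lifts (\<lambda>t. l (1 - t/2)) {0..1} (\<lambda>t. G (1 - t/2))"
      by (rule lifts_compose[OF G(1)]) (auto intro!: continuous_intros)
    then have b: "lifts g2 {0..1} (\<lambda>t. G (1 - t/2))"
    proof (rule lifts_cong)
      fix t :: real assume t: "t \<in> {0..1}"
      show "l (1 - t / 2) = g2 t"
      \<comment> \<open>At the midpoint the join takes its value from \<open>g1\<close>, so the
        common endpoint \<open>w\<close> enters.\<close>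
      proof (cases "t = 1")
        case True
        then show ?thesis using 1(4) 2(4) by (simp add: l_def joinpaths_def pathfinish_def)
      next
        case False
        then show ?thesis using t by (simp add: l_def joinpaths_def reversepath_def)
      qed
    qed simp
    have "(\<lambda>t. G (1 - t/2)) 1 = G2 1"
      by (rule lifts_unique[OF _ b 2(5), of 0]) (use 2 G G10 in \<open>auto simp: path_image_def\<close>)
    ultimately show ?thesis using 1 2 by simp
  qed
  define f where "f = (\<lambda>w. THE v. tr w v)"
  have f: "f w = v" if "tr w v" for w v
    unfolding f_def by (rule the_equality[where P = "tr w", OF that]) (rule uniq[OF _ that])
  have trf: "tr w (f w)" if "w \<in> D" for w using ex[OF that] f by auto
  show ?thesis
  proof
    have "tr w0 v0" unfolding tr_def
      by (rule exI[of _ "\<lambda>_. w0"], rule exI[of _ "\<lambda>_. v0"])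
         (use w0 v0 lifts_const in \<open>auto simp: path_def path_image_def pathstart_def pathfinish_def\<close>)
    then show "f w0 = v0" by (rule f)
    fix p assume p: "p \<in> D"
    obtain g G where g: "path g" "path_image g \<subseteq> D" "pathstart g = w0" "pathfinish g = p"
      "lifts g {0..1} G" "G 0 = v0" "G 1 = f p" using trf[OF p] unfolding tr_def by (elim exE conjE) (rule that)
    have "f p \<in> V" using lifts_in[OF g(5), of 1] g(7) by simp
    then obtain c where c: "c \<in> V" "F p c p = f p" using F_surj[OF p T_self[OF p]] by blast
    have "f w = F p c w" if w: "w \<in> T p" for w
    proof -
      obtain k where k: "path k" "path_image k \<subseteq> T p" "pathstart k = p" "pathfinish k = w"
        using T_connected[OF p, unfolded path_connected_def, rule_format, OF T_self[OF p] w]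
        by (elim exE conjE) (rule that)
      define l where "l = g +++ k"
      have kD: "path_image k \<subseteq> D" using k T_sub[OF p] by blast
      have l: "path l" "path_image l \<subseteq> D" "pathstart l = w0" "pathfinish l = w"
        using g k kD by (auto simp: l_def path_image_join)
      obtain H where H: "lifts l {0..1} H" "H 0 = v0" using lifts_path_ex[OF l(1,2) v0] .
      have a: "lifts g {0..1} (\<lambda>t. H (t/2))" using first_half H(1) unfolding l_def by blast
      have h1: "(\<lambda>t. H (t/2)) 1 = G 1"
        by (rule lifts_unique[OF _ a g(5), of 0]) (use g H in \<open>auto simp: path_image_def\<close>)
      have "lifts (\<lambda>t. l (1/2 + t/2)) {0..1} (\<lambda>t. H (1/2 + t/2))"
        by (rule lifts_compose[OF H(1)]) (auto intro!: continuous_intros)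
      then have b: "lifts k {0..1} (\<lambda>t. H (1/2 + t/2))"
      proof (rule lifts_cong)
        fix t :: real assume t: "t \<in> {0..1}"
        show "l (1/2 + t/2) = k t"
          using g(4) k(3) t by (cases "t = 0") (auto simp: l_def joinpaths_def pathfinish_def pathstart_def)
      qed simp
      have b': "lifts k {0..1} (\<lambda>t. F p c (k t))"
        by (rule lifts_local[OF p _ _ c(1)]) (use k in \<open>auto simp: path_image_def path_def\<close>)
      have "(\<lambda>t. H (1/2 + t/2)) 1 = F p c (k 1)"
        by (rule lifts_unique[OF _ b b', of 0])
           (use kD k h1 g c in \<open>auto simp: path_image_def pathstart_def\<close>)
      then have "H 1 = F p c w" using k(4) by (simp add: pathfinish_def)
      moreover have "tr w (H 1)" unfolding tr_def by (intro exI conjI) (rule l H refl)+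
      ultimately show ?thesis using f by simp
    qed
    then show "\<exists>c\<in>V. \<forall>w\<in>T p. f w = F p c w" using c(1) by blast
  qed
qed

end

section \<open>Integration along rays in a polydisc\<close>

text \<open>The parameter \<open>t\<close> is complex so that complex differentiation applies along
  the segment; integration uses real \<open>t\<close> between 0 and 1.\<close>

definition ray :: "('i \<Rightarrow> complex) \<Rightarrow> ('i \<Rightarrow> complex) \<Rightarrow> complex \<Rightarrow> 'i \<Rightarrow> complex" where
  "ray w0 w t = (\<lambda>i. w0 i + t * (w i - w0 i))"

lemma ray_0 [simp]: "ray w0 w 0 = w0" and ray_1 [simp]: "ray w0 w 1 = w"
  by (auto simp: ray_def)

lemma ray_upd: "ray w0 (w(i := z)) t = (ray w0 w t)(i := w0 i + t * (z - w0 i))"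
  by (auto simp: ray_def)

lemma ray_in_pball:
  assumes w: "w \<in> pball I w0 \<rho>" and t: "t \<in> {0..1::real}"
  shows "ray w0 w (of_real t) \<in> pball I w0 \<rho>"
proof -
  have "norm (of_real t * (w i - w0 i)) < \<rho>" if "i \<in> I" for i
  proof -
    have "norm (of_real t * (w i - w0 i)) = t * norm (w i - w0 i)"
      using t by (simp add: norm_mult)
    also have "\<dots> \<le> norm (w i - w0 i)" using t by (intro mult_left_le_one_le) auto
    also have "\<dots> < \<rho>" using w that by (simp add: pball_def)
    finally show ?thesis .
  qed
  then show ?thesis using w by (auto simp: pball_def ray_def)
qed

lemma continuous_on_ray:
  fixes w0 :: "'i \<Rightarrow> complex"
  shows "continuous_on A (\<lambda>x. ray w0 (fst x) (of_real (snd x)))"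
proof -
  have *: "continuous_on A (\<lambda>x::('i\<Rightarrow>complex)\<times>real. fst x k)" for k
    by (rule continuous_on_app) (intro continuous_on_fst continuous_on_id)
  show ?thesis
    unfolding ray_def
    by (rule continuous_on_coordinatewise_then_product)
       (intro continuous_on_add continuous_on_const continuous_on_mult continuous_on_diff *
          continuous_on_of_real continuous_on_snd continuous_on_id)
qed

lemma continuous_on_ray_t: "continuous_on A (\<lambda>t. ray w0 w (of_real t))"
  unfolding ray_def
  by (rule continuous_on_coordinatewise_then_product)
     (intro continuous_on_add continuous_on_const continuous_on_mult
          continuous_on_of_real continuous_on_id)

text \<open>Chain rule from separate derivatives, one coordinate at a time. The coordinates in
  \<open>J\<close> and the new coordinate \<open>k\<close> move with independent variables
  \<open>x\<close> and \<open>y\<close>; a function of two variables with these partial derivatives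
  is differentiable once the one in \<open>y\<close> is continuous, and the diagonal gives the
  claim.\<close>

lemma hol_chain_aux:
  assumes dom: "pdom I D" and H: "hol I D H" and J: "finite J" "J \<subseteq> I"
  shows "w \<in> D \<Longrightarrow> ((\<lambda>t. H (\<lambda>i. if i \<in> J then w i + t * \<xi> i else w i)) has_field_derivative
           (\<Sum>i\<in>J. \<xi> i * pd i H w)) (at 0)"
  using J
proof (induction J arbitrary: w rule: finite_induct)
  case empty
  then show ?case by simp
next
  case (insert k J)
  note fin = pdom_finite[OF dom]
  have k: "k \<in> I" using insert.prems by simp
  obtain \<rho> where \<rho>: "\<rho> > 0" "pball I w \<rho> \<subseteq> D" using pdom_pball[OF dom insert.prems(1)] .
  \<comment> \<open>The bound \<open>L\<close> on all directions turns the polydisc radius into a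
    disc radius \<open>\<rho> / L\<close> for \<open>x\<close> and \<open>y\<close>; the summand 1
    makes it positive.\<close>
  define L where "L = (\<Sum>i\<in>J. norm (\<xi> i)) + norm (\<xi> k) + 1"
  have L: "L > 0" by (simp add: L_def add_nonneg_pos sum_nonneg)
  have L2: "norm (\<xi> i) < L" if "i \<in> insert k J" for i
  proof -
    have "norm (\<xi> i) \<le> (\<Sum>i\<in>insert k J. norm (\<xi> i))"
      using member_le_sum[OF that, of "\<lambda>i. norm (\<xi> i)"] insert.hyps by simp
    then show ?thesis using insert.hyps by (simp add: L_def)
  qed
  define X where "X = ball (0::complex) (\<rho> / L)"
  have X0: "0 \<in> X" using \<rho> L by (simp add: X_def)
  define c where "c = (\<lambda>x y. (\<lambda>i. if i \<in> J then w i + x * \<xi> i else (w(k := w k + y * \<xi> k)) i))"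
  have small: "norm (x * \<xi> i) < \<rho>" if "x \<in> X" "i \<in> insert k J" for x i
  proof -
    have "norm (x * \<xi> i) = norm x * norm (\<xi> i)" by (simp add: norm_mult)
    also have "\<dots> \<le> norm x * L" using L2[OF that(2)] by (intro mult_left_mono) auto
    also have "\<dots> < \<rho>" using that(1) L by (simp add: X_def field_simps)
    finally show ?thesis .
  qed
  have cD: "c x y \<in> D" if "x \<in> X" "y \<in> X" for x y
    using small that insert.prems \<rho> k by (intro subsetD[OF \<rho>(2)]) (auto simp: pball_def c_def)
  have c_upd: "c x y = (c x 0)(k := w k + y * \<xi> k)" for x y
    using insert.hyps by (auto simp: c_def fun_eq_iff)
  have c_k: "c x y k = w k + y * \<xi> k" for x y using insert.hyps by (simp add: c_def)
  have c_upd2: "(c x y)(k := z) = (c x 0)(k := z)" for x y z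
    using insert.hyps by (auto simp: c_def fun_eq_iff)
  define f where "f = (\<lambda>x y. H (c x y))"
  have dy: "((\<lambda>y. f x y) has_field_derivative \<xi> k * pd k H (c x y)) (at y)" if "x \<in> X" "y \<in> X" for x y
  proof -
    have 1: "((\<lambda>z. H ((c x 0)(k := z))) has_field_derivative pd k H (c x y)) (at (w k + y * \<xi> k))"
      using hol_pd_DERIV[OF H cD[OF that] k] by (simp only: c_upd2[of x y] c_k)
    have 2: "((\<lambda>y. w k + y * \<xi> k) has_field_derivative \<xi> k) (at y)"
      by (auto intro!: derivative_eq_intros)
    from DERIV_chain2[OF 1 2] show ?thesis
      by (simp only: f_def c_upd[symmetric] mult.commute[of "\<xi> k"])
  qed
  have dx: "((\<lambda>x. f x 0) has_field_derivative (\<Sum>i\<in>J. \<xi> i * pd i H w)) (at 0)"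
  proof -
    have "c x 0 = (\<lambda>i. if i \<in> J then w i + x * \<xi> i else w i)" for x
      by (auto simp: c_def fun_eq_iff)
    then show ?thesis using insert.IH[OF insert.prems(1)] insert.prems(2) by (simp add: f_def)
  qed
  have cont_c: "continuous_on (X \<times> X) (\<lambda>x. c (fst x) (snd x))"
  proof (rule continuous_on_coordinatewise_then_product)
    fix i
    show "continuous_on (X \<times> X) (\<lambda>x. c (fst x) (snd x) i)"
      by (cases "i \<in> J"; cases "i = k") (auto simp: c_def intro!: continuous_intros)
  qed
  have "continuous_on (X \<times> X) (\<lambda>x. pd k H (c (fst x) (snd x)))"
    by (rule continuous_on_compose2[OF pd_continuous[OF dom H k] cont_c]) (use cD in auto)
  then have "continuous_on (X \<times> X) (\<lambda>x. blinfun_mult_right (\<xi> k * pd k H (c (fst x) (snd x))))"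
    by (intro bounded_linear.continuous_on[OF bounded_linear_blinfun_mult_right] continuous_on_mult continuous_on_const)
  then have cb: "continuous (at (0, 0) within X \<times> X) (\<lambda>(x, y). blinfun_mult_right (\<xi> k * pd k H (c x y)))"
    using X0 by (auto simp: continuous_on_eq_continuous_within case_prod_unfold)
  have dg: "((\<lambda>(x, y). f x y) has_derivative
      (\<lambda>(tx, ty). (\<Sum>i\<in>J. \<xi> i * pd i H w) * tx + blinfun_mult_right (\<xi> k * pd k H (c 0 0)) ty)) (at (0, 0) within X \<times> X)"
  proof (rule has_derivative_partialsI[where fy = "\<lambda>x y. blinfun_mult_right (\<xi> k * pd k H (c x y))"])
    show "((\<lambda>x. f x 0) has_derivative (*) (\<Sum>i\<in>J. \<xi> i * pd i H w)) (at 0 within X)"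
      using dx by (simp add: has_field_derivative_def has_derivative_at_withinI)
    show "((\<lambda>y. f x y) has_derivative blinfun_apply (blinfun_mult_right (\<xi> k * pd k H (c x y)))) (at y within X)"
      if "x \<in> X" "y \<in> X" for x y
      using dy[OF that] by (simp add: has_field_derivative_def has_derivative_at_withinI)
  qed (use cb X0 in \<open>auto simp: X_def\<close>)
  have dt: "((\<lambda>t::complex. (t, t)) has_derivative (\<lambda>t. (t, t))) (at 0 within X)"
    by (intro derivative_intros)
  have c00: "c 0 0 = w" by (auto simp: c_def)
  have dg': "((\<lambda>(x, y). f x y) has_derivative
      (\<lambda>(tx, ty). (\<Sum>i\<in>J. \<xi> i * pd i H w) * tx + blinfun_mult_right (\<xi> k * pd k H (c 0 0)) ty))
      (at ((\<lambda>t::complex. (t, t)) 0) within (\<lambda>t. (t, t)) ` X)"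
    by (rule has_derivative_subset[OF dg]) auto
  have "((\<lambda>t. f t t) has_derivative (\<lambda>t. (\<Sum>i\<in>J. \<xi> i * pd i H w) * t + \<xi> k * pd k H (c 0 0) * t)) (at 0 within X)"
    using has_derivative_in_compose[OF dt dg'] by simp
  then have ftt: "((\<lambda>t. f t t) has_derivative (\<lambda>t. (\<Sum>i\<in>J. \<xi> i * pd i H w) * t + \<xi> k * pd k H w * t)) (at 0)"
    using at_within_open[OF X0] by (simp add: c00 X_def)
  have "((\<lambda>t. f t t) has_field_derivative (\<Sum>i\<in>insert k J. \<xi> i * pd i H w)) (at 0)"
  proof -
    have "(\<lambda>t. (\<Sum>i\<in>J. \<xi> i * pd i H w) * t + \<xi> k * pd k H w * t) = (*) (\<Sum>i\<in>insert k J. \<xi> i * pd i H w)"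
      using insert.hyps by (auto simp: fun_eq_iff distrib_right)
    then show ?thesis using ftt by (simp only: has_field_derivative_def)
  qed
  moreover have "f t t = H (\<lambda>i. if i \<in> insert k J then w i + t * \<xi> i else w i)" for t
    unfolding f_def by (rule arg_cong[of _ _ H]) (auto simp: c_def)
  ultimately show ?case by simp
qed

lemma hol_chain:
  assumes dom: "pdom I D" and H: "hol I D H" and tD: "ray w0 w t \<in> D" and off: "\<And>i. i \<notin> I \<Longrightarrow> w i = w0 i"
  shows "((\<lambda>t. H (ray w0 w t)) has_field_derivative (\<Sum>i\<in>I. (w i - w0 i) * pd i H (ray w0 w t))) (at t)"
proof -
  define \<xi> where "\<xi> = (\<lambda>i. w i - w0 i)"
  have eq: "ray w0 w (t + s) = (\<lambda>i. if i \<in> I then ray w0 w t i + s * \<xi> i else ray w0 w t i)" for s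
    using off by (auto simp: ray_def \<xi>_def fun_eq_iff algebra_simps)
  have "((\<lambda>s. H (ray w0 w (t + s))) has_field_derivative (\<Sum>i\<in>I. \<xi> i * pd i H (ray w0 w t))) (at 0)"
    unfolding eq using hol_chain_aux[OF dom H pdom_finite[OF dom] _ tD] by simp
  then show ?thesis
    using DERIV_at_within_shift[of "\<lambda>x. H (ray w0 w x)" _ t 0 UNIV] by (simp add: \<xi>_def)
qed

text \<open>The exponent \<open>e\<close> counts derivatives already taken: differentiating in a
  coordinate of the endpoint multiplies the integrand by \<open>t\<close>.\<close>

definition radint :: "('i \<Rightarrow> complex) \<Rightarrow> nat \<Rightarrow> (('i \<Rightarrow> complex) \<Rightarrow> complex) \<Rightarrow> ('i \<Rightarrow> complex) \<Rightarrow> complex" where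
  "radint w0 e H w = integral {0..1} (\<lambda>t::real. of_real t ^ e * H (ray w0 w (of_real t)))"

context
  fixes I :: "'i set" and w0 :: "'i \<Rightarrow> complex" and \<rho> :: real
  assumes fin: "finite I"
begin

lemma radint_integrand_continuous:
  fixes H :: "('i \<Rightarrow> complex) \<Rightarrow> complex"
  assumes "continuous_on (pball I w0 \<rho>) H"
  shows "continuous_on (pball I w0 \<rho> \<times> {0..1}) (\<lambda>x. of_real (snd x) ^ e * H (ray w0 (fst x) (of_real (snd x))))"
proof (intro continuous_on_mult continuous_on_power continuous_on_of_real continuous_on_snd continuous_on_id)
  show "continuous_on (pball I w0 \<rho> \<times> {0..1}) (\<lambda>x. H (ray w0 (fst x) (complex_of_real (snd x))))"
    by (rule continuous_on_compose2[OF assms continuous_on_ray]) (use ray_in_pball in fastforce)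
qed

lemma radint_integrand_continuous_t:
  fixes H :: "('i \<Rightarrow> complex) \<Rightarrow> complex"
  assumes "continuous_on (pball I w0 \<rho>) H" "w \<in> pball I w0 \<rho>"
  shows "continuous_on {0..1} (\<lambda>t. of_real t ^ e * H (ray w0 w (of_real t)))"
proof (intro continuous_on_mult continuous_on_power continuous_on_of_real continuous_on_id)
  show "continuous_on {0..1} (\<lambda>t. H (ray w0 w (complex_of_real t)))"
    by (rule continuous_on_compose2[OF assms(1) continuous_on_ray_t]) (use ray_in_pball[OF assms(2)] in auto)
qed

lemma radint_norm_le:
  assumes H: "continuous_on (pball I w0 \<rho>) H" and w: "w \<in> pball I w0 \<rho>"
    and B: "\<And>w. w \<in> pball I w0 \<rho> \<Longrightarrow> norm (H w) \<le> B"
  shows "norm (radint w0 e H w) \<le> B"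
proof -
  have "norm (radint w0 e H w) \<le> B * (1 - 0)"
    unfolding radint_def
  proof (rule integral_bound)
    fix t :: real assume t: "t \<in> {0..1}"
    have "norm (of_real t ^ e * H (ray w0 w (of_real t))) = t ^ e * norm (H (ray w0 w (of_real t)))"
      using t by (simp add: norm_mult norm_power)
    also have "\<dots> \<le> 1 * norm (H (ray w0 w (of_real t)))"
      using t by (intro mult_right_mono power_le_one) auto
    also have "\<dots> \<le> B" using B[OF ray_in_pball[OF w t]] by simp
    finally show "norm (of_real t ^ e * H (ray w0 w (of_real t))) \<le> B" .
  qed (use radint_integrand_continuous_t[OF H w] in auto)
  then show ?thesis by simp
qed

lemma radint_sum:
  assumes H: "\<And>a. a \<in> A \<Longrightarrow> continuous_on (pball I w0 \<rho>) (H a)" and w: "w \<in> pball I w0 \<rho>"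
  shows "radint w0 e (\<lambda>w. \<Sum>a\<in>A. H a w) w = (\<Sum>a\<in>A. radint w0 e (H a) w)"
proof (cases "finite A")
  case True
  show ?thesis
    unfolding radint_def sum_distrib_left
    by (rule integral_sum[OF True]) (auto intro!: integrable_continuous_real radint_integrand_continuous_t H w)
qed (simp add: radint_def)

lemma radint_diff:
  assumes "continuous_on (pball I w0 \<rho>) H" "continuous_on (pball I w0 \<rho>) H'" and w: "w \<in> pball I w0 \<rho>"
  shows "radint w0 e (\<lambda>w. H w - H' w) w = radint w0 e H w - radint w0 e H' w"
  unfolding radint_def right_diff_distrib
  by (rule integral_diff) (auto intro!: integrable_continuous_real radint_integrand_continuous_t assms)

lemma radint_cmult: "radint w0 e (\<lambda>w. c * H w) w = c * radint w0 e H w"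
  unfolding radint_def by (simp add: mult.left_commute)

lemma
  assumes H: "hol I (pball I w0 \<rho>) H"
  shows hol_radint: "hol I (pball I w0 \<rho>) (radint w0 e H)"
    and pd_radint: "w \<in> pball I w0 \<rho> \<Longrightarrow> i \<in> I \<Longrightarrow> pd i (radint w0 e H) w = radint w0 (Suc e) (pd i H) w"
proof -
  note dom = pball_pdom[OF fin, of w0 \<rho>]
  have der: "((\<lambda>z. radint w0 e H (w(i := z))) has_field_derivative radint w0 (Suc e) (pd i H) w) (at (w i))"
    if w: "w \<in> pball I w0 \<rho>" and i: "i \<in> I" for w i
  proof -
    obtain r where r: "r > 0" "\<And>z. norm (z - w i) < r \<Longrightarrow> w(i := z) \<in> pball I w0 \<rho>"
      using pdom_upd[OF dom w i] by blast
    define U where "U = ball (w i) r"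
    have U: "w(i := z) \<in> pball I w0 \<rho>" if "z \<in> U" for z
      using r(2)[of z] that by (auto simp: U_def dist_norm norm_minus_commute)
    have "((\<lambda>z. integral (cbox 0 1) (\<lambda>t::real. of_real t ^ e * H (ray w0 (w(i := z)) (of_real t)))) has_field_derivative
        integral (cbox 0 1) (\<lambda>t::real. of_real t ^ Suc e * pd i H (ray w0 (w(i := w i)) (of_real t)))) (at (w i) within U)"
    proof (rule leibniz_rule_field_derivative)
      fix z and t :: real assume z: "z \<in> U" and t: "t \<in> cbox 0 1"
      then have t': "t \<in> {0..1}" by simp
      have inD: "(ray w0 w (of_real t))(i := w0 i + of_real t * (z - w0 i)) \<in> pball I w0 \<rho>"
        using ray_in_pball[OF U[OF z] t'] by (simp add: ray_upd)
      have 1: "((\<lambda>\<zeta>. H ((ray w0 w (of_real t))(i := \<zeta>))) has_field_derivative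
          pd i H (ray w0 (w(i := z)) (of_real t))) (at (w0 i + of_real t * (z - w0 i)))"
        using hol_pd_DERIV_upd[OF H inD i] by (simp add: ray_upd)
      have 2: "((\<lambda>z. w0 i + of_real t * (z - w0 i)) has_field_derivative of_real t) (at z)"
        by (auto intro!: derivative_eq_intros)
      have "((\<lambda>z. H (ray w0 (w(i := z)) (of_real t))) has_field_derivative
          pd i H (ray w0 (w(i := z)) (of_real t)) * of_real t) (at z)"
        using DERIV_chain2[OF 1 2] by (simp add: ray_upd)
      note cm = DERIV_cmult[OF this, of "of_real t ^ e"]
      show "((\<lambda>x. of_real t ^ e * H (ray w0 (w(i := x)) (of_real t))) has_field_derivative
          of_real t ^ Suc e * pd i H (ray w0 (w(i := z)) (of_real t))) (at z within U)"
        by (rule has_field_derivative_at_within, rule DERIV_cong[OF cm]) (simp add: mult_ac)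
    next
      fix z assume "z \<in> U"
      then show "(\<lambda>t. of_real t ^ e * H (ray w0 (w(i := z)) (of_real t))) integrable_on cbox 0 1"
        using radint_integrand_continuous_t[OF hol_continuous[OF H] U]
        by (auto intro: integrable_continuous_real)
    next
      have "continuous_on (pball I w0 \<rho> \<times> {0..1}) (\<lambda>x. of_real (snd x) ^ Suc e * pd i H (ray w0 (fst x) (of_real (snd x))))"
        by (rule radint_integrand_continuous[OF pd_continuous[OF dom H i]])
      then have "continuous_on (U \<times> {0..1}) (\<lambda>x. of_real (snd (w(i := fst x), snd x)) ^ Suc e * pd i H (ray w0 (fst (w(i := fst x), snd x)) (of_real (snd (w(i := fst x), snd x)))))"
        by (rule continuous_on_compose2)
           (use U in \<open>auto intro!: continuous_on_Pair continuous_on_upd continuous_on_fst continuous_on_snd continuous_on_id\<close>)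
      then show "continuous_on (U \<times> cbox 0 1) (\<lambda>(x, t). of_real t ^ Suc e * pd i H (ray w0 (w(i := x)) (of_real t)))"
        by (simp add: case_prod_unfold)
    qed (use r in \<open>auto simp: U_def\<close>)
    then show ?thesis using r(1) by (simp add: radint_def U_def at_within_open[of "w i" "ball (w i) r"])
  qed
  have "continuous_on (pball I w0 \<rho>) (\<lambda>w. integral (cbox 0 1) (\<lambda>t. of_real t ^ e * H (ray w0 w (of_real t))))"
    by (rule integral_continuous_on_param)
       (use radint_integrand_continuous[OF hol_continuous[OF H], of e] in \<open>simp add: case_prod_unfold\<close>)
  then have "continuous_on (pball I w0 \<rho>) (radint w0 e H)" by (simp add: radint_def[abs_def])
  then show "hol I (pball I w0 \<rho>) (radint w0 e H)" by (rule holI) (use der in blast)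
  show "pd i (radint w0 e H) w = radint w0 (Suc e) (pd i H) w" if "w \<in> pball I w0 \<rho>" "i \<in> I"
    using pd_eqI[OF der[OF that]] .
qed

text \<open>Fundamental theorem of calculus along a ray, applied to \<open>t\<^sup>e H\<close>.\<close>

lemma radint_ftc:
  assumes H: "hol I (pball I w0 \<rho>) H" and w: "w \<in> pball I w0 \<rho>"
  shows "H w - H w0 = (\<Sum>i\<in>I. (w i - w0 i) * radint w0 0 (pd i H) w)"
    and "H w = radint w0 0 H w + (\<Sum>i\<in>I. (w i - w0 i) * radint w0 1 (pd i H) w)"
proof -
  note dom = pball_pdom[OF fin, of w0 \<rho>]
  have off: "w i = w0 i" if "i \<notin> I" for i using w that by (simp add: pball_def)
  have cpd: "continuous_on (pball I w0 \<rho>) (pd i H)" if "i \<in> I" for i by (rule pd_continuous[OF dom H that])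
  have der: "((\<lambda>t. H (ray w0 w t)) has_field_derivative (\<Sum>i\<in>I. (w i - w0 i) * pd i H (ray w0 w (of_real t)))) (at (of_real t))"
    if "t \<in> {0..1}" for t :: real
    by (rule hol_chain[OF dom H ray_in_pball[OF w that] off])
  have der': "((\<lambda>t. H (ray w0 w (of_real t))) has_vector_derivative
       (\<Sum>i\<in>I. (w i - w0 i) * pd i H (ray w0 w (of_real t)))) (at t within {0..1})" if "t \<in> {0..1}" for t :: real
    using has_vector_derivative_real_field[OF der[OF that]] has_vector_derivative_at_within by blast
  have "((\<lambda>t. \<Sum>i\<in>I. (w i - w0 i) * pd i H (ray w0 w (of_real t))) has_integral
      (H (ray w0 w (of_real 1)) - H (ray w0 w (of_real 0)))) {0..1}"
    by (rule fundamental_theorem_of_calculus) (use der' in auto)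
  then have "H w - H w0 = radint w0 0 (\<lambda>w'. \<Sum>i\<in>I. (w i - w0 i) * pd i H w') w"
    unfolding radint_def by (simp add: integral_unique)
  also have "\<dots> = (\<Sum>i\<in>I. (w i - w0 i) * radint w0 0 (pd i H) w)"
    by (subst radint_sum[OF _ w]) (auto intro!: continuous_on_mult continuous_on_const cpd simp: radint_cmult)
  finally show "H w - H w0 = (\<Sum>i\<in>I. (w i - w0 i) * radint w0 0 (pd i H) w)" .
  define S where "S = (\<lambda>w'. \<Sum>i\<in>I. (w i - w0 i) * pd i H w')"
  have cS: "continuous_on (pball I w0 \<rho>) S"
    unfolding S_def by (intro continuous_on_sum continuous_on_mult continuous_on_const cpd)
  have "((\<lambda>t. H (ray w0 w (of_real t)) + of_real t * S (ray w0 w (of_real t))) has_integral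
      (of_real 1 * H (ray w0 w (of_real 1)) - of_real 0 * H (ray w0 w (of_real 0)))) {0..1}"
  proof (rule fundamental_theorem_of_calculus)
    fix t :: real assume t: "t \<in> {0..1}"
    show "((\<lambda>t. of_real t * H (ray w0 w (of_real t))) has_vector_derivative
        (H (ray w0 w (of_real t)) + of_real t * S (ray w0 w (of_real t)))) (at t within {0..1})"
    proof -
      have "((\<lambda>t. t * H (ray w0 w t)) has_field_derivative
          (1 * H (ray w0 w (of_real t)) + S (ray w0 w (of_real t)) * of_real t)) (at (of_real t))"
        unfolding S_def by (rule DERIV_mult[OF DERIV_ident der[OF t]])
      from has_vector_derivative_real_field[OF this] show ?thesis
        by (simp add: has_vector_derivative_at_within mult.commute)
    qed
  qed simp
  then have "H w = integral {0..1} (\<lambda>t. H (ray w0 w (of_real t)) + of_real t * S (ray w0 w (of_real t)))"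
    by (simp add: integral_unique)
  also have "\<dots> = radint w0 0 H w + radint w0 1 S w"
    unfolding radint_def
    using radint_integrand_continuous_t[OF hol_continuous[OF H] w, of 0] radint_integrand_continuous_t[OF cS w, of 1]
    by (subst integral_add[symmetric]) (auto intro: integrable_continuous_real)
  also have "radint w0 1 S w = (\<Sum>i\<in>I. (w i - w0 i) * radint w0 1 (pd i H) w)"
    unfolding S_def
    by (subst radint_sum[OF _ w]) (auto intro!: continuous_on_mult continuous_on_const cpd simp: radint_cmult)
  finally show "H w = radint w0 0 H w + (\<Sum>i\<in>I. (w i - w0 i) * radint w0 1 (pd i H) w)" .
qed

end

section \<open>Flat connections on a small polydisc\<close>

lemma continuous_on_pdomE:
  fixes f :: "('i \<Rightarrow> complex) \<Rightarrow> 'b::metric_space"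
  assumes "pdom I D" "continuous_on D f" "w \<in> D" "e > 0"
  obtains \<delta> where "\<delta> > 0" "\<forall>w'\<in>pball I w \<delta> \<inter> D. dist (f w') (f w) < e"
  using continuous_on_pdom_iff[OF assms(1), THEN iffD1, OF assms(2), rule_format, OF assms(3,4)]
  by (elim exE conjE) (rule that)

text \<open>Every bound halves itself, so the bounds decay geometrically. This is the uniqueness
  argument for radial integral equations, used for flat vectors that vanish at a point and for the
  defect of a Picard solution.\<close>

lemma contraction_zero:
  fixes E :: "'x \<Rightarrow> complex"
  assumes bound: "\<And>x. x \<in> S \<Longrightarrow> norm (E x) \<le> C"
    and step: "\<And>c x. c \<ge> 0 \<Longrightarrow> (\<And>y. y \<in> S \<Longrightarrow> norm (E y) \<le> c) \<Longrightarrow> x \<in> S \<Longrightarrow> norm (E x) \<le> c / 2"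
    and x: "x \<in> S"
  shows "E x = 0"
proof -
  define C' where "C' = max C 0"
  have "\<forall>x\<in>S. norm (E x) \<le> C' * (1/2) ^ k" for k
  proof (induction k)
    case 0
    then show ?case using bound by (auto simp: C'_def le_max_iff_disj)
  next
    case (Suc k)
    have "C' * (1/2) ^ k \<ge> 0" by (simp add: C'_def)
    from step[OF this] Suc show ?case by fastforce
  qed
  then have le: "norm (E x) \<le> C' * (1/2) ^ k" for k using x by blast
  have "(\<lambda>k. C' * (1/2::real) ^ k) \<longlonglongrightarrow> C' * 0" by (intro tendsto_intros) simp
  then have "norm (E x) \<le> C' * 0" by (rule LIMSEQ_le_const) (use le in blast)
  then show ?thesis by simp
qed

text \<open>Weierstrass' theorem in each coordinate separately; joint continuity of the limit comes
  from uniformity in all coordinates together.\<close>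

lemma hol_uniform_limit:
  assumes dom: "pdom I D" and f: "\<And>k. hol I D (f k)" and lim: "uniform_limit D f g sequentially"
  shows "hol I D g"
proof (rule holI)
  show "continuous_on D g"
    by (rule uniform_limit_theorem[OF _ lim]) (use f in \<open>auto simp: hol_def\<close>)
  fix w i assume wi: "w \<in> D" "i \<in> I"
  obtain \<rho> where \<rho>: "\<rho> > 0" "\<And>z. norm (z - w i) < \<rho> \<Longrightarrow> w(i := z) \<in> D"
    using pdom_upd[OF dom wi] by blast
  define r where "r = \<rho> / 2"
  have r: "r > 0" using \<rho> by (simp add: r_def)
  have inD: "w(i := z) \<in> D" if "z \<in> cball (w i) r" for z
    using \<rho>(1) that by (intro \<rho>(2)) (simp add: r_def dist_norm norm_minus_commute)
  have ul: "uniform_limit (cball (w i) r) (\<lambda>k z. f k (w(i := z))) (\<lambda>z. g (w(i := z))) sequentially"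
    by (rule uniform_limit_compose'[OF lim]) (use inD in auto)
  have hl: "(\<lambda>z. f k (w(i := z))) holomorphic_on cball (w i) r" for k
    by (rule hol_upd_holomorphic[OF f wi(2)]) (use inD in auto)
  have ev: "\<forall>\<^sub>F k in sequentially. continuous_on (cball (w i) r) (\<lambda>z. f k (w(i := z))) \<and>
      (\<lambda>z. f k (w(i := z))) holomorphic_on ball (w i) r"
    using hl holomorphic_on_imp_continuous_on holomorphic_on_subset[OF hl ball_subset_cball]
    by (intro always_eventually allI conjI) auto
  have "(\<lambda>z. g (w(i := z))) holomorphic_on ball (w i) r"
    by (rule holomorphic_uniform_limit[OF ev ul]) auto
  then have "(\<lambda>z. g (w(i := z))) field_differentiable at (w i)"
    using r by (intro holomorphic_on_imp_differentiable_at[of _ "ball (w i) r"]) auto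
  then show "\<exists>c. ((\<lambda>z. g (w(i := z))) has_field_derivative c) (at (w i))"
    by (simp add: field_differentiable_def)
qed

lemma pball_offset_sum_le:
  assumes w: "w \<in> pball I x r" and R: "\<And>i. i \<in> I \<Longrightarrow> norm (R i) \<le> B" and B: "B \<ge> 0"
  shows "norm (\<Sum>i\<in>I. (w i - x i) * R i) \<le> of_nat (card I) * r * B"
proof -
  have "norm (\<Sum>i\<in>I. (w i - x i) * R i) \<le> (\<Sum>i\<in>I. norm ((w i - x i) * R i))" by (rule norm_sum)
  also have "\<dots> \<le> (\<Sum>i\<in>I. r * B)"
  proof (rule sum_mono)
    fix i assume i: "i \<in> I"
    then have "norm (w i - x i) \<le> r" using w by (simp add: pball_def less_imp_le)
    then show "norm ((w i - x i) * R i) \<le> r * B"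
      unfolding norm_mult using R[OF i] B by (intro mult_mono') auto
  qed
  finally show ?thesis by (simp add: mult.assoc)
qed

text \<open>\<open>flat\<close> is the integrability condition of the system
  \<open>pd i G = A i G\<close>: it equates the two expressions for a mixed derivative of a
  solution.\<close>

locale flat_connection =
  fixes I :: "'i set" and D :: "('i \<Rightarrow> complex) set" and n :: nat
    and A :: "'i \<Rightarrow> nat \<Rightarrow> nat \<Rightarrow> ('i \<Rightarrow> complex) \<Rightarrow> complex"
  assumes dom: "pdom I D"
    and hol_A: "i \<in> I \<Longrightarrow> p < n \<Longrightarrow> q < n \<Longrightarrow> hol I D (A i p q)"
    and flat: "i \<in> I \<Longrightarrow> j \<in> I \<Longrightarrow> p < n \<Longrightarrow> s < n \<Longrightarrow> w \<in> D \<Longrightarrow>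
       pd j (A i p s) w + (\<Sum>q<n. A i p q w * A j q s w) = pd i (A j p s) w + (\<Sum>q<n. A j p q w * A i q s w)"
begin

lemma fin: "finite I"
  using dom by (rule pdom_finite)

definition flat_on :: "('i \<Rightarrow> complex) set \<Rightarrow> (nat \<Rightarrow> ('i \<Rightarrow> complex) \<Rightarrow> complex) \<Rightarrow> bool" where
  "flat_on S G \<longleftrightarrow> (\<forall>p<n. hol I S (G p) \<and> (\<forall>w\<in>S. \<forall>i\<in>I. pd i (G p) w = (\<Sum>q<n. A i p q w * G q w)))"

text \<open>The last inequality makes the radial integral operators below contractions.\<close>

definition bounded_radius :: "('i \<Rightarrow> complex) \<Rightarrow> real \<Rightarrow> real \<Rightarrow> bool" where
  "bounded_radius x r M \<longleftrightarrow> r > 0 \<and> M \<ge> 0 \<and> pball I x r \<subseteq> D \<and>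
     (\<forall>w\<in>pball I x r. \<forall>i\<in>I. \<forall>p<n. \<forall>q<n. norm (A i p q w) \<le> M) \<and>
     of_nat (card I) * r * (2 * of_nat n * M) \<le> 1 / 2"

lemma bounded_radius_ex:
  assumes x: "x \<in> D"
  shows "\<exists>r M. bounded_radius x r M"
proof -
  \<comment> \<open>One continuous function dominates every entry of every matrix, so a single
    neighbourhood serves all of them.\<close>
  define g where "g = (\<lambda>w. \<Sum>i\<in>I. \<Sum>p<n. \<Sum>q<n. norm (A i p q w))"
  have cg: "continuous_on D g"
    unfolding g_def
    by (intro continuous_on_sum continuous_on_norm hol_continuous[OF hol_A]) auto
  obtain \<delta> where \<delta>: "\<delta> > 0" "\<forall>w'\<in>pball I x \<delta> \<inter> D. dist (g w') (g x) < 1"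
    by (rule continuous_on_pdomE[OF dom cg x, where e = 1]) (simp, rule that)
  obtain \<rho> where \<rho>: "\<rho> > 0" "pball I x \<rho> \<subseteq> D" using pdom_pball[OF dom x] .
  define M where "M = g x + 1"
  have M: "M > 0" by (simp add: M_def g_def sum_nonneg add_nonneg_pos)
  define K where "K = of_nat (card I) * (2 * of_nat n * M)"
  have K: "K \<ge> 0" using M by (simp add: K_def)
  \<comment> \<open>The last bound yields \<open>r * K \<le> 1 / 2\<close>; the increment in
    \<open>K + 1\<close> covers \<open>K = 0\<close>.\<close>
  define r where "r = min (min \<delta> \<rho>) (1 / (2 * (K + 1)))"
  have r: "r > 0" using \<delta> \<rho> K by (simp add: r_def)
  have sub: "pball I x r \<subseteq> pball I x \<delta>" "pball I x r \<subseteq> pball I x \<rho>"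
    by (rule pball_mono, simp add: r_def)+
  have "norm (A i p q w) \<le> M" if w: "w \<in> pball I x r" and ipq: "i \<in> I" "p < n" "q < n" for w i p q
  proof -
    have "norm (A i p q w) \<le> (\<Sum>q<n. norm (A i p q w))"
      by (rule member_le_sum) (use ipq in auto)
    also have "\<dots> \<le> (\<Sum>p<n. \<Sum>q<n. norm (A i p q w))"
      using member_le_sum[of p "{..<n}" "\<lambda>p. \<Sum>q<n. norm (A i p q w)"] ipq by (simp add: sum_nonneg)
    also have "\<dots> \<le> g w"
      unfolding g_def using member_le_sum[of i I "\<lambda>i. \<Sum>p<n. \<Sum>q<n. norm (A i p q w)"] ipq fin
      by (simp add: sum_nonneg)
    also have "\<dots> \<le> M"
    proof -
      have "w \<in> pball I x \<delta> \<inter> D" using w sub \<rho>(2) by blast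
      then have "dist (g w) (g x) < 1" using \<delta>(2) by blast
      then show ?thesis by (simp add: M_def dist_real_def)
    qed
    finally show ?thesis .
  qed
  moreover have "of_nat (card I) * r * (2 * of_nat n * M) \<le> 1 / 2"
  proof -
    have "r * K \<le> 1 / (2 * (K + 1)) * K" using K by (intro mult_right_mono) (auto simp: r_def)
    also have "\<dots> \<le> 1 / 2" using K by (simp add: field_simps)
    finally show ?thesis by (simp add: K_def mult_ac)
  qed
  ultimately have "bounded_radius x r M"
    unfolding bounded_radius_def using r M sub \<rho>(2) by auto
  then show ?thesis by blast
qed

lemma bounded_radius_mono:
  assumes "bounded_radius x r M" "pball I y s \<subseteq> pball I x r" "0 < s" "s \<le> r"
  shows "bounded_radius y s M"
proof -
  have "of_nat (card I) * s * (2 * of_nat n * M) \<le> of_nat (card I) * r * (2 * of_nat n * M)"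
    using assms by (intro mult_right_mono mult_left_mono) (auto simp: bounded_radius_def)
  also have "\<dots> \<le> 1 / 2"
    using assms(1) unfolding bounded_radius_def by (elim conjE)
  finally have "of_nat (card I) * s * (2 * of_nat n * M) \<le> 1 / 2" .
  moreover have "norm (A i p q w) \<le> M" if "w \<in> pball I y s" "i \<in> I" "p < n" "q < n" for w i p q
    using assms(1) that subsetD[OF assms(2) that(1)] by (simp add: bounded_radius_def)
  ultimately show ?thesis using assms by (auto simp: bounded_radius_def)
qed

lemma sum_A_le:
  assumes br: "bounded_radius x r M" and w: "w \<in> pball I x r" and i: "i \<in> I" and p: "p < n"
    and c: "\<And>q. q < n \<Longrightarrow> norm (g q) \<le> c"
  shows "norm (\<Sum>q<n. A i p q w * g q) \<le> of_nat n * M * c"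
proof -
  have "norm (\<Sum>q<n. A i p q w * g q) \<le> (\<Sum>q<n. norm (A i p q w * g q))" by (rule norm_sum)
  also have "\<dots> \<le> (\<Sum>q<n. M * c)"
  proof (rule sum_mono)
    fix q assume q: "q \<in> {..<n}"
    then show "norm (A i p q w * g q) \<le> M * c"
      unfolding norm_mult using br w i p c[of q] by (intro mult_mono') (auto simp: bounded_radius_def)
  qed
  finally show ?thesis by simp
qed

text \<open>Two strengths: flat vectors and Picard steps involve one sum over \<open>A\<close>, the
  defect of a Picard solution involves two.\<close>

lemma half_bound:
  assumes br: "bounded_radius x r M" and c: "c \<ge> 0"
  shows "of_nat (card I) * r * (2 * of_nat n * M * c) \<le> c / 2"
    and "of_nat (card I) * r * (of_nat n * M * c) \<le> c / 2"
proof -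
  have *: "of_nat (card I) * r * (2 * of_nat n * M) * c \<le> 1 / 2 * c"
    using br c by (intro mult_right_mono) (auto simp: bounded_radius_def)
  then show "of_nat (card I) * r * (2 * of_nat n * M * c) \<le> c / 2" by (simp add: mult_ac)
  have "of_nat (card I) * r * (of_nat n * M * c) \<ge> 0" using br c by (simp add: bounded_radius_def)
  with * show "of_nat (card I) * r * (of_nat n * M * c) \<le> c / 2" by (simp add: mult_ac)
qed

lemma flat_on_cont: "flat_on S G \<Longrightarrow> p < n \<Longrightarrow> continuous_on S (G p)"
  by (simp add: flat_on_def hol_def)

lemma flat_on_subset: "flat_on S G \<Longrightarrow> S' \<subseteq> S \<Longrightarrow> flat_on S' G"
  unfolding flat_on_def by (intro allI impI conjI ballI) (auto intro: hol_subset)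

text \<open>A flat vector that vanishes at the centre is a radial integral of its own derivatives
  \<open>A i G\<close>, so that a bound \<open>c\<close> improves to \<open>c / 2\<close>.\<close>

lemma flat_zero_local:
  assumes br: "bounded_radius x r M" and G: "flat_on (pball I x r) G"
    and C: "\<And>p w. p < n \<Longrightarrow> w \<in> pball I x r \<Longrightarrow> norm (G p w) \<le> C"
    and 0: "\<And>p. p < n \<Longrightarrow> G p x = 0"
    and p: "p < n" and w: "w \<in> pball I x r"
  shows "G p w = 0"
proof -
  have "(\<lambda>(p, w). G p w) (p, w) = 0"
  proof (rule contraction_zero[where S = "{..<n} \<times> pball I x r"])
    fix c y assume c: "c \<ge> 0" and le: "\<And>y. y \<in> {..<n} \<times> pball I x r \<Longrightarrow> norm ((\<lambda>(p, w). G p w) y) \<le> c"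
      and y: "y \<in> {..<n} \<times> pball I x r"
    obtain p w where pw: "y = (p, w)" "p < n" "w \<in> pball I x r" using y by auto
    have H: "hol I (pball I x r) (G p)" using G pw by (simp add: flat_on_def)
    have eq: "G p w = (\<Sum>i\<in>I. (w i - x i) * radint x 0 (pd i (G p)) w)"
      using radint_ftc(1)[OF fin H pw(3)] 0 pw by simp
    have "norm (radint x 0 (pd i (G p)) w) \<le> of_nat n * M * c" if i: "i \<in> I" for i
    proof (rule radint_norm_le[OF fin pd_continuous[OF pball_pdom[OF fin] H i] pw(3)])
      fix w' assume w': "w' \<in> pball I x r"
      have "pd i (G p) w' = (\<Sum>q<n. A i p q w' * G q w')" using G pw(2) w' i by (simp add: flat_on_def)
      then show "norm (pd i (G p) w') \<le> of_nat n * M * c"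
        using sum_A_le[OF br w' i pw(2), of "\<lambda>q. G q w'" c] le[of "(_, w')"] w' by auto
    qed
    then have "norm (G p w) \<le> of_nat (card I) * r * (of_nat n * M * c)"
      unfolding eq using br c by (intro pball_offset_sum_le pw(3)) (auto simp: bounded_radius_def)
    also have "\<dots> \<le> c / 2" by (rule half_bound(2)[OF br c])
    finally show "norm ((\<lambda>(p, w). G p w) y) \<le> c / 2" using pw by simp
  qed (use C p w in auto)
  then show ?thesis by simp
qed

text \<open>Supplies the a priori bound from which a contraction can start; an open polydisc is not
  compact, so the radius may have to shrink.\<close>

lemma local_bound:
  assumes dom': "pdom I S" and G: "\<And>p. p \<in> X \<Longrightarrow> continuous_on S (G p)" and x: "x \<in> S" and X: "finite X"
  shows "\<exists>s>0. \<exists>C. \<forall>p\<in>X. \<forall>w\<in>pball I x s \<inter> S. norm (G p w :: complex) \<le> C"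
proof -
  define g where "g = (\<lambda>w. \<Sum>p\<in>X. norm (G p w))"
  have cg: "continuous_on S g"
    unfolding g_def by (intro continuous_on_sum continuous_on_norm G)
  obtain \<delta> where \<delta>: "\<delta> > 0" "\<forall>w'\<in>pball I x \<delta> \<inter> S. dist (g w') (g x) < 1"
    by (rule continuous_on_pdomE[OF dom' cg x, where e = 1]) (simp, rule that)
  have "norm (G p w) \<le> g x + 1" if "p \<in> X" "w \<in> pball I x \<delta> \<inter> S" for p w
  proof -
    have "norm (G p w) \<le> g w"
      unfolding g_def by (rule member_le_sum) (use that X in auto)
    moreover have "dist (g w) (g x) < 1" using \<delta>(2) that by blast
    ultimately show ?thesis by (simp add: dist_real_def)
  qed
  then show ?thesis using \<delta>(1) by (intro exI[of _ \<delta>] conjI exI[of _ "g x + 1"] ballI) auto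
qed

text \<open>Zeros of flat vectors propagate: the radius does not depend on which point of the
  neighbourhood carries the zero.\<close>

lemma flat_zero_nbhd:
  assumes dom': "pdom I S" and SD: "S \<subseteq> D" and G: "flat_on S G" and a: "a \<in> S"
  shows "\<exists>s>0. pball I a s \<subseteq> S \<and> (\<forall>x\<in>pball I a s. (\<forall>p<n. G p x = 0) \<longrightarrow> (\<forall>y\<in>pball I a s. \<forall>p<n. G p y = 0))"
proof -
  obtain r0 M where br0: "bounded_radius a r0 M" using bounded_radius_ex SD a by blast
  obtain s1 C where s1: "s1 > 0" "\<forall>p\<in>{..<n}. \<forall>w\<in>pball I a s1 \<inter> S. norm (G p w) \<le> C"
  proof -
    have "continuous_on S (G p)" if "p \<in> {..<n}" for p using flat_on_cont[OF G] that by simp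
    from local_bound[where G = G and X = "{..<n}", OF dom' this a] show ?thesis using that by auto
  qed
  obtain s2 where s2: "s2 > 0" "pball I a s2 \<subseteq> S" using pdom_pball[OF dom' a] .
  define r where "r = min r0 (min s1 s2)"
  have r: "r > 0" using br0 s1 s2 by (simp add: r_def bounded_radius_def)
  have sub: "pball I a r \<subseteq> pball I a r0" "pball I a r \<subseteq> pball I a s1" "pball I a r \<subseteq> pball I a s2"
    by (rule pball_mono, simp add: r_def)+
  have rS: "pball I a r \<subseteq> S" using sub s2 by blast
  show ?thesis
  \<comment> \<open>Any two points \<open>x\<close> and \<open>y\<close> of the polydisc of radius
    \<open>r / 4\<close> are within \<open>r / 2\<close> of each other, and the polydisc of radius
    \<open>r / 2\<close> around \<open>x\<close> stays in the one of radius \<open>r\<close> around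
    \<open>a\<close>.\<close>
  proof (intro exI[of _ "r/4"] conjI ballI impI allI)
    have "pball I a (r/4) \<subseteq> pball I a r" by (rule pball_mono) (use r in simp)
    then show "pball I a (r/4) \<subseteq> S" using rS by blast
    fix x y p assume x: "x \<in> pball I a (r/4)" and 0: "\<forall>p<n. G p x = 0" and y: "y \<in> pball I a (r/4)" and p: "p < n"
    have xr: "pball I x (r/2) \<subseteq> pball I a r"
    proof (rule order_trans[OF pball_subset_pball[OF x]])
      show "pball I a (r/4 + r/2) \<subseteq> pball I a r" by (rule pball_mono) (use r in simp)
    qed
    have yx: "y \<in> pball I x (r/2)"
    proof -
      have "norm (y i - x i) < r/2" if i: "i \<in> I" for i
      proof -
        have "norm (y i - x i) \<le> norm (y i - a i) + norm (x i - a i)"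
          using norm_triangle_ineq4[of "y i - a i" "x i - a i"] by simp
        then show ?thesis using x y i by (force simp: pball_def)
      qed
      then show ?thesis using x y by (auto simp: pball_def)
    qed
    have br: "bounded_radius x (r/2) M"
      by (rule bounded_radius_mono[OF br0]) (use xr sub r in \<open>auto simp: r_def\<close>)
    show "G p y = 0"
    proof (rule flat_zero_local[OF br _ _ _ p yx])
      show "flat_on (pball I x (r/2)) G" using flat_on_subset[OF G] xr rS by blast
      show "norm (G q w) \<le> C" if "q < n" "w \<in> pball I x (r/2)" for q w
        using s1(2) that xr sub rS by blast
    qed (use 0 in auto)
  qed (use r in simp)
qed

lemma flat_zero_connected:
  assumes dom': "pdom I S" and SD: "S \<subseteq> D" and G: "flat_on S G" and conn: "connected S"
    and x: "x \<in> S" "\<And>p. p < n \<Longrightarrow> G p x = 0" and y: "y \<in> S" and p: "p < n"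
  shows "G p y = 0"
proof -
  have "\<forall>p<n. G p y = 0"
  proof (rule connected_induction_simple[OF conn x(1) y, where P = "\<lambda>y. \<forall>p<n. G p y = 0"])
    fix a assume a: "a \<in> S"
    obtain s where s: "s > 0" "pball I a s \<subseteq> S"
      "\<forall>x\<in>pball I a s. (\<forall>p<n. G p x = 0) \<longrightarrow> (\<forall>y\<in>pball I a s. \<forall>p<n. G p y = 0)"
      using flat_zero_nbhd[OF dom' SD G a] by (elim exE conjE) (rule that)
    obtain U where U: "open U" "U \<inter> S = pball I a s \<inter> S" by (rule open_pball_pdom[OF dom' a]) (rule that)
    then have "openin (top_of_set S) (pball I a s)" using s(2) by (metis Int_absorb2 inf_commute openin_open)
    then show "\<exists>T. openin (top_of_set S) T \<and> a \<in> T \<and>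
        (\<forall>x\<in>T. \<forall>y\<in>T. (\<forall>p<n. G p x = 0) \<longrightarrow> (\<forall>p<n. G p y = 0))"
      using s pball_self[OF s(1)] by (intro exI[of _ "pball I a s"]) auto
  qed (use x in auto)
  then show ?thesis using p by blast
qed

context
  fixes w0 :: "'i \<Rightarrow> complex" and r M :: real
  assumes br: "bounded_radius w0 r M"
begin

abbreviation (input) "P \<equiv> pball I w0 r"

lemma hol_A_P: "i \<in> I \<Longrightarrow> p < n \<Longrightarrow> q < n \<Longrightarrow> hol I P (A i p q)"
  using hol_subset[OF hol_A] br by (simp add: bounded_radius_def)

text \<open>The one-form with components \<open>A i G\<close> is integrated along the ray from
  \<open>w0\<close>. A fixed point solves the system a priori only in the radial direction.\<close>

definition picard where
  "picard v G p w = v p + (\<Sum>i\<in>I. (w i - w0 i) * radint w0 0 (\<lambda>w. \<Sum>q<n. A i p q w * G q w) w)"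

lemma hol_AG:
  assumes "\<And>q. q < n \<Longrightarrow> hol I P (G q)" "i \<in> I" "p < n"
  shows "hol I P (\<lambda>w. \<Sum>q<n. A i p q w * G q w)"
  by (rule hol_sum, rule hol_mult, rule hol_A_P) (use assms in auto)

lemma hol_picard:
  assumes "\<And>q. q < n \<Longrightarrow> hol I P (G q)" "p < n"
  shows "hol I P (picard v G p)"
  unfolding picard_def[abs_def]
  by (rule hol_add[OF hol_const], rule hol_sum, rule hol_mult[OF hol_diff[OF hol_coord hol_const]],
      rule hol_radint[OF fin hol_AG]) (use assms in auto)

lemma picard_diff:
  assumes G: "\<And>q. q < n \<Longrightarrow> hol I P (G q)" and G': "\<And>q. q < n \<Longrightarrow> hol I P (G' q)"
    and c: "\<And>q w. q < n \<Longrightarrow> w \<in> P \<Longrightarrow> norm (G q w - G' q w) \<le> c" and c0: "c \<ge> 0"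
    and p: "p < n" and w: "w \<in> P"
  shows "norm (picard v G p w - picard v G' p w) \<le> c / 2"
proof -
  define R where "R = (\<lambda>i. radint w0 0 (\<lambda>w. (\<Sum>q<n. A i p q w * G q w) - (\<Sum>q<n. A i p q w * G' q w)) w)"
  have "picard v G p w - picard v G' p w = (\<Sum>i\<in>I. (w i - w0 i) * R i)"
  proof -
    have "R i = radint w0 0 (\<lambda>w. \<Sum>q<n. A i p q w * G q w) w - radint w0 0 (\<lambda>w. \<Sum>q<n. A i p q w * G' q w) w"
      if "i \<in> I" for i
      unfolding R_def
      by (rule radint_diff[OF fin hol_continuous[OF hol_AG[OF G that p]] hol_continuous[OF hol_AG[OF G' that p]] w])
    then show ?thesis by (simp add: picard_def sum_subtractf right_diff_distrib cong: sum.cong)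
  qed
  moreover have "norm (\<Sum>i\<in>I. (w i - w0 i) * R i) \<le> of_nat (card I) * r * (of_nat n * M * c)"
  proof (rule pball_offset_sum_le[OF w])
    fix i assume i: "i \<in> I"
    show "norm (R i) \<le> of_nat n * M * c"
      unfolding R_def
    proof (rule radint_norm_le[OF fin _ w])
      show "continuous_on P (\<lambda>w. (\<Sum>q<n. A i p q w * G q w) - (\<Sum>q<n. A i p q w * G' q w))"
        by (intro continuous_on_diff hol_continuous[OF hol_AG[OF G i p]] hol_continuous[OF hol_AG[OF G' i p]])
      fix w assume w: "w \<in> P"
      have "(\<Sum>q<n. A i p q w * G q w) - (\<Sum>q<n. A i p q w * G' q w) = (\<Sum>q<n. A i p q w * (G q w - G' q w))"
        by (simp add: sum_subtractf right_diff_distrib)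
      then show "norm ((\<Sum>q<n. A i p q w * G q w) - (\<Sum>q<n. A i p q w * G' q w)) \<le> of_nat n * M * c"
        using sum_A_le[OF br w i p, of "\<lambda>q. G q w - G' q w" c] c[OF _ w] by simp
    qed
  qed (use br c0 in \<open>auto simp: bounded_radius_def\<close>)
  ultimately show ?thesis using half_bound(2)[OF br c0] by simp
qed

text \<open>Successive differences of the iterates are dominated by a geometric series, so the limit
  is uniform, hence holomorphic, and inherits the fixed-point equation.\<close>

lemma picard_fixpoint:
  "\<exists>L. (\<forall>p<n. hol I P (L p)) \<and> (\<forall>p<n. \<forall>w\<in>P. L p w = picard v L p w)"
proof -
  define G where "G = rec_nat (\<lambda>p w. v p :: complex) (\<lambda>_ G. picard v G)"
  have G0: "G 0 = (\<lambda>p w. v p)" and GS: "G (Suc k) = picard v (G k)" for k by (simp_all add: G_def)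
  have hG: "\<forall>p<n. hol I P (G k p)" for k
    by (induction k) (auto simp: G0 GS intro!: hol_picard)
  have hG': "hol I P (G k p)" if "p < n" for k p using hG that by blast
  obtain C where C: "C \<ge> 0" "\<And>p w. p < n \<Longrightarrow> w \<in> P \<Longrightarrow> norm (G 1 p w - G 0 p w) \<le> C"
  proof -
    define c where "c = (\<Sum>p<n. norm (v p))"
    have c0: "c \<ge> 0" by (simp add: c_def sum_nonneg)
    have vc: "norm (v q) \<le> c" if "q < n" for q
      unfolding c_def by (rule member_le_sum) (use that in auto)
    \<comment> \<open>The constant start \<open>v\<close> is itself the Picard image of zero, so the
      contraction estimate controls the first difference too.\<close>
    have pz: "picard v (\<lambda>q w. 0) p w = v p" for p w by (simp add: picard_def radint_def)
    have "norm (G 1 p w - G 0 p w) \<le> c / 2" if "p < n" "w \<in> P" for p w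
      using picard_diff[of "\<lambda>q w. v q" "\<lambda>q w. 0" c p w v] vc c0 that by (simp add: G0 GS pz)
    then show ?thesis using c0 by (intro that[of "c / 2"]) auto
  qed
  have diff: "\<forall>p<n. \<forall>w\<in>P. norm (G (Suc k) p w - G k p w) \<le> C * (1/2) ^ k" for k
  proof (induction k)
    case 0
    then show ?case using C by simp
  next
    case (Suc k)
    show ?case
    proof (intro allI impI ballI)
      fix p w assume pw: "p < n" "w \<in> P"
      have "norm (picard v (G (Suc k)) p w - picard v (G k) p w) \<le> (C * (1/2) ^ k) / 2"
        by (rule picard_diff[OF hG' hG' _ _ pw]) (use Suc C in auto)
      then show "norm (G (Suc (Suc k)) p w - G (Suc k) p w) \<le> C * (1/2) ^ Suc k" by (simp add: GS)
    qed
  qed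
  define L where "L = (\<lambda>p w. v p + (\<Sum>k. G (Suc k) p w - G k p w))"
  have ul: "uniform_limit P (\<lambda>k. G k p) (L p) sequentially" if p: "p < n" for p
  proof -
    have "uniform_limit P (\<lambda>m w. \<Sum>k<m. G (Suc k) p w - G k p w) (\<lambda>w. \<Sum>k. G (Suc k) p w - G k p w) sequentially"
    proof (rule Weierstrass_m_test)
      show "norm (G (Suc k) p w - G k p w) \<le> C * (1/2) ^ k" if "w \<in> P" for k w
        using diff p that by blast
      show "summable (\<lambda>k. C * (1/2::real) ^ k)" by (intro summable_mult summable_geometric) simp
    qed
    then have "uniform_limit P (\<lambda>m w. v p + (\<Sum>k<m. G (Suc k) p w - G k p w)) (L p) sequentially"
      unfolding L_def by (intro uniform_limit_add uniform_limit_const)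
    moreover have "v p + (\<Sum>k<m. G (Suc k) p w - G k p w) = G m p w" for m w
      using sum_lessThan_telescope[of "\<lambda>k. G k p w" m] by (simp add: G0)
    ultimately show ?thesis by simp
  qed
  have hL: "hol I P (L p)" if "p < n" for p
    by (rule hol_uniform_limit[OF pball_pdom[OF fin] hG'[OF that] ul[OF that]])
  have "L p w = picard v L p w" if pw: "p < n" "w \<in> P" for p w
  proof -
    have l1: "(\<lambda>k. G (Suc k) p w) \<longlonglongrightarrow> L p w"
      by (rule LIMSEQ_Suc[OF tendsto_uniform_limitI[OF ul[OF pw(1)] pw(2)]])
    have l2: "(\<lambda>k. picard v (G k) p w) \<longlonglongrightarrow> picard v L p w"
    proof (rule metric_LIMSEQ_I)
      fix e :: real assume e: "e > 0"
      have "\<forall>q\<in>{..<n}. \<forall>\<^sub>F k in sequentially. \<forall>w\<in>P. dist (G k q w) (L q w) < e"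
        using ul e unfolding uniform_limit_iff by auto
      then have "\<forall>\<^sub>F k in sequentially. \<forall>q\<in>{..<n}. \<forall>w\<in>P. dist (G k q w) (L q w) < e"
        by (intro eventually_ball_finite) auto
      then obtain N where N: "\<And>k. k \<ge> N \<Longrightarrow> \<forall>q\<in>{..<n}. \<forall>w\<in>P. dist (G k q w) (L q w) < e"
        unfolding eventually_sequentially by blast
      show "\<exists>N. \<forall>k\<ge>N. dist (picard v (G k) p w) (picard v L p w) < e"
      proof (intro exI[of _ N] allI impI)
        fix k assume k: "k \<ge> N"
        have "norm (picard v (G k) p w - picard v L p w) \<le> e / 2"
          by (rule picard_diff[OF hG' hL _ _ pw])
             (use N[OF k] e in \<open>auto simp: dist_norm less_imp_le\<close>)
        then show "dist (picard v (G k) p w) (picard v L p w) < e" using e by (simp add: dist_norm)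
      qed
    qed
    show ?thesis using LIMSEQ_unique[OF l1[unfolded GS] l2] .
  qed
  then show ?thesis using hL by blast
qed

lemma picard_center: "picard v L p w0 = v p"
  by (simp add: picard_def)

text \<open>The defect \<open>pd j L - H j\<close>, with \<open>H = A L\<close>, measures the
  failure in non-radial directions. Flatness expresses the curl of \<open>H\<close> linearly through
  the defect, and the defect is a radial integral of this curl; near \<open>w0\<close> such a
  homogeneous equation has only the zero solution.\<close>

lemma picard_solutions_flat:
  assumes hL: "\<And>a p. a < n \<Longrightarrow> p < n \<Longrightarrow> hol I P (L a p)"
    and fx: "\<And>a p w. a < n \<Longrightarrow> p < n \<Longrightarrow> w \<in> P \<Longrightarrow> L a p w = picard (v a) (L a) p w"
  shows "\<exists>s>0. s \<le> r \<and> (\<forall>a<n. flat_on (pball I w0 s) (L a))"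
proof -
  define H where "H = (\<lambda>a i p w. \<Sum>q<n. A i p q w * L a q w)"
  have hH: "hol I P (H a i p)" if "a < n" "i \<in> I" "p < n" for a i p
    unfolding H_def using that by (intro hol_AG hL)
  define E where "E = (\<lambda>(a, j, p) w. pd j (L a p) w - H a j p w)"
  note domP = pball_pdom[OF fin, of w0 r]
  have rpos: "r > 0" using br by (simp add: bounded_radius_def)
  have cE: "continuous_on P (E x)" if "x \<in> {..<n} \<times> I \<times> {..<n}" for x
    using that unfolding E_def
    by (auto intro!: continuous_on_diff pd_continuous[OF domP] hL hol_continuous[OF hH])
  have fX: "finite ({..<n} \<times> I \<times> {..<n})" using fin by simp
  \<comment> \<open>A bound on \<open>E\<close> must exist before it can be halved; this costs a
    smaller radius.\<close>
  have "\<exists>s>0. \<exists>C. \<forall>x\<in>{..<n} \<times> I \<times> {..<n}. \<forall>w\<in>pball I w0 s \<inter> P. norm (E x w) \<le> C"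
    by (rule local_bound[OF domP cE pball_self[OF rpos] fX])
  then obtain s0 C where s0: "s0 > 0" "\<forall>x\<in>{..<n} \<times> I \<times> {..<n}. \<forall>w\<in>pball I w0 s0 \<inter> P. norm (E x w) \<le> C"
    by (elim exE conjE) (rule that)
  define s where "s = min s0 r"
  have s: "s > 0" "s \<le> r" using s0 rpos by (auto simp: s_def)
  define S where "S = pball I w0 s"
  have SP: "S \<subseteq> P" unfolding S_def by (rule pball_mono[OF s(2)])
  have Ss0: "S \<subseteq> pball I w0 s0" unfolding S_def by (rule pball_mono) (simp add: s_def)
  have brs: "bounded_radius w0 s M"
    by (rule bounded_radius_mono[OF br]) (use SP s in \<open>auto simp: S_def\<close>)
  have SD: "S \<subseteq> D" using brs by (auto simp: bounded_radius_def S_def)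
  note domS = pball_pdom[OF fin, of w0 s, folded S_def]
  note hLS = hol_subset[OF hL SP] and hHS = hol_subset[OF hH SP]
  have hAS: "hol I S (A i p q)" if "i \<in> I" "p < n" "q < n" for i p q
    using hol_subset[OF hol_A SD] that by blast
  \<comment> \<open>All terms free of \<open>E\<close> cancel by flatness of
    \<open>A\<close>.\<close>
  have pdH: "pd j (H a i p) w - pd i (H a j p) w = (\<Sum>q<n. A i p q w * E (a, j, q) w) - (\<Sum>q<n. A j p q w * E (a, i, q) w)"
    if a: "a < n" and i: "i \<in> I" and j: "j \<in> I" and p: "p < n" and w: "w \<in> S" for a i j p w
  proof -
    have pdH1: "pd j (H a i p) w = (\<Sum>q<n. pd j (A i p q) w * L a q w) + (\<Sum>q<n. A i p q w * pd j (L a q) w)"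
      if i: "i \<in> I" and j: "j \<in> I" for i j
    proof -
      have "pd j (H a i p) w = (\<Sum>q<n. pd j (\<lambda>w. A i p q w * L a q w) w)"
        unfolding H_def by (rule pd_sum[OF _ w j]) (use a i p in \<open>auto intro!: hol_mult hAS hLS\<close>)
      also have "\<dots> = (\<Sum>q<n. pd j (A i p q) w * L a q w + A i p q w * pd j (L a q) w)"
        by (intro sum.cong refl pd_mult[OF _ _ w j]) (use a i p in \<open>auto intro!: hAS hLS\<close>)
      finally show ?thesis by (simp add: sum.distrib)
    qed
    have pdL: "pd j (L a q) w = E (a, j, q) w + (\<Sum>s<n. A j q s w * L a s w)" for j q
      by (simp add: E_def H_def)
    have ex: "(\<Sum>q<n. A i p q w * pd j (L a q) w) =
        (\<Sum>q<n. A i p q w * E (a, j, q) w) + (\<Sum>s<n. (\<Sum>q<n. A i p q w * A j q s w) * L a s w)" for i j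
    proof -
      have "(\<Sum>q<n. A i p q w * (\<Sum>s<n. A j q s w * L a s w)) = (\<Sum>s<n. (\<Sum>q<n. A i p q w * A j q s w) * L a s w)"
        by (simp only: sum_distrib_left sum_distrib_right mult.assoc) (rule sum.swap)
      then show ?thesis by (simp add: pdL distrib_left sum.distrib)
    qed
    have "(\<Sum>s<n. pd j (A i p s) w * L a s w) + (\<Sum>s<n. (\<Sum>q<n. A i p q w * A j q s w) * L a s w)
      = (\<Sum>s<n. (pd j (A i p s) w + (\<Sum>q<n. A i p q w * A j q s w)) * L a s w)"
      by (simp add: distrib_right sum.distrib)
    also have "\<dots> = (\<Sum>s<n. (pd i (A j p s) w + (\<Sum>q<n. A j p q w * A i q s w)) * L a s w)"
      by (rule sum.cong) (use flat[OF i j p] w SD in auto)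
    also have "\<dots> = (\<Sum>s<n. pd i (A j p s) w * L a s w) + (\<Sum>s<n. (\<Sum>q<n. A j p q w * A i q s w) * L a s w)"
      by (simp add: distrib_right sum.distrib)
    finally show ?thesis
      unfolding pdH1[OF i j] pdH1[OF j i] ex by (simp add: algebra_simps)
  qed
  have Eeq: "E (a, j, p) w = (\<Sum>i\<in>I. (w i - w0 i) * radint w0 1 (\<lambda>w. pd j (H a i p) w - pd i (H a j p) w) w)"
    if a: "a < n" and j: "j \<in> I" and p: "p < n" and w: "w \<in> S" for a j p w
  proof -
    define Q where "Q = (\<lambda>i w. (w i - w0 i) * radint w0 0 (H a i p) w)"
    have hR: "hol I S (radint w0 0 (H a i p))" if "i \<in> I" for i
      unfolding S_def by (rule hol_radint[OF fin]) (use hHS[OF a that p] in \<open>simp add: S_def\<close>)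
    have hc: "hol I S (\<lambda>w. w i - w0 i)" for i by (rule hol_diff[OF hol_coord hol_const])
    have hQ: "hol I S (Q i)" if "i \<in> I" for i
      unfolding Q_def by (rule hol_mult[OF hc hR[OF that]])
    have pdQ: "pd j (Q i) w = (if i = j then radint w0 0 (H a j p) w else 0) + (w i - w0 i) * radint w0 1 (pd j (H a i p)) w"
      if i: "i \<in> I" for i
    proof -
      have "pd j (Q i) w = pd j (\<lambda>w. w i - w0 i) w * radint w0 0 (H a i p) w + (w i - w0 i) * pd j (radint w0 0 (H a i p)) w"
        unfolding Q_def by (rule pd_mult[OF hc hR[OF i] w j])
      moreover have "pd j (\<lambda>w. w i - w0 i) w = (if i = j then 1 else 0)"
        using pd_diff[OF hol_coord hol_const w j] by (simp add: pd_coord)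
      moreover have "pd j (radint w0 0 (H a i p)) w = radint w0 1 (pd j (H a i p)) w"
        using pd_radint[OF fin, of w0 s "H a i p" w j 0] hHS[OF a i p] w j by (simp add: S_def)
      ultimately show ?thesis by simp
    qed
    have "pd j (L a p) w = pd j (\<lambda>w. v a p + (\<Sum>i\<in>I. Q i w)) w"
      by (rule pd_cong[OF domS w j]) (use fx[OF a p] SP in \<open>auto simp: picard_def Q_def H_def\<close>)
    also have "\<dots> = (\<Sum>i\<in>I. pd j (Q i) w)"
      by (subst pd_add[OF hol_const hol_sum[where A = I, OF hQ] w j]; (assumption)?)
         (simp add: pd_sum[where A = I, OF hQ w j])
    also have "\<dots> = (\<Sum>i\<in>I. if i = j then radint w0 0 (H a j p) w else 0) + (\<Sum>i\<in>I. (w i - w0 i) * radint w0 1 (pd j (H a i p)) w)"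
      by (simp add: pdQ sum.distrib)
    also have "(\<Sum>i\<in>I. if i = j then radint w0 0 (H a j p) w else 0) = radint w0 0 (H a j p) w"
      using fin j by (simp add: sum.delta)
    finally have 1: "pd j (L a p) w = radint w0 0 (H a j p) w + (\<Sum>i\<in>I. (w i - w0 i) * radint w0 1 (pd j (H a i p)) w)" .
    \<comment> \<open>Writing \<open>H\<close> as the integral of the derivative of
      \<open>t * H\<close> reproduces the leading term of \<open>pd j L\<close>, so only the
      antisymmetrised derivatives survive in the difference.\<close>
    have 2: "H a j p w = radint w0 0 (H a j p) w + (\<Sum>i\<in>I. (w i - w0 i) * radint w0 1 (pd i (H a j p)) w)"
      using radint_ftc(2)[OF fin, of w0 s "H a j p" w] hHS[OF a j p] w by (simp add: S_def)
    have 3: "radint w0 1 (\<lambda>w. pd j (H a i p) w - pd i (H a j p) w) w = radint w0 1 (pd j (H a i p)) w - radint w0 1 (pd i (H a j p)) w"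
      if i: "i \<in> I" for i
      by (rule radint_diff[OF fin pd_continuous[OF domS hHS[OF a i p] j, unfolded S_def]
          pd_continuous[OF domS hHS[OF a j p] i, unfolded S_def] w[unfolded S_def]])
    have "E (a, j, p) w = (\<Sum>i\<in>I. (w i - w0 i) * (radint w0 1 (pd j (H a i p)) w - radint w0 1 (pd i (H a j p)) w))"
      unfolding E_def by (simp add: 1 2 sum_subtractf right_diff_distrib)
    also have "\<dots> = (\<Sum>i\<in>I. (w i - w0 i) * radint w0 1 (\<lambda>w. pd j (H a i p) w - pd i (H a j p) w) w)"
      by (intro sum.cong refl) (simp only: 3)
    finally show ?thesis .
  qed
  have E0: "(\<lambda>(x, w). E x w) y = 0" if y: "y \<in> ({..<n} \<times> I \<times> {..<n}) \<times> S" for y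
  proof (rule contraction_zero[OF _ _ y])
    show "norm ((\<lambda>(x, w). E x w) y') \<le> C" if y': "y' \<in> ({..<n} \<times> I \<times> {..<n}) \<times> S" for y'
    proof -
      obtain x w where xw: "y' = (x, w)" "x \<in> {..<n} \<times> I \<times> {..<n}" "w \<in> S"
        using y' by (cases y') auto
      then have "w \<in> pball I w0 s0 \<inter> P" using Ss0 SP by blast
      from s0(2)[rule_format, OF xw(2) this] show ?thesis by (simp add: xw(1))
    qed
    fix c y assume c: "c \<ge> 0" and le: "\<And>y. y \<in> ({..<n} \<times> I \<times> {..<n}) \<times> S \<Longrightarrow> norm ((\<lambda>(x, w). E x w) y) \<le> c"
      and y: "y \<in> ({..<n} \<times> I \<times> {..<n}) \<times> S"
    obtain a j p w where ajp: "y = ((a, j, p), w)" "a < n" "j \<in> I" "p < n" "w \<in> S" using y by auto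
    have le': "norm (E (a, i, q) w) \<le> c" if "i \<in> I" "q < n" "w \<in> S" for i q w
      using le[of "((a, i, q), w)"] ajp(2) that by simp
    have "norm (E (a, j, p) w) \<le> of_nat (card I) * s * (2 * of_nat n * M * c)"
      unfolding Eeq[OF ajp(2-5)]
    proof (rule pball_offset_sum_le[OF ajp(5)[unfolded S_def]])
      fix i assume i: "i \<in> I"
      show "norm (radint w0 1 (\<lambda>w. pd j (H a i p) w - pd i (H a j p) w) w) \<le> 2 * of_nat n * M * c"
      proof (rule radint_norm_le[OF fin _ ajp(5)[unfolded S_def]])
        show "continuous_on (pball I w0 s) (\<lambda>w. pd j (H a i p) w - pd i (H a j p) w)"
          using pd_continuous[OF domS hHS[OF ajp(2) i ajp(4)] ajp(3)] pd_continuous[OF domS hHS[OF ajp(2) ajp(3) ajp(4)] i]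
          unfolding S_def by (rule continuous_on_diff)
        fix w assume "w \<in> pball I w0 s"
        then have w: "w \<in> S" by (simp add: S_def)
        have "norm (\<Sum>q<n. A i p q w * E (a, j, q) w) \<le> of_nat n * M * c"
          by (rule sum_A_le[OF brs _ i ajp(4)]) (use w le' ajp in \<open>auto simp: S_def\<close>)
        moreover have "norm (\<Sum>q<n. A j p q w * E (a, i, q) w) \<le> of_nat n * M * c"
          by (rule sum_A_le[OF brs _ ajp(3) ajp(4)]) (use w le' i in \<open>auto simp: S_def\<close>)
        ultimately show "norm (pd j (H a i p) w - pd i (H a j p) w) \<le> 2 * of_nat n * M * c"
          unfolding pdH[OF ajp(2) i ajp(3) ajp(4) w]
          using norm_triangle_ineq4[of "\<Sum>q<n. A i p q w * E (a, j, q) w" "\<Sum>q<n. A j p q w * E (a, i, q) w"]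
          by linarith
      qed
    qed (use brs c in \<open>auto simp: bounded_radius_def\<close>)
    also have "\<dots> \<le> c / 2" by (rule half_bound(1)[OF brs c])
    finally show "norm ((\<lambda>(x, w). E x w) y) \<le> c / 2" using ajp by simp
  qed
  have "flat_on S (L a)" if a: "a < n" for a
    unfolding flat_on_def
  proof (intro allI impI conjI ballI)
    fix p assume p: "p < n"
    show "hol I S (L a p)" by (rule hLS[OF a p])
    fix w i assume w: "w \<in> S" and i: "i \<in> I"
    show "pd i (L a p) w = (\<Sum>q<n. A i p q w * L a q w)"
      using E0[of "((a, i, p), w)"] a p w i by (simp add: E_def H_def)
  qed
  then show ?thesis using s unfolding S_def by blast
qed

end

lemma local_frame:
  assumes w0: "w0 \<in> D"
  shows "\<exists>s>0. \<exists>L. pball I w0 s \<subseteq> D \<and> (\<forall>a<n. flat_on (pball I w0 s) (L a)) \<and>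
     (\<forall>a<n. \<forall>p<n. L a p w0 = (if p = a then 1 else 0))"
proof -
  obtain r M where br: "bounded_radius w0 r M" using bounded_radius_ex[OF w0] by blast
  define v where "v = (\<lambda>(a::nat) (p::nat). if p = a then 1 else 0 :: complex)"
  have "\<forall>a. \<exists>L. (\<forall>p<n. hol I (pball I w0 r) (L p)) \<and> (\<forall>p<n. \<forall>w\<in>pball I w0 r. L p w = picard w0 (v a) L p w)"
    using picard_fixpoint[OF br] by blast
  then obtain L where L: "\<forall>a. (\<forall>p<n. hol I (pball I w0 r) (L a p)) \<and> (\<forall>p<n. \<forall>w\<in>pball I w0 r. L a p w = picard w0 (v a) (L a) p w)"
    unfolding choice_iff by blast
  have rpos: "r > 0" "pball I w0 r \<subseteq> D" using br by (auto simp: bounded_radius_def)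
  obtain s where s: "s > 0" "s \<le> r" "\<forall>a<n. flat_on (pball I w0 s) (L a)"
    using picard_solutions_flat[OF br, of L v] L by blast
  have "L a p w0 = (if p = a then 1 else 0)" if "p < n" for a p
  proof -
    have "L a p w0 = picard w0 (v a) (L a) p w0" using L that pball_self[OF rpos(1)] by blast
    then show ?thesis unfolding picard_center[OF br] by (simp add: v_def)
  qed
  moreover have "pball I w0 s \<subseteq> D" using pball_mono[OF s(2)] rpos(2) by blast
  ultimately show ?thesis using s by blast
qed

end

section \<open>Global fundamental systems\<close>

text \<open>A zero determinant would give a nonzero kernel vector. This links nondegeneracy of a
  family of solutions with two-sided inverses.\<close>

lemma injective_square_system_solvable:
  fixes M :: "nat \<Rightarrow> nat \<Rightarrow> complex"
  assumes inj: "\<And>c. (\<And>p. p < n \<Longrightarrow> (\<Sum>a<n. M p a * c a) = 0) \<Longrightarrow> (\<And>a. a < n \<Longrightarrow> c a = 0)"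
  obtains B where "\<And>p q. p < n \<Longrightarrow> q < n \<Longrightarrow> (\<Sum>a<n. M p a * B a q) = (if p = q then 1 else 0)"
    "\<And>p q. p < n \<Longrightarrow> q < n \<Longrightarrow> (\<Sum>a<n. B p a * M a q) = (if p = q then 1 else 0)"
proof -
  define MM where "MM = Matrix.mat n n (\<lambda>(p, a). M p a)"
  have MM: "MM \<in> carrier_mat n n" by (simp add: MM_def)
  have "Determinant.det MM \<noteq> 0"
  proof
    assume "Determinant.det MM = 0"
    then obtain v where v: "v \<in> carrier_vec n" "v \<noteq> 0\<^sub>v n" "MM *\<^sub>v v = 0\<^sub>v n"
      using det_0_iff_vec_prod_zero_field[OF MM] by blast
    have z: "(\<Sum>a<n. M p a * (vec_index v a)) = 0" if "p < n" for p
    proof -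
      have "vec_index (MM *\<^sub>v v) p = (\<Sum>a<n. M p a * (vec_index v a))"
        using that v(1) by (auto simp: MM_def scalar_prod_def lessThan_atLeast0 intro!: sum.cong)
      then show ?thesis using v(3) that by simp
    qed
    have "vec_index v a = 0" if "a < n" for a
      by (rule inj[OF z that])
    then have "v = 0\<^sub>v n" using v(1) by (intro eq_vecI) auto
    then show False using v(2) by simp
  qed
  then have "MM \<in> Group.Units (ring_mat TYPE(complex) n ())" by (rule det_non_zero_imp_unit[OF MM])
  then obtain BB where BB: "BB \<in> carrier_mat n n" "BB * MM = 1\<^sub>m n" "MM * BB = 1\<^sub>m n"
    unfolding Group.Units_def ring_mat_def by auto
  show ?thesis
  proof (rule that[of "\<lambda>a q. BB $$ (a, q)"])
    fix p q assume pq: "p < n" "q < n"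
    have "(MM * BB) $$ (p, q) = (\<Sum>a<n. M p a * BB $$ (a, q))"
      using pq BB(1) MM by (auto simp: MM_def scalar_prod_def lessThan_atLeast0 intro!: sum.cong)
    then show "(\<Sum>a<n. M p a * BB $$ (a, q)) = (if p = q then 1 else 0)" using BB(3) pq by simp
    have "(BB * MM) $$ (p, q) = (\<Sum>a<n. BB $$ (p, a) * M a q)"
      using pq BB(1) MM by (auto simp: MM_def scalar_prod_def lessThan_atLeast0 intro!: sum.cong)
    then show "(\<Sum>a<n. BB $$ (p, a) * M a q) = (if p = q then 1 else 0)" using BB(2) pq by simp
  qed
qed

lemma path_connected_pball: "path_connected (pball I x r)"
  unfolding path_connected_def
proof (intro ballI)
  fix a b assume a: "a \<in> pball I x r" and b: "b \<in> pball I x r"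
  define g where "g = (\<lambda>t::real. ray a b (of_real t))"
  have "g t \<in> pball I x r" if t: "t \<in> {0..1}" for t
  proof -
    have "norm (g t i - x i) < r" if i: "i \<in> I" for i
    proof -
      have eq: "g t i - x i = of_real (1 - t) * (a i - x i) + of_real t * (b i - x i)"
        by (simp add: g_def ray_def algebra_simps)
      have "a i - x i \<in> ball 0 r" "b i - x i \<in> ball 0 r"
        using a b i by (auto simp: pball_def)
      then have "(1 - t) *\<^sub>R (a i - x i) + t *\<^sub>R (b i - x i) \<in> ball 0 r"
        using t by (intro convexD[OF convex_ball]) auto
      then show ?thesis by (simp add: eq scaleR_conv_of_real)
    qed
    then show ?thesis using a b by (auto simp: pball_def g_def ray_def)
  qed
  moreover have "path g" unfolding path_def g_def by (rule continuous_on_ray_t)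
  ultimately show "\<exists>g. path g \<and> path_image g \<subseteq> pball I x r \<and> pathstart g = a \<and> pathfinish g = b"
    by (intro exI[of _ g]) (auto simp: path_image_def pathstart_def pathfinish_def g_def)
qed

lemma pdom_subset_Int:
  assumes "pdom I S" "pdom I S'"
  shows "pdom I (S \<inter> S')"
  unfolding pdom_def
proof (intro conjI ballI allI impI)
  fix w assume w: "w \<in> S \<inter> S'"
  obtain a where a: "a > 0" "pball I w a \<subseteq> S" using pdom_pball[OF assms(1)] w by blast
  obtain b where b: "b > 0" "pball I w b \<subseteq> S'" using pdom_pball[OF assms(2)] w by blast
  have "pball I w (min a b) \<subseteq> S \<inter> S'"
    using a b pball_mono[of "min a b" a I w] pball_mono[of "min a b" b I w] by auto
  then show "\<exists>\<rho>>0. pball I w \<rho> \<subseteq> S \<inter> S'" using a b by (intro exI[of _ "min a b"]) auto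
qed (use assms in \<open>auto simp: pdom_def\<close>)

context flat_connection
begin

lemma flat_on_lincomb:
  assumes dom': "pdom I S" and L: "\<And>a. a < m \<Longrightarrow> flat_on S (L a)"
  shows "flat_on S (\<lambda>p w. \<Sum>a<m. L a p w * c a)"
  unfolding flat_on_def
proof (intro allI impI conjI ballI)
  fix p assume p: "p < n"
  have hL: "hol I S (\<lambda>w. L a p w * c a)" if "a \<in> {..<m}" for a
    using L[of a] p that by (intro hol_mult hol_const) (auto simp: flat_on_def)
  show "hol I S (\<lambda>w. \<Sum>a<m. L a p w * c a)" by (rule hol_sum[OF hL])
  fix w i assume w: "w \<in> S" and i: "i \<in> I"
  have "pd i (\<lambda>w. \<Sum>a<m. L a p w * c a) w = (\<Sum>a<m. pd i (\<lambda>w. L a p w * c a) w)"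
    by (rule pd_sum[OF hL w i])
  also have "\<dots> = (\<Sum>a<m. (\<Sum>q<n. A i p q w * L a q w) * c a)"
  proof (rule sum.cong[OF refl])
    fix a assume a: "a \<in> {..<m}"
    have h: "hol I S (L a p)" using L[of a] p a by (simp add: flat_on_def)
    have "pd i (\<lambda>w. L a p w * c a) w = pd i (L a p) w * c a + L a p w * pd i (\<lambda>w. c a) w"
      by (rule pd_mult[OF h hol_const w i])
    then show "pd i (\<lambda>w. L a p w * c a) w = (\<Sum>q<n. A i p q w * L a q w) * c a"
      using L[of a] p a w i by (simp add: flat_on_def)
  qed
  also have "\<dots> = (\<Sum>a<m. \<Sum>q<n. A i p q w * (L a q w * c a))"
    by (simp only: sum_distrib_right mult.assoc)
  also have "\<dots> = (\<Sum>q<n. \<Sum>a<m. A i p q w * (L a q w * c a))"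
    by (rule sum.swap)
  also have "\<dots> = (\<Sum>q<n. A i p q w * (\<Sum>a<m. L a q w * c a))"
    by (simp only: sum_distrib_left)
  finally show "pd i (\<lambda>w. \<Sum>a<m. L a p w * c a) w = (\<Sum>q<n. A i p q w * (\<Sum>a<m. L a q w * c a))" .
qed

lemma flat_on_diff:
  assumes "flat_on S G" "flat_on S G'" 
  shows "flat_on S (\<lambda>p w. G p w - G' p w)"
  unfolding flat_on_def
proof (intro allI impI conjI ballI)
  fix p assume p: "p < n"
  have h: "hol I S (G p)" "hol I S (G' p)" using assms p by (auto simp: flat_on_def)
  then show "hol I S (\<lambda>w. G p w - G' p w)" by (rule hol_diff)
  fix w i assume w: "w \<in> S" and i: "i \<in> I"
  show "pd i (\<lambda>w. G p w - G' p w) w = (\<Sum>q<n. A i p q w * (G q w - G' q w))"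
    using assms p w i pd_diff[OF h w i] by (simp add: flat_on_def sum_subtractf right_diff_distrib)
qed

text \<open>The flat vectors form a locally constant sheaf with polydiscs carrying a local frame as
  charts; the global sections through the unit vectors at \<open>w0\<close> are the fundamental
  system.\<close>

theorem fundamental_system:
  assumes sc: "simply_connected D"
  obtains F where "\<And>a. a < n \<Longrightarrow> flat_on D (F a)"
    "\<And>w c. w \<in> D \<Longrightarrow> (\<And>p. p < n \<Longrightarrow> (\<Sum>a<n. F a p w * c a) = 0) \<Longrightarrow> (\<And>a. a < n \<Longrightarrow> c a = 0)"
proof (cases "D = {}")
  case True
  \<comment> \<open>Over an empty domain both claims are vacuous, so any family serves.\<close>
  show ?thesis by (rule that[of "\<lambda>a p w. 0"]) (auto simp: True flat_on_def hol_def)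
next
  case False
  then obtain w0 where w0: "w0 \<in> D" by blast
  obtain s L where sL: "\<And>x. x \<in> D \<Longrightarrow> s x > 0 \<and> pball I x (s x) \<subseteq> D \<and>
      (\<forall>a<n. flat_on (pball I x (s x)) (L x a)) \<and> (\<forall>a<n. \<forall>p<n. L x a p x = (if p = a then 1 else 0))"
  proof -
    have "\<forall>x. \<exists>s L. x \<in> D \<longrightarrow> s > 0 \<and> pball I x s \<subseteq> D \<and>
      (\<forall>a<n. flat_on (pball I x s) (L a)) \<and> (\<forall>a<n. \<forall>p<n. L a p x = (if p = a then 1 else 0))"
    proof
      fix x show "\<exists>s L. x \<in> D \<longrightarrow> s > 0 \<and> pball I x s \<subseteq> D \<and>
        (\<forall>a<n. flat_on (pball I x s) (L a)) \<and> (\<forall>a<n. \<forall>p<n. L a p x = (if p = a then 1 else 0))"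
      proof (cases "x \<in> D")
        case True
        from local_frame[OF this] show ?thesis by (elim exE conjE) (intro exI impI conjI, assumption+)
      qed simp
    qed
    then show ?thesis unfolding choice_iff using that by auto
  qed
  define T where "T = (\<lambda>x. pball I x (s x))"
  \<comment> \<open>Vectors of length \<open>n\<close> are functions extended by zero, so that
    equality of vectors is equality of functions.\<close>
  define V where "V = {v :: nat \<Rightarrow> complex. \<forall>k\<ge>n. v k = 0}"
  define S where "S = (\<lambda>x c w. (\<lambda>p. if p < n then \<Sum>a<n. L x a p w * c a else 0))"
  have T_pdom: "pdom I (T x)" for x unfolding T_def by (rule pball_pdom[OF fin])
  have T_sub: "T x \<subseteq> D" and T_self: "x \<in> T x" if "x \<in> D" for x
    using sL[OF that] pball_self[of "s x" x I] by (auto simp: T_def)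
  have T_open: "openin (top_of_set D) (T x)" if x: "x \<in> D" for x
  proof -
    obtain U where U: "open U" "U \<inter> D = pball I x (s x) \<inter> D" by (rule open_pball_pdom[OF dom x]) (rule that)
    then have "T x = D \<inter> U" using T_sub[OF x] by (auto simp: T_def)
    then show ?thesis using U(1) by (auto simp: openin_open)
  qed
  have S_flat: "flat_on (T x) (\<lambda>p w. S x c w p)" if x: "x \<in> D" for x c
  proof -
    have "flat_on (T x) (\<lambda>p w. \<Sum>a<n. L x a p w * c a)"
      by (rule flat_on_lincomb[OF T_pdom]) (use sL[OF x] in \<open>simp add: T_def\<close>)
    then show ?thesis by (simp add: flat_on_def S_def)
  qed
  \<comment> \<open>A combination that vanishes at \<open>w\<close> vanishes at the centre
    \<open>x\<close>, where the frame is the identity.\<close>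
  have S_inj: "c a = 0" if x: "x \<in> D" and w: "w \<in> T x" and z: "\<And>p. p < n \<Longrightarrow> (\<Sum>a<n. L x a p w * c a) = 0"
    and a: "a < n" for x w c a
  proof -
    have fl: "flat_on (T x) (\<lambda>p w. \<Sum>a<n. L x a p w * c a)"
      by (rule flat_on_lincomb[OF T_pdom]) (use sL[OF x] in \<open>simp add: T_def\<close>)
    have conn: "connected (T x)" unfolding T_def by (rule path_connected_imp_connected[OF path_connected_pball])
    have "(\<Sum>b<n. L x b a x * c b) = 0"
      by (rule flat_zero_connected[OF T_pdom T_sub[OF x] fl conn w _ T_self[OF x] a]) (rule z)
    moreover have "(\<Sum>b<n. L x b a x * c b) = (\<Sum>b<n. if a = b then c b else 0)"
      by (rule sum.cong) (use sL[OF x] a in auto)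
    ultimately show ?thesis using a by simp
  qed
  interpret sheaf: locally_constant_sheaf D T S V
  proof
    fix x w c x' c' assume x: "x \<in> D" and w: "w \<in> T x"
    show "bij_betw (\<lambda>c. S x c w) V V"
    proof -
      obtain B where B: "\<And>p q. p < n \<Longrightarrow> q < n \<Longrightarrow> (\<Sum>a<n. L x a p w * B a q) = (if p = q then 1 else 0)"
        "\<And>p q. p < n \<Longrightarrow> q < n \<Longrightarrow> (\<Sum>a<n. B p a * L x q a w) = (if p = q then 1 else 0)"
        by (rule injective_square_system_solvable[of n "\<lambda>p a. L x a p w"])
           (rule S_inj[OF x w], assumption+, rule that)
      have guard: "(\<Sum>p<n. X p * (if p < n then g p else 0)) = (\<Sum>p<n. X p * g p)" for X g :: "nat \<Rightarrow> complex"
        by (rule sum.cong) auto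
      define S' where "S' = (\<lambda>v a. if a < n then \<Sum>p<n. B a p * v p else 0)"
      have 1: "(\<Sum>a<n. X p a * (\<Sum>b<n. Y a b * v b)) = v p"
        if "\<And>p q. p < n \<Longrightarrow> q < n \<Longrightarrow> (\<Sum>a<n. X p a * Y a q) = (if p = q then 1 else 0)" "p < n"
        for X Y :: "nat \<Rightarrow> nat \<Rightarrow> complex" and v p
      proof -
        have "(\<Sum>a<n. X p a * (\<Sum>b<n. Y a b * v b)) = (\<Sum>b<n. (\<Sum>a<n. X p a * Y a b) * v b)"
          by (simp only: sum_distrib_left sum_distrib_right mult.assoc) (rule sum.swap)
        also have "\<dots> = (\<Sum>b<n. if p = b then v b else 0)"
          by (rule sum.cong) (use that in auto)
        also have "\<dots> = v p" using that(2) by simp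
        finally show ?thesis .
      qed
      show ?thesis
      proof (rule bij_betw_byWitness[where f' = S'])
        show "\<forall>c\<in>V. S' (S x c w) = c"
        proof
          fix c assume c: "c \<in> V"
          show "S' (S x c w) = c"
          proof
            fix a show "S' (S x c w) a = c a"
              using 1[OF B(2), of a c] c by (simp add: S'_def S_def V_def guard)
          qed
        qed
        show "\<forall>v\<in>V. S x (S' v) w = v"
        proof
          fix v assume v: "v \<in> V"
          show "S x (S' v) w = v"
          proof
            fix p show "S x (S' v) w p = v p"
              using 1[OF B(1), of p v] v by (simp add: S'_def S_def V_def guard)
          qed
        qed
      qed (auto simp: S_def S'_def V_def)
    qed
    assume x': "x' \<in> D" and w': "w \<in> T x'" and cc: "c \<in> V" "c' \<in> V" and eq: "S x c w = S x' c' w"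
    define N where "N = T x \<inter> T x'"
    have N: "pdom I N" "N \<subseteq> D" "w \<in> N" using pdom_subset_Int[OF T_pdom T_pdom] T_sub[OF x] w w' by (auto simp: N_def)
    have fl: "flat_on N (\<lambda>p w. S x c w p - S x' c' w p)"
      by (rule flat_on_diff; rule flat_on_subset[OF S_flat]) (auto simp: N_def x x')
    obtain \<delta> where \<delta>: "\<delta> > 0" "pball I w \<delta> \<subseteq> N"
      "\<forall>y\<in>pball I w \<delta>. (\<forall>p<n. S x c y p - S x' c' y p = 0) \<longrightarrow> (\<forall>z\<in>pball I w \<delta>. \<forall>p<n. S x c z p - S x' c' z p = 0)"
      using flat_zero_nbhd[OF N(1,2) fl N(3)] by (elim exE conjE) (rule that)
    have z: "S x c z = S x' c' z" if "z \<in> pball I w \<delta>" for z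
    proof
      fix p
      have "\<forall>p<n. S x c w p - S x' c' w p = 0" using eq by simp
      then have "p < n \<Longrightarrow> S x c z p = S x' c' z p"
        using \<delta>(3)[rule_format, OF pball_self[OF \<delta>(1)] _ that] by simp
      then show "S x c z p = S x' c' z p" by (cases "p < n") (auto simp: S_def)
    qed
    obtain U where U: "open U" "U \<inter> D = pball I w \<delta> \<inter> D" by (rule open_pball_pdom[OF dom]) (use N in blast, rule that)
    show "\<exists>U. open U \<and> w \<in> U \<and> (\<forall>w'\<in>U \<inter> T x \<inter> T x'. S x c w' = S x' c' w')"
    proof (intro exI conjI ballI)
      show "w \<in> U" using U(2) N pball_self[OF \<delta>(1)] by blast
      fix y assume y: "y \<in> U \<inter> T x \<inter> T x'"
      then have "y \<in> pball I w \<delta>" using U(2) T_sub[OF x] by blast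
      then show "S x c y = S x' c' y" by (rule z)
    qed (rule U(1))
  qed (use T_self T_sub T_open in \<open>auto simp: T_def path_connected_pball\<close>)
  define e where "e = (\<lambda>(a::nat) (p::nat). if p = a \<and> a < n then 1 else 0 :: complex)"
  have eV: "e a \<in> V" for a by (auto simp: e_def V_def)
  have "\<forall>a. \<exists>f. f w0 = e a \<and> (\<forall>p\<in>D. \<exists>c\<in>V. \<forall>w\<in>T p. f w = S p c w)"
  proof
    fix a
    show "\<exists>f. f w0 = e a \<and> (\<forall>p\<in>D. \<exists>c\<in>V. \<forall>w\<in>T p. f w = S p c w)"
      by (rule sheaf.global_section[OF sc w0 eV[of a]]) blast
  qed
  then obtain f where f: "\<And>a. f a w0 = e a" "\<And>a p. p \<in> D \<Longrightarrow> \<exists>c\<in>V. \<forall>w\<in>T p. f a w = S p c w"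
    unfolding choice_iff by blast
  have F_flat: "flat_on D (\<lambda>p w. f a w p)" for a
    unfolding flat_on_def
  proof (intro allI impI conjI)
    fix p assume p: "p < n"
    have loc: "\<exists>c. \<forall>w\<in>T x. \<forall>p. f a w p = S x c w p" if "x \<in> D" for x using f(2)[OF that, of a] by metis
    have der: "((\<lambda>z. f a (w(i := z)) p) has_field_derivative (\<Sum>q<n. A i p q w * f a w q)) (at (w i))"
      if w: "w \<in> D" and i: "i \<in> I" for w i
    proof -
      obtain c where c: "\<And>w' p. w' \<in> T w \<Longrightarrow> f a w' p = S w c w' p" using loc[OF w] by blast
      have hS: "hol I (T w) (\<lambda>w'. S w c w' p)" and pdS: "pd i (\<lambda>w'. S w c w' p) w = (\<Sum>q<n. A i p q w * f a w q)"
        using S_flat[OF w, of c] p i T_self[OF w] c by (auto simp: flat_on_def)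
      have "hol I (T w) (\<lambda>w'. f a w' p)" by (rule hol_cong[OF T_pdom _ hS]) (simp add: c)
      from hol_pd_DERIV[OF this T_self[OF w] i]
      have "((\<lambda>z. f a (w(i := z)) p) has_field_derivative pd i (\<lambda>w'. f a w' p) w) (at (w i))" .
      moreover have "pd i (\<lambda>w'. f a w' p) w = pd i (\<lambda>w'. S w c w' p) w"
        by (rule pd_cong[OF T_pdom T_self[OF w] i]) (rule c)
      ultimately show ?thesis by (simp add: pdS)
    qed
    show "hol I D (\<lambda>w. f a w p)"
    proof (rule holI)
      show "continuous_on D (\<lambda>w. f a w p)"
        unfolding continuous_on_pdom_iff[OF dom]
      proof (intro ballI allI impI)
        fix x and \<epsilon> :: real assume x: "x \<in> D" and \<epsilon>: "\<epsilon> > 0"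
        obtain c where c: "\<And>w' p. w' \<in> T x \<Longrightarrow> f a w' p = S x c w' p" using loc[OF x] by blast
        have "continuous_on (T x) (\<lambda>w'. S x c w' p)" using S_flat[OF x, of c] p by (simp add: flat_on_def hol_def)
        from continuous_on_pdomE[OF T_pdom this T_self[OF x] \<epsilon>] obtain \<delta> where
          \<delta>: "\<delta> > 0" "\<forall>w'\<in>pball I x \<delta> \<inter> T x. dist (S x c w' p) (S x c x p) < \<epsilon>" by metis
        show "\<exists>\<delta>>0. \<forall>w'\<in>pball I x \<delta> \<inter> D. dist (f a w' p) (f a x p) < \<epsilon>"
        proof (intro exI[of _ "min \<delta> (s x)"] conjI ballI)
          show "min \<delta> (s x) > 0" using \<delta> sL[OF x] by simp
          fix w' assume "w' \<in> pball I x (min \<delta> (s x)) \<inter> D"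
          then have "w' \<in> pball I x \<delta> \<inter> T x"
            using pball_mono[of "min \<delta> (s x)" \<delta> I x] pball_mono[of "min \<delta> (s x)" "s x" I x] by (auto simp: T_def)
          then show "dist (f a w' p) (f a x p) < \<epsilon>" using \<delta>(2) c T_self[OF x] by simp
        qed
      qed
    qed (use der in blast)
    show "\<forall>w\<in>D. \<forall>i\<in>I. pd i (\<lambda>w. f a w p) w = (\<Sum>q<n. A i p q w * f a w q)"
    proof (intro ballI)
      fix w i assume "w \<in> D" "i \<in> I"
      from pd_eqI[OF der[OF this]] show "pd i (\<lambda>w. f a w p) w = (\<Sum>q<n. A i p q w * f a w q)" .
    qed
  qed
  show ?thesis
  proof (rule that[of "\<lambda>a p w. f a w p"])
    show "flat_on D (\<lambda>p w. f a w p)" for a by (rule F_flat)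
    fix w c a assume w: "w \<in> D" and z: "\<And>p. p < n \<Longrightarrow> (\<Sum>a<n. f a w p * c a) = 0" and a: "a < n"
    have fl: "flat_on D (\<lambda>p w. \<Sum>a<n. f a w p * c a)"
      by (rule flat_on_lincomb[OF dom]) (rule F_flat)
    have conn: "connected D"
    proof (rule path_connected_imp_connected)
      show "path_connected D" unfolding path_connected_def
      proof (intro ballI)
        fix a b assume "a \<in> D" "b \<in> D"
        from sheaf.simply_connected_path[OF sc this]
        show "\<exists>g. path g \<and> path_image g \<subseteq> D \<and> pathstart g = a \<and> pathfinish g = b" by metis
      qed
    qed
    \<comment> \<open>A linear relation at \<open>w\<close> is transported to \<open>w0\<close>,
      where the sections are unit vectors.\<close>
    have "(\<Sum>b<n. f b w0 a * c b) = 0"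
      by (rule flat_zero_connected[OF dom order_refl fl conn w _ w0 a]) (rule z)
    moreover have "(\<Sum>b<n. f b w0 a * c b) = (\<Sum>b<n. if a = b then c b else 0)"
      by (rule sum.cong) (auto simp: f(1) e_def)
    ultimately show "c a = 0" using a by simp
  qed
qed

end

section \<open>Deformations of linear recursions\<close>

text \<open>Relation \<open>r\<close> couples the indices \<open>r - 1\<close> to
  \<open>r + d\<close>. Left of the window \<open>n0..n0 + d\<close> relation \<open>m + 1\<close>
  is solved for its first entry, right of it relation \<open>m - d\<close> for its last.\<close>

function frame :: "nat \<Rightarrow> nat \<Rightarrow> (nat \<Rightarrow> nat \<Rightarrow> complex) \<Rightarrow> (nat \<Rightarrow> complex) \<Rightarrow> nat \<Rightarrow> complex" where
  "frame d n0 C v m =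
     (if m < n0 then - (\<Sum>k\<in>{1..d + 1}. C (m + 1) k * frame d n0 C v (m + k)) / C (m + 1) 0
      else if m \<le> n0 + d then v (m - n0)
      else - (\<Sum>k\<in>{..d}. C (m - d) k * frame d n0 C v (m - d - 1 + k)) / C (m - d) (d + 1))"
  by pat_completeness auto
termination
  \<comment> \<open>Left of the window the measure exceeds \<open>n0 + d\<close> and grows with the
    distance to the window; right of it the index itself decreases without leaving the range from
    \<open>n0\<close> on.\<close>
  by (relation "Wellfounded.measure (\<lambda>(d, n0, C, v, m). if m < n0 then n0 + d + 1 + (n0 - m) else m)") auto

declare frame.simps [simp del]

lemma frame_window: "k \<le> d \<Longrightarrow> frame d n0 C v (n0 + k) = v k"
  by (subst frame.simps) simp

lemma frame_relation:
  assumes nz: "\<And>r. r \<ge> 1 \<Longrightarrow> C r 0 \<noteq> 0" "\<And>r. r \<ge> 1 \<Longrightarrow> C r (d + 1) \<noteq> 0" and r: "r \<ge> 1"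
  shows "(\<Sum>k\<le>d + 1. C r k * frame d n0 C v (r - 1 + k)) = 0"
proof (cases "r - 1 < n0")
  case True
  have "frame d n0 C v (r - 1) = - (\<Sum>k\<in>{1..d + 1}. C (r - 1 + 1) k * frame d n0 C v (r - 1 + k)) / C (r - 1 + 1) 0"
    by (subst frame.simps) (use True in simp)
  then have "C r 0 * frame d n0 C v (r - 1) = - (\<Sum>k\<in>{1..d + 1}. C r k * frame d n0 C v (r - 1 + k))"
    using nz(1)[OF r] r by (simp add: field_simps)
  moreover have "{..d + 1} = insert 0 {1..d + 1}" by auto
  ultimately show ?thesis by simp
next
  case False
  have m: "r + d - d = r" "r + d - d - 1 = r - 1" "\<not> r + d < n0" "\<not> r \<le> n0" using False r by auto
  have "frame d n0 C v (r + d) = - (\<Sum>k\<in>{..d}. C r k * frame d n0 C v (r - 1 + k)) / C r (d + 1)"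
    by (subst frame.simps) (simp add: m)
  then have "C r (d + 1) * frame d n0 C v (r - 1 + (d + 1)) = - (\<Sum>k\<in>{..d}. C r k * frame d n0 C v (r - 1 + k))"
    using nz(2)[OF r] r by (simp add: field_simps)
  moreover have "{..d + 1} = insert (d + 1) {..d}" by auto
  ultimately show ?thesis by simp
qed

text \<open>Index \<open>m\<close> below the window is recovered from relation \<open>m + 1\<close>,
  so the relations \<open>r > s\<close> carry zeros down exactly to index \<open>s\<close>.\<close>

lemma relation_zero:
  fixes h :: "nat \<Rightarrow> complex"
  assumes nz: "\<And>r. r \<ge> 1 \<Longrightarrow> C r 0 \<noteq> 0" "\<And>r. r \<ge> 1 \<Longrightarrow> C r (d + 1) \<noteq> 0"
    and rel: "\<And>r. r > s \<Longrightarrow> (\<Sum>k\<le>d + 1. C r k * h (r - 1 + k)) = 0"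
    and n0: "n0 \<ge> s" and win: "\<And>k. k \<le> d \<Longrightarrow> h (n0 + k) = 0" and m: "m \<ge> s"
  shows "h m = 0"
proof -
  have up: "h m = 0" if "m \<ge> n0" for m
    using that
  proof (induction m rule: less_induct)
    case (less m)
    show ?case
    proof (cases "m \<le> n0 + d")
      case True
      then show ?thesis using win[of "m - n0"] less.prems by simp
    next
      case False
      define r where "r = m - d"
      have r: "r > s" "r \<ge> 1" "r - 1 + (d + 1) = m" using False n0 by (auto simp: r_def)
      have "{..d + 1} = insert (d + 1) {..d}" by auto
      moreover have "h (r - 1 + k) = 0" if "k \<in> {..d}" for k
        by (rule less.IH) (use that False in \<open>auto simp: r_def\<close>)
      ultimately have "C r (d + 1) * h (r - 1 + (d + 1)) = 0" using rel[OF r(1)] by simp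
      then show ?thesis using nz(2)[OF r(2)] unfolding r(3) by simp
    qed
  qed
  have "\<forall>m. s \<le> m \<longrightarrow> n0 - m \<le> j \<longrightarrow> h m = 0" for j
  proof (induction j)
    case 0
    then show ?case using up by auto
  next
    case (Suc j)
    show ?case
    proof (intro allI impI)
      fix m assume m: "s \<le> m" "n0 - m \<le> Suc j"
      show "h m = 0"
      proof (cases "m \<ge> n0")
        case False
        have "h (m + k) = 0" if "k \<in> {1..d + 1}" for k
        proof -
          have "1 \<le> k" using that by simp
          then have "n0 - (m + k) \<le> j" using m by linarith
          then show ?thesis using Suc m by simp
        qed
        moreover have "{..d + 1} = insert 0 {1..d + 1}" by auto
        ultimately have "C (m + 1) 0 * h m = 0" using rel[of "m + 1"] m by simp
        then show ?thesis using nz(1)[of "m + 1"] by simp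
      qed (use up in simp)
    qed
  qed
  then show ?thesis using m by blast
qed

lemma hol_frame:
  assumes c: "\<And>r k. r \<ge> 1 \<Longrightarrow> k \<le> d + 1 \<Longrightarrow> hol I D (c r k)"
    and nz: "\<And>r w. r \<ge> 1 \<Longrightarrow> w \<in> D \<Longrightarrow> c r 0 w \<noteq> 0" "\<And>r w. r \<ge> 1 \<Longrightarrow> w \<in> D \<Longrightarrow> c r (d + 1) w \<noteq> 0"
  shows "hol I D (\<lambda>w. frame d n0 (\<lambda>r k. c r k w) v m)"
proof (induction "if m < n0 then n0 + d + 1 + (n0 - m) else m" arbitrary: m rule: less_induct)
  case less
  consider "m < n0" | "n0 \<le> m" "m \<le> n0 + d" | "m > n0 + d" by linarith
  then show ?case
  proof cases
    case 1
    have "hol I D (\<lambda>w. - (\<Sum>k\<in>{1..d + 1}. c (m + 1) k w * frame d n0 (\<lambda>r k. c r k w) v (m + k)) / c (m + 1) 0 w)"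
    proof (rule hol_divide[OF hol_minus[OF hol_sum[OF hol_mult]]])
      fix k assume "k \<in> {1..d + 1}"
      then show "hol I D (\<lambda>w. frame d n0 (\<lambda>r k. c r k w) v (m + k))" by (intro less) (use 1 in auto)
    qed (use c nz in auto)
    then show ?thesis by (subst frame.simps) (use 1 in simp)
  next
    case 2
    then show ?thesis by (subst frame.simps) simp
  next
    case 3
    have "hol I D (\<lambda>w. - (\<Sum>k\<in>{..d}. c (m - d) k w * frame d n0 (\<lambda>r k. c r k w) v (m - d - 1 + k)) / c (m - d) (d + 1) w)"
    proof (rule hol_divide[OF hol_minus[OF hol_sum[OF hol_mult]]])
      fix k assume "k \<in> {..d}"
      then show "hol I D (\<lambda>w. frame d n0 (\<lambda>r k. c r k w) v (m - d - 1 + k))" by (intro less) (use 3 in auto)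
    qed (use c nz 3 in auto)
    then show ?thesis by (subst frame.simps) (use 3 in simp)
  qed
qed

text \<open>A linear recursion \<open>\<Sum>\<^sub>k c r k f (r - 1 + k) = 0\<close> (\<open>r \<ge> 1\<close>) together with the deformations
  \<open>\<partial>\<^sub>i f n = \<Sum>\<^sub>m X i n m f m\<close>. The deformation \<open>i\<close> respects the recursion only from the index
  \<open>s i\<close> on, because the rows of \<open>X i\<close> reach back \<open>s i\<close> places.\<close>

locale deformed_recursion =
  fixes I :: "'i set" and D :: "('i \<Rightarrow> complex) set" and d b :: nat
    and c :: "nat \<Rightarrow> nat \<Rightarrow> ('i \<Rightarrow> complex) \<Rightarrow> complex"
    and X :: "'i \<Rightarrow> nat \<Rightarrow> nat \<Rightarrow> ('i \<Rightarrow> complex) \<Rightarrow> complex"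
    and s :: "'i \<Rightarrow> nat"
  assumes dom: "pdom I D" and sc: "simply_connected D"
    and hol_c: "r \<ge> 1 \<Longrightarrow> k \<le> d + 1 \<Longrightarrow> hol I D (c r k)"
    and c_first: "r \<ge> 1 \<Longrightarrow> w \<in> D \<Longrightarrow> c r 0 w \<noteq> 0"
    and c_last: "r \<ge> 1 \<Longrightarrow> w \<in> D \<Longrightarrow> c r (d + 1) w \<noteq> 0"
    and hol_X: "i \<in> I \<Longrightarrow> hol I D (X i m l)"
    and X_upper: "i \<in> I \<Longrightarrow> w \<in> D \<Longrightarrow> l > m + b \<Longrightarrow> X i m l w = 0"
    and X_lower: "i \<in> I \<Longrightarrow> w \<in> D \<Longrightarrow> l + s i < m \<Longrightarrow> X i m l w = 0"
    and flat_X: "i \<in> I \<Longrightarrow> j \<in> I \<Longrightarrow> w \<in> D \<Longrightarrow>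
      pd j (X i m l) w + (\<Sum>k\<le>m + b. X i m k w * X j k l w) = pd i (X j m l) w + (\<Sum>k\<le>m + b. X j m k w * X i k l w)"
    and preserve: "i \<in> I \<Longrightarrow> w \<in> D \<Longrightarrow> (\<And>r. r \<ge> 1 \<Longrightarrow> (\<Sum>k\<le>d + 1. c r k w * f (r - 1 + k)) = 0) \<Longrightarrow>
      r > s i \<Longrightarrow> (\<Sum>k\<le>d + 1. pd i (c r k) w * f (r - 1 + k)) +
        (\<Sum>k\<le>d + 1. c r k w * (\<Sum>l\<le>r - 1 + k + b. X i (r - 1 + k) l w * f l)) = 0"
begin

section \<open>The deformation as a flat connection on a window\<close>

text \<open>The factor 2 gives \<open>s i + s j \<le> base\<close> also for \<open>i = j\<close>: an
  entry that \<open>X i\<close> reaches from the window still has index at least \<open>s j\<close>,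
  where deformation \<open>j\<close> respects the recursion.\<close>

definition base :: nat where
  "base = 2 * (\<Sum>i\<in>I. s i)"

lemma s_le: "i \<in> I \<Longrightarrow> s i \<le> (\<Sum>i\<in>I. s i)"
  using pdom_finite[OF dom] by (intro member_le_sum) auto

lemma base_ge: "i \<in> I \<Longrightarrow> j \<in> I \<Longrightarrow> s i + s j \<le> base"
  using s_le[of i] s_le[of j] by (simp add: base_def)

lemma base_ge': "i \<in> I \<Longrightarrow> s i \<le> base"
  using s_le[of i] by (simp add: base_def)

definition e :: "nat \<Rightarrow> nat \<Rightarrow> ('i \<Rightarrow> complex) \<Rightarrow> complex" where
  "e q m w = frame d base (\<lambda>r k. c r k w) (\<lambda>k. if k = q then 1 else 0) m"

text \<open>The deformation applied to the solution \<open>e q\<close> and read off on the window,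
  that is, the matrix of \<open>X i\<close> modulo the recursion.\<close>

definition conn :: "'i \<Rightarrow> nat \<Rightarrow> nat \<Rightarrow> ('i \<Rightarrow> complex) \<Rightarrow> complex" where
  "conn i p q w = (\<Sum>m\<le>base + p + b. X i (base + p) m w * e q m w)"

lemma hol_e: "hol I D (e q m)"
  unfolding e_def[abs_def] by (rule hol_frame[OF hol_c c_first c_last])

lemma hol_conn: "i \<in> I \<Longrightarrow> hol I D (conn i p q)"
  unfolding conn_def[abs_def] by (intro hol_sum hol_mult hol_X hol_e)

lemma e_relation: "r \<ge> 1 \<Longrightarrow> w \<in> D \<Longrightarrow> (\<Sum>k\<le>d + 1. c r k w * e q (r - 1 + k) w) = 0"
  unfolding e_def by (rule frame_relation[OF c_first c_last])

lemma e_window: "p \<le> d \<Longrightarrow> e q (base + p) w = (if p = q then 1 else 0)"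
  by (simp add: e_def frame_window)

text \<open>The difference of both sides solves the recursion beyond \<open>s i\<close>, by
  differentiating the relations of \<open>e q\<close> and by \<open>preserve\<close>, and vanishes
  on the window, where \<open>e q\<close> is constant in the parameters.\<close>

lemma pd_e:
  assumes i: "i \<in> I" and w: "w \<in> D" and q: "q \<le> d" and m: "m \<ge> s i"
  shows "pd i (e q m) w = (\<Sum>l\<le>m + b. X i m l w * e q l w) - (\<Sum>p\<le>d. conn i p q w * e p m w)"
proof -
  define h where "h = (\<lambda>m. pd i (e q m) w - (\<Sum>l\<le>m + b. X i m l w * e q l w) + (\<Sum>p\<le>d. conn i p q w * e p m w))"
  have "h m = 0"
  proof (rule relation_zero[where C = "\<lambda>r k. c r k w" and s = "s i" and ?n0.0 = base, OF _ _ _ _ _ m])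
    fix r assume r: "r > s i"
    then have r1: "r \<ge> 1" by simp
    have "0 = pd i (\<lambda>w. \<Sum>k\<le>d + 1. c r k w * e q (r - 1 + k) w) w"
      by (subst pd_cong[OF dom w i, of _ "\<lambda>_. 0"]) (use e_relation[OF r1] in auto)
    also have "\<dots> = (\<Sum>k\<le>d + 1. pd i (\<lambda>w. c r k w * e q (r - 1 + k) w) w)"
      by (rule pd_sum[OF _ w i]) (intro hol_mult hol_c r1 hol_e, simp)
    also have "\<dots> = (\<Sum>k\<le>d + 1. pd i (c r k) w * e q (r - 1 + k) w + c r k w * pd i (e q (r - 1 + k)) w)"
      by (intro sum.cong refl pd_mult[OF _ hol_e w i] hol_c r1) simp
    finally have 1: "(\<Sum>k\<le>d + 1. pd i (c r k) w * e q (r - 1 + k) w) + (\<Sum>k\<le>d + 1. c r k w * pd i (e q (r - 1 + k)) w) = 0"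
      by (simp add: sum.distrib)
    have 2: "(\<Sum>k\<le>d + 1. pd i (c r k) w * e q (r - 1 + k) w) +
        (\<Sum>k\<le>d + 1. c r k w * (\<Sum>l\<le>r - 1 + k + b. X i (r - 1 + k) l w * e q l w)) = 0"
      by (rule preserve[OF i w _ r]) (rule e_relation[OF _ w])
    have "(\<Sum>k\<le>d + 1. c r k w * (\<Sum>p\<le>d. conn i p q w * e p (r - 1 + k) w)) =
        (\<Sum>p\<le>d. conn i p q w * (\<Sum>k\<le>d + 1. c r k w * e p (r - 1 + k) w))"
      by (simp only: sum_distrib_left mult.left_commute) (rule sum.swap)
    also have "\<dots> = 0" using e_relation[OF r1 w] by simp
    finally have 3: "(\<Sum>k\<le>d + 1. c r k w * (\<Sum>p\<le>d. conn i p q w * e p (r - 1 + k) w)) = 0" .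
    have "(\<Sum>k\<le>d + 1. c r k w * h (r - 1 + k)) =
        (\<Sum>k\<le>d + 1. c r k w * pd i (e q (r - 1 + k)) w)
        - (\<Sum>k\<le>d + 1. c r k w * (\<Sum>l\<le>r - 1 + k + b. X i (r - 1 + k) l w * e q l w))
        + (\<Sum>k\<le>d + 1. c r k w * (\<Sum>p\<le>d. conn i p q w * e p (r - 1 + k) w))"
      unfolding h_def by (simp only: distrib_left right_diff_distrib sum.distrib sum_subtractf)
    also have "\<dots> = 0" using 1 2 3 by (simp only: add_eq_0_iff) simp
    finally show "(\<Sum>k\<le>d + 1. c r k w * h (r - 1 + k)) = 0" .
  next
    fix k assume k: "k \<le> d"
    have "pd i (e q (base + k)) w = 0"
      by (subst pd_cong[OF dom w i, of _ "\<lambda>_. if k = q then 1 else 0"]) (use k e_window in auto)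
    moreover have "(\<Sum>p\<le>d. conn i p q w * e p (base + k) w) = (\<Sum>p\<le>d. if k = p then conn i p q w else 0)"
      by (rule sum.cong) (use k e_window in auto)
    ultimately show "h (base + k) = 0" using k by (simp add: h_def conn_def)
  qed (use w c_first c_last base_ge'[OF i] in auto)
  then show ?thesis unfolding h_def by (simp only: diff_add_eq eq_diff_eq right_minus_eq)
qed

text \<open>Expanding the derivative of \<open>e q\<close> by \<open>pd_e\<close> turns this half of
  the curvature of \<open>conn\<close> into the corresponding half for \<open>X\<close>, applied to
  \<open>e q\<close>; the latter is symmetric in \<open>i\<close> and \<open>j\<close> by
  \<open>flat_X\<close>.\<close>

lemma conn_flat_half:
  assumes i: "i \<in> I" and j: "j \<in> I" and w: "w \<in> D" and p: "p \<le> d" and q: "q \<le> d"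
  shows "pd j (conn i p q) w + (\<Sum>t\<le>d. conn i p t w * conn j t q w) =
    (\<Sum>l\<le>base + p + 2 * b. (pd j (X i (base + p) l) w + (\<Sum>k\<le>base + p + b. X i (base + p) k w * X j k l w)) * e q l w)"
proof -
  define N where "N = base + p"
  have X0: "pd j (X i N l) w = 0" if "l > N + b" for l
    by (subst pd_cong[OF dom w j, of _ "\<lambda>_. 0"]) (use X_upper[OF i _ that] in auto)
  have "pd j (conn i p q) w = (\<Sum>m\<le>N + b. pd j (\<lambda>w. X i N m w * e q m w) w)"
    unfolding conn_def[abs_def] N_def by (rule pd_sum[OF _ w j]) (intro hol_mult hol_X i hol_e)
  also have "\<dots> = (\<Sum>m\<le>N + b. pd j (X i N m) w * e q m w + X i N m w * pd j (e q m) w)"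
    by (intro sum.cong refl pd_mult[OF hol_X[OF i] hol_e w j])
  also have "\<dots> = (\<Sum>m\<le>N + b. pd j (X i N m) w * e q m w) + (\<Sum>m\<le>N + b. X i N m w * pd j (e q m) w)"
    by (rule sum.distrib)
  also have "(\<Sum>m\<le>N + b. pd j (X i N m) w * e q m w) = (\<Sum>l\<le>N + 2 * b. pd j (X i N l) w * e q l w)"
    by (rule sum.mono_neutral_left) (use X0 in auto)
  also have "(\<Sum>m\<le>N + b. X i N m w * pd j (e q m) w) =
      (\<Sum>m\<le>N + b. X i N m w * (\<Sum>l\<le>N + 2 * b. X j m l w * e q l w)) - (\<Sum>m\<le>N + b. X i N m w * (\<Sum>t\<le>d. conn j t q w * e t m w))"
    unfolding sum_subtractf[symmetric] right_diff_distrib[symmetric]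
  proof (rule sum.cong[OF refl])
    fix m assume m: "m \<in> {..N + b}"
    show "X i N m w * pd j (e q m) w = X i N m w * ((\<Sum>l\<le>N + 2 * b. X j m l w * e q l w) - (\<Sum>t\<le>d. conn j t q w * e t m w))"
    \<comment> \<open>Entries of row \<open>N\<close> of \<open>X i\<close> vanish below
      \<open>N - s i\<close>; from there on the index is at least \<open>s j\<close> by the choice
      of \<open>base\<close>, so \<open>pd_e\<close> applies in direction \<open>j\<close>.\<close>
    proof (cases "m + s i < N")
      case True
      then show ?thesis using X_lower[OF i w] by simp
    next
      case False
      then have "m \<ge> s j" using base_ge[OF i j] by (simp add: N_def)
      from pd_e[OF j w q this]
      have "pd j (e q m) w = (\<Sum>l\<le>m + b. X j m l w * e q l w) - (\<Sum>t\<le>d. conn j t q w * e t m w)" .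
      also have "(\<Sum>l\<le>m + b. X j m l w * e q l w) = (\<Sum>l\<le>N + 2 * b. X j m l w * e q l w)"
        by (rule sum.mono_neutral_left) (use m X_upper[OF j w] in auto)
      finally show ?thesis by simp
    qed
  qed
  also have "(\<Sum>m\<le>N + b. X i N m w * (\<Sum>t\<le>d. conn j t q w * e t m w)) = (\<Sum>t\<le>d. conn i p t w * conn j t q w)"
  proof -
    have "(\<Sum>m\<le>N + b. X i N m w * (\<Sum>t\<le>d. conn j t q w * e t m w)) = (\<Sum>m\<le>N + b. \<Sum>t\<le>d. X i N m w * e t m w * conn j t q w)"
      by (simp only: sum_distrib_left mult_ac)
    also have "\<dots> = (\<Sum>t\<le>d. \<Sum>m\<le>N + b. X i N m w * e t m w * conn j t q w)" by (rule sum.swap)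
    also have "\<dots> = (\<Sum>t\<le>d. (\<Sum>m\<le>N + b. X i N m w * e t m w) * conn j t q w)"
      by (simp only: sum_distrib_right)
    finally show ?thesis unfolding conn_def N_def .
  qed
  also have "(\<Sum>m\<le>N + b. X i N m w * (\<Sum>l\<le>N + 2 * b. X j m l w * e q l w)) =
      (\<Sum>l\<le>N + 2 * b. (\<Sum>k\<le>N + b. X i N k w * X j k l w) * e q l w)"
    by (simp only: sum_distrib_left sum_distrib_right mult.assoc) (rule sum.swap)
  finally show ?thesis
    unfolding N_def by (simp add: distrib_right sum.distrib)
qed

sublocale flat_connection I D "d + 1" conn
proof
  fix i j p q w
  assume "i \<in> I" "j \<in> I" "p < d + 1" "q < d + 1" "w \<in> D"
  then have "pd j (conn i p q) w + (\<Sum>t\<le>d. conn i p t w * conn j t q w) = pd i (conn j p q) w + (\<Sum>t\<le>d. conn j p t w * conn i t q w)"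
    by (simp add: conn_flat_half flat_X)
  then show "pd j (conn i p q) w + (\<Sum>t<d + 1. conn i p t w * conn j t q w) = pd i (conn j p q) w + (\<Sum>t<d + 1. conn j p t w * conn i t q w)"
    by (simp add: lessThan_Suc_atMost)
qed (use dom hol_conn in auto)

text \<open>Coefficients \<open>F\<close> that are flat for \<open>conn\<close> are combined with
  the moving frame \<open>e\<close>: the connection term in the derivative of the frame cancels the
  derivative of the coefficients. Nondegeneracy holds on every window, as a combination that
  vanishes on one vanishes everywhere.\<close>

theorem solutions:
  obtains f where "\<And>a m. a \<le> d \<Longrightarrow> hol I D (f a m)"
    "\<And>a r w. a \<le> d \<Longrightarrow> r \<ge> 1 \<Longrightarrow> w \<in> D \<Longrightarrow> (\<Sum>k\<le>d + 1. c r k w * f a (r - 1 + k) w) = 0"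
    "\<And>a i m w. a \<le> d \<Longrightarrow> i \<in> I \<Longrightarrow> w \<in> D \<Longrightarrow> m \<ge> s i \<Longrightarrow> pd i (f a m) w = (\<Sum>l\<le>m + b. X i m l w * f a l w)"
    "\<And>w N g a. w \<in> D \<Longrightarrow> (\<And>k. k \<le> d \<Longrightarrow> (\<Sum>a\<le>d. f a (N + k) w * g a) = 0) \<Longrightarrow> a \<le> d \<Longrightarrow> g a = 0"
proof (rule fundamental_system[OF sc])
  fix F assume F: "\<And>a. a < d + 1 \<Longrightarrow> flat_on D (F a)"
    "\<And>w g a. w \<in> D \<Longrightarrow> (\<And>p. p < d + 1 \<Longrightarrow> (\<Sum>a<d + 1. F a p w * g a) = 0) \<Longrightarrow> a < d + 1 \<Longrightarrow> g a = 0"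
  have hF: "hol I D (F a p)" if "a \<le> d" "p \<le> d" for a p
    using F(1)[of a] that unfolding flat_on_def by simp
  have pdF: "pd i (F a p) w = (\<Sum>q\<le>d. conn i p q w * F a q w)" if "a \<le> d" "p \<le> d" "i \<in> I" "w \<in> D" for a p i w
    using F(1)[of a] that unfolding flat_on_def by (simp add: lessThan_Suc_atMost)
  define f where "f = (\<lambda>a m w. \<Sum>p\<le>d. e p m w * F a p w)"
  have rel: "(\<Sum>k\<le>d + 1. c r k w * f a (r - 1 + k) w) = 0" if r: "r \<ge> 1" and w: "w \<in> D" for a r w
  proof -
    have "(\<Sum>k\<le>d + 1. c r k w * f a (r - 1 + k) w) = (\<Sum>k\<le>d + 1. \<Sum>p\<le>d. c r k w * e p (r - 1 + k) w * F a p w)"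
      unfolding f_def by (simp only: sum_distrib_left mult.assoc)
    also have "\<dots> = (\<Sum>p\<le>d. \<Sum>k\<le>d + 1. c r k w * e p (r - 1 + k) w * F a p w)" by (rule sum.swap)
    also have "\<dots> = (\<Sum>p\<le>d. (\<Sum>k\<le>d + 1. c r k w * e p (r - 1 + k) w) * F a p w)"
      by (simp only: sum_distrib_right)
    finally show ?thesis using e_relation[OF r w] by simp
  qed
  show ?thesis
  proof (rule that[of f])
    show "hol I D (f a m)" if "a \<le> d" for a m
      unfolding f_def by (intro hol_sum hol_mult hol_e hF that) simp
    show "(\<Sum>k\<le>d + 1. c r k w * f a (r - 1 + k) w) = 0" if "r \<ge> 1" "w \<in> D" for a r w
      by (rule rel[OF that])
  next
    fix a i m w assume a: "a \<le> d" and i: "i \<in> I" and w: "w \<in> D" and m: "m \<ge> s i"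
    have "pd i (f a m) w = (\<Sum>p\<le>d. pd i (\<lambda>w. e p m w * F a p w) w)"
      unfolding f_def by (rule pd_sum[OF _ w i]) (intro hol_mult hol_e hF a, simp)
    also have "\<dots> = (\<Sum>p\<le>d. pd i (e p m) w * F a p w + e p m w * pd i (F a p) w)"
      by (intro sum.cong refl pd_mult[OF hol_e hF w i] a) simp
    also have "\<dots> = (\<Sum>p\<le>d. (\<Sum>l\<le>m + b. X i m l w * e p l w) * F a p w)
        - (\<Sum>p\<le>d. (\<Sum>q\<le>d. conn i q p w * e q m w) * F a p w) + (\<Sum>p\<le>d. e p m w * (\<Sum>q\<le>d. conn i p q w * F a q w))"
      unfolding sum_subtractf[symmetric] sum.distrib[symmetric]
    proof (rule sum.cong[OF refl])
      fix p assume "p \<in> {..d}"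
      then have p: "p \<le> d" by simp
      show "pd i (e p m) w * F a p w + e p m w * pd i (F a p) w =
          (\<Sum>l\<le>m + b. X i m l w * e p l w) * F a p w - (\<Sum>q\<le>d. conn i q p w * e q m w) * F a p w
          + e p m w * (\<Sum>q\<le>d. conn i p q w * F a q w)"
        unfolding pd_e[OF i w p m] pdF[OF a p i w] by (simp only: left_diff_distrib)
    qed
    also have "(\<Sum>p\<le>d. e p m w * (\<Sum>q\<le>d. conn i p q w * F a q w)) = (\<Sum>p\<le>d. (\<Sum>q\<le>d. conn i q p w * e q m w) * F a p w)"
      unfolding sum_distrib_left sum_distrib_right by (subst sum.swap) (simp only: mult_ac)
    also have "(\<Sum>p\<le>d. (\<Sum>l\<le>m + b. X i m l w * e p l w) * F a p w) = (\<Sum>l\<le>m + b. X i m l w * f a l w)"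
      unfolding f_def sum_distrib_left sum_distrib_right by (subst sum.swap) (simp only: mult_ac)
    finally show "pd i (f a m) w = (\<Sum>l\<le>m + b. X i m l w * f a l w)" by simp
  next
    fix w N g a assume w: "w \<in> D" and z: "\<And>k. k \<le> d \<Longrightarrow> (\<Sum>a\<le>d. f a (N + k) w * g a) = 0" and a: "a \<le> d"
    define h where "h = (\<lambda>m. \<Sum>a\<le>d. f a m w * g a)"
    have h0: "h m = 0" for m
    \<comment> \<open>The relations themselves hold for all \<open>r \<ge> 1\<close>, so zeros
      spread to every index, in particular to the window at \<open>base\<close>, where
      \<open>f\<close> reduces to \<open>F\<close>.\<close>
    proof (rule relation_zero[where C = "\<lambda>r k. c r k w" and s = 0 and ?n0.0 = N])
      fix r :: nat assume r: "r > 0"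
      have "(\<Sum>k\<le>d + 1. c r k w * h (r - 1 + k)) = (\<Sum>k\<le>d + 1. \<Sum>a\<le>d. c r k w * f a (r - 1 + k) w * g a)"
        unfolding h_def by (simp only: sum_distrib_left mult.assoc)
      also have "\<dots> = (\<Sum>a\<le>d. \<Sum>k\<le>d + 1. c r k w * f a (r - 1 + k) w * g a)" by (rule sum.swap)
      also have "\<dots> = (\<Sum>a\<le>d. (\<Sum>k\<le>d + 1. c r k w * f a (r - 1 + k) w) * g a)" by (simp only: sum_distrib_right)
      also have "\<dots> = 0" using rel[OF _ w] r by simp
      finally show "(\<Sum>k\<le>d + 1. c r k w * h (r - 1 + k)) = 0" .
    qed (use c_first c_last w z in \<open>auto simp: h_def\<close>)
    show "g a = 0"
    proof (rule F(2)[OF w])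
      fix p assume p: "p < d + 1"
      have "f a (base + p) w = (\<Sum>q\<le>d. if p = q then F a q w else 0)" for a
        unfolding f_def by (rule sum.cong) (use p e_window in auto)
      then have "f a (base + p) w = F a p w" for a using p by simp
      then show "(\<Sum>a<d + 1. F a p w * g a) = 0" using h0[of "base + p"] by (simp add: h_def lessThan_Suc_atMost)
    qed (use a in simp)
  qed
qed

end

section \<open>Deformation of biorthogonal polynomials\<close>

lemma hol_upper_half:
  assumes "\<And>n m. hol I D (\<lambda>w. A w n m)"
  shows "hol I D (\<lambda>w. upper_half (A w) n m)"
proof -
  have "hol I D (\<lambda>w. (1/2) * A w n n)" by (rule hol_cmult[OF assms])
  then show ?thesis using assms by (cases n m rule: linorder_cases) (auto simp: upper_half_def)
qed

lemma poly_eq_sum_monom: "degree (f :: complex poly) \<le> N \<Longrightarrow> f = (\<Sum>k\<le>N. monom (coeff f k) k)"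
  by (rule poly_eqI) (auto simp: coeff_sum coeff_eq_0 if_distrib cong: if_cong)

text \<open>The pairing is an abstract bilinear form, so exchanging its arguments is another
  interpretation; in this way the systems in \<open>y\<close> become instances of those in
  \<open>x\<close>.\<close>

locale biorthogonal_basis =
  fixes I :: "'i set" and D :: "('i \<Rightarrow> complex) set"
    and B :: "('i \<Rightarrow> complex) \<Rightarrow> complex poly \<Rightarrow> complex poly \<Rightarrow> complex"
    and p s :: "('i \<Rightarrow> complex) \<Rightarrow> nat \<Rightarrow> complex poly"
  assumes dom: "pdom I D"
    and B_add_left: "w \<in> D \<Longrightarrow> B w (f + g) h = B w f h + B w g h"
    and B_smult_left: "w \<in> D \<Longrightarrow> B w (Polynomial.smult a f) h = a * B w f h"
    and B_add_right: "w \<in> D \<Longrightarrow> B w h (f + g) = B w h f + B w h g"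
    and B_smult_right: "w \<in> D \<Longrightarrow> B w h (Polynomial.smult a f) = a * B w h f"
    and deg_p: "w \<in> D \<Longrightarrow> degree (p w n) = n"
    and deg_s: "w \<in> D \<Longrightarrow> degree (s w n) = n"
    and orthonormal: "w \<in> D \<Longrightarrow> B w (p w n) (s w m) = (if n = m then 1 else 0)"
    and hol_B: "hol I D (\<lambda>w. B w f g)"
begin

lemma basis_swap: "biorthogonal_basis I D (\<lambda>w f g. B w g f) s p"
  using dom B_add_left B_smult_left B_add_right B_smult_right deg_p deg_s orthonormal hol_B
  by unfold_locales auto

lemma B_zero_left: "w \<in> D \<Longrightarrow> B w 0 h = 0"
  using B_smult_left[of w 0 0 h] by simp

lemma B_sum_left: "w \<in> D \<Longrightarrow> B w (\<Sum>a\<in>A. f a) h = (\<Sum>a\<in>A. B w (f a) h)"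
  by (induction A rule: infinite_finite_induct) (auto simp: B_zero_left B_add_left)

lemma B_zero_right: "w \<in> D \<Longrightarrow> B w h 0 = 0"
  using B_smult_right[of w h 0 0] by simp

lemma B_sum_right: "w \<in> D \<Longrightarrow> B w h (\<Sum>a\<in>A. f a) = (\<Sum>a\<in>A. B w h (f a))"
  by (induction A rule: infinite_finite_induct) (auto simp: B_zero_right B_add_right)

lemma lead_nz: "w \<in> D \<Longrightarrow> coeff (p w n) n \<noteq> 0"
proof
  assume w: "w \<in> D" and "coeff (p w n) n = 0"
  then have "p w n = 0" using deg_p[OF w, of n] leading_coeff_0_iff[of "p w n"] by simp
  then show False using orthonormal[OF w, of n n] B_zero_left[OF w] by simp
qed

lemma p_basis:
  assumes w: "w \<in> D"
  shows "degree f \<le> N \<Longrightarrow> \<exists>a. f = (\<Sum>m\<le>N. Polynomial.smult (a m) (p w m))"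
proof (induction N arbitrary: f)
  case 0
  then have "f = [:coeff f 0:]" by (metis degree_eq_zeroE le_zero_eq coeff_pCons_0)
  moreover have "p w 0 = [:coeff (p w 0) 0:]" using deg_p[OF w, of 0] by (metis degree_eq_zeroE coeff_pCons_0)
  ultimately have "f = Polynomial.smult (coeff f 0 / coeff (p w 0) 0) (p w 0)"
    using lead_nz[OF w, of 0] by (metis smult_pCons smult_0_right nonzero_eq_divide_eq)
  then show ?case by (intro exI[of _ "\<lambda>m. coeff f 0 / coeff (p w 0) 0"]) simp
next
  case (Suc N)
  define a0 where "a0 = coeff f (Suc N) / coeff (p w (Suc N)) (Suc N)"
  define g where "g = f - Polynomial.smult a0 (p w (Suc N))"
  have "coeff g (Suc N) = 0" using lead_nz[OF w, of "Suc N"] by (simp add: g_def a0_def)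
  moreover have "degree g \<le> Suc N"
    unfolding g_def by (rule degree_diff_le) (use Suc.prems deg_p[OF w, of "Suc N"] degree_smult_le[of a0 "p w (Suc N)"] in auto)
  ultimately have "degree g \<le> N"
    by (metis coeff_0 degree_0 le_SucE leading_coeff_0_iff zero_le)
  then obtain a where a: "g = (\<Sum>m\<le>N. Polynomial.smult (a m) (p w m))" using Suc.IH by blast
  have "f = Polynomial.smult a0 (p w (Suc N)) + (\<Sum>m\<le>N. Polynomial.smult (a m) (p w m))"
    using a by (simp add: g_def algebra_simps)
  also have "\<dots> = (\<Sum>m\<le>Suc N. Polynomial.smult ((a(Suc N := a0)) m) (p w m))" by simp
  finally show ?case by blast
qed

lemma p_expansion:
  assumes w: "w \<in> D" and f: "degree f \<le> N"
  shows "f = (\<Sum>m\<le>N. Polynomial.smult (B w f (s w m)) (p w m))"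
proof -
  obtain a where a: "f = (\<Sum>m\<le>N. Polynomial.smult (a m) (p w m))" using p_basis[OF w f] by blast
  have "B w f (s w m) = a m" if "m \<le> N" for m
  proof -
    have "B w f (s w m) = (\<Sum>k\<le>N. a k * (if k = m then 1 else 0))"
      by (subst a) (simp add: B_sum_left[OF w] B_smult_left[OF w] orthonormal[OF w])
    also have "\<dots> = (\<Sum>k\<le>N. if k = m then a k else 0)" by (rule sum.cong) auto
    also have "\<dots> = a m" using that by simp
    finally show ?thesis .
  qed
  then have "(\<Sum>m\<le>N. Polynomial.smult (B w f (s w m)) (p w m)) = (\<Sum>m\<le>N. Polynomial.smult (a m) (p w m))" by simp
  then show ?thesis using a by simp
qed

lemma B_low_left:
  assumes w: "w \<in> D" and f: "degree f < m"
  shows "B w f (s w m) = 0"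
proof -
  obtain a where a: "f = (\<Sum>k\<le>degree f. Polynomial.smult (a k) (p w k))" using p_basis[OF w order_refl] by blast
  show ?thesis
    by (subst a) (use f in \<open>auto simp: B_sum_left[OF w] B_smult_left[OF w] orthonormal[OF w] intro!: sum.neutral\<close>)
qed

lemma B_low_right: "w \<in> D \<Longrightarrow> degree f < m \<Longrightarrow> B w (p w m) f = 0"
  using biorthogonal_basis.B_low_left[OF basis_swap] .

lemma lead_s_nz: "w \<in> D \<Longrightarrow> coeff (s w n) n \<noteq> 0"
  by (rule biorthogonal_basis.lead_nz[OF basis_swap])

text \<open>Only the top term of the expansion of \<open>g\<close> in the basis \<open>s\<close>
  contributes to degree \<open>n\<close>. Used to see that a polynomial of exact degree
  \<open>n\<close> is not annihilated by \<open>p w n\<close>.\<close>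

lemma B_top_right:
  assumes w: "w \<in> D" and g: "degree g \<le> n"
  shows "B w (p w n) g * coeff (s w n) n = coeff g n"
proof -
  have "coeff g n = coeff (\<Sum>m\<le>n. Polynomial.smult (B w (p w m) g) (s w m)) n"
    using biorthogonal_basis.p_expansion[OF basis_swap w g] by simp
  also have "\<dots> = (\<Sum>m\<le>n. if m = n then B w (p w n) g * coeff (s w n) n else 0)"
    unfolding coeff_sum by (rule sum.cong) (auto simp: coeff_eq_0 deg_s[OF w])
  finally show ?thesis by simp
qed

text \<open>The degree bound is uniform in the parameter, so that pairings of families are finite
  sums of moments with holomorphic coefficients.\<close>

definition fam :: "nat \<Rightarrow> (('i \<Rightarrow> complex) \<Rightarrow> complex poly) \<Rightarrow> bool" where
  "fam N f \<longleftrightarrow> (\<forall>w\<in>D. degree (f w) \<le> N) \<and> (\<forall>k. hol I D (\<lambda>w. coeff (f w) k))"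

definition pdp :: "'i \<Rightarrow> nat \<Rightarrow> (('i \<Rightarrow> complex) \<Rightarrow> complex poly) \<Rightarrow> ('i \<Rightarrow> complex) \<Rightarrow> complex poly" where
  "pdp i N f w = (\<Sum>k\<le>N. monom (pd i (\<lambda>w. coeff (f w) k) w) k)"

lemma fam_monom: "fam N f \<Longrightarrow> fam (k + N) (\<lambda>w. monom 1 k * f w)"
  unfolding fam_def
proof (intro conjI ballI allI)
  assume f: "(\<forall>w\<in>D. degree (f w) \<le> N) \<and> (\<forall>k. hol I D (\<lambda>w. coeff (f w) k))"
  show "degree (monom 1 k * f w) \<le> k + N" if "w \<in> D" for w
    using f that by (intro order_trans[OF degree_mult_le] add_mono degree_monom_le) auto
  show "hol I D (\<lambda>w. coeff (monom 1 k * f w) j)" for j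
    using f by (cases "j < k") (auto simp: coeff_monom_mult)
qed

lemma degree_pdp: "degree (pdp i N f w) \<le> N"
  unfolding pdp_def by (rule degree_sum_le) (auto intro: order_trans[OF degree_monom_le])

lemma B_fam_eq:
  assumes f: "degree f \<le> N" and g: "degree g \<le> M" and w: "w \<in> D"
  shows "B w f g = (\<Sum>k\<le>N. \<Sum>l\<le>M. coeff f k * coeff g l * B w (monom 1 k) (monom 1 l))"
proof -
  have m: "monom a k = Polynomial.smult a (monom 1 k)" for a :: complex and k by (simp add: smult_monom)
  have "B w f g = B w (\<Sum>k\<le>N. Polynomial.smult (coeff f k) (monom 1 k)) (\<Sum>l\<le>M. Polynomial.smult (coeff g l) (monom 1 l))"
    using poly_eq_sum_monom[OF f] poly_eq_sum_monom[OF g] by (simp add: m[symmetric])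
  also have "\<dots> = (\<Sum>k\<le>N. \<Sum>l\<le>M. coeff f k * coeff g l * B w (monom 1 k) (monom 1 l))"
    unfolding B_sum_left[OF w] B_smult_left[OF w]
    by (simp add: B_sum_right[OF w] B_smult_right[OF w] sum_distrib_left mult.assoc)
  finally show ?thesis .
qed

lemma hol_B_fam:
  assumes f: "fam N f" and g: "fam M g"
  shows "hol I D (\<lambda>w. B w (f w) (g w))"
proof (rule hol_cong[OF dom])
  show "hol I D (\<lambda>w. \<Sum>k\<le>N. \<Sum>l\<le>M. coeff (f w) k * coeff (g w) l * B w (monom 1 k) (monom 1 l))"
    using f g by (intro hol_sum hol_mult hol_B) (auto simp: fam_def)
qed (use f g in \<open>auto simp: fam_def intro!: B_fam_eq[symmetric]\<close>)

end

section \<open>Lax and zero curvature equations\<close>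

text \<open>\<open>pd_B\<close> is the effect of a factor
  \<open>exp (- \<kappa> i * w i * x ^ ex i * y ^ ey i)\<close> in the weight. By
  \<open>one_sided\<close> a deformation acts through a power of \<open>x\<close> alone or of
  \<open>y\<close> alone; \<open>b\<close> bounds all band widths.\<close>

locale biorthogonal_family = biorthogonal_basis I D B p s
  for I :: "'i set" and D and B and p s +
  fixes ex ey :: "'i \<Rightarrow> nat" and \<kappa> :: "'i \<Rightarrow> complex" and b :: nat
  assumes lead_eq: "w \<in> D \<Longrightarrow> coeff (p w n) n = coeff (s w n) n"
    and pd_B: "w \<in> D \<Longrightarrow> i \<in> I \<Longrightarrow>
      pd i (\<lambda>w. B w f g) w = - \<kappa> i * B w (monom 1 (ex i) * f) (monom 1 (ey i) * g)"
    and hol_p: "hol I D (\<lambda>w. coeff (p w n) k)"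
    and hol_s: "hol I D (\<lambda>w. coeff (s w n) k)"
    and one_sided: "i \<in> I \<Longrightarrow> (ex i = 0) \<noteq> (ey i = 0)"
    and exponents_le: "i \<in> I \<Longrightarrow> ex i \<le> b" "i \<in> I \<Longrightarrow> ey i \<le> b"
begin

lemma swap: "biorthogonal_family I D (\<lambda>w f g. B w g f) s p ey ex \<kappa> b"
  using dom B_add_left B_smult_left B_add_right B_smult_right deg_p deg_s orthonormal lead_eq hol_B
    pd_B hol_p hol_s one_sided exponents_le
  by unfold_locales auto

lemma fam_p: "fam n (\<lambda>w. p w n)" and fam_s: "fam n (\<lambda>w. s w n)"
  using deg_p deg_s hol_p hol_s by (auto simp: fam_def)

text \<open>Product rule with three factors after expansion into moments: the coefficients of either
  polynomial and the moment itself.\<close>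

lemma pd_B_fam:
  assumes f: "fam N f" and g: "fam M g" and w: "w \<in> D" and i: "i \<in> I"
  shows "pd i (\<lambda>w. B w (f w) (g w)) w = B w (pdp i N f w) (g w) + B w (f w) (pdp i M g w)
    - \<kappa> i * B w (monom 1 (ex i) * f w) (monom 1 (ey i) * g w)"
proof -
  define cf where "cf = (\<lambda>k w. coeff (f w) k)"
  define cg where "cg = (\<lambda>k w. coeff (g w) k)"
  define m where "m = (\<lambda>k l w. B w (monom 1 k) (monom 1 l))"
  have h: "hol I D (cf k)" "hol I D (cg k)" "hol I D (m k l)" for k l
    using f g hol_B by (auto simp: fam_def cf_def cg_def m_def)
  have df: "degree (f w) \<le> N" and dg: "degree (g w) \<le> M" using f g w by (auto simp: fam_def)
  have "pd i (\<lambda>w. B w (f w) (g w)) w = pd i (\<lambda>w. \<Sum>k\<le>N. \<Sum>l\<le>M. cf k w * cg l w * m k l w) w"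
    by (rule pd_cong[OF dom w i]) (use f g B_fam_eq in \<open>auto simp: fam_def cf_def cg_def m_def\<close>)
  also have "\<dots> = (\<Sum>k\<le>N. \<Sum>l\<le>M. pd i (\<lambda>w. cf k w * cg l w * m k l w) w)"
    by (subst pd_sum[OF _ w i] | intro sum.cong refl hol_sum hol_mult h)+
  also have "\<dots> = (\<Sum>k\<le>N. \<Sum>l\<le>M. pd i (cf k) w * cg l w * m k l w + cf k w * pd i (cg l) w * m k l w
      + cf k w * cg l w * pd i (m k l) w)"
    by (intro sum.cong refl) (simp add: pd_mult[OF hol_mult[OF h(1,2)] h(3) w i] pd_mult[OF h(1,2) w i] distrib_right)
  also have "\<dots> = (\<Sum>k\<le>N. \<Sum>l\<le>M. pd i (cf k) w * cg l w * m k l w) + (\<Sum>k\<le>N. \<Sum>l\<le>M. cf k w * pd i (cg l) w * m k l w)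
      + (\<Sum>k\<le>N. \<Sum>l\<le>M. cf k w * cg l w * pd i (m k l) w)"
    by (simp only: sum.distrib)
  also have "(\<Sum>k\<le>N. \<Sum>l\<le>M. pd i (cf k) w * cg l w * m k l w) = B w (pdp i N f w) (g w)"
    by (subst B_fam_eq[OF degree_pdp dg w])
       (auto simp: pdp_def coeff_sum cf_def cg_def m_def if_distrib cong: if_cong intro!: sum.cong)
  also have "(\<Sum>k\<le>N. \<Sum>l\<le>M. cf k w * pd i (cg l) w * m k l w) = B w (f w) (pdp i M g w)"
    by (subst B_fam_eq[OF df degree_pdp w])
       (auto simp: pdp_def coeff_sum cf_def cg_def m_def if_distrib cong: if_cong intro!: sum.cong)
  also have "(\<Sum>k\<le>N. \<Sum>l\<le>M. cf k w * cg l w * pd i (m k l) w) = - \<kappa> i * B w (monom 1 (ex i) * f w) (monom 1 (ey i) * g w)"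
  proof -
    have mm: "monom 1 e * monom a k = Polynomial.smult a (monom 1 e * monom 1 k)" for a :: complex and e k
      by (simp add: mult_monom smult_monom)
    have "B w (monom 1 (ex i) * f w) (monom 1 (ey i) * g w) =
        B w (\<Sum>k\<le>N. Polynomial.smult (cf k w) (monom 1 (ex i) * monom 1 k)) (\<Sum>l\<le>M. Polynomial.smult (cg l w) (monom 1 (ey i) * monom 1 l))"
      unfolding mm[symmetric] cf_def cg_def
      using poly_eq_sum_monom[OF df] poly_eq_sum_monom[OF dg] by (simp add: sum_distrib_left[symmetric])
    also have "\<dots> = (\<Sum>k\<le>N. \<Sum>l\<le>M. cf k w * (cg l w * B w (monom 1 (ex i) * monom 1 k) (monom 1 (ey i) * monom 1 l)))"
      unfolding B_sum_left[OF w] B_smult_left[OF w]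
      by (simp add: B_sum_right[OF w] B_smult_right[OF w] sum_distrib_left)
    finally show ?thesis
      by (simp add: m_def pd_B[OF w i] sum_distrib_left mult_ac)
  qed
  finally show ?thesis by simp
qed

definition Z :: "'i \<Rightarrow> nat \<Rightarrow> nat \<Rightarrow> ('i \<Rightarrow> complex) \<Rightarrow> complex" where
  "Z i n m w = B w (monom 1 (ex i) * p w n) (monom 1 (ey i) * s w m)"

definition Q :: "nat \<Rightarrow> nat \<Rightarrow> ('i \<Rightarrow> complex) \<Rightarrow> complex" where
  "Q n m w = B w (monom 1 1 * p w n) (s w m)"

text \<open>Coefficients of the deformed wave functions. Differentiating the polynomial contributes
  the lower half of \<open>\<kappa> i * Z i\<close>; in a deformation by powers of \<open>x\<close>
  the exponential subtracts all of it, leaving minus the upper half, and in one by powers of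
  \<open>y\<close> the exponential is constant. Exchanged arguments of \<open>upper_half\<close>
  select the lower half.\<close>

definition X :: "'i \<Rightarrow> nat \<Rightarrow> nat \<Rightarrow> ('i \<Rightarrow> complex) \<Rightarrow> complex" where
  "X i n m w = (if ex i > 0 then - \<kappa> i * upper_half (\<lambda>n m. Z i n m w) n m
                else \<kappa> i * upper_half (\<lambda>m n. Z i n m w) m n)"

lemma hol_Z: "hol I D (Z i n m)"
  unfolding Z_def[abs_def] by (rule hol_B_fam[OF fam_monom[OF fam_p] fam_monom[OF fam_s]])

lemma hol_Q: "hol I D (Q n m)"
  unfolding Q_def[abs_def] by (rule hol_B_fam[OF fam_monom[OF fam_p] fam_s])

lemma hol_X: "hol I D (X i n m)"
  using hol_cmult[OF hol_upper_half[of I D "\<lambda>w n m. Z i n m w", OF hol_Z], of "- \<kappa> i" n m]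
    hol_cmult[OF hol_upper_half[of I D "\<lambda>w n m. Z i m n w", OF hol_Z], of "\<kappa> i" m n]
  by (cases "ex i > 0") (simp_all add: X_def[abs_def])

lemma degree_monom_mult_p: "w \<in> D \<Longrightarrow> degree (monom 1 k * p w n) \<le> n + k"
  using order_trans[OF degree_mult_le add_mono[OF degree_monom_le[of 1 k] order_refl]] deg_p[of w n]
  by (metis add.commute)

lemma degree_monom_mult_s: "w \<in> D \<Longrightarrow> degree (monom 1 k * s w n) \<le> n + k"
  using order_trans[OF degree_mult_le add_mono[OF degree_monom_le[of 1 k] order_refl]] deg_s[of w n]
  by (metis add.commute)

lemma Q_upper: "w \<in> D \<Longrightarrow> m > n + 1 \<Longrightarrow> Q n m w = 0"
  unfolding Q_def by (rule B_low_left) (use degree_monom_mult_p[of w 1 n] in auto)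

lemma Z_upper:
  assumes "w \<in> D" "ey i = 0" "m > n + ex i"
  shows "Z i n m w = 0"
proof -
  have "B w (monom 1 (ex i) * p w n) (s w m) = 0"
    by (rule B_low_left) (use degree_monom_mult_p[OF assms(1), of "ex i" n] assms in auto)
  then show ?thesis using assms(2) by (simp add: Z_def one_pCons[symmetric] monom_0)
qed

lemma Z_lower:
  assumes "w \<in> D" "ex i = 0" "n > m + ey i"
  shows "Z i n m w = 0"
proof -
  have "B w (p w n) (monom 1 (ey i) * s w m) = 0"
    by (rule B_low_right) (use degree_monom_mult_s[OF assms(1), of "ey i" m] assms in auto)
  then show ?thesis using assms(2) by (simp add: Z_def one_pCons[symmetric] monom_0)
qed

lemma X_upper: "i \<in> I \<Longrightarrow> w \<in> D \<Longrightarrow> m > n + ex i \<Longrightarrow> X i n m w = 0"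
  using one_sided[of i] Z_upper[of w i n m] by (auto simp: X_def upper_half_def)

lemma X_lower: "i \<in> I \<Longrightarrow> w \<in> D \<Longrightarrow> n > m + ey i \<Longrightarrow> X i n m w = 0"
  using one_sided[of i] Z_lower[of w i m n] by (auto simp: X_def upper_half_def)

lemma X_upper_b: "i \<in> I \<Longrightarrow> w \<in> D \<Longrightarrow> m > n + b \<Longrightarrow> X i n m w = 0"
  using X_upper[of i w n m] exponents_le(1)[of i] by simp

text \<open>Differentiating the orthonormality relations splits \<open>\<kappa> Z\<close> into its lower and upper
  triangular parts; the diagonal is shared equally because \<open>p\<close> and \<open>s\<close> have equal leading
  coefficients.\<close>

lemma pdp_coefficients:
  assumes w: "w \<in> D" and i: "i \<in> I"
  shows "B w (pdp i n (\<lambda>w. p w n) w) (s w m) =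
    (if m < n then \<kappa> i * Z i n m w else if m = n then \<kappa> i * Z i n n w / 2 else 0)"
proof -
  define P where "P = pdp i n (\<lambda>w. p w n) w"
  define S where "S = pdp i m (\<lambda>w. s w m) w"
  have sum: "B w P (s w m) + B w (p w n) S = \<kappa> i * Z i n m w"
  proof -
    have "pd i (\<lambda>w. B w (p w n) (s w m)) w = 0"
      by (subst pd_cong[OF dom w i, of _ "\<lambda>_. if n = m then 1 else 0"]) (auto simp: orthonormal)
    then show ?thesis using pd_B_fam[OF fam_p[of n] fam_s[of m] w i] by (simp add: P_def S_def Z_def)
  qed
  consider "m < n" | "m > n" | "m = n" by linarith
  then show ?thesis
  proof cases
    case 1
    have "degree S \<le> m" unfolding S_def by (rule degree_pdp)
    then have "B w (p w n) S = 0" using 1 by (intro B_low_right[OF w]) simp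
    then show ?thesis using sum 1 by (simp add: P_def)
  next
    case 2
    have "degree P \<le> n" unfolding P_def by (rule degree_pdp)
    then have "B w P (s w m) = 0" using 2 by (intro B_low_left[OF w]) simp
    then show ?thesis using 2 by (simp add: P_def)
  next
    case 3
    have "coeff P n = (\<Sum>k\<le>n. B w P (s w k) * coeff (p w k) n)"
      by (subst p_expansion[OF w degree_pdp[of i n "\<lambda>w. p w n" w], folded P_def]) (simp add: coeff_sum)
    also have "\<dots> = (\<Sum>k\<le>n. if k = n then B w P (s w n) * coeff (p w n) n else 0)"
      by (rule sum.cong) (auto simp: coeff_eq_0 deg_p[OF w])
    finally have 1: "coeff P n = B w P (s w n) * coeff (p w n) n" by simp
    have "coeff S n = (\<Sum>k\<le>n. B w (p w k) S * coeff (s w k) n)"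
      by (subst biorthogonal_basis.p_expansion[OF basis_swap w degree_pdp[of i n "\<lambda>w. s w n" w], folded S_def[unfolded 3]])
         (simp add: coeff_sum S_def 3)
    also have "\<dots> = (\<Sum>k\<le>n. if k = n then B w (p w n) S * coeff (s w n) n else 0)"
      by (rule sum.cong) (auto simp: coeff_eq_0 deg_s[OF w])
    finally have 2: "coeff S n = B w (p w n) S * coeff (s w n) n" by simp
    have "coeff P n = pd i (\<lambda>w. coeff (p w n) n) w" "coeff S n = pd i (\<lambda>w. coeff (s w n) n) w"
      using 3 by (simp_all add: P_def S_def pdp_def coeff_sum)
    moreover have "pd i (\<lambda>w. coeff (p w n) n) w = pd i (\<lambda>w. coeff (s w n) n) w"
      by (rule pd_cong[OF dom w i]) (rule lead_eq)
    ultimately have "B w P (s w n) * coeff (s w n) n = B w (p w n) S * coeff (s w n) n"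
      using 1 2 lead_eq[OF w, of n] by simp
    moreover have "coeff (s w n) n \<noteq> 0" using lead_nz[OF w, of n] lead_eq[OF w, of n] by simp
    ultimately have "B w P (s w n) = B w (p w n) S" by simp
    then have "2 * B w P (s w n) = \<kappa> i * Z i n n w" using sum 3 by simp
    then show ?thesis using 3 by (simp add: P_def mult.commute)
  qed
qed

text \<open>The exponential collects the deformations by powers of \<open>x\<close>; its derivative
  in \<open>w i\<close> multiplies by \<open>- \<kappa> i * x ^ ex i\<close>.\<close>

definition wave :: "nat \<Rightarrow> complex \<Rightarrow> ('i \<Rightarrow> complex) \<Rightarrow> complex" where
  "wave n x w = poly (p w n) x * exp (- (\<Sum>i\<in>{i\<in>I. ex i > 0}. \<kappa> i * x ^ ex i * w i))"

lemma poly_p: "w \<in> D \<Longrightarrow> poly (p w n) x = (\<Sum>k\<le>n. coeff (p w n) k * x ^ k)"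
  using deg_p[of w n] by (simp add: poly_altdef)

lemma hol_poly_p: "hol I D (\<lambda>w. poly (p w n) x)"
  by (rule hol_cong[OF dom, of "\<lambda>w. \<Sum>k\<le>n. coeff (p w n) k * x ^ k"])
     (auto simp: poly_p intro!: hol_sum hol_mult hol_p hol_const)

lemma hol_wave: "hol I D (wave n x)"
  unfolding wave_def[abs_def]
  by (intro hol_mult hol_poly_p hol_exp hol_minus hol_sum hol_cmult hol_coord)

text \<open>The exponential never vanishes, so a relation for all \<open>x\<close> is an identity of
  polynomials, and pairing with \<open>s w m\<close> isolates each coefficient.\<close>

lemma wave_independent:
  assumes w: "w \<in> D" and z: "\<And>x. (\<Sum>m\<le>N. a m * wave m x w) = 0" and m: "m \<le> N"
  shows "a m = 0"
proof -
  define f where "f = (\<Sum>m\<le>N. Polynomial.smult (a m) (p w m))"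
  have "poly f x = 0" for x
  proof -
    have "(\<Sum>m\<le>N. a m * wave m x w) = poly f x * exp (- (\<Sum>i\<in>{i\<in>I. ex i > 0}. \<kappa> i * x ^ ex i * w i))"
      by (simp add: f_def poly_sum wave_def sum_distrib_right mult.assoc)
    then show ?thesis using z[of x] by simp
  qed
  then have "f = 0" using poly_all_0_iff_0 by blast
  then have "B w f (s w m) = 0" using B_zero_left[OF w] by simp
  moreover have "B w f (s w m) = (\<Sum>k\<le>N. if k = m then a k else 0)"
    unfolding f_def B_sum_left[OF w] B_smult_left[OF w] orthonormal[OF w] by (rule sum.cong) auto
  ultimately show ?thesis using m by simp
qed

lemma wave_times_x:
  assumes w: "w \<in> D" and N: "N \<ge> n + 1"
  shows "x * wave n x w = (\<Sum>m\<le>N. Q n m w * wave m x w)"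
proof -
  have "degree (monom 1 1 * p w n) \<le> N" using degree_monom_mult_p[OF w, of 1 n] N by simp
  from p_expansion[OF w this]
  have "poly (monom 1 1 * p w n) x = poly (\<Sum>m\<le>N. Polynomial.smult (Q n m w) (p w m)) x" by (simp add: Q_def)
  then have "x * poly (p w n) x = (\<Sum>m\<le>N. Q n m w * poly (p w m) x)"
    by (simp add: poly_sum poly_monom)
  then show ?thesis by (simp add: wave_def sum_distrib_right mult.assoc[symmetric])
qed

text \<open>The derivative is a polynomial \<open>G\<close> times the same exponential, and the
  triangular splitting of the derivative of \<open>p\<close> identifies the coefficients of
  \<open>G\<close> in the basis \<open>p\<close> with a row of \<open>X\<close>.\<close>

lemma pd_wave:
  assumes w: "w \<in> D" and i: "i \<in> I" and N: "N \<ge> n + b"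
  shows "pd i (wave n x) w = (\<Sum>m\<le>N. X i n m w * wave m x w)"
proof -
  define E where "E = (\<lambda>w::'i\<Rightarrow>complex. - (\<Sum>i\<in>{i\<in>I. ex i > 0}. \<kappa> i * x ^ ex i * w i))"
  have hE: "hol I D E" unfolding E_def by (intro hol_minus hol_sum hol_cmult hol_coord)
  have pdE: "pd i E w = (if ex i > 0 then - \<kappa> i * x ^ ex i else 0)"
  proof -
    have "pd i E w = - (\<Sum>j\<in>{j\<in>I. ex j > 0}. \<kappa> j * x ^ ex j * pd i (\<lambda>w. w j) w)"
      unfolding E_def
      by (subst pd_minus[OF hol_sum[OF hol_cmult[OF hol_coord]] w i],
          subst pd_sum[OF hol_cmult[OF hol_coord] w i], simp add: pd_cmult[OF hol_coord w i])
    also have "(\<Sum>j\<in>{j\<in>I. ex j > 0}. \<kappa> j * x ^ ex j * pd i (\<lambda>w. w j) w) =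
        (\<Sum>j\<in>{j\<in>I. ex j > 0}. if j = i then \<kappa> i * x ^ ex i else 0)"
      by (rule sum.cong) (auto simp: pd_coord)
    also have "\<dots> = (if ex i > 0 then \<kappa> i * x ^ ex i else 0)"
      using pdom_finite[OF dom] i by (simp add: sum.delta)
    finally show ?thesis by simp
  qed
  have pdpoly: "pd i (\<lambda>w. poly (p w n) x) w = poly (pdp i n (\<lambda>w. p w n) w) x"
  proof -
    have "pd i (\<lambda>w. poly (p w n) x) w = pd i (\<lambda>w. \<Sum>k\<le>n. coeff (p w n) k * x ^ k) w"
      by (rule pd_cong[OF dom w i]) (rule poly_p)
    also have "\<dots> = (\<Sum>k\<le>n. pd i (\<lambda>w. coeff (p w n) k * x ^ k) w)"
      by (rule pd_sum[OF _ w i]) (intro hol_mult hol_p hol_const)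
    also have "\<dots> = (\<Sum>k\<le>n. pd i (\<lambda>w. coeff (p w n) k) w * x ^ k)"
      by (simp add: pd_mult[OF hol_p hol_const w i])
    finally show ?thesis by (simp add: pdp_def poly_sum poly_monom)
  qed
  define G where "G = pdp i n (\<lambda>w. p w n) w - (if ex i > 0 then Polynomial.smult (\<kappa> i) (monom 1 (ex i) * p w n) else 0)"
  have degG: "degree G \<le> N"
  proof -
    have "degree (if ex i > 0 then Polynomial.smult (\<kappa> i) (monom 1 (ex i) * p w n) else 0) \<le> N"
      using degree_monom_mult_p[OF w, of "ex i" n] N exponents_le(1)[OF i]
        degree_smult_le[of "\<kappa> i" "monom 1 (ex i) * p w n"] by auto
    moreover have "degree (pdp i n (\<lambda>w. p w n) w) \<le> N" using degree_pdp[of i n "\<lambda>w. p w n" w] N by simp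
    ultimately show ?thesis unfolding G_def by (intro degree_diff_le)
  qed
  have XG: "B w G (s w m) = X i n m w" for m
  proof -
    have "B w G (s w m) = B w (pdp i n (\<lambda>w. p w n) w) (s w m)
        + (- 1) * B w (if ex i > 0 then Polynomial.smult (\<kappa> i) (monom 1 (ex i) * p w n) else 0) (s w m)"
      unfolding G_def B_smult_left[OF w, symmetric] B_add_left[OF w, symmetric] by simp
    moreover have "Z i n m w = B w (monom 1 (ex i) * p w n) (s w m)" if "ex i > 0"
      using that one_sided[OF i] by (simp add: Z_def monom_0 one_pCons[symmetric])
    ultimately show ?thesis
      unfolding pdp_coefficients[OF w i]
      by (cases n m rule: linorder_cases) (auto simp: X_def upper_half_def B_smult_left[OF w] B_zero_left[OF w])
  qed
  have "pd i (wave n x) w = pd i (\<lambda>w. poly (p w n) x) w * exp (E w) + poly (p w n) x * (exp (E w) * pd i E w)"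
  proof -
    have "wave n x = (\<lambda>w. poly (p w n) x * exp (E w))" by (simp add: wave_def[abs_def] E_def)
    then show ?thesis by (simp only: pd_mult[OF hol_poly_p hol_exp[OF hE] w i] pd_exp[OF hE w i])
  qed
  also have "\<dots> = poly G x * exp (E w)"
    by (simp add: pdpoly pdE G_def poly_monom algebra_simps)
  also have "poly G x = (\<Sum>m\<le>N. X i n m w * poly (p w m) x)"
    by (subst p_expansion[OF w degG]) (simp add: poly_sum XG)
  finally have eq: "pd i (wave n x) w = (\<Sum>m\<le>N. X i n m w * poly (p w m) x) * exp (E w)" .
  show ?thesis unfolding eq by (simp add: wave_def E_def sum_distrib_right mult.assoc)
qed

text \<open>The derivative of \<open>x * wave n x\<close> is computed from the derivative of the
  wave and from its expansion by \<open>Q\<close>; independence of the waves allows coefficients to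
  be compared.\<close>

lemma lax:
  assumes w: "w \<in> D" and i: "i \<in> I" and N: "N \<ge> n + b + 1"
  shows "pd i (Q n l) w = (\<Sum>m\<le>N. X i n m w * Q m l w) - (\<Sum>m\<le>N. Q n m w * X i m l w)"
proof -
  \<comment> \<open>Contains \<open>l\<close> and every index that a band matrix reaches from an
    index up to \<open>N\<close>, so all expansions run over one range.\<close>
  define L where "L = max l (N + b + 1)"
  have "pd i (Q n l) w - (\<Sum>m\<le>N. X i n m w * Q m l w) + (\<Sum>m\<le>N. Q n m w * X i m l w) = 0"
  proof (rule wave_independent[OF w, where N = L and m = l])
    fix x
    have "pd i (\<lambda>w. x * wave n x w) w = x * pd i (wave n x) w" by (rule pd_cmult[OF hol_wave w i])
    also have "\<dots> = (\<Sum>m\<le>N. X i n m w * (x * wave m x w))"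
      by (subst pd_wave[OF w i, of n N]) (use N in \<open>auto simp: sum_distrib_left mult.left_commute\<close>)
    also have "\<dots> = (\<Sum>m\<le>N. X i n m w * (\<Sum>l\<le>L. Q m l w * wave l x w))"
      by (intro sum.cong refl arg_cong2[of _ _ _ _ "(*)"] wave_times_x[OF w]) (auto simp: L_def)
    also have "\<dots> = (\<Sum>l\<le>L. (\<Sum>m\<le>N. X i n m w * Q m l w) * wave l x w)"
      by (simp only: sum_distrib_left sum_distrib_right mult.assoc) (rule sum.swap)
    finally have 1: "pd i (\<lambda>w. x * wave n x w) w = (\<Sum>l\<le>L. (\<Sum>m\<le>N. X i n m w * Q m l w) * wave l x w)" .
    have pdQ0: "pd i (Q n m) w = 0" if "m > N" for m
      by (subst pd_cong[OF dom w i, of _ "\<lambda>_. 0"]) (use Q_upper[of _ n m] that N in auto)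
    have "pd i (\<lambda>w. x * wave n x w) w = pd i (\<lambda>w. \<Sum>m\<le>N. Q n m w * wave m x w) w"
      by (rule pd_cong[OF dom w i]) (use wave_times_x[of _ n N x] N in auto)
    also have "\<dots> = (\<Sum>m\<le>N. pd i (\<lambda>w. Q n m w * wave m x w) w)"
      by (rule pd_sum[OF _ w i]) (intro hol_mult hol_Q hol_wave)
    also have "\<dots> = (\<Sum>m\<le>N. pd i (Q n m) w * wave m x w + Q n m w * pd i (wave m x) w)"
      by (simp only: pd_mult[OF hol_Q hol_wave w i])
    also have "\<dots> = (\<Sum>m\<le>N. pd i (Q n m) w * wave m x w) + (\<Sum>m\<le>N. Q n m w * pd i (wave m x) w)"
      by (rule sum.distrib)
    also have "(\<Sum>m\<le>N. pd i (Q n m) w * wave m x w) = (\<Sum>l\<le>L. pd i (Q n l) w * wave l x w)"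
      by (rule sum.mono_neutral_left) (use pdQ0 in \<open>auto simp: L_def\<close>)
    also have "(\<Sum>m\<le>N. Q n m w * pd i (wave m x) w) = (\<Sum>m\<le>N. Q n m w * (\<Sum>l\<le>L. X i m l w * wave l x w))"
      by (intro sum.cong refl arg_cong2[of _ _ _ _ "(*)"] pd_wave[OF w i]) (auto simp: L_def)
    also have "\<dots> = (\<Sum>l\<le>L. (\<Sum>m\<le>N. Q n m w * X i m l w) * wave l x w)"
      by (simp only: sum_distrib_left sum_distrib_right mult.assoc) (rule sum.swap)
    finally show "(\<Sum>l\<le>L. (pd i (Q n l) w - (\<Sum>m\<le>N. X i n m w * Q m l w) + (\<Sum>m\<le>N. Q n m w * X i m l w)) * wave l x w) = 0"
      using 1 by (simp add: distrib_right left_diff_distrib sum.distrib sum_subtractf)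
  qed (simp add: L_def)
  then show ?thesis by (simp only: diff_add_eq eq_diff_eq right_minus_eq)
qed

text \<open>This is the symmetry of mixed derivatives of the wave functions, with coefficients
  compared in the independent family.\<close>

lemma flat_X:
  assumes w: "w \<in> D" and i: "i \<in> I" and j: "j \<in> I" and N: "N \<ge> n + b"
  shows "pd j (X i n l) w + (\<Sum>m\<le>N. X i n m w * X j m l w) = pd i (X j n l) w + (\<Sum>m\<le>N. X j n m w * X i m l w)"
proof -
  define L where "L = max l (N + b)"
  have half: "pd j (pd i (wave n x)) w = (\<Sum>l\<le>L. (pd j (X i n l) w + (\<Sum>m\<le>N. X i n m w * X j m l w)) * wave l x w)"
    if i: "i \<in> I" and j: "j \<in> I" for i j x
  proof -
    have pdX0: "pd j (X i n m) w = 0" if "m > N" for m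
      by (subst pd_cong[OF dom w j, of _ "\<lambda>_. 0"]) (use X_upper_b[OF i, of _ n m] that N in auto)
    have "pd j (pd i (wave n x)) w = pd j (\<lambda>w. \<Sum>m\<le>N. X i n m w * wave m x w) w"
      by (rule pd_cong[OF dom w j]) (rule pd_wave[OF _ i N])
    also have "\<dots> = (\<Sum>m\<le>N. pd j (\<lambda>w. X i n m w * wave m x w) w)"
      by (rule pd_sum[OF _ w j]) (intro hol_mult hol_X hol_wave)
    also have "\<dots> = (\<Sum>m\<le>N. pd j (X i n m) w * wave m x w + X i n m w * pd j (wave m x) w)"
      by (simp only: pd_mult[OF hol_X hol_wave w j])
    also have "\<dots> = (\<Sum>m\<le>N. pd j (X i n m) w * wave m x w) + (\<Sum>m\<le>N. X i n m w * pd j (wave m x) w)"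
      by (rule sum.distrib)
    also have "(\<Sum>m\<le>N. pd j (X i n m) w * wave m x w) = (\<Sum>l\<le>L. pd j (X i n l) w * wave l x w)"
      by (rule sum.mono_neutral_left) (use pdX0 in \<open>auto simp: L_def\<close>)
    also have "(\<Sum>m\<le>N. X i n m w * pd j (wave m x) w) = (\<Sum>m\<le>N. X i n m w * (\<Sum>l\<le>L. X j m l w * wave l x w))"
      by (intro sum.cong refl arg_cong2[of _ _ _ _ "(*)"] pd_wave[OF w j]) (auto simp: L_def)
    also have "\<dots> = (\<Sum>l\<le>L. (\<Sum>m\<le>N. X i n m w * X j m l w) * wave l x w)"
      by (simp only: sum_distrib_left sum_distrib_right mult.assoc) (rule sum.swap)
    finally show ?thesis by (simp add: distrib_right sum.distrib)
  qed
  have "(pd j (X i n l) w + (\<Sum>m\<le>N. X i n m w * X j m l w)) - (pd i (X j n l) w + (\<Sum>m\<le>N. X j n m w * X i m l w)) = 0"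
  proof (rule wave_independent[OF w, where N = L and m = l])
    fix x
    have "pd j (pd i (wave n x)) w = pd i (pd j (wave n x)) w" by (rule pd_commute[OF dom hol_wave w j i])
    then show "(\<Sum>l\<le>L. ((pd j (X i n l) w + (\<Sum>m\<le>N. X i n m w * X j m l w))
        - (pd i (X j n l) w + (\<Sum>m\<le>N. X j n m w * X i m l w))) * wave l x w) = 0"
      unfolding half[OF i j] half[OF j i] by (simp add: left_diff_distrib sum_subtractf)
  qed (simp add: L_def)
  then show ?thesis by simp
qed

text \<open>Comparison of leading coefficients. Its consequence, a nonzero superdiagonal, gives row
  and column relations one nonvanishing end.\<close>

lemma Q_superdiagonal:
  assumes w: "w \<in> D"
  shows "Q n (n + 1) w * coeff (p w (n + 1)) (n + 1) = coeff (p w n) n"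
proof -
  have "coeff (monom 1 1 * p w n) (n + 1) = coeff (\<Sum>m\<le>n + 1. Polynomial.smult (Q n m w) (p w m)) (n + 1)"
    using p_expansion[OF w degree_monom_mult_p[OF w, of 1 n]] by (simp add: Q_def)
  also have "\<dots> = (\<Sum>m\<le>n + 1. if m = n + 1 then Q n (n + 1) w * coeff (p w (n + 1)) (n + 1) else 0)"
    unfolding coeff_sum by (rule sum.cong) (auto simp: coeff_eq_0 deg_p[OF w])
  finally show ?thesis by (simp add: coeff_monom_mult)
qed

lemma Q_superdiagonal_nz: "w \<in> D \<Longrightarrow> Q n (n + 1) w \<noteq> 0"
  using Q_superdiagonal[of w n] lead_nz[of w n] by auto

text \<open>Powers of \<open>Q\<close> represent multiplication by powers of \<open>x\<close>; the
  sum over the support in \<open>semi_inf_pow\<close> is finite because rows of \<open>Q\<close> end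
  at the superdiagonal.\<close>

lemma power_expansion:
  assumes w: "w \<in> D"
  shows "semi_inf_pow (\<lambda>n m. Q n m w) k n m = B w (monom 1 k * p w n) (s w m)"
proof (induction k arbitrary: n)
  case 0
  then show ?case by (simp add: monom_0 one_pCons[symmetric] orthonormal[OF w])
next
  case (Suc k)
  have fin: "finite {l. Q n l w \<noteq> 0}"
    by (rule finite_subset[of _ "{..n + 1}"]) (use Q_upper[OF w, of n] in \<open>auto simp: not_le[symmetric]\<close>)
  have "monom 1 (Suc k) * p w n = monom 1 k * (monom 1 1 * p w n)"
    by (simp add: mult.assoc[symmetric] mult_monom)
  also have "\<dots> = monom 1 k * (\<Sum>l\<le>n + 1. Polynomial.smult (Q n l w) (p w l))"
    using p_expansion[OF w degree_monom_mult_p[OF w, of 1 n]] by (simp add: Q_def)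
  also have "\<dots> = (\<Sum>l\<le>n + 1. Polynomial.smult (Q n l w) (monom 1 k * p w l))"
    by (simp only: sum_distrib_left mult_smult_right)
  finally have "B w (monom 1 (Suc k) * p w n) (s w m) = (\<Sum>l\<le>n + 1. Q n l w * semi_inf_pow (\<lambda>n m. Q n m w) k l m)"
    by (simp only: B_sum_left[OF w] B_smult_left[OF w] Suc)
  also have "\<dots> = (\<Sum>l | Q n l w \<noteq> 0. Q n l w * semi_inf_pow (\<lambda>n m. Q n m w) k l m)"
    by (rule sum.mono_neutral_right) (use Q_upper[OF w, of n] in \<open>auto simp: not_le[symmetric]\<close>)
  finally show ?case by simp
qed

end

section \<open>Row and column recursions of a banded family\<close>

lemma sum_window:
  fixes g :: "nat \<Rightarrow> complex"
  assumes "\<And>m. m < a \<Longrightarrow> g m = 0" "\<And>m. m > a + K \<Longrightarrow> g m = 0" "M \<ge> a + K"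
  shows "(\<Sum>m\<le>M. g m) = (\<Sum>k\<le>K. g (a + k))"
proof -
  have "(\<Sum>m\<le>M. g m) = (\<Sum>m\<in>{a..a + K}. g m)"
    by (rule sum.mono_neutral_right) (use assms in \<open>auto simp: not_le\<close>)
  also have "\<dots> = (\<Sum>k\<le>K. g (a + k))"
    by (rule sum.reindex_bij_witness[of _ "\<lambda>k. a + k" "\<lambda>m. m - a"]) auto
  finally show ?thesis .
qed

text \<open>With the nonzero superdiagonal these conditions make rows and columns of
  \<open>Q - x\<close>, away from the boundary, (d + 2)-term relations with nonvanishing ends;
  \<open>d \<ge> 1\<close> keeps the shift by \<open>x\<close> off the ends.\<close>

locale banded_biorthogonal_family = biorthogonal_family +
  fixes d :: nat
  assumes sc: "simply_connected D" and d: "d \<ge> 1"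
    and Q_lower: "w \<in> D \<Longrightarrow> m + d < n \<Longrightarrow> Q n m w = 0"
    and Q_subdiagonal: "w \<in> D \<Longrightarrow> Q (n + d) n w \<noteq> 0"
begin

lemma pdQ_upper: "w \<in> D \<Longrightarrow> i \<in> I \<Longrightarrow> m > n + 1 \<Longrightarrow> pd i (Q n m) w = 0"
  by (subst pd_cong[OF dom, of w i _ "\<lambda>_. 0"]) (use Q_upper[of _ n m] in auto)

lemma pdQ_lower: "w \<in> D \<Longrightarrow> i \<in> I \<Longrightarrow> m + d < n \<Longrightarrow> pd i (Q n m) w = 0"
  by (subst pd_cong[OF dom, of w i _ "\<lambda>_. 0"]) (use Q_lower[of _ m n] in auto)

lemma row_sum:
  assumes w: "w \<in> D" and n: "n = r - 1 + d" and M: "M \<ge> n + 1"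
  shows "(\<Sum>k\<le>d + 1. (Q n (r - 1 + k) w - (if k = d then x else 0)) * f (r - 1 + k)) = (\<Sum>m\<le>M. Q n m w * f m) - x * f n"
proof -
  have "(\<Sum>k\<le>d + 1. (Q n (r - 1 + k) w - (if k = d then x else 0)) * f (r - 1 + k))
      = (\<Sum>k\<le>d + 1. Q n (r - 1 + k) w * f (r - 1 + k)) - (\<Sum>k\<le>d + 1. if k = d then x * f (r - 1 + d) else 0)"
    unfolding sum_subtractf[symmetric] by (rule sum.cong) (auto simp: left_diff_distrib)
  also have "(\<Sum>k\<le>d + 1. if k = d then x * f (r - 1 + d) else 0) = x * f n" by (simp add: n)
  also have "(\<Sum>k\<le>d + 1. Q n (r - 1 + k) w * f (r - 1 + k)) = (\<Sum>m\<le>M. Q n m w * f m)"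
    by (rule sum_window[symmetric]) (use Q_lower[OF w] Q_upper[OF w] n M in auto)
  finally show ?thesis .
qed

lemma column_sum:
  assumes w: "w \<in> D" and r: "r \<ge> 1" and M: "M \<ge> r + d"
  shows "(\<Sum>k\<le>d + 1. (Q (r - 1 + k) r w - (if k = 1 then x else 0)) * f (r - 1 + k)) = (\<Sum>m\<le>M. Q m r w * f m) - x * f r"
proof -
  have "(\<Sum>k\<le>d + 1. (Q (r - 1 + k) r w - (if k = 1 then x else 0)) * f (r - 1 + k))
      = (\<Sum>k\<le>d + 1. Q (r - 1 + k) r w * f (r - 1 + k)) - (\<Sum>k\<le>d + 1. if k = 1 then x * f (r - 1 + 1) else 0)"
    unfolding sum_subtractf[symmetric] by (rule sum.cong) (auto simp: left_diff_distrib)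
  also have "(\<Sum>k\<le>d + 1. if k = 1 then x * f (r - 1 + 1) else 0) = x * f r" using r by simp
  also have "(\<Sum>k\<le>d + 1. Q (r - 1 + k) r w * f (r - 1 + k)) = (\<Sum>m\<le>M. Q m r w * f m)"
    by (rule sum_window[symmetric]) (use Q_lower[OF w] Q_upper[OF w] r M in auto)
  finally show ?thesis .
qed

lemma X_row_sum:
  assumes "w \<in> D" "i \<in> I" "M \<ge> n + b"
  shows "(\<Sum>l\<le>n + b. X i n l w * f l) = (\<Sum>l\<le>M. X i n l w * f l)"
  by (rule sum.mono_neutral_left) (use assms X_upper_b[of i w n] in auto)

lemma X_column_sum:
  assumes "w \<in> D" "i \<in> I" "M \<ge> n + b"
  shows "(\<Sum>l\<le>n + b. X i l n w * f l) = (\<Sum>l\<le>M. X i l n w * f l)"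
  by (rule sum.mono_neutral_left) (use assms X_lower[of i w n] exponents_le(2)[of i] in auto)

text \<open>Relation \<open>r\<close> is row \<open>r - 1 + d\<close> of \<open>Q - x\<close>;
  earlier rows are cut off by the boundary and discarded. The Lax equation turns the derivative of a
  row into \<open>X\<close> acting on rows and rows acting on \<open>X\<close>; the former reduces
  to multiplication by \<open>x\<close> as long as only retained rows are reached.\<close>

lemma primal_recursion:
  "deformed_recursion I D d b (\<lambda>r k w. Q (r - 1 + d) (r - 1 + k) w - (if k = d then x else 0)) X ey"
proof
  fix r k :: nat
  show "hol I D (\<lambda>w. Q (r - 1 + d) (r - 1 + k) w - (if k = d then x else 0))"
    by (rule hol_diff[OF hol_Q hol_const])
next
  fix r :: nat and w assume r: "r \<ge> 1" and w: "w \<in> D"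
  show "Q (r - 1 + d) (r - 1 + 0) w - (if 0 = d then x else 0) \<noteq> 0"
    using Q_subdiagonal[OF w, of "r - 1"] d by simp
  show "Q (r - 1 + d) (r - 1 + (d + 1)) w - (if d + 1 = d then x else 0) \<noteq> 0"
    using Q_superdiagonal_nz[OF w, of "r - 1 + d"] by (simp add: add.assoc)
next
  fix i j :: 'a and w m l assume "i \<in> I" "j \<in> I" "w \<in> D"
  then show "pd j (X i m l) w + (\<Sum>k\<le>m + b. X i m k w * X j k l w) = pd i (X j m l) w + (\<Sum>k\<le>m + b. X j m k w * X i k l w)"
    by (intro flat_X) auto
next
  fix i w f and r :: nat
  assume i: "i \<in> I" and w: "w \<in> D"
    and rel: "\<And>r. 1 \<le> r \<Longrightarrow> (\<Sum>k\<le>d + 1. (Q (r - 1 + d) (r - 1 + k) w - (if k = d then x else 0)) * f (r - 1 + k)) = 0"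
    and r: "ey i < r"
  define n where "n = r - 1 + d"
  define N where "N = n + b + 1"
  define M where "M = N + b + 1"
  define G where "G = (\<lambda>m. \<Sum>l\<le>m + b. X i m l w * f l)"
  have rel': "(\<Sum>m\<le>M. Q k m w * f m) = x * f k" if "k \<ge> d" "k \<le> N" for k
  proof -
    have "k = (k - d + 1) - 1 + d" using that by simp
    from row_sum[OF w this, of M x f] rel[of "k - d + 1"] that show ?thesis by (simp add: M_def)
  qed
  have A: "(\<Sum>m\<le>M. pd i (Q n m) w * f m) = x * G n - (\<Sum>k\<le>N. Q n k w * G k)"
  proof -
    have "(\<Sum>m\<le>M. pd i (Q n m) w * f m) = (\<Sum>m\<le>M. (\<Sum>k\<le>N. X i n k w * Q k m w) * f m) - (\<Sum>m\<le>M. (\<Sum>k\<le>N. Q n k w * X i k m w) * f m)"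
      by (simp add: lax[OF w i, of n N] N_def left_diff_distrib sum_subtractf)
    also have "(\<Sum>m\<le>M. (\<Sum>k\<le>N. X i n k w * Q k m w) * f m) = (\<Sum>k\<le>N. X i n k w * (\<Sum>m\<le>M. Q k m w * f m))"
      by (simp only: sum_distrib_left sum_distrib_right mult.assoc) (rule sum.swap)
    also have "\<dots> = (\<Sum>k\<le>N. x * (X i n k w * f k))"
    proof (rule sum.cong[OF refl])
      fix k assume k: "k \<in> {..N}"
      show "X i n k w * (\<Sum>m\<le>M. Q k m w * f m) = x * (X i n k w * f k)"
      \<comment> \<open>Here \<open>r > ey i\<close> enters: from row \<open>n\<close> the
        deformation reaches back only to rows \<open>k \<ge> d\<close>.\<close>
      proof (cases "n > k + ey i")
        case True
        then show ?thesis using X_lower[OF i w] by simp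
      next
        case False
        then have "k \<ge> d" using r by (simp add: n_def)
        then show ?thesis using rel' k by simp
      qed
    qed
    also have "\<dots> = x * G n"
    proof -
      have "G n = (\<Sum>l\<le>N. X i n l w * f l)" unfolding G_def by (rule X_row_sum[OF w i]) (simp add: N_def)
      then show ?thesis by (simp only: sum_distrib_left[symmetric])
    qed
    also have "(\<Sum>m\<le>M. (\<Sum>k\<le>N. Q n k w * X i k m w) * f m) = (\<Sum>k\<le>N. Q n k w * (\<Sum>m\<le>M. X i k m w * f m))"
      by (simp only: sum_distrib_left sum_distrib_right mult.assoc) (rule sum.swap)
    also have "\<dots> = (\<Sum>k\<le>N. Q n k w * G k)"
      unfolding G_def by (intro sum.cong refl arg_cong2[of _ _ _ _ "(*)"] X_row_sum[OF w i, symmetric]) (simp add: M_def)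
    finally show ?thesis .
  qed
  have B: "(\<Sum>k\<le>d + 1. pd i (\<lambda>w. Q n (r - 1 + k) w - (if k = d then x else 0)) w * f (r - 1 + k)) = (\<Sum>m\<le>M. pd i (Q n m) w * f m)"
  proof -
    have "pd i (\<lambda>w. Q n (r - 1 + k) w - (if k = d then x else 0)) w = pd i (Q n (r - 1 + k)) w" for k
      using pd_diff[OF hol_Q hol_const w i] by simp
    then have "(\<Sum>k\<le>d + 1. pd i (\<lambda>w. Q n (r - 1 + k) w - (if k = d then x else 0)) w * f (r - 1 + k)) = (\<Sum>k\<le>d + 1. pd i (Q n (r - 1 + k)) w * f (r - 1 + k))"
      by simp
    also have "\<dots> = (\<Sum>m\<le>M. pd i (Q n m) w * f m)"
      by (rule sum_window[symmetric]) (use pdQ_lower[OF w i] pdQ_upper[OF w i] in \<open>auto simp: n_def M_def N_def\<close>)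
    finally show ?thesis .
  qed
  have C: "(\<Sum>k\<le>d + 1. (Q n (r - 1 + k) w - (if k = d then x else 0)) * G (r - 1 + k)) = (\<Sum>m\<le>N. Q n m w * G m) - x * G n"
    by (rule row_sum[OF w n_def]) (simp add: N_def)
  show "(\<Sum>k\<le>d + 1. pd i (\<lambda>w. Q (r - 1 + d) (r - 1 + k) w - (if k = d then x else 0)) w * f (r - 1 + k)) +
      (\<Sum>k\<le>d + 1. (Q (r - 1 + d) (r - 1 + k) w - (if k = d then x else 0)) * (\<Sum>l\<le>r - 1 + k + b. X i (r - 1 + k) l w * f l)) = 0"
  proof -
    have "(\<Sum>k\<le>d + 1. pd i (\<lambda>w. Q n (r - 1 + k) w - (if k = d then x else 0)) w * f (r - 1 + k)) +
        (\<Sum>k\<le>d + 1. (Q n (r - 1 + k) w - (if k = d then x else 0)) * G (r - 1 + k)) = 0"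
      unfolding B C A by simp
    then show ?thesis unfolding G_def n_def .
  qed
qed (use dom sc hol_X X_upper_b X_lower in auto)

text \<open>The adjoint flow: columns of \<open>Q - x\<close> instead of rows and \<open>- X\<close>
  transposed, which exchanges the roles of \<open>ex\<close> and \<open>ey\<close>. Column 0 has no
  entry above the diagonal and is discarded.\<close>

lemma dual_recursion:
  "deformed_recursion I D d b (\<lambda>r k w. Q (r - 1 + k) r w - (if k = 1 then x else 0)) (\<lambda>i n m w. - X i m n w) ex"
proof
  fix r k :: nat
  show "hol I D (\<lambda>w. Q (r - 1 + k) r w - (if k = 1 then x else 0))"
    by (rule hol_diff[OF hol_Q hol_const])
next
  fix r :: nat and w assume r: "r \<ge> 1" and w: "w \<in> D"
  show "Q (r - 1 + 0) r w - (if 0 = (1::nat) then x else 0) \<noteq> 0"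
    using Q_superdiagonal_nz[OF w, of "r - 1"] r by simp
  have "r - 1 + (d + 1) = r + d" using r by simp
  then show "Q (r - 1 + (d + 1)) r w - (if d + 1 = 1 then x else 0) \<noteq> 0"
    using Q_subdiagonal[OF w, of r] d by simp
next
  fix i m l assume i: "i \<in> I"
  show "hol I D (\<lambda>w. - X i l m w)" by (rule hol_minus[OF hol_X])
  fix w assume w: "w \<in> D"
  show "- X i l m w = 0" if "m + b < l" using X_lower[OF i w, of m l] exponents_le(2)[OF i] that by simp
  show "- X i l m w = 0" if "l + ex i < m" using X_upper[OF i w that] by simp
next
  fix i j :: 'a and w m l assume i: "i \<in> I" and j: "j \<in> I" and w: "w \<in> D"
  define M where "M = m + l + b"
  have sw: "(\<Sum>k\<le>m + b. - X i k m w * - X j l k w) = (\<Sum>k\<le>M. X j l k w * X i k m w)" if i: "i \<in> I" for i j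
    using X_column_sum[OF w i, of m M "\<lambda>k. X j l k w"] by (simp add: M_def mult.commute)
  have "pd i (X j l m) w + (\<Sum>k\<le>M. X j l k w * X i k m w) = pd j (X i l m) w + (\<Sum>k\<le>M. X i l k w * X j k m w)"
    by (rule flat_X[OF w j i]) (simp add: M_def)
  then have "- pd j (X i l m) w + (\<Sum>k\<le>M. X j l k w * X i k m w) = - pd i (X j l m) w + (\<Sum>k\<le>M. X i l k w * X j k m w)"
    by (simp add: algebra_simps)
  then show "pd j (\<lambda>w. - X i l m w) w + (\<Sum>k\<le>m + b. - X i k m w * - X j l k w) =
      pd i (\<lambda>w. - X j l m w) w + (\<Sum>k\<le>m + b. - X j k m w * - X i l k w)"
    unfolding sw[OF i] sw[OF j] pd_minus[OF hol_X w i] pd_minus[OF hol_X w j] .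
next
  fix i w f and r :: nat
  assume i: "i \<in> I" and w: "w \<in> D"
    and rel: "\<And>r. 1 \<le> r \<Longrightarrow> (\<Sum>k\<le>d + 1. (Q (r - 1 + k) r w - (if k = 1 then x else 0)) * f (r - 1 + k)) = 0"
    and r: "ex i < r"
  then have r1: "r \<ge> 1" by simp
  define M where "M = r + d + b"
  define N where "N = M + b + 1"
  define G where "G = (\<lambda>m. \<Sum>l\<le>m + b. - X i l m w * f l)"
  have rel': "(\<Sum>m\<le>M. Q m k w * f m) = x * f k" if "k \<ge> 1" "k \<le> r + b" for k
    using column_sum[OF w that(1), of M x f] rel[OF that(1)] that by (simp add: M_def)
  have Gm: "G m = - (\<Sum>l\<le>L. X i l m w * f l)" if "L \<ge> m + b" for m L
    unfolding G_def using X_column_sum[OF w i that, of f] by (simp add: sum_negf)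
  have A: "(\<Sum>m\<le>M. pd i (Q m r) w * f m) = - (\<Sum>k\<le>N. Q k r w * G k) + x * G r"
  proof -
    have "(\<Sum>m\<le>M. pd i (Q m r) w * f m) = (\<Sum>m\<le>M. (\<Sum>k\<le>N. X i m k w * Q k r w) * f m) - (\<Sum>m\<le>M. (\<Sum>k\<le>N. Q m k w * X i k r w) * f m)"
    proof -
      have "pd i (Q m r) w = (\<Sum>k\<le>N. X i m k w * Q k r w) - (\<Sum>k\<le>N. Q m k w * X i k r w)" if "m \<in> {..M}" for m
        by (rule lax[OF w i]) (use that in \<open>simp add: N_def\<close>)
      then have "(\<Sum>m\<le>M. pd i (Q m r) w * f m) = (\<Sum>m\<le>M. (\<Sum>k\<le>N. X i m k w * Q k r w) * f m - (\<Sum>k\<le>N. Q m k w * X i k r w) * f m)"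
        by (intro sum.cong refl) (simp only: left_diff_distrib)
      then show ?thesis by (simp only: sum_subtractf)
    qed
    also have "(\<Sum>m\<le>M. (\<Sum>k\<le>N. X i m k w * Q k r w) * f m) = (\<Sum>k\<le>N. Q k r w * (\<Sum>m\<le>M. X i m k w * f m))"
      by (simp only: sum_distrib_left sum_distrib_right mult_ac) (rule sum.swap)
    also have "\<dots> = (\<Sum>k\<le>N. - (Q k r w * G k))"
    proof (rule sum.cong[OF refl])
      fix k
      show "Q k r w * (\<Sum>m\<le>M. X i m k w * f m) = - (Q k r w * G k)"
      proof (cases "k > r + d")
        case True
        then show ?thesis using Q_lower[OF w] by simp
      next
        case False
        then show ?thesis using Gm[of k M] by (simp add: M_def)
      qed
    qed
    also have "\<dots> = - (\<Sum>k\<le>N. Q k r w * G k)" by (rule sum_negf)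
    also have "(\<Sum>m\<le>M. (\<Sum>k\<le>N. Q m k w * X i k r w) * f m) = (\<Sum>k\<le>N. X i k r w * (\<Sum>m\<le>M. Q m k w * f m))"
      by (simp only: sum_distrib_left sum_distrib_right mult_ac) (rule sum.swap)
    also have "\<dots> = (\<Sum>k\<le>N. x * (X i k r w * f k))"
    proof (rule sum.cong[OF refl])
      fix k
      show "X i k r w * (\<Sum>m\<le>M. Q m k w * f m) = x * (X i k r w * f k)"
      \<comment> \<open>Outside these bounds \<open>X i\<close> vanishes; inside them
        \<open>r > ex i\<close> keeps \<open>k\<close> away from the discarded column 0.\<close>
      proof (cases "r > k + ex i \<or> k > r + b")
        case True
        then have "X i k r w = 0"
          using X_upper[OF i w] X_lower[OF i w, of r k] exponents_le(2)[OF i] by auto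
        then show ?thesis by simp
      next
        case False
        then have "k \<ge> 1" "k \<le> r + b" using r by auto
        then show ?thesis using rel' by simp
      qed
    qed
    also have "\<dots> = - x * G r"
    proof -
      have "G r = - (\<Sum>l\<le>N. X i l r w * f l)" by (rule Gm) (simp add: N_def M_def)
      then show ?thesis by (simp add: sum_distrib_left[symmetric])
    qed
    finally show ?thesis by simp
  qed
  have B: "(\<Sum>k\<le>d + 1. pd i (\<lambda>w. Q (r - 1 + k) r w - (if k = 1 then x else 0)) w * f (r - 1 + k)) = (\<Sum>m\<le>M. pd i (Q m r) w * f m)"
  proof -
    have "pd i (\<lambda>w. Q (r - 1 + k) r w - (if k = 1 then x else 0)) w = pd i (Q (r - 1 + k) r) w" for k
      using pd_diff[OF hol_Q hol_const w i] by simp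
    then have "(\<Sum>k\<le>d + 1. pd i (\<lambda>w. Q (r - 1 + k) r w - (if k = 1 then x else 0)) w * f (r - 1 + k)) = (\<Sum>k\<le>d + 1. pd i (Q (r - 1 + k) r) w * f (r - 1 + k))"
      by simp
    also have "\<dots> = (\<Sum>m\<le>M. pd i (Q m r) w * f m)"
      by (rule sum_window[symmetric]) (use pdQ_lower[OF w i] pdQ_upper[OF w i] r1 in \<open>auto simp: M_def\<close>)
    finally show ?thesis .
  qed
  have C: "(\<Sum>k\<le>d + 1. (Q (r - 1 + k) r w - (if k = 1 then x else 0)) * G (r - 1 + k)) = (\<Sum>m\<le>N. Q m r w * G m) - x * G r"
    by (rule column_sum[OF w r1]) (simp add: N_def M_def)
  show "(\<Sum>k\<le>d + 1. pd i (\<lambda>w. Q (r - 1 + k) r w - (if k = 1 then x else 0)) w * f (r - 1 + k)) +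
      (\<Sum>k\<le>d + 1. (Q (r - 1 + k) r w - (if k = 1 then x else 0)) * (\<Sum>l\<le>r - 1 + k + b. - X i l (r - 1 + k) w * f l)) = 0"
  proof -
    have "(\<Sum>k\<le>d + 1. pd i (\<lambda>w. Q (r - 1 + k) r w - (if k = 1 then x else 0)) w * f (r - 1 + k)) +
        (\<Sum>k\<le>d + 1. (Q (r - 1 + k) r w - (if k = 1 then x else 0)) * G (r - 1 + k)) = 0"
      unfolding B C A by simp
    then show ?thesis unfolding G_def .
  qed
qed (use dom sc in auto)

end

section \<open>Moments as holomorphic functions of the potentials\<close>

text \<open>Both coefficient families become one function on a disjoint sum, so that a single index
  set of coordinates can be used.\<close>

definition enc :: "params \<Rightarrow> nat + nat \<Rightarrow> complex" where
  "enc w = case_sum (fst w) (snd w)"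

definition dec :: "(nat + nat \<Rightarrow> complex) \<Rightarrow> params" where
  "dec f = (\<lambda>k. f (Inl k), \<lambda>k. f (Inr k))"

lemma dec_enc [simp]: "dec (enc w) = w" and enc_dec [simp]: "enc (dec f) = f"
  by (auto simp: enc_def dec_def fun_eq_iff split: sum.split)

lemma enc_upd_u: "enc ((fst w)(k := z), snd w) = (enc w)(Inl k := z)"
  and enc_upd_v: "enc (fst w, (snd w)(k := z)) = (enc w)(Inr k := z)"
  by (auto simp: enc_def fun_eq_iff split: sum.split)

lemma continuous_on_enc: "continuous_on A enc"
proof (rule continuous_on_coordinatewise_then_product)
  fix i :: "nat + nat"
  have "continuous_on A (\<lambda>w::params. fst w k)" "continuous_on A (\<lambda>w::params. snd w k)" for k
    by (rule continuous_on_product_then_coordinatewise, intro continuous_on_fst continuous_on_snd continuous_on_id)+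
  then show "continuous_on A (\<lambda>w. enc w i)" by (cases i) (auto simp: enc_def)
qed

lemma continuous_on_dec: "continuous_on A dec"
  unfolding dec_def
  by (intro continuous_on_Pair continuous_on_coordinatewise_then_product)
     (rule continuous_on_product_then_coordinatewise, rule continuous_on_id)+

text \<open>\<open>enc\<close> and \<open>dec\<close> are mutually inverse and continuous: loops are
  pulled back by \<open>dec\<close>, the homotopy is pushed forward by \<open>enc\<close>.\<close>

lemma simply_connected_enc:
  assumes "simply_connected D"
  shows "simply_connected (enc ` D)"
  unfolding simply_connected_def
proof (intro allI impI)
  fix p q assume pq: "path p \<and> pathfinish p = pathstart p \<and> path_image p \<subseteq> enc ` D \<and>
    path q \<and> pathfinish q = pathstart q \<and> path_image q \<subseteq> enc ` D"
  have path: "path (dec \<circ> g) \<and> pathfinish (dec \<circ> g) = pathstart (dec \<circ> g) \<and> path_image (dec \<circ> g) \<subseteq> D"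
    if "path g" "pathfinish g = pathstart g" "path_image g \<subseteq> enc ` D" for g
  proof (intro conjI)
    show "path (dec \<circ> g)" using that(1) unfolding path_def by (rule continuous_on_compose[OF _ continuous_on_dec])
    show "path_image (dec \<circ> g) \<subseteq> D" using that(3) by (fastforce simp: path_image_def)
  qed (use that in \<open>auto simp: pathfinish_def pathstart_def\<close>)
  have "homotopic_loops D (dec \<circ> p) (dec \<circ> q)"
    using assms[unfolded simply_connected_def, rule_format, of "dec \<circ> p" "dec \<circ> q"] path[of p] path[of q] pq by blast
  then have "homotopic_loops (enc ` D) (enc \<circ> (dec \<circ> p)) (enc \<circ> (dec \<circ> q))"
    by (rule homotopic_loops_continuous_image[OF _ continuous_on_enc]) auto
  moreover have "enc \<circ> (dec \<circ> g) = g" for g :: "real \<Rightarrow> nat + nat \<Rightarrow> complex" by (simp add: fun_eq_iff)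
  ultimately show "homotopic_loops (enc ` D) p q" by simp
qed

definition coords :: "nat \<Rightarrow> nat \<Rightarrow> (nat + nat) set" where
  "coords d1 d2 = Inl ` {1..d1 + 1} \<union> Inr ` {1..d2 + 1}"

definition xexp :: "nat + nat \<Rightarrow> nat" where "xexp i = (case i of Inl k \<Rightarrow> k | Inr k \<Rightarrow> 0)"
definition yexp :: "nat + nat \<Rightarrow> nat" where "yexp i = (case i of Inl k \<Rightarrow> 0 | Inr k \<Rightarrow> k)"
text \<open>The factor \<open>1 / K\<close> in front of the monomials of the potentials; it becomes
  the \<open>\<kappa>\<close> of the biorthogonal family.\<close>

definition scale :: "nat + nat \<Rightarrow> complex" where
  "scale i = (case i of Inl k \<Rightarrow> 1 / of_nat k | Inr k \<Rightarrow> 1 / of_nat k)"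

lemma finite_coords: "finite (coords d1 d2)"
  by (simp add: coords_def)

text \<open>\<open>param_space\<close> pins all coefficients off \<open>coords d1 d2\<close> to
  zero, so a relatively open set contains a polydisc in these coordinates around each of its
  points.\<close>

lemma pdom_enc:
  assumes "param_domain d1 d2 D"
  shows "pdom (coords d1 d2) (enc ` D)"
proof -
  obtain T where T: "open T" "D = param_space d1 d2 \<inter> T"
    using assms by (auto simp: param_domain_def openin_open)
  have off: "enc w i = 0" if "w \<in> D" "i \<notin> coords d1 d2" for w i
  proof -
    obtain u v where w: "w = (u, v)" by (cases w)
    then have "\<forall>k. k \<notin> {1..d1 + 1} \<longrightarrow> u k = 0" "\<forall>k. k \<notin> {1..d2 + 1} \<longrightarrow> v k = 0"
      using T(2) that(1) by (auto simp only: param_space_def mem_Collect_eq prod.case Int_iff)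
    moreover have "k \<notin> {1..d1 + 1}" if "i = Inl k" for k using \<open>i \<notin> coords d1 d2\<close> that unfolding coords_def by blast
    moreover have "k \<notin> {1..d2 + 1}" if "i = Inr k" for k using \<open>i \<notin> coords d1 d2\<close> that unfolding coords_def by blast
    ultimately show ?thesis by (cases i) (simp_all add: enc_def w del: atLeastAtMost_iff)
  qed
  show ?thesis unfolding pdom_def
  proof (intro conjI ballI allI impI)
    fix w assume w: "w \<in> enc ` D"
    have "open (dec -` T)" using T(1) continuous_on_dec[of UNIV] by (simp add: open_vimage)
    moreover have "w \<in> dec -` T" using w T(2) by auto
    ultimately obtain \<rho> where \<rho>: "\<rho> > 0" "pball (coords d1 d2) w \<rho> \<subseteq> dec -` T"
      using pball_sub_nbhd[OF finite_coords] by metis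
    have "pball (coords d1 d2) w \<rho> \<subseteq> enc ` D"
    proof
      fix f assume f: "f \<in> pball (coords d1 d2) w \<rho>"
      have f0: "f i = 0" if "i \<notin> coords d1 d2" for i
        using f w off that by (auto simp: pball_def)
      have "f (Inl k) = 0" if "k \<notin> {1..d1 + 1}" for k by (rule f0) (use that in \<open>unfold coords_def, blast\<close>)
      moreover have "f (Inr k) = 0" if "k \<notin> {1..d2 + 1}" for k by (rule f0) (use that in \<open>unfold coords_def, blast\<close>)
      ultimately have "dec f \<in> param_space d1 d2" unfolding dec_def param_space_def by blast
      moreover have "dec f \<in> T" using \<rho>(2) f by blast
      ultimately have "dec f \<in> D" using T(2) by blast
      then show "f \<in> enc ` D" by (metis enc_dec image_eqI)
    qed
    then show "\<exists>\<rho>>0. pball (coords d1 d2) w \<rho> \<subseteq> enc ` D" using \<rho>(1) by blast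
  next
    fix w w' i assume "w \<in> enc ` D" "w' \<in> enc ` D" "i \<notin> coords d1 d2"
    then show "w' i = w i" using off by auto
  qed (rule finite_coords)
qed

section \<open>Dominated estimates for the moments\<close>

text \<open>\<open>norm a\<close> is at most \<open>\<bar>Re a\<bar> + \<bar>Im a\<bar>\<close>, and
  \<open>x * y \<le> x^2 + y^2\<close> separates the two exponentials at the price of doubling
  \<open>\<rho>\<close>; bounding \<open>exp \<bar>t\<bar>\<close> by
  \<open>exp t + exp (- t)\<close> produces the four directions.\<close>

lemma exp_modulus_le_directions:
  fixes a :: complex and \<rho> :: real
  assumes "\<rho> \<ge> 0"
  shows "exp (\<rho> * norm a) \<le> (\<Sum>\<epsilon>\<in>{1, -1, \<i>, -\<i>}. norm (exp (- (of_real (2 * \<rho>) * \<epsilon> * a))))"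
proof -
  have "exp (\<rho> * norm a) \<le> exp (\<rho> * \<bar>Re a\<bar> + \<rho> * \<bar>Im a\<bar>)"
    using cmod_le[of a] assms by (simp add: mult_left_mono flip: distrib_left)
  also have "\<dots> = exp (\<rho> * \<bar>Re a\<bar>) * exp (\<rho> * \<bar>Im a\<bar>)" by (rule exp_add)
  also have "\<dots> \<le> (exp (\<rho> * \<bar>Re a\<bar>))\<^sup>2 + (exp (\<rho> * \<bar>Im a\<bar>))\<^sup>2"
  proof -
    have "x * y \<le> x\<^sup>2 + y\<^sup>2" if "x \<ge> 0" "y \<ge> 0" for x y :: real
      using sum_squares_bound[of x y] mult_nonneg_nonneg[OF that] unfolding mult.assoc by linarith
    then show ?thesis by simp
  qed
  also have "\<dots> = exp \<bar>2 * \<rho> * Re a\<bar> + exp \<bar>2 * \<rho> * Im a\<bar>"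
    using assms by (simp add: power2_eq_square abs_mult mult.assoc flip: exp_add)
  also have "\<dots> \<le> (exp (2 * \<rho> * Re a) + exp (- (2 * \<rho> * Re a))) + (exp (2 * \<rho> * Im a) + exp (- (2 * \<rho> * Im a)))"
    by (intro add_mono) (auto simp: abs_if)
  also have "\<dots> = (\<Sum>\<epsilon>\<in>{1, -1, \<i>, -\<i>}. norm (exp (- (of_real (2 * \<rho>) * \<epsilon> * a))))"
    by (simp add: complex_eq_iff norm_exp_eq_Re)
  finally show ?thesis .
qed

lemma cmod_exp_minus_1_le: "norm (exp z - 1) \<le> norm z * exp (norm z)" for z :: complex
proof -
  have "norm (exp z - (\<Sum>k\<le>0. z ^ k / fact k)) \<le> exp (norm z) * norm z ^ Suc 0 / fact 0"
    by (rule Taylor_exp_field)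
  then show ?thesis by (simp add: mult.commute)
qed

lemma cmod_exp_minus_linear_le: "norm (exp z - 1 - z) \<le> (norm z)\<^sup>2 * exp (norm z)" for z :: complex
proof -
  have "norm (exp z - (\<Sum>k\<le>1. z ^ k / fact k)) \<le> exp (norm z) * norm z ^ Suc 1 / fact 1"
    by (rule Taylor_exp_field)
  then show ?thesis by (simp add: mult.commute power2_eq_square algebra_simps)
qed

locale moments =
  fixes d1 d2 :: nat and \<Gamma>x \<Gamma>y :: "real \<Rightarrow> complex" and D :: "params set"
  assumes domain: "param_domain d1 d2 D"
    and convergent: "\<And>w. w \<in> D \<Longrightarrow> convergent_integrals d1 d2 \<Gamma>x \<Gamma>y w"
begin

abbreviation "I \<equiv> coords d1 d2"
definition "E = enc ` D"

lemma dom: "pdom I E"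
  unfolding E_def by (rule pdom_enc[OF domain])

lemma dec_D: "w \<in> E \<Longrightarrow> dec w \<in> D"
  by (auto simp: E_def)

definition mono :: "nat + nat \<Rightarrow> complex \<Rightarrow> complex \<Rightarrow> complex" where
  "mono i x y = scale i * x ^ xexp i * y ^ yexp i"

lemma potential_sum:
  "potential d1 (fst (dec w)) x + potential d2 (snd (dec w)) y = (\<Sum>i\<in>I. w i * mono i x y)"
proof -
  have "(\<Sum>i\<in>I. w i * mono i x y) = (\<Sum>i\<in>Inl ` {1..d1 + 1}. w i * mono i x y) + (\<Sum>i\<in>Inr ` {1..d2 + 1}. w i * mono i x y)"
    unfolding coords_def by (rule sum.union_disjoint) auto
  also have "(\<Sum>i\<in>Inl ` {1..d1 + 1}. w i * mono i x y) = potential d1 (fst (dec w)) x"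
    by (subst sum.reindex) (auto simp: potential_def dec_def mono_def scale_def xexp_def yexp_def intro!: sum.cong)
  also have "(\<Sum>i\<in>Inr ` {1..d2 + 1}. w i * mono i x y) = potential d2 (snd (dec w)) y"
    by (subst sum.reindex) (auto simp: potential_def dec_def mono_def scale_def xexp_def yexp_def intro!: sum.cong)
  finally show ?thesis by simp
qed

lemma weight_shift:
  "weight d1 d2 (dec w') x y = weight d1 d2 (dec w) x y * exp (- (\<Sum>i\<in>I. (w' i - w i) * mono i x y))"
proof -
  have "- potential d1 (fst (dec w')) x - potential d2 (snd (dec w')) y + x * y =
      (- potential d1 (fst (dec w)) x - potential d2 (snd (dec w)) y + x * y) + (- (\<Sum>i\<in>I. (w' i - w i) * mono i x y))"
    using potential_sum[of w' x y] potential_sum[of w x y]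
    by (simp add: left_diff_distrib sum_subtractf algebra_simps)
  then show ?thesis unfolding weight_def by (simp only: exp_add)
qed

definition integrand :: "(nat + nat \<Rightarrow> complex) \<Rightarrow> complex poly \<Rightarrow> complex poly \<Rightarrow> real \<times> real \<Rightarrow> complex" where
  "integrand w f g = (\<lambda>(s, t). poly f (\<Gamma>x s) * poly g (\<Gamma>y t) * weight d1 d2 (dec w) (\<Gamma>x s) (\<Gamma>y t)
     * vector_derivative \<Gamma>x (at s) * vector_derivative \<Gamma>y (at t))"

definition mono' :: "nat + nat \<Rightarrow> real \<times> real \<Rightarrow> complex" where
  "mono' i z = mono i (\<Gamma>x (fst z)) (\<Gamma>y (snd z))"

text \<open>The pairing as one integral over the product measure, where domination applies;
  \<open>pairing_eq\<close> is Fubini's theorem.\<close>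

definition J :: "(nat + nat \<Rightarrow> complex) \<Rightarrow> complex poly \<Rightarrow> complex poly \<Rightarrow> complex" where
  "J w f g = (LINT z|(lborel \<Otimes>\<^sub>M lborel). integrand w f g z)"

lemma integrable_integrand: "w \<in> E \<Longrightarrow> integrable (lborel \<Otimes>\<^sub>M lborel) (integrand w f g)"
  using convergent[OF dec_D] unfolding convergent_integrals_def integrand_def by blast

lemma integrand_shift: "integrand w' f g z = integrand w f g z * exp (- (\<Sum>i\<in>I. (w' i - w i) * mono' i z))"
  unfolding integrand_def case_prod_unfold weight_shift[of w' _ _ w] mono'_def by (simp add: mult_ac)

lemma integrand_shift_upd:
  assumes "i \<in> I"
  shows "integrand (w(i := w i + c)) f g z = integrand w f g z * exp (- (c * mono' i z))"
proof -
  have "(\<Sum>j\<in>I. ((w(i := w i + c)) j - w j) * mono' j z) = (\<Sum>j\<in>I. if j = i then c * mono' i z else 0)"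
    by (rule sum.cong) auto
  then show ?thesis using integrand_shift[of "w(i := w i + c)" f g z w] assms finite_coords by simp
qed

lemma integrand_mono: "mono' i z * integrand w f g z = scale i * integrand w (monom 1 (xexp i) * f) (monom 1 (yexp i) * g) z"
  unfolding integrand_def mono'_def mono_def case_prod_unfold by (simp add: poly_monom mult_ac)

lemma pairing_eq: "w \<in> E \<Longrightarrow> pairing d1 d2 \<Gamma>x \<Gamma>y (dec w) f g = J w f g"
proof -
  assume w: "w \<in> E"
  have "pairing d1 d2 \<Gamma>x \<Gamma>y (dec w) f g = (LINT s|lborel. LINT t|lborel. integrand w f g (s, t))"
    unfolding pairing_def contour_int_def integrand_def Bochner_Integration.integral_mult_left_zero[symmetric]
    by (intro Bochner_Integration.integral_cong refl) (simp only: prod.case mult_ac)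
  also have "\<dots> = J w f g" unfolding J_def by (rule lborel_pair.integral_fst'[OF integrable_integrand[OF w]])
  finally show ?thesis .
qed

text \<open>On all of the integration domain \<open>exp (\<rho> |m|)\<close> is bounded by the sum of the four weights
  obtained by moving the coefficient of the monomial \<open>m\<close> by \<open>2 \<rho> \<epsilon>\<close>, \<open>\<epsilon>\<^sup>4 = 1\<close>; all of them are
  integrable by assumption, and this provides the dominating function.\<close>

lemma domination_aux:
  assumes fin: "finite K" and \<rho>: "\<rho> \<ge> 0" and K: "K \<subseteq> I"
  shows "(\<And>w'. (\<And>i. i \<notin> K \<Longrightarrow> w' i = w i) \<Longrightarrow> (\<And>i. norm (w' i - w i) \<le> 2 * \<rho>) \<Longrightarrow> w' \<in> E) \<Longrightarrow>
    \<exists>G. integrable (lborel \<Otimes>\<^sub>M lborel) G \<and> (\<forall>z. exp (\<rho> * (\<Sum>i\<in>K. norm (mono' i z))) * norm (integrand w f g z) \<le> (G z :: real))"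
  using fin K
proof (induction K arbitrary: w rule: finite_induct)
  case empty
  have "w \<in> E" by (rule empty) (use \<rho> in auto)
  then show ?case
    by (intro exI[of _ "\<lambda>z. norm (integrand w f g z)"]) (auto intro: integrable_integrand)
next
  case (insert k K)
  \<comment> \<open>The removed monomial moves its own coordinate to four points, and the induction
    hypothesis is used at each of them; the premise on \<open>w'\<close> keeps all of these in
    \<open>E\<close>.\<close>
  define c where "c = (\<lambda>\<epsilon>. complex_of_real (2 * \<rho>) * \<epsilon>)"
  define R where "R = {1, -1, \<i>, -\<i>}"
  have "\<exists>G. integrable (lborel \<Otimes>\<^sub>M lborel) G \<and>
      (\<forall>z. exp (\<rho> * (\<Sum>i\<in>K. norm (mono' i z))) * norm (integrand (w(k := w k + c \<epsilon>)) f g z) \<le> (G z :: real))" if \<epsilon>: "\<epsilon> \<in> R" for \<epsilon>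
  proof (rule insert.IH)
    have ne: "norm \<epsilon> = 1" using \<epsilon> by (auto simp: R_def)
    show "w' \<in> E" if w': "\<And>i. i \<notin> K \<Longrightarrow> w' i = (w(k := w k + c \<epsilon>)) i" "\<And>i. norm (w' i - (w(k := w k + c \<epsilon>)) i) \<le> 2 * \<rho>" for w'
    proof (rule insert.prems(1))
      show "w' i = w i" if "i \<notin> insert k K" for i using w'(1)[of i] that by auto
      show "norm (w' i - w i) \<le> 2 * \<rho>" for i
      proof (cases "i = k")
        case True
        then have "w' i - w i = c \<epsilon>" using w'(1)[of k] insert.hyps(2) by simp
        then show ?thesis using ne \<rho> by (simp add: c_def norm_mult)
      next
        case False
        then show ?thesis using w'(2)[of i] by simp
      qed
    qed
  qed (use insert.prems in auto)
  then obtain G where G: "\<And>\<epsilon>. \<epsilon> \<in> R \<Longrightarrow> integrable (lborel \<Otimes>\<^sub>M lborel) (G \<epsilon>)"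
    "\<And>\<epsilon> z. \<epsilon> \<in> R \<Longrightarrow> exp (\<rho> * (\<Sum>i\<in>K. norm (mono' i z))) * norm (integrand (w(k := w k + c \<epsilon>)) f g z) \<le> (G \<epsilon> z :: real)"
    by metis
  have kI: "k \<in> I" using insert.prems by blast
  show ?case
  proof (intro exI[of _ "\<lambda>z. \<Sum>\<epsilon>\<in>R. G \<epsilon> z"] conjI allI)
    show "integrable (lborel \<Otimes>\<^sub>M lborel) (\<lambda>z. \<Sum>\<epsilon>\<in>R. G \<epsilon> z)"
      by (rule Bochner_Integration.integrable_sum) (rule G(1))
    fix z
    define S where "S = exp (\<rho> * (\<Sum>i\<in>K. norm (mono' i z)))"
    have "exp (\<rho> * (\<Sum>i\<in>insert k K. norm (mono' i z))) = exp (\<rho> * norm (mono' k z)) * S"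
      using insert.hyps by (simp add: S_def distrib_left exp_add)
    also have "\<dots> * norm (integrand w f g z) \<le> (\<Sum>\<epsilon>\<in>R. norm (exp (- (c \<epsilon> * mono' k z)))) * S * norm (integrand w f g z)"
      using exp_modulus_le_directions[OF \<rho>, of "mono' k z"] unfolding R_def c_def
      by (intro mult_right_mono) (auto simp: S_def)
    also have "\<dots> = (\<Sum>\<epsilon>\<in>R. S * norm (integrand (w(k := w k + c \<epsilon>)) f g z))"
      by (simp only: integrand_shift_upd[OF kI] sum_distrib_right sum_distrib_left norm_mult mult_ac)
    also have "\<dots> \<le> (\<Sum>\<epsilon>\<in>R. G \<epsilon> z)" by (rule sum_mono) (use G(2) in \<open>simp add: S_def\<close>)
    finally show "exp (\<rho> * (\<Sum>i\<in>insert k K. norm (mono' i z))) * norm (integrand w f g z) \<le> (\<Sum>\<epsilon>\<in>R. G \<epsilon> z)" .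
  qed
qed

lemma domination:
  assumes w: "w \<in> E"
  obtains \<rho> G where "\<rho> > 0" "pball I w \<rho> \<subseteq> E" "integrable (lborel \<Otimes>\<^sub>M lborel) G"
    "\<And>z. exp (\<rho> * (\<Sum>i\<in>I. norm (mono' i z))) * norm (integrand w f g z) \<le> (G z :: real)"
proof -
  obtain \<rho>' where \<rho>': "\<rho>' > 0" "pball I w \<rho>' \<subseteq> E" using pdom_pball[OF dom w] .
  \<comment> \<open>A third, so that shifts of size \<open>2 * \<rho>\<close> remain strictly inside
    the polydisc of radius \<open>\<rho>'\<close>.\<close>
  define \<rho> where "\<rho> = \<rho>' / 3"
  have \<rho>: "\<rho> > 0" using \<rho>' by (simp add: \<rho>_def)
  have "w' \<in> E" if "\<And>i. i \<notin> I \<Longrightarrow> w' i = w i" "\<And>i. norm (w' i - w i) \<le> 2 * \<rho>" for w'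
  proof (rule subsetD[OF \<rho>'(2)])
    have "norm (w' i - w i) < \<rho>'" for i using that(2)[of i] \<rho>'(1) by (simp add: \<rho>_def)
    then show "w' \<in> pball I w \<rho>'" using that(1) by (simp add: pball_def)
  qed
  then have "\<exists>G. integrable (lborel \<Otimes>\<^sub>M lborel) G \<and> (\<forall>z. exp (\<rho> * (\<Sum>i\<in>I. norm (mono' i z))) * norm (integrand w f g z) \<le> (G z :: real))"
    using \<rho> by (intro domination_aux finite_coords) auto
  then obtain G where "integrable (lborel \<Otimes>\<^sub>M lborel) G"
    "\<forall>z. exp (\<rho> * (\<Sum>i\<in>I. norm (mono' i z))) * norm (integrand w f g z) \<le> (G z :: real)" by blast
  moreover have "pball I w \<rho> \<subseteq> E" using pball_mono[of \<rho> \<rho>' I w] \<rho>' by (auto simp: \<rho>_def)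
  ultimately show ?thesis using that[of \<rho> G] \<rho> by blast
qed

text \<open>The Taylor remainder of the exponential is at most
  \<open>norm c ^ 2 * a ^ 2 * exp (norm c * a)\<close>, with \<open>a\<close> the modulus of the
  monomial. For \<open>norm c < \<rho> / 2\<close> one half of the dominating exponent pays for
  \<open>a ^ 2\<close>, the other for the exponential.\<close>

lemma J_DERIV:
  assumes w: "w \<in> E" and i: "i \<in> I"
  shows "((\<lambda>c. J (w(i := c)) f g) has_field_derivative - scale i * J w (monom 1 (xexp i) * f) (monom 1 (yexp i) * g)) (at (w i))"
proof -
  obtain \<rho> G where G: "\<rho> > 0" "pball I w \<rho> \<subseteq> E" "integrable (lborel \<Otimes>\<^sub>M lborel) G"
    "\<And>z. exp (\<rho> * (\<Sum>i\<in>I. norm (mono' i z))) * norm (integrand w f g z) \<le> (G z :: real)"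
    using domination[OF w, of f g] by blast
  define J' where "J' = scale i * J w (monom 1 (xexp i) * f) (monom 1 (yexp i) * g)"
  \<comment> \<open>With \<open>y = \<rho> / 2 * a\<close> one has
    \<open>a^2 = 4 / \<rho>^2 * y^2\<close> and \<open>y^2 \<le> 2 * exp y\<close>, hence the
    8.\<close>
  define C where "C = 8 / \<rho>\<^sup>2 * (LINT z|(lborel \<Otimes>\<^sub>M lborel). G z)"
  have err: "norm (J (w(i := w i + c)) f g - J w f g + c * J') \<le> C * (norm c)\<^sup>2" if c: "norm c < \<rho> / 2" for c
  proof -
    have wc: "w(i := w i + c) \<in> E"
      by (rule subsetD[OF G(2) pball_upd[OF i pball_self[OF G(1)]]]) (use c G(1) in auto)
    define H where "H = (\<lambda>z. integrand (w(i := w i + c)) f g z - integrand w f g z + c * (mono' i z * integrand w f g z))"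
    note int = integrable_integrand[OF wc, of f g] integrable_integrand[OF w, of f g]
      integrable_integrand[OF w, of "monom 1 (xexp i) * f" "monom 1 (yexp i) * g"]
    have "J (w(i := w i + c)) f g - J w f g + c * J' = (LINT z|(lborel \<Otimes>\<^sub>M lborel). H z)"
      unfolding H_def J_def J'_def integrand_mono using int by simp
    also have "norm \<dots> \<le> (LINT z|(lborel \<Otimes>\<^sub>M lborel). 8 / \<rho>\<^sup>2 * (norm c)\<^sup>2 * G z)"
    proof (rule Bochner_Integration.integral_norm_bound_integral)
      show "integrable (lborel \<Otimes>\<^sub>M lborel) H" unfolding H_def integrand_mono using int by simp
      show "integrable (lborel \<Otimes>\<^sub>M lborel) (\<lambda>z. 8 / \<rho>\<^sup>2 * (norm c)\<^sup>2 * G z)" using G(3) by simp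
      fix z
      define a where "a = norm (mono' i z)"
      have a0: "a \<ge> 0" by (simp add: a_def)
      have "H z = integrand w f g z * (exp (- (c * mono' i z)) - 1 - (- (c * mono' i z)))"
        unfolding H_def integrand_shift_upd[OF i] by (simp add: algebra_simps)
      then have "norm (H z) \<le> norm (integrand w f g z) * ((norm c * a)\<^sup>2 * exp (norm c * a))"
        using cmod_exp_minus_linear_le[of "- (c * mono' i z)"] unfolding a_def
        by (simp add: norm_mult mult_left_mono)
      also have "(norm c * a)\<^sup>2 * exp (norm c * a) \<le> (norm c)\<^sup>2 * (8 / \<rho>\<^sup>2 * exp (\<rho> * (\<Sum>i\<in>I. norm (mono' i z))))"
      proof -
        define y where "y = \<rho> / 2 * a"
        have y0: "y \<ge> 0" using a0 G(1) by (simp add: y_def)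
        have "y\<^sup>2 \<le> 2 * exp y" using exp_lower_Taylor_quadratic[OF y0] y0 by simp
        moreover have "a\<^sup>2 = 4 / \<rho>\<^sup>2 * y\<^sup>2" using G(1) by (simp add: y_def power_mult_distrib power_divide)
        ultimately have a2: "a\<^sup>2 \<le> 8 / \<rho>\<^sup>2 * exp y" using G(1) by (simp add: field_simps)
        have "exp (norm c * a) \<le> exp y" using c mult_right_mono[of "norm c" "\<rho> / 2" a, OF _ a0] by (simp add: y_def)
        then have "a\<^sup>2 * exp (norm c * a) \<le> 8 / \<rho>\<^sup>2 * exp y * exp y"
          using a2 by (intro mult_mono) auto
        also have "\<dots> = 8 / \<rho>\<^sup>2 * (exp y * exp y)" by (rule mult.assoc)
        also have "exp y * exp y = exp (\<rho> * a)" by (simp add: y_def flip: exp_add)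
        finally have "a\<^sup>2 * exp (norm c * a) \<le> 8 / \<rho>\<^sup>2 * exp (\<rho> * a)" .
        also have "\<dots> \<le> 8 / \<rho>\<^sup>2 * exp (\<rho> * (\<Sum>i\<in>I. norm (mono' i z)))"
          unfolding a_def using G(1) member_le_sum[OF i, of "\<lambda>i. norm (mono' i z)"] finite_coords
          by (intro mult_left_mono) auto
        finally show ?thesis unfolding power_mult_distrib mult.assoc by (rule mult_left_mono) simp
      qed
      then have "norm (integrand w f g z) * ((norm c * a)\<^sup>2 * exp (norm c * a)) \<le>
          norm (integrand w f g z) * ((norm c)\<^sup>2 * (8 / \<rho>\<^sup>2 * exp (\<rho> * (\<Sum>i\<in>I. norm (mono' i z)))))"
        by (rule mult_left_mono) simp
      also have "\<dots> = 8 / \<rho>\<^sup>2 * (norm c)\<^sup>2 * (exp (\<rho> * (\<Sum>i\<in>I. norm (mono' i z))) * norm (integrand w f g z))"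
        by (simp add: mult_ac)
      also have "\<dots> \<le> 8 / \<rho>\<^sup>2 * (norm c)\<^sup>2 * G z" by (intro mult_left_mono G(4)) simp
      finally show "norm (H z) \<le> 8 / \<rho>\<^sup>2 * (norm c)\<^sup>2 * G z" by simp
    qed
    also have "\<dots> = C * (norm c)\<^sup>2" by (simp add: C_def)
    finally show ?thesis .
  qed
  have "((\<lambda>c. (J (w(i := w i + c)) f g - J w f g) / c) \<longlongrightarrow> - J') (at 0)"
  proof (rule LIM_zero_cancel, rule Lim_null_comparison)
    show "\<forall>\<^sub>F c in at 0. norm ((J (w(i := w i + c)) f g - J w f g) / c - - J') \<le> C * norm c"
    proof -
      have "\<forall>\<^sub>F c in at 0. norm (c::complex) < \<rho> / 2" 
        unfolding eventually_at using G(1) by (intro exI[of _ "\<rho> / 2"]) (auto simp: dist_norm)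
      moreover have "\<forall>\<^sub>F c in at 0. (c::complex) \<noteq> 0" by (simp add: eventually_at_filter)
      ultimately show ?thesis
      proof eventually_elim
        case (elim c)
        have "(J (w(i := w i + c)) f g - J w f g) / c - - J' = (J (w(i := w i + c)) f g - J w f g + c * J') / c"
          using elim(2) by (simp add: field_simps)
        then have "norm ((J (w(i := w i + c)) f g - J w f g) / c - - J') \<le> C * (norm c)\<^sup>2 / norm c"
          using err[OF elim(1)] by (simp add: norm_divide divide_right_mono)
        then show ?case using elim(2) by (simp add: power2_eq_square)
      qed
    qed
    have "((\<lambda>c::complex. C * norm c) \<longlongrightarrow> C * norm (0::complex)) (at 0)" by (intro tendsto_intros)
    then show "((\<lambda>c::complex. C * norm c) \<longlongrightarrow> 0) (at 0)" by simp
  qed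
  then show ?thesis unfolding DERIV_def J'_def by simp
qed

text \<open>The same splitting of the dominating exponent, now with the remainder of order zero and
  with all coordinates moving at once.\<close>

lemma J_continuous: "continuous_on E (\<lambda>w. J w f g)"
  unfolding continuous_on_pdom_iff[OF dom]
proof (intro ballI allI impI)
  fix w and e :: real assume w: "w \<in> E" and e: "e > 0"
  obtain \<rho> G where G: "\<rho> > 0" "pball I w \<rho> \<subseteq> E" "integrable (lborel \<Otimes>\<^sub>M lborel) G"
    "\<And>z. exp (\<rho> * (\<Sum>i\<in>I. norm (mono' i z))) * norm (integrand w f g z) \<le> (G z :: real)"
    using domination[OF w, of f g] by blast
  define C where "C = 2 / \<rho> * (LINT z|(lborel \<Otimes>\<^sub>M lborel). G z)"
  have Gnn: "0 \<le> G z" for z using G(4)[of z] by (rule order_trans[rotated]) simp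
  have C: "C \<ge> 0" using G(1) Gnn by (simp add: C_def)
  \<comment> \<open>The bound \<open>\<rho> / 2\<close> leaves half of the exponent to absorb the
    factor \<open>S\<close>; \<open>e / (C + 1)\<close> makes the total error smaller than
    \<open>e\<close>, also for \<open>C = 0\<close>.\<close>
  define \<delta> where "\<delta> = min (\<rho> / 2) (e / (C + 1))"
  have \<delta>': "\<delta> \<le> \<rho> / 2" unfolding \<delta>_def by (rule min.cobounded1)
  have \<delta>: "\<delta> > 0" using G(1) e C by (simp add: \<delta>_def)
  have "dist (J w' f g) (J w f g) < e" if w': "w' \<in> pball I w \<delta> \<inter> E" for w'
  proof -
    note int = integrable_integrand[OF IntD2[OF w'], of f g] integrable_integrand[OF w, of f g]
    have "J w' f g - J w f g = (LINT z|(lborel \<Otimes>\<^sub>M lborel). integrand w' f g z - integrand w f g z)"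
      unfolding J_def using int by simp
    also have "norm \<dots> \<le> (LINT z|(lborel \<Otimes>\<^sub>M lborel). \<delta> * (2 / \<rho>) * G z)"
    proof (rule Bochner_Integration.integral_norm_bound_integral)
      show "integrable (lborel \<Otimes>\<^sub>M lborel) (\<lambda>z. integrand w' f g z - integrand w f g z)" using int by simp
      show "integrable (lborel \<Otimes>\<^sub>M lborel) (\<lambda>z. \<delta> * (2 / \<rho>) * G z)" using G(3) by simp
      fix z
      define S where "S = (\<Sum>i\<in>I. norm (mono' i z))"
      define \<eta> where "\<eta> = - (\<Sum>i\<in>I. (w' i - w i) * mono' i z)"
      have S0: "S \<ge> 0" by (simp add: S_def sum_nonneg)
      have "norm \<eta> \<le> (\<Sum>i\<in>I. norm ((w' i - w i) * mono' i z))" unfolding \<eta>_def norm_minus_cancel by (rule norm_sum)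
      also have "\<dots> \<le> (\<Sum>i\<in>I. \<delta> * norm (mono' i z))"
        unfolding norm_mult using w' by (intro sum_mono mult_right_mono) (auto simp: pball_def less_imp_le)
      finally have \<eta>: "norm \<eta> \<le> \<delta> * S" by (simp add: S_def sum_distrib_left)
      have "norm (exp \<eta> - 1) \<le> norm \<eta> * exp (norm \<eta>)" by (rule cmod_exp_minus_1_le)
      also have "\<dots> \<le> \<delta> * S * exp (\<delta> * S)" using \<eta> S0 \<delta> by (intro mult_mono) auto
      also have "\<dots> \<le> \<delta> * S * exp (\<rho> / 2 * S)" using mult_right_mono[OF \<delta>' S0] S0 \<delta> by (intro mult_left_mono) simp_all
      also have "\<dots> \<le> \<delta> * (2 / \<rho> * exp (\<rho> / 2 * S)) * exp (\<rho> / 2 * S)"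
      proof -
        have "\<rho> / 2 * S \<le> exp (\<rho> / 2 * S)" using exp_ge_add_one_self[of "\<rho> / 2 * S"] by linarith
        then have "S \<le> 2 / \<rho> * exp (\<rho> / 2 * S)" using G(1) by (simp add: field_simps)
        then show ?thesis using \<delta> by (intro mult_right_mono mult_left_mono) auto
      qed
      also have "\<dots> = \<delta> * (2 / \<rho>) * exp (\<rho> * S)"
      proof -
        have "exp (\<rho> / 2 * S) * exp (\<rho> / 2 * S) = exp (\<rho> * S)" by (simp flip: exp_add)
        then show ?thesis by (metis mult.assoc)
      qed
      finally have "norm (integrand w f g z) * norm (exp \<eta> - 1) \<le> norm (integrand w f g z) * (\<delta> * (2 / \<rho>) * exp (\<rho> * S))"
        by (rule mult_left_mono) simp
      also have "\<dots> = \<delta> * (2 / \<rho>) * (exp (\<rho> * S) * norm (integrand w f g z))" by (simp only: mult_ac)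
      also have "\<dots> \<le> \<delta> * (2 / \<rho>) * G z" using G(4)[of z] \<delta> G(1) unfolding S_def by (intro mult_left_mono) auto
      finally show "norm (integrand w' f g z - integrand w f g z) \<le> \<delta> * (2 / \<rho>) * G z"
        unfolding integrand_shift[of w' f g z w] \<eta>_def[symmetric] norm_mult[symmetric] by (simp add: right_diff_distrib)
    qed
    also have "\<dots> = \<delta> * C" by (simp add: C_def)
    also have "\<dots> \<le> e / (C + 1) * C" using C by (intro mult_right_mono) (auto simp: \<delta>_def)
    also have "\<dots> < e" using C e by (simp add: field_simps)
    finally show ?thesis by (simp add: dist_norm)
  qed
  then show "\<exists>\<delta>>0. \<forall>w'\<in>pball I w \<delta> \<inter> E. dist (J w' f g) (J w f g) < e" using \<delta> by blast
qed

lemma hol_J: "hol I E (\<lambda>w. J w f g)"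
  by (rule holI[OF J_continuous]) (use J_DERIV in blast)

lemma pd_J: "w \<in> E \<Longrightarrow> i \<in> I \<Longrightarrow> pd i (\<lambda>w. J w f g) w = - scale i * J w (monom 1 (xexp i) * f) (monom 1 (yexp i) * g)"
  by (rule pd_eqI[OF J_DERIV])

lemma J_add_left: "w \<in> E \<Longrightarrow> J w (f + g) h = J w f h + J w g h"
  using integrable_integrand[of w f h] integrable_integrand[of w g h]
  by (simp add: J_def integrand_def case_prod_unfold distrib_right flip: Bochner_Integration.integral_add)

lemma J_add_right: "w \<in> E \<Longrightarrow> J w h (f + g) = J w h f + J w h g"
  using integrable_integrand[of w h f] integrable_integrand[of w h g]
  by (simp add: J_def integrand_def case_prod_unfold distrib_right distrib_left flip: Bochner_Integration.integral_add)

lemma J_smult_left: "J w (Polynomial.smult a f) h = a * J w f h"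
  by (simp add: J_def integrand_def case_prod_unfold mult.assoc)

lemma J_smult_right: "J w h (Polynomial.smult a f) = a * J w h f"
  by (simp add: J_def integrand_def case_prod_unfold mult.left_commute mult.assoc)

end

section \<open>The two-matrix model\<close>

text \<open>Gram-Schmidt for the monic polynomials. The normalisation enters only through
  \<open>(r m)\<^sup>2\<close>, so no choice of square root affects the coefficients.\<close>

lemma (in biorthogonal_basis) monic_expansion:
  assumes w: "w \<in> D"
    and P: "\<And>n. p w n = Polynomial.smult (1 / r n) (P n)" and S: "\<And>n. s w n = Polynomial.smult (1 / r n) (S n)"
    and lead: "\<And>n. coeff (P n) n = 1"
  shows "coeff (P N) k = (if k = N then 1 else 0) - (\<Sum>m<N. B w (monom 1 N) (S m) / (r m)\<^sup>2 * coeff (P m) k)"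
proof -
  define c where "c = (\<lambda>m. B w (monom 1 N) (S m) / (r m)\<^sup>2)"
  have degP: "degree (P m) = m" for m
  proof -
    have "r m \<noteq> 0" using lead_nz[OF w, of m] by (auto simp: P)
    then show ?thesis using deg_p[OF w, of m] by (simp add: P)
  qed
  have "monom 1 N = (\<Sum>m\<le>N. Polynomial.smult (B w (monom 1 N) (s w m)) (p w m))"
    by (rule p_expansion[OF w degree_monom_le])
  also have "\<dots> = (\<Sum>m\<le>N. Polynomial.smult (c m) (P m))"
    by (rule sum.cong) (simp_all add: P S B_smult_right[OF w] c_def power2_eq_square)
  finally have mN: "monom 1 N = (\<Sum>m\<le>N. Polynomial.smult (c m) (P m))" .
  have co: "(if N = j then 1 else 0) = (\<Sum>m<N. c m * coeff (P m) j) + c N * coeff (P N) j" for j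
  proof -
    have "(if N = j then 1 else 0) = coeff (\<Sum>m\<le>N. Polynomial.smult (c m) (P m)) j"
      unfolding mN[symmetric] by simp
    then show ?thesis by (simp add: coeff_sum flip: lessThan_Suc_atMost)
  qed
  have "(\<Sum>m<N. c m * coeff (P m) N) = 0" by (rule sum.neutral) (simp add: coeff_eq_0 degP)
  then have "c N = 1" using co[of N] lead[of N] by simp
  then show ?thesis using co[of k] by (auto simp: c_def algebra_simps)
qed

definition potential_deriv :: "nat \<Rightarrow> (nat \<Rightarrow> complex) \<Rightarrow> complex poly" where
  "potential_deriv d c = (\<Sum>k\<in>{1..d + 1}. monom (c k) (k - 1))"

lemma potential_DERIV: "(potential d c has_field_derivative poly (potential_deriv d c) x) (at x)"
proof -
  have "((\<lambda>z. \<Sum>k\<in>{1..d + 1}. c k / of_nat k * z ^ k) has_field_derivative (\<Sum>k\<in>{1..d + 1}. c k * x ^ (k - 1))) (at x)"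
  proof (rule DERIV_sum)
    fix k assume "k \<in> {1..d + 1}"
    then have k: "(of_nat k :: complex) \<noteq> 0" by auto
    have "((\<lambda>z. c k / of_nat k * z ^ k) has_field_derivative c k / of_nat k * (of_nat k * x ^ (k - Suc 0))) (at x)"
      by (auto intro!: derivative_eq_intros)
    then show "((\<lambda>z. c k / of_nat k * z ^ k) has_field_derivative c k * x ^ (k - 1)) (at x)" using k by simp
  qed
  moreover have "potential d c = (\<lambda>z. \<Sum>k\<in>{1..d + 1}. c k / of_nat k * z ^ k)" by (simp add: potential_def fun_eq_iff)
  moreover have "poly (potential_deriv d c) x = (\<Sum>k\<in>{1..d + 1}. c k * x ^ (k - 1))"
    unfolding potential_deriv_def poly_sum poly_monom ..
  ultimately show ?thesis by simp
qed

lemma coeff_potential_deriv: "coeff (potential_deriv d c) d = c (d + 1)"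
  and degree_potential_deriv: "degree (potential_deriv d c) \<le> d"
proof -
  have "coeff (potential_deriv d c) d = (\<Sum>k\<in>{1..d + 1}. if k = d + 1 then c (d + 1) else 0)"
    unfolding potential_deriv_def coeff_sum coeff_monom by (rule sum.cong) auto
  then show "coeff (potential_deriv d c) d = c (d + 1)" by (simp del: sum.cl_ivl_Suc)
  show "degree (potential_deriv d c) \<le> d"
    unfolding potential_deriv_def by (rule degree_sum_le) (auto intro!: order_trans[OF degree_monom_le])
qed

text \<open>By \<open>parts\<close> the factor \<open>x\<close> on the left can be traded for the
  operator taking \<open>s w n\<close> to \<open>pderiv (s w n) - v * s w n\<close>; the result has
  exact degree \<open>n + d\<close> and therefore pairs nontrivially with
  \<open>p w (n + d)\<close>.\<close>

lemma (in biorthogonal_basis) subdiagonal_nz: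
  assumes w: "w \<in> D" and v: "coeff v d \<noteq> 0" "degree v \<le> d"
    and parts: "\<And>f g. B w f (pderiv g - v * g) + B w (monom 1 1 * f) g = 0"
  shows "B w (monom 1 1 * p w (n + d)) (s w n) \<noteq> 0"
proof
  assume z: "B w (monom 1 1 * p w (n + d)) (s w n) = 0"
  have s: "coeff (s w n) n \<noteq> 0" "degree (s w n) = n" using lead_s_nz[OF w] deg_s[OF w] by auto
  have dv: "degree v = d" using v le_degree[of v d] by simp
  define g where "g = pderiv (s w n) - v * s w n"
  have "coeff (v * s w n) (n + d) = coeff v d * coeff (s w n) n"
    using coeff_mult_degree_sum[of v "s w n"] s(2) dv by (simp add: add.commute)
  moreover have "coeff (pderiv (s w n)) (n + d) = 0"
    using s(2) by (simp add: coeff_pderiv coeff_eq_0)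
  ultimately have "coeff g (n + d) = - (coeff v d * coeff (s w n) n)" by (simp add: g_def)
  moreover have "degree g \<le> n + d" unfolding g_def
    by (rule degree_diff_le) (use degree_mult_le[of v "s w n"] s(2) dv in \<open>auto simp: degree_pderiv\<close>)
  ultimately have "B w (p w (n + d)) g \<noteq> 0" using B_top_right[OF w, of g "n + d"] s(1) v(1) by auto
  then show False using parts[of "p w (n + d)" "s w n"] z by (simp add: g_def)
qed

text \<open>Minus the transpose of \<open>P\<close> has the same band shape with
  \<open>\<beta>\<close> as \<open>Q\<close> has with \<open>\<alpha>\<close>, so both kinds of
  deformation matrices come from one construction.\<close>

lemma V_mat_eq_U_mat: "V_mat d \<beta> J n m = U_mat d \<beta> J n m"
proof -
  have "(\<lambda>i k. - P_mat d \<beta> k i) = Q_mat d \<beta>" by (auto simp: P_mat_def Q_mat_def fun_eq_iff)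
  then show ?thesis by (simp add: V_mat_def U_mat_def)
qed

section \<open>The model as a pair of banded families\<close>

locale two_matrix_model = moments +
  fixes \<pi> \<sigma> :: "params \<Rightarrow> nat \<Rightarrow> complex poly"
    and h r :: "params \<Rightarrow> nat \<Rightarrow> complex"
    and \<alpha> \<beta> :: "params \<Rightarrow> int \<Rightarrow> nat \<Rightarrow> complex"
  assumes d1: "d1 \<ge> 1" and d2: "d2 \<ge> 1"
    and no_boundary: "\<And>w. w \<in> D \<Longrightarrow> no_boundary_terms d1 d2 \<Gamma>x \<Gamma>y w"
    and biorthogonal: "\<And>w. w \<in> D \<Longrightarrow> monic_biorthogonal d1 d2 \<Gamma>x \<Gamma>y w (\<pi> w) (\<sigma> w) (h w)"
    and r_square: "\<And>w n. w \<in> D \<Longrightarrow> (r w n)\<^sup>2 = h w n"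
    and r_continuous: "\<And>n. continuous_on D (\<lambda>w. r w n)"
    and recursion: "\<And>w. w \<in> D \<Longrightarrow>
      recursion_coeffs d1 d2 (quasi_poly d1 w (\<pi> w) (r w)) (r w) (\<alpha> w) (\<beta> w)"
begin

lemma r_nz: "w \<in> D \<Longrightarrow> r w n \<noteq> 0"
  using biorthogonal[of w] r_square[of w n] by (auto simp: monic_biorthogonal_def)

definition p :: "(nat + nat \<Rightarrow> complex) \<Rightarrow> nat \<Rightarrow> complex poly" where
  "p w n = Polynomial.smult (1 / r (dec w) n) (\<pi> (dec w) n)"

definition s :: "(nat + nat \<Rightarrow> complex) \<Rightarrow> nat \<Rightarrow> complex poly" where
  "s w n = Polynomial.smult (1 / r (dec w) n) (\<sigma> (dec w) n)"

lemma monic: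
  assumes "w \<in> E"
  shows "degree (\<pi> (dec w) n) = n" "coeff (\<pi> (dec w) n) n = 1" "degree (\<sigma> (dec w) n) = n" "coeff (\<sigma> (dec w) n) n = 1"
    "J w (\<pi> (dec w) n) (\<sigma> (dec w) m) = (if n = m then h (dec w) n else 0)" "h (dec w) n \<noteq> 0"
proof -
  note m = biorthogonal[OF dec_D[OF assms], unfolded monic_biorthogonal_def pairing_eq[OF assms]]
  show "degree (\<pi> (dec w) n) = n" "degree (\<sigma> (dec w) n) = n" "h (dec w) n \<noteq> 0"
    "J w (\<pi> (dec w) n) (\<sigma> (dec w) m) = (if n = m then h (dec w) n else 0)"
    using m by auto
  then show "coeff (\<pi> (dec w) n) n = 1" "coeff (\<sigma> (dec w) n) n = 1"
    using m by metis+
qed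

lemma basis: "biorthogonal_basis I E J p s"
proof
  fix w n m assume w: "w \<in> E"
  have "J w (p w n) (s w m) = (if n = m then h (dec w) n / (r (dec w) n)\<^sup>2 else 0)"
    by (simp add: p_def s_def J_smult_left J_smult_right monic[OF w] power2_eq_square)
  then show "J w (p w n) (s w m) = (if n = m then 1 else 0)"
    using r_square[OF dec_D[OF w]] r_nz[OF dec_D[OF w]] monic(6)[OF w] by simp
qed (use dom J_add_left J_smult_left J_add_right J_smult_right hol_J r_nz[OF dec_D] monic in \<open>auto simp: p_def s_def\<close>)

text \<open>The polynomials of degree \<open>N\<close> are determined by moments and by data of
  lower index, and \<open>h\<close> at \<open>N\<close> is the pairing of the two new polynomials.
  The three claims need a joint induction because the expansion of \<open>\<pi>\<close> uses
  \<open>\<sigma>\<close> and \<open>h\<close>, and conversely.\<close>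

lemma hol_monic:
  "(\<forall>k. hol I E (\<lambda>w. coeff (\<pi> (dec w) N) k)) \<and> (\<forall>k. hol I E (\<lambda>w. coeff (\<sigma> (dec w) N) k)) \<and> hol I E (\<lambda>w. h (dec w) N)"
proof (induction N rule: less_induct)
  case (less N)
  interpret B: biorthogonal_basis I E J p s by (rule basis)
  interpret C: biorthogonal_basis I E "\<lambda>w f g. J w g f" s p by (rule B.basis_swap)
  have fam: "B.fam m (\<lambda>w. \<pi> (dec w) m)" "B.fam m (\<lambda>w. \<sigma> (dec w) m)"
    if "\<forall>k. hol I E (\<lambda>w. coeff (\<pi> (dec w) m) k)" "\<forall>k. hol I E (\<lambda>w. coeff (\<sigma> (dec w) m) k)" for m
    using that monic(1,3) by (auto simp: B.fam_def)
  have famN: "B.fam N (\<lambda>w. monom 1 N)" by (auto simp: B.fam_def degree_monom_le)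
  have IH: "B.fam m (\<lambda>w. \<pi> (dec w) m)" "B.fam m (\<lambda>w. \<sigma> (dec w) m)" "hol I E (\<lambda>w. h (dec w) m)"
    "hol I E (\<lambda>w. coeff (\<pi> (dec w) m) k)" "hol I E (\<lambda>w. coeff (\<sigma> (dec w) m) k)" if "m < N" for m k
    using less.IH[OF that] fam[of m] by auto
  have IH': "hol I E (\<lambda>w. coeff (\<sigma> (dec w) m) k)" "hol I E (\<lambda>w. J w (monom 1 N) (\<sigma> (dec w) m))"
    "hol I E (\<lambda>w. J w (\<pi> (dec w) m) (monom 1 N))" if "m < N" for m k
    using less.IH[OF that] B.hol_B_fam[OF famN IH(2)[OF that]] B.hol_B_fam[OF IH(1)[OF that] famN] by auto
  have pi: "hol I E (\<lambda>w. coeff (\<pi> (dec w) N) k)" for k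
  proof (rule hol_cong[OF dom])
    show "hol I E (\<lambda>w. (if k = N then 1 else 0) - (\<Sum>m<N. J w (monom 1 N) (\<sigma> (dec w) m) / h (dec w) m * coeff (\<pi> (dec w) m) k))"
      by (intro hol_diff hol_const hol_sum hol_mult hol_divide IH(3,4) IH') (auto simp: monic)
    show "(if k = N then 1 else 0) - (\<Sum>m<N. J w (monom 1 N) (\<sigma> (dec w) m) / h (dec w) m * coeff (\<pi> (dec w) m) k)
        = coeff (\<pi> (dec w) N) k" if w: "w \<in> E" for w
      by (subst B.monic_expansion[OF w p_def s_def monic(2)[OF w], of N]) (simp add: r_square[OF dec_D[OF w]])
  qed
  have si: "hol I E (\<lambda>w. coeff (\<sigma> (dec w) N) k)" for k
  proof (rule hol_cong[OF dom])
    show "hol I E (\<lambda>w. (if k = N then 1 else 0) - (\<Sum>m<N. J w (\<pi> (dec w) m) (monom 1 N) / h (dec w) m * coeff (\<sigma> (dec w) m) k))"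
      by (intro hol_diff hol_const hol_sum hol_mult hol_divide IH(3) IH') (auto simp: monic)
    show "(if k = N then 1 else 0) - (\<Sum>m<N. J w (\<pi> (dec w) m) (monom 1 N) / h (dec w) m * coeff (\<sigma> (dec w) m) k)
        = coeff (\<sigma> (dec w) N) k" if w: "w \<in> E" for w
      by (subst C.monic_expansion[OF w s_def p_def monic(4)[OF w], of N]) (simp add: r_square[OF dec_D[OF w]])
  qed
  have "hol I E (\<lambda>w. h (dec w) N)"
  proof (rule hol_cong[OF dom])
    show "hol I E (\<lambda>w. J w (\<pi> (dec w) N) (\<sigma> (dec w) N))" by (rule B.hol_B_fam[OF fam]) (use pi si in auto)
  qed (simp add: monic)
  then show ?case using pi si by blast
qed

lemma hol_r: "hol I E (\<lambda>w. r (dec w) n)"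
proof (rule hol_sqrt[OF dom, of "\<lambda>w. h (dec w) n"])
  show "continuous_on E (\<lambda>w. r (dec w) n)"
    by (rule continuous_on_compose2[OF r_continuous continuous_on_dec]) (use dec_D in auto)
qed (use hol_monic r_square dec_D monic(6) in auto)

abbreviation "b \<equiv> max (d1 + 1) (d2 + 1)"

lemma family: "biorthogonal_family I E J p s xexp yexp scale b"
proof (intro biorthogonal_family.intro basis biorthogonal_family_axioms.intro)
  show "hol I E (\<lambda>w. coeff (p w n) k)" "hol I E (\<lambda>w. coeff (s w n) k)" for n k
    unfolding p_def s_def coeff_smult using hol_monic[of n] r_nz[OF dec_D]
    by (auto intro!: hol_mult hol_divide hol_r)
  show "coeff (p w n) n = coeff (s w n) n" if "w \<in> E" for w n
    using monic[OF that] by (simp add: p_def s_def)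
  show "pd i (\<lambda>w. J w f g) w = - scale i * J w (monom 1 (xexp i) * f) (monom 1 (yexp i) * g)"
    if "w \<in> E" "i \<in> I" for w i f g
    by (rule pd_J[OF that])
qed (auto simp: coords_def xexp_def yexp_def)

text \<open>Fubini for a sum of two product integrands, the shape in which the total derivatives of
  \<open>no_boundary_terms\<close> appear.\<close>

lemma iterated_integral:
  assumes w: "w \<in> E" and F: "\<And>x y. F x y = poly f x * poly g y * weight d1 d2 (dec w) x y
      + poly f' x * poly g' y * weight d1 d2 (dec w) x y"
  shows "contour_int \<Gamma>x (\<lambda>x. contour_int \<Gamma>y (F x)) = J w f g + J w f' g'"
proof -
  note int = integrable_integrand[OF w, of f g] integrable_integrand[OF w, of f' g']
  have "contour_int \<Gamma>x (\<lambda>x. contour_int \<Gamma>y (F x)) = (LINT s|lborel. LINT t|lborel. integrand w f g (s, t) + integrand w f' g' (s, t))"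
    unfolding contour_int_def F integrand_def Bochner_Integration.integral_mult_left_zero[symmetric]
    by (intro Bochner_Integration.integral_cong refl) (simp only: prod.case distrib_right distrib_left mult_ac)
  also have "\<dots> = (LINT z|(lborel \<Otimes>\<^sub>M lborel). integrand w f g z + integrand w f' g' z)"
    by (rule lborel_pair.integral_fst'[OF Bochner_Integration.integrable_add[OF int]])
  also have "\<dots> = J w f g + J w f' g'" unfolding J_def by (rule Bochner_Integration.integral_add[OF int])
  finally show ?thesis .
qed

text \<open>The logarithmic derivative of the weight in \<open>x\<close> is \<open>y\<close> minus
  the derivative of the first potential; the vanishing total derivative thus trades multiplication
  of \<open>g\<close> by \<open>y\<close> for a differential operator on \<open>f\<close>.\<close>

lemma parts_x:
  assumes w: "w \<in> E"
  shows "J w (pderiv f - potential_deriv d1 (fst (dec w)) * f) g + J w f (monom 1 1 * g) = 0"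
proof -
  have "deriv (\<lambda>\<xi>. poly f \<xi> * poly g y * weight d1 d2 (dec w) \<xi> y) x =
      poly (pderiv f - potential_deriv d1 (fst (dec w)) * f) x * poly g y * weight d1 d2 (dec w) x y
      + poly f x * poly (monom 1 1 * g) y * weight d1 d2 (dec w) x y" for x y
    unfolding weight_def
    by (rule DERIV_imp_deriv) (rule derivative_eq_intros potential_DERIV poly_DERIV refl | simp add: poly_monom algebra_simps)+
  from iterated_integral[OF w this] show ?thesis
    using no_boundary[OF dec_D[OF w]] unfolding no_boundary_terms_def by simp
qed

lemma parts_y:
  assumes w: "w \<in> E"
  shows "J w f (pderiv g - potential_deriv d2 (snd (dec w)) * g) + J w (monom 1 1 * f) g = 0"
proof -
  have "deriv (\<lambda>\<eta>. poly f x * poly g \<eta> * weight d1 d2 (dec w) x \<eta>) y =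
      poly f x * poly (pderiv g - potential_deriv d2 (snd (dec w)) * g) y * weight d1 d2 (dec w) x y
      + poly (monom 1 1 * f) x * poly g y * weight d1 d2 (dec w) x y" for x y
    unfolding weight_def
    by (rule DERIV_imp_deriv) (rule derivative_eq_intros potential_DERIV poly_DERIV refl | simp add: poly_monom algebra_simps)+
  from iterated_integral[OF w this] show ?thesis
    using no_boundary[OF dec_D[OF w]] unfolding no_boundary_terms_def by simp
qed

abbreviation "wave w n x \<equiv> poly (p w n) x * exp (- potential d1 (fst (dec w)) x)"

lemma quasi_poly_eq: "quasi_poly d1 (dec w) (\<pi> (dec w)) (r (dec w)) n = wave w n"
  by (simp add: quasi_poly_def p_def fun_eq_iff)

text \<open>The common exponential cancels, and an identity at all \<open>x\<close> is one of
  polynomials.\<close>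

lemma x_recursion:
  assumes w: "w \<in> E"
  shows "monom 1 1 * p w n = (\<Sum>j | j \<in> {-1..int d2} \<and> 0 \<le> int n - j. Polynomial.smult (\<alpha> (dec w) j n) (p w (nat (int n - j))))"
proof (unfold poly_eq_poly_eq_iff[symmetric], rule ext)
  fix x
  have "x * wave w n x = (\<Sum>j | j \<in> {-1..int d2} \<and> 0 \<le> int n - j. \<alpha> (dec w) j n * wave w (nat (int n - j)) x)"
    using recursion[OF dec_D[OF w]] unfolding recursion_coeffs_def quasi_poly_eq by blast
  also have "\<dots> = (\<Sum>j | j \<in> {-1..int d2} \<and> 0 \<le> int n - j. \<alpha> (dec w) j n * poly (p w (nat (int n - j))) x)
      * exp (- potential d1 (fst (dec w)) x)"
    by (simp only: sum_distrib_right mult.assoc)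
  finally have "x * poly (p w n) x = (\<Sum>j | j \<in> {-1..int d2} \<and> 0 \<le> int n - j. \<alpha> (dec w) j n * poly (p w (nat (int n - j))) x)"
    unfolding mult.assoc[symmetric] by simp
  then show "poly (monom 1 1 * p w n) x = poly (\<Sum>j | j \<in> {-1..int d2} \<and> 0 \<le> int n - j. Polynomial.smult (\<alpha> (dec w) j n) (p w (nat (int n - j)))) x"
    by (simp add: poly_sum poly_monom)
qed

lemma derivative_recursion:
  assumes w: "w \<in> E"
  shows "pderiv (p w n) - potential_deriv d1 (fst (dec w)) * p w n =
    - (\<Sum>j | j \<in> {-1..int d1} \<and> 0 \<le> int n + j. Polynomial.smult (\<beta> (dec w) j (nat (int n + j))) (p w (nat (int n + j))))"
    (is "?l = ?r")
proof -
  have "poly ?l x = poly ?r x" for x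
  proof -
    define A where "A = {j. j \<in> {-1..int d1} \<and> 0 \<le> int n + j}"
    have "(wave w n has_field_derivative - (\<Sum>j\<in>A. \<beta> (dec w) j (nat (int n + j)) * wave w (nat (int n + j)) x)) (at x)"
      using recursion[OF dec_D[OF w]] unfolding recursion_coeffs_def quasi_poly_eq A_def by blast
    moreover have "(wave w n has_field_derivative poly ?l x * exp (- potential d1 (fst (dec w)) x)) (at x)"
      by (rule derivative_eq_intros potential_DERIV poly_DERIV refl | simp add: algebra_simps)+
    ultimately have "poly ?l x * exp (- potential d1 (fst (dec w)) x) = - (\<Sum>j\<in>A. \<beta> (dec w) j (nat (int n + j)) * wave w (nat (int n + j)) x)"
      using DERIV_unique by blast
    also have "\<dots> = - (\<Sum>j\<in>A. \<beta> (dec w) j (nat (int n + j)) * poly (p w (nat (int n + j))) x) * exp (- potential d1 (fst (dec w)) x)"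
      by (simp only: sum_distrib_right mult.assoc mult_minus_left)
    finally have "poly ?l x = - (\<Sum>j\<in>A. \<beta> (dec w) j (nat (int n + j)) * poly (p w (nat (int n + j))) x)"
      using mult_right_cancel[OF exp_not_eq_zero] by blast
    then show ?thesis by (simp add: poly_sum A_def)
  qed
  then show ?thesis by (simp add: fun_eq_iff flip: poly_eq_poly_eq_iff)
qed

lemma Q_x:
  assumes w: "w \<in> E"
  shows "J w (monom 1 1 * p w n) (s w m) = Q_mat d2 (\<alpha> (dec w)) n m"
proof -
  interpret B: biorthogonal_basis I E J p s by (rule basis)
  define A where "A = {j. j \<in> {-1..int d2} \<and> 0 \<le> int n - j}"
  have fin: "finite A" by (rule finite_subset[of _ "{-1..int d2}"]) (auto simp: A_def)
  have "J w (monom 1 1 * p w n) (s w m) = (\<Sum>j\<in>A. \<alpha> (dec w) j n * (if nat (int n - j) = m then 1 else 0))"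
    unfolding x_recursion[OF w] A_def B.B_sum_left[OF w] B.B_smult_left[OF w] B.orthonormal[OF w] ..
  also have "\<dots> = (\<Sum>j\<in>A. if j = int n - int m then \<alpha> (dec w) j n else 0)"
    by (rule sum.cong) (auto simp: A_def)
  also have "\<dots> = Q_mat d2 (\<alpha> (dec w)) n m" using fin by (auto simp: Q_mat_def A_def)
  finally show ?thesis .
qed

text \<open>\<open>\<beta>\<close> is given through differentiation of the wave functions in
  \<open>x\<close>; integration by parts turns this into multiplication by \<open>y\<close> on the
  other side of the pairing, which is how minus the transpose of \<open>P\<close> arises.\<close>

lemma Q_y:
  assumes w: "w \<in> E"
  shows "J w (p w m) (monom 1 1 * s w n) = Q_mat d1 (\<beta> (dec w)) n m"
proof -
  interpret B: biorthogonal_basis I E J p s by (rule basis)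
  define A where "A = {j. j \<in> {-1..int d1} \<and> 0 \<le> int m + j}"
  have fin: "finite A" by (rule finite_subset[of _ "{-1..int d1}"]) (auto simp: A_def)
  have neg: "J w (- f) g = - J w f g" for f g using J_smult_left[of w "-1" f g] by simp
  have "J w (p w m) (monom 1 1 * s w n) = - J w (pderiv (p w m) - potential_deriv d1 (fst (dec w)) * p w m) (s w n)"
    using parts_x[OF w, of "p w m" "s w n"] by (simp add: add_eq_0_iff)
  also have "\<dots> = (\<Sum>j\<in>A. \<beta> (dec w) j (nat (int m + j)) * (if nat (int m + j) = n then 1 else 0))"
    unfolding derivative_recursion[OF w] A_def neg minus_minus B.B_sum_left[OF w] B.B_smult_left[OF w] B.orthonormal[OF w] ..
  also have "\<dots> = (\<Sum>j\<in>A. if j = int n - int m then \<beta> (dec w) j n else 0)"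
    by (rule sum.cong) (auto simp: A_def)
  also have "\<dots> = Q_mat d1 (\<beta> (dec w)) n m" using fin by (auto simp: Q_mat_def A_def)
  finally show ?thesis .
qed

lemma potential_deriv_top:
  assumes "w \<in> E"
  shows "coeff (potential_deriv d1 (fst (dec w))) d1 \<noteq> 0" "coeff (potential_deriv d2 (snd (dec w))) d2 \<noteq> 0"
  using domain dec_D[OF assms] unfolding param_domain_def coeff_potential_deriv by auto

lemma simply_connected_E: "simply_connected E"
  unfolding E_def by (rule simply_connected_enc) (use domain in \<open>simp add: param_domain_def\<close>)

text \<open>The band width comes from the recursion in \<open>x\<close>, nonvanishing of the lowest
  diagonal from the leading coefficient of the potential in \<open>y\<close>.\<close>

lemma banded_x: "banded_biorthogonal_family I E J p s xexp yexp scale b d2"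
proof -
  interpret F: biorthogonal_family I E J p s xexp yexp scale b by (rule family)
  show ?thesis
  proof (unfold_locales)
    show "F.Q (n + d2) n w \<noteq> 0" if w: "w \<in> E" for w n
      unfolding F.Q_def by (rule F.subdiagonal_nz[OF w potential_deriv_top(2)[OF w] degree_potential_deriv parts_y[OF w]])
    show "F.Q n m w = 0" if "w \<in> E" "m + d2 < n" for w n m
      unfolding F.Q_def Q_x[OF that(1)] using that(2) by (simp add: Q_mat_def)
  qed (rule simply_connected_E d2)+
qed

lemma banded_y: "banded_biorthogonal_family I E (\<lambda>w f g. J w g f) s p yexp xexp scale b d1"
proof -
  interpret F: biorthogonal_family I E "\<lambda>w f g. J w g f" s p yexp xexp scale b
    by (rule biorthogonal_family.swap[OF family])
  show ?thesis
  proof (unfold_locales)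
    show "F.Q (n + d1) n w \<noteq> 0" if w: "w \<in> E" for w n
      unfolding F.Q_def
      by (rule F.subdiagonal_nz[OF w potential_deriv_top(1)[OF w] degree_potential_deriv parts_x[OF w]])
    show "F.Q n m w = 0" if "w \<in> E" "m + d1 < n" for w n m
      unfolding F.Q_def Q_y[OF that(1)] using that(2) by (simp add: Q_mat_def)
  qed (rule simply_connected_E d1)+
qed

lemma powers:
  assumes w: "w \<in> E"
  shows "J w (monom 1 k * p w n) (s w m) = semi_inf_pow (Q_mat d2 (\<alpha> (dec w))) k n m"
    "J w (p w m) (monom 1 k * s w n) = semi_inf_pow (Q_mat d1 (\<beta> (dec w))) k n m"
proof -
  interpret F: biorthogonal_family I E J p s xexp yexp scale b by (rule family)
  interpret G: biorthogonal_family I E "\<lambda>w f g. J w g f" s p yexp xexp scale b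
    by (rule biorthogonal_family.swap[OF family])
  show "J w (monom 1 k * p w n) (s w m) = semi_inf_pow (Q_mat d2 (\<alpha> (dec w))) k n m"
    using F.power_expansion[OF w, of k n m] unfolding F.Q_def Q_x[OF w] by simp
  show "J w (p w m) (monom 1 k * s w n) = semi_inf_pow (Q_mat d1 (\<beta> (dec w))) k n m"
    using G.power_expansion[OF w, of k n m] unfolding G.Q_def Q_y[OF w] by simp
qed

text \<open>Dictionary to the deformation matrices: on \<open>p\<close> a parameter \<open>u\<close>
  acts by \<open>U_mat\<close> and a parameter \<open>v\<close> by minus the transpose of
  \<open>V_mat\<close>.\<close>

lemma X_x:
  assumes w: "w \<in> E"
  shows "K \<ge> 1 \<Longrightarrow> biorthogonal_family.X J p s xexp yexp scale (Inl K) n m w = U_mat d2 (\<alpha> (dec w)) K n m"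
    "biorthogonal_family.X J p s xexp yexp scale (Inr K) n m w = - V_mat d1 (\<beta> (dec w)) K m n"
proof -
  interpret F: biorthogonal_family I E J p s xexp yexp scale b by (rule family)
  show "F.X (Inl K) n m w = U_mat d2 (\<alpha> (dec w)) K n m" if "K \<ge> 1"
    using that powers(1)[OF w, of K]
    by (simp add: F.X_def F.Z_def xexp_def yexp_def scale_def U_mat_def monom_0 flip: one_pCons)
  show "F.X (Inr K) n m w = - V_mat d1 (\<beta> (dec w)) K m n"
    using powers(2)[OF w, of _ K]
    by (simp add: F.X_def F.Z_def xexp_def yexp_def scale_def V_mat_eq_U_mat U_mat_def monom_0 flip: one_pCons)
qed

lemma X_y:
  assumes w: "w \<in> E"
  shows "K \<ge> 1 \<Longrightarrow> biorthogonal_family.X (\<lambda>w f g. J w g f) s p yexp xexp scale (Inr K) n m w = V_mat d1 (\<beta> (dec w)) K n m"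
    "biorthogonal_family.X (\<lambda>w f g. J w g f) s p yexp xexp scale (Inl K) n m w = - U_mat d2 (\<alpha> (dec w)) K m n"
proof -
  interpret F: biorthogonal_family I E "\<lambda>w f g. J w g f" s p yexp xexp scale b
    by (rule biorthogonal_family.swap[OF family])
  show "F.X (Inr K) n m w = V_mat d1 (\<beta> (dec w)) K n m" if "K \<ge> 1"
    using that powers(2)[OF w, of _ K]
    by (simp add: F.X_def F.Z_def xexp_def yexp_def scale_def V_mat_eq_U_mat U_mat_def monom_0 flip: one_pCons)
  show "F.X (Inl K) n m w = - U_mat d2 (\<alpha> (dec w)) K m n"
    using powers(1)[OF w, of K]
    by (simp add: F.X_def F.Z_def xexp_def yexp_def scale_def U_mat_def monom_0 flip: one_pCons)
qed

end

section \<open>Windows and ladder matrices\<close>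

lemma sum_window_down:
  fixes g :: "nat \<Rightarrow> complex"
  assumes "\<And>m. m + K < a \<Longrightarrow> g m = 0" "\<And>m. m > a \<Longrightarrow> g m = 0" "K \<le> a" "a \<le> M"
  shows "(\<Sum>m\<le>M. g m) = (\<Sum>k\<le>K. g (a - k))"
proof -
  have "(\<Sum>m\<le>M. g m) = (\<Sum>k\<le>K. g (a - K + k))"
    by (rule sum_window) (use assms in auto)
  also have "\<dots> = (\<Sum>k\<le>K. g (a - k))"
    by (rule sum.reindex_bij_witness[of _ "\<lambda>k. K - k" "\<lambda>k. K - k"]) (use assms(3) in auto)
  finally show ?thesis .
qed

section \<open>Products of matrices acting on sequences of windows\<close>

text \<open>\<open>mat_inv\<close> takes the result of an elimination that may fail; exhibiting a
  right inverse guarantees success, and the result is two-sided.\<close>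

lemma mat_inv_inverts:
  fixes A B :: "complex mat"
  assumes A: "A \<in> carrier_mat n n" and B: "B \<in> carrier_mat n n" "A * B = 1\<^sub>m n"
  shows "mat_inv A \<in> carrier_mat n n" "A * mat_inv A = 1\<^sub>m n" "mat_inv A * A = 1\<^sub>m n"
proof -
  have "B * A = 1\<^sub>m n" by (rule mat_mult_left_right_inverse[OF A B])
  then have "A \<in> Units (ring_mat TYPE(complex) n ())"
    using A B unfolding Units_def ring_mat_def by auto
  then obtain C where "mat_inverse A = Some C" using mat_inverse(1)[OF A, of "()"] by (cases "mat_inverse A") auto
  then show "mat_inv A \<in> carrier_mat n n" "A * mat_inv A = 1\<^sub>m n" "mat_inv A * A = 1\<^sub>m n"
    using mat_inverse(2)[OF A] by (auto simp: mat_inv_def)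
qed

lemma mat_mult_entry:
  assumes "A \<in> carrier_mat n n" "B \<in> carrier_mat n n" "i < n" "k < n"
  shows "(A * B) $$ (i, k) = (\<Sum>j<n. A $$ (i, j) * B $$ (j, k))"
  using assms by (simp add: scalar_prod_def lessThan_atLeast0)

lemma mat_sum_carrier [simp]: "mat_sum n F K \<in> carrier_mat n n"
  by (simp add: mat_sum_def)

lemma mat_sum_mult:
  assumes "\<And>j. j \<le> K \<Longrightarrow> F j \<in> carrier_mat n n" "W \<in> carrier_mat n n" "i < n" "k < n"
  shows "(mat_sum n F K * W) $$ (i, k) = (\<Sum>j\<le>K. (F j * W) $$ (i, k))"
proof -
  have "(mat_sum n F K * W) $$ (i, k) = (\<Sum>l<n. \<Sum>j\<le>K. F j $$ (i, l) * W $$ (l, k))"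
    unfolding mat_mult_entry[OF mat_sum_carrier assms(2-4)]
    by (rule sum.cong) (auto simp: mat_sum_def sum_distrib_right assms(3))
  also have "\<dots> = (\<Sum>j\<le>K. \<Sum>l<n. F j $$ (i, l) * W $$ (l, k))" by (rule sum.swap)
  also have "\<dots> = (\<Sum>j\<le>K. (F j * W) $$ (i, k))"
    by (rule sum.cong) (use mat_mult_entry[OF assms(1) assms(2-4)] in auto)
  finally show ?thesis .
qed

lemma mult_mat_sum:
  assumes "\<And>j. j \<le> K \<Longrightarrow> F j \<in> carrier_mat n n" "W \<in> carrier_mat n n" "i < n" "k < n"
  shows "(W * mat_sum n F K) $$ (i, k) = (\<Sum>j\<le>K. (W * F j) $$ (i, k))"
proof -
  have "(W * mat_sum n F K) $$ (i, k) = (\<Sum>l<n. \<Sum>j\<le>K. W $$ (i, l) * F j $$ (l, k))"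
    unfolding mat_mult_entry[OF assms(2) mat_sum_carrier assms(3-4)]
    by (rule sum.cong) (auto simp: mat_sum_def sum_distrib_left assms(4))
  also have "\<dots> = (\<Sum>j\<le>K. \<Sum>l<n. W $$ (i, l) * F j $$ (l, k))" by (rule sum.swap)
  also have "\<dots> = (\<Sum>j\<le>K. (W * F j) $$ (i, k))"
    by (rule sum.cong) (use mat_mult_entry[OF assms(2) assms(1) assms(3-4)] in auto)
  finally show ?thesis .
qed

lemma diag_block_carrier: "diag_block A j q d \<in> carrier_mat (d + 1) (d + 1)"
  by (simp add: diag_block_def mat_diag_def)

lemma diag_block_mult:
  assumes "M \<in> carrier_mat (d + 1) (d + 1)" "W \<in> carrier_mat (d + 1) (d + 1)" "i \<le> d" "k \<le> d"
  shows "(diag_block A j q d * M * W) $$ (i, k) = A (q + i) (q + i + j) * (M * W) $$ (i, k)"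
proof -
  have "diag_block A j q d * M * W = diag_block A j q d * (M * W)"
    by (rule assoc_mult_mat[OF diag_block_carrier assms(1,2)])
  then show ?thesis unfolding diag_block_def
    using mat_diag_mult_left[of "M * W" "d + 1" "d + 1"] assms by simp
qed

lemma mult_diag_block:
  assumes "M \<in> carrier_mat (d + 1) (d + 1)" "W \<in> carrier_mat (d + 1) (d + 1)" "i \<le> d" "k \<le> d"
  shows "(W * (M * diag_block A j q d)) $$ (i, k) = (W * M) $$ (i, k) * A (q + k) (q + k + j)"
proof -
  have "W * (M * diag_block A j q d) = (W * M) * diag_block A j q d"
    by (rule assoc_mult_mat[symmetric, OF assms(2,1) diag_block_carrier])
  then show ?thesis unfolding diag_block_def
    using mat_diag_mult_right[of "W * M" "d + 1" "d + 1"] assms by simp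
qed

lemma mat_prod_Cons [simp]: "mat_prod n (A # As) = A * mat_prod n As"
  and mat_prod_Nil [simp]: "mat_prod n [] = 1\<^sub>m n"
  by (simp_all add: mat_prod_def)

lemma mat_prod_carrier: "(\<And>A. A \<in> set As \<Longrightarrow> A \<in> carrier_mat n n) \<Longrightarrow> mat_prod n As \<in> carrier_mat n n"
  by (induction As) (auto intro: mult_carrier_mat)

lemma upt_rev_Suc: "rev [N..<N + Suc j] = (N + j) # rev [N..<N + j]"
  by simp

text \<open>A product of consecutive ladders telescopes on a sequence of windows; the three variants
  below differ in direction and side.\<close>

lemma shift_up_left:
  assumes "\<And>n. L n \<in> carrier_mat k k" "\<And>n. W n \<in> carrier_mat k k"
    and "\<And>n. n \<ge> N \<Longrightarrow> L n * W n = W (Suc n)"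
  shows "mat_prod k (map L (rev [N..<N + j])) * W N = W (N + j)"
proof (induction j)
  case 0
  then show ?case using assms(2)[of N] by simp
next
  case (Suc j)
  have "mat_prod k (map L (rev [N..<N + Suc j])) * W N = L (N + j) * (mat_prod k (map L (rev [N..<N + j])) * W N)"
    unfolding upt_rev_Suc list.map mat_prod_Cons
    by (rule assoc_mult_mat[OF assms(1) _ assms(2)]) (rule mat_prod_carrier, use assms(1) in auto)
  then show ?case using Suc assms(3)[of "N + j"] by simp
qed

text \<open>The one-step hypothesis starts at \<open>N0\<close> because inverse ladders act on
  windows only from index \<open>d\<close> on.\<close>

lemma shift_down_left:
  assumes "\<And>n. M n \<in> carrier_mat k k" "\<And>n. W n \<in> carrier_mat k k"
    and "\<And>n. n \<ge> N0 \<Longrightarrow> M n * W (Suc n) = W n"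
  shows "N0 + j \<le> N \<Longrightarrow> mat_prod k (map M [N - j..<N]) * W N = W (N - j)"
proof (induction j)
  case 0
  then show ?case using assms(2)[of N] by simp
next
  case (Suc j)
  have l: "[N - Suc j..<N] = (N - Suc j) # [N - j..<N]"
    using Suc.prems upt_conv_Cons[of "N - Suc j" N] Suc_diff_Suc[of j N] by simp
  have "mat_prod k (map M [N - Suc j..<N]) * W N = M (N - Suc j) * (mat_prod k (map M [N - j..<N]) * W N)"
    unfolding l list.map mat_prod_Cons
    by (rule assoc_mult_mat[OF assms(1) _ assms(2)]) (rule mat_prod_carrier, use assms(1) in auto)
  also have "\<dots> = M (N - Suc j) * W (Suc (N - Suc j))" using Suc Suc_diff_Suc[of j N] by simp
  also have "\<dots> = W (N - Suc j)" by (rule assms(3)) (use Suc.prems in simp)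
  finally show ?case .
qed

lemma shift_down_right:
  assumes "\<And>n. L n \<in> carrier_mat k k" "\<And>n. W n \<in> carrier_mat k k"
    and "\<And>n. W (Suc n) * L (Suc n) = W n"
  shows "W (N + j) * mat_prod k (map L (rev [Suc N..<Suc N + j])) = W N"
proof (induction j)
  case 0
  then show ?case using assms(2)[of N] by simp
next
  case (Suc j)
  have l: "rev [Suc N..<Suc N + Suc j] = Suc (N + j) # rev [Suc N..<Suc N + j]" by simp
  have "W (Suc (N + j)) * mat_prod k (map L (rev [Suc N..<Suc N + Suc j]))
      = (W (Suc (N + j)) * L (Suc (N + j))) * mat_prod k (map L (rev [Suc N..<Suc N + j]))"
    unfolding l list.map mat_prod_Cons
    by (rule assoc_mult_mat[symmetric, OF assms(2) assms(1)]) (rule mat_prod_carrier, use assms(1) in auto)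
  then show ?case using Suc assms(3)[of "N + j"] by simp
qed

lemma shift_up_right:
  assumes "\<And>n. M n \<in> carrier_mat k k" "\<And>n. W n \<in> carrier_mat k k"
    and "\<And>n. W n * M (Suc n) = W (Suc n)"
  shows "W N * mat_prod k (map M [Suc N..<Suc N + j]) = W (N + j)"
proof (induction j arbitrary: N)
  case 0
  then show ?case using assms(2)[of N] by simp
next
  case (Suc j)
  have l: "[Suc N..<Suc N + Suc j] = Suc N # [Suc (Suc N)..<Suc (Suc N) + j]"
    by (simp add: upt_conv_Cons del: upt_Suc)
  have "W N * mat_prod k (map M [Suc N..<Suc N + Suc j])
      = (W N * M (Suc N)) * mat_prod k (map M [Suc (Suc N)..<Suc (Suc N) + j])"
    unfolding l list.map mat_prod_Cons
    by (rule assoc_mult_mat[symmetric, OF assms(2) assms(1)]) (rule mat_prod_carrier, use assms(1) in auto)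
  then show ?case using Suc[of "Suc N"] assms(3)[of N] by simp
qed

section \<open>Windows of solutions and the ladder matrices\<close>

text \<open>Columns are basis solutions, rows are consecutive indices; \<open>dual_window\<close> is
  the transpose because the dual systems act from the right.\<close>

definition window :: "nat \<Rightarrow> (nat \<Rightarrow> nat \<Rightarrow> complex) \<Rightarrow> nat \<Rightarrow> complex mat" where
  "window d f n = Matrix.mat (d + 1) (d + 1) (\<lambda>(i, a). f a (n + i))"

definition dual_window :: "nat \<Rightarrow> (nat \<Rightarrow> nat \<Rightarrow> complex) \<Rightarrow> nat \<Rightarrow> complex mat" where
  "dual_window d f n = Matrix.mat (d + 1) (d + 1) (\<lambda>(a, i). f a (n + i))"

lemma window_carrier: "window d f n \<in> carrier_mat (d + 1) (d + 1)"
  and dual_window_carrier: "dual_window d f n \<in> carrier_mat (d + 1) (d + 1)"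
  by (simp_all add: window_def dual_window_def)

lemma window_entry: "i \<le> d \<Longrightarrow> a \<le> d \<Longrightarrow> window d f n $$ (i, a) = f a (n + i)"
  and dual_window_entry: "i \<le> d \<Longrightarrow> a \<le> d \<Longrightarrow> dual_window d f n $$ (a, i) = f a (n + i)"
  by (simp_all add: window_def dual_window_def)

lemma dual_window_transpose: "dual_window d f n = transpose_mat (window d f n)"
  by (rule eq_matI) (auto simp: window_def dual_window_def)

lemma ladder_carrier: "ladder d c N x \<in> carrier_mat (d + 1) (d + 1)"
  and dual_ladder_carrier: "dual_ladder d c N x \<in> carrier_mat (d + 1) (d + 1)"
  by (simp_all add: ladder_def dual_ladder_def)

lemma carriers_Suc [simp]:
  "window d f n \<in> carrier_mat (Suc d) (Suc d)" "dual_window d f n \<in> carrier_mat (Suc d) (Suc d)"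
  "ladder d c N x \<in> carrier_mat (Suc d) (Suc d)" "dual_ladder d c N x \<in> carrier_mat (Suc d) (Suc d)"
  using window_carrier[of d f n] dual_window_carrier[of d f n] ladder_carrier[of d c N x] dual_ladder_carrier[of d c N x]
  by simp_all

locale nondegenerate_windows =
  fixes d :: nat and f :: "nat \<Rightarrow> nat \<Rightarrow> complex"
  assumes nondegenerate: "(\<And>k. k \<le> d \<Longrightarrow> (\<Sum>a\<le>d. f a (N + k) * g a) = 0) \<Longrightarrow> a \<le> d \<Longrightarrow> g a = 0"
begin

lemma window_inverse: "\<exists>B \<in> carrier_mat (d + 1) (d + 1). window d f n * B = 1\<^sub>m (d + 1) \<and> B * window d f n = 1\<^sub>m (d + 1)"
proof -
  obtain B where B: "\<And>p q. p < d + 1 \<Longrightarrow> q < d + 1 \<Longrightarrow> (\<Sum>a<d + 1. f a (n + p) * B a q) = (if p = q then 1 else 0)"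
  proof (rule injective_square_system_solvable[of "d + 1" "\<lambda>p a. f a (n + p)"])
    fix g a assume z: "\<And>p. p < d + 1 \<Longrightarrow> (\<Sum>a<d + 1. f a (n + p) * g a) = 0" and a: "a < d + 1"
    show "g a = 0"
      by (rule nondegenerate[of n]) (use z a in \<open>simp_all add: lessThan_Suc_atMost\<close>)
  next
    fix B assume a: "\<And>p q. p < d + 1 \<Longrightarrow> q < d + 1 \<Longrightarrow> (\<Sum>a<d + 1. f a (n + p) * B a q) = (if p = q then 1 else 0)"
      "\<And>p q. p < d + 1 \<Longrightarrow> q < d + 1 \<Longrightarrow> (\<Sum>a<d + 1. B p a * f q (n + a)) = (if p = q then 1 else 0)"
    show thesis by (rule that, rule a(1))
  qed
  define C where "C = Matrix.mat (d + 1) (d + 1) (\<lambda>(a, q). B a q)"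
  have C: "C \<in> carrier_mat (d + 1) (d + 1)" by (simp add: C_def)
  have "window d f n * C = 1\<^sub>m (d + 1)"
  proof (rule eq_matI)
    fix i j assume ij: "i < dim_row (1\<^sub>m (d + 1))" "j < dim_col (1\<^sub>m (d + 1))"
    then have "(window d f n * C) $$ (i, j) = (\<Sum>a<d + 1. f a (n + i) * B a j)"
      by (subst mat_mult_entry[OF window_carrier C]) (auto simp: window_entry C_def intro!: sum.cong)
    then show "(window d f n * C) $$ (i, j) = 1\<^sub>m (d + 1) $$ (i, j)" using B[of i j] ij by simp
  qed (use C carrier_matD[OF window_carrier[of d f n]] in auto)
  then show ?thesis using C mat_mult_left_right_inverse[OF window_carrier C] by blast
qed

lemma window_invertible: "invertible_mat (window d f n)"
proof -
  obtain B where "B \<in> carrier_mat (d + 1) (d + 1)" "window d f n * B = 1\<^sub>m (d + 1)" "B * window d f n = 1\<^sub>m (d + 1)"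
    using window_inverse[of n] by blast
  then show ?thesis
    using carrier_matD[OF window_carrier[of d f n]]
    unfolding invertible_mat_def inverts_mat_def by (auto intro!: exI[of _ B])
qed

lemma dual_window_inverse: "\<exists>B \<in> carrier_mat (d + 1) (d + 1). dual_window d f n * B = 1\<^sub>m (d + 1) \<and> B * dual_window d f n = 1\<^sub>m (d + 1)"
proof -
  obtain B where B: "B \<in> carrier_mat (d + 1) (d + 1)" "window d f n * B = 1\<^sub>m (d + 1)" "B * window d f n = 1\<^sub>m (d + 1)"
    using window_inverse[of n] by blast
  have t: "dual_window d f n * transpose_mat B = transpose_mat (B * window d f n)"
    "transpose_mat B * dual_window d f n = transpose_mat (window d f n * B)"
    unfolding dual_window_transpose
    using transpose_mult[OF B(1) window_carrier[of d f n]] transpose_mult[OF window_carrier[of d f n] B(1)] by auto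
  show ?thesis using B(1) by (intro bexI[of _ "transpose_mat B"]) (simp_all only: t B transpose_one transpose_carrier_mat simp_thms)
qed

lemma dual_window_invertible: "invertible_mat (dual_window d f n)"
proof -
  obtain B where "B \<in> carrier_mat (d + 1) (d + 1)" "dual_window d f n * B = 1\<^sub>m (d + 1)" "B * dual_window d f n = 1\<^sub>m (d + 1)"
    using dual_window_inverse[of n] by blast
  then show ?thesis
    using carrier_matD[OF dual_window_carrier[of d f n]]
    unfolding invertible_mat_def inverts_mat_def by (auto intro!: exI[of _ B])
qed

end

text \<open>The relation is row \<open>m + d\<close> of \<open>Q - x\<close>, so the ladder of index
  \<open>N\<close> belongs to the window that starts at \<open>N - d\<close>.\<close>

locale ladder_windows = nondegenerate_windows +
  fixes c :: "int \<Rightarrow> nat \<Rightarrow> complex" and x :: complex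
  assumes top: "c (-1) n \<noteq> 0"
    and relation: "a \<le> d \<Longrightarrow> (\<Sum>k\<le>d + 1. (Q_mat d c (m + d) (m + k) - (if k = d then x else 0)) * f a (m + k)) = 0"
begin

text \<open>All rows but the last shift the window; the last one is the recursion solved for its top
  entry, with \<open>c (-1) (m + d)\<close> as divisor.\<close>

lemma ladder_mult: "ladder d c (m + d) x * window d f m = window d f (Suc m)"
proof (rule eq_matI)
  fix i a assume "i < dim_row (window d f (Suc m))" "a < dim_col (window d f (Suc m))"
  then have i: "i \<le> d" and a: "a \<le> d" by (auto simp: window_def)
  define N where "N = m + d"
  have entry: "(ladder d c N x * window d f m) $$ (i, a) = (\<Sum>j<d + 1. ladder d c N x $$ (i, j) * f a (m + j))"
    using i a by (subst mat_mult_entry[OF ladder_carrier window_carrier]) (auto simp: window_entry intro!: sum.cong)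
  show "(ladder d c (m + d) x * window d f m) $$ (i, a) = window d f (Suc m) $$ (i, a)"
  proof (cases "i = d")
    case False
    have "(\<Sum>j<d + 1. ladder d c N x $$ (i, j) * f a (m + j)) = (\<Sum>j<d + 1. if j = i + 1 then f a (m + j) else 0)"
      by (rule sum.cong) (use i False in \<open>auto simp: ladder_def\<close>)
    also have "\<dots> = f a (m + (i + 1))" using i False by simp
    finally show ?thesis using entry i a by (simp add: window_entry N_def)
  next
    case True
    define l where "l = (\<lambda>k. if k = d then x - c 0 N else - c (int d - int k) N)"
    have top_term: "Q_mat d c N (m + (d + 1)) = c (-1) N" by (simp add: Q_mat_def N_def)
    have l: "Q_mat d c N (m + k) - (if k = d then x else 0) = - l k" if "k \<le> d" for k
      using that by (auto simp: l_def Q_mat_def N_def)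
    have "(\<Sum>k\<le>d. (Q_mat d c N (m + k) - (if k = d then x else 0)) * f a (m + k)) + c (-1) N * f a (m + (d + 1)) = 0"
      using relation[OF a, of m] top_term by (simp add: N_def)
    moreover have "(\<Sum>k\<le>d. (Q_mat d c N (m + k) - (if k = d then x else 0)) * f a (m + k)) = - (\<Sum>k\<le>d. l k * f a (m + k))"
      unfolding sum_negf[symmetric] by (rule sum.cong) (use l in auto)
    ultimately have e: "(\<Sum>k\<le>d. l k * f a (m + k)) = c (-1) N * f a (m + (d + 1))" by simp
    have "(\<Sum>j<d + 1. ladder d c N x $$ (i, j) * f a (m + j)) = (\<Sum>j\<le>d. l j * f a (m + j) / c (-1) N)"
      by (rule sum.cong) (use True in \<open>auto simp: ladder_def l_def\<close>)
    also have "\<dots> = f a (m + (d + 1))" unfolding sum_divide_distrib[symmetric] e using top by simp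
    finally show ?thesis using entry True a by (simp add: window_entry N_def)
  qed
qed (auto simp: ladder_def window_def)

text \<open>The ladder carries one invertible window to another, which supplies its inverse without
  a determinant.\<close>

lemma ladder_inverse:
  assumes "N \<ge> d"
  shows "mat_inv (ladder d c N x) \<in> carrier_mat (d + 1) (d + 1)"
    "mat_inv (ladder d c N x) * window d f (Suc (N - d)) = window d f (N - d)"
proof -
  define m where "m = N - d"
  have N: "N = m + d" using assms by (simp add: m_def)
  obtain B where B: "B \<in> carrier_mat (d + 1) (d + 1)" "window d f (Suc m) * B = 1\<^sub>m (d + 1)"
    using window_inverse[of "Suc m"] by blast
  have "ladder d c N x * (window d f m * B) = 1\<^sub>m (d + 1)"
    using assoc_mult_mat[OF ladder_carrier window_carrier B(1), of c N x f m] ladder_mult[of m] B(2) by (simp add: N)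
  from mat_inv_inverts[OF ladder_carrier mult_carrier_mat[OF window_carrier B(1)] this]
  have inv: "mat_inv (ladder d c N x) \<in> carrier_mat (d + 1) (d + 1)"
    "mat_inv (ladder d c N x) * ladder d c N x = 1\<^sub>m (d + 1)" by blast+
  show "mat_inv (ladder d c N x) \<in> carrier_mat (d + 1) (d + 1)" by (rule inv)
  show "mat_inv (ladder d c N x) * window d f (Suc (N - d)) = window d f (N - d)"
    using assoc_mult_mat[OF inv(1) ladder_carrier window_carrier, of c N x f m] ladder_mult[of m] inv(2)
      left_mult_one_mat[OF window_carrier[of d f m]] by (simp add: N)
qed

text \<open>A product of \<open>j\<close> ladders moves the window up by \<open>j\<close>, so the
  matrix sum is the upper band of \<open>A\<close>, of width \<open>K\<close>, acting on the
  sequence.\<close>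

lemma up_sum:
  assumes N: "N \<ge> d" and i: "i \<le> d" and a: "a \<le> d"
  shows "(mat_sum (d + 1) (\<lambda>j. diag_block A j (N - d) d
      * mat_prod (d + 1) (map (\<lambda>n. ladder d c n x) (rev [N..<N + j]))) K * window d f (N - d)) $$ (i, a)
    = (\<Sum>j\<le>K. A (N - d + i) (N - d + i + j) * f a (N - d + i + j))"
proof -
  have shift: "mat_prod (d + 1) (map (\<lambda>n. ladder d c n x) (rev [N..<N + j])) * window d f (N - d) = window d f (N + j - d)" for j
  proof (rule shift_up_left[of "\<lambda>n. ladder d c n x" "d + 1" "\<lambda>n. window d f (n - d)", OF ladder_carrier window_carrier])
    fix n assume "n \<ge> N"
    then show "ladder d c n x * window d f (n - d) = window d f (Suc n - d)"
      using ladder_mult[of "n - d"] N by (simp add: Suc_diff_le)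
  qed
  have car: "mat_prod (d + 1) (map (\<lambda>n. ladder d c n x) (rev [N..<N + j])) \<in> carrier_mat (d + 1) (d + 1)" for j
    by (rule mat_prod_carrier) (use ladder_carrier in auto)
  show ?thesis
  proof (rule trans[OF mat_sum_mult sum.cong[OF refl]], goal_cases)
    case (1 j)
    show ?case by (rule mult_carrier_mat[OF diag_block_carrier car])
  next
    case 2
    show ?case by (rule window_carrier)
  next
    case (5 j)
    have e: "N + j - d + i = N - d + i + j" using N by simp
    show ?case unfolding diag_block_mult[OF car window_carrier i a] shift window_entry[OF i a] e ..
  qed (use i a in auto)
qed

lemma down_sum:
  assumes N: "N \<ge> d + K" and i: "i \<le> d" and a: "a \<le> d"
  shows "(mat_sum (d + 1) (\<lambda>j. diag_block A j (N - d - j) d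
      * mat_prod (d + 1) (map (\<lambda>n. mat_inv (ladder d c n x)) [N - j..<N])) K * window d f (N - d)) $$ (i, a)
    = (\<Sum>j\<le>K. A (N - d + i - j) (N - d + i) * f a (N - d + i - j))"
proof -
  \<comment> \<open>Inverses are established only from index \<open>d\<close> on; the identity fills
    in below, so that \<open>M\<close> has the right size everywhere. For \<open>j \<le> K\<close>
    the products stay above these indices by \<open>N \<ge> d + K\<close>.\<close>
  define M where "M = (\<lambda>n. if n \<ge> d then mat_inv (ladder d c n x) else 1\<^sub>m (d + 1))"
  have M: "M n \<in> carrier_mat (d + 1) (d + 1)" for n using ladder_inverse(1) by (simp add: M_def)
  have eq: "map (\<lambda>n. mat_inv (ladder d c n x)) [N - j..<N] = map M [N - j..<N]" if "j \<le> K" for j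
    using that N by (auto simp: M_def)
  have shift: "mat_prod (d + 1) (map M [N - j..<N]) * window d f (N - d) = window d f (N - j - d)" if "j \<le> K" for j
    by (rule shift_down_left[of M "d + 1" "\<lambda>n. window d f (n - d)" d, OF M window_carrier])
       (use that N ladder_inverse(2) in \<open>auto simp: M_def Suc_diff_le\<close>)
  have car: "mat_prod (d + 1) (map M [N - j..<N]) \<in> carrier_mat (d + 1) (d + 1)" for j
    by (rule mat_prod_carrier) (use M in auto)
  have entry: "(diag_block A j (N - d - j) d * mat_prod (d + 1) (map (\<lambda>n. mat_inv (ladder d c n x)) [N - j..<N]) * window d f (N - d)) $$ (i, a)
      = A (N - d + i - j) (N - d + i) * f a (N - d + i - j)" if j: "j \<le> K" for j
  proof -
    have e: "N - d - j + i = N - d + i - j" "N - d + i - j + j = N - d + i" "N - j - d + i = N - d + i - j" using j N by auto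
    show ?thesis
      unfolding eq[OF j] diag_block_mult[OF car window_carrier i a] shift[OF j] window_entry[OF i a] e ..
  qed
  show ?thesis
  proof (rule trans[OF mat_sum_mult sum.cong[OF refl]], goal_cases)
    case (1 j)
    show ?case unfolding eq[OF 1] by (rule mult_carrier_mat[OF diag_block_carrier car])
  next
    case 2
    show ?case by (rule window_carrier)
  next
    case (5 j)
    then show ?case by (intro entry) simp
  qed (use i a in auto)
qed

end

text \<open>Column \<open>Suc m\<close> of \<open>Q - x\<close>; its first entry
  \<open>c (-1) m\<close> is the divisor in the dual ladder of index \<open>Suc m\<close>, so the
  relation is solved for the lowest index.\<close>

locale dual_ladder_windows = nondegenerate_windows +
  fixes c :: "int \<Rightarrow> nat \<Rightarrow> complex" and x :: complex
  assumes top: "c (-1) n \<noteq> 0"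
    and relation: "a \<le> d \<Longrightarrow> (\<Sum>k\<le>d + 1. (Q_mat d c (m + k) (Suc m) - (if k = 1 then x else 0)) * f a (m + k)) = 0"
begin

lemma dual_ladder_mult: "dual_window d f (Suc m) * dual_ladder d c (Suc m) x = dual_window d f m"
proof (rule eq_matI)
  fix a i assume "a < dim_row (dual_window d f m)" "i < dim_col (dual_window d f m)"
  then have i: "i \<le> d" and a: "a \<le> d" by (auto simp: dual_window_def)
  have entry: "(dual_window d f (Suc m) * dual_ladder d c (Suc m) x) $$ (a, i)
      = (\<Sum>j<d + 1. f a (Suc m + j) * dual_ladder d c (Suc m) x $$ (j, i))"
    using i a by (subst mat_mult_entry[OF dual_window_carrier dual_ladder_carrier]) (auto simp: dual_window_entry intro!: sum.cong)
  show "(dual_window d f (Suc m) * dual_ladder d c (Suc m) x) $$ (a, i) = dual_window d f m $$ (a, i)"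
  proof (cases i)
    case (Suc i')
    have "(\<Sum>j<d + 1. f a (Suc m + j) * dual_ladder d c (Suc m) x $$ (j, i)) = (\<Sum>j<d + 1. if j = i' then f a (Suc m + j) else 0)"
      by (rule sum.cong) (use i Suc in \<open>auto simp: dual_ladder_def\<close>)
    also have "\<dots> = f a (Suc m + i')" using i Suc by simp
    finally show ?thesis using entry i a Suc by (simp add: dual_window_entry)
  next
    case 0
    define l where "l = (\<lambda>k. if k = 0 then x - c 0 (Suc m) else - c (int k) (Suc m + k))"
    have top_term: "Q_mat d c (m + 0) (Suc m) = c (-1) m" by (simp add: Q_mat_def)
    have l: "Q_mat d c (m + Suc k) (Suc m) - (if Suc k = 1 then x else 0) = - l k" if "k \<le> d" for k
      using that by (auto simp: l_def Q_mat_def)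
    have "(\<Sum>k\<le>Suc d. (Q_mat d c (m + k) (Suc m) - (if k = 1 then x else 0)) * f a (m + k)) = 0"
      using relation[OF a, of m] by simp
    then have "c (-1) m * f a m + (\<Sum>k\<le>d. (Q_mat d c (m + Suc k) (Suc m) - (if Suc k = 1 then x else 0)) * f a (m + Suc k)) = 0"
      unfolding sum.atMost_Suc_shift top_term by simp
    moreover have "(\<Sum>k\<le>d. (Q_mat d c (m + Suc k) (Suc m) - (if Suc k = 1 then x else 0)) * f a (m + Suc k)) = - (\<Sum>k\<le>d. l k * f a (Suc m + k))"
      unfolding sum_negf[symmetric] by (rule sum.cong) (use l in auto)
    ultimately have e: "(\<Sum>k\<le>d. l k * f a (Suc m + k)) = c (-1) m * f a m" by simp
    have "(\<Sum>j<d + 1. f a (Suc m + j) * dual_ladder d c (Suc m) x $$ (j, i)) = (\<Sum>j\<le>d. l j * f a (Suc m + j) / c (-1) m)"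
      by (rule sum.cong) (use 0 in \<open>auto simp: dual_ladder_def l_def\<close>)
    also have "\<dots> = f a m" unfolding sum_divide_distrib[symmetric] e using top by simp
    finally show ?thesis using entry 0 a by (simp add: dual_window_entry)
  qed
qed (auto simp: dual_ladder_def dual_window_def)

lemma dual_ladder_inverse:
  "mat_inv (dual_ladder d c (Suc m) x) \<in> carrier_mat (d + 1) (d + 1)"
  "dual_window d f m * mat_inv (dual_ladder d c (Suc m) x) = dual_window d f (Suc m)"
proof -
  let ?L = "dual_ladder d c (Suc m) x"
  obtain B where B: "B \<in> carrier_mat (d + 1) (d + 1)" "B * dual_window d f m = 1\<^sub>m (d + 1)"
    using dual_window_inverse[of m] by blast
  have BW: "B * dual_window d f (Suc m) \<in> carrier_mat (d + 1) (d + 1)"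
    by (rule mult_carrier_mat[OF B(1) dual_window_carrier])
  \<comment> \<open>This is a left inverse; for square matrices it is two-sided, whereas
    \<open>mat_inv_inverts\<close> asks for a right one.\<close>
  have "(B * dual_window d f (Suc m)) * ?L = 1\<^sub>m (d + 1)"
    using assoc_mult_mat[OF B(1) dual_window_carrier dual_ladder_carrier, of f "Suc m" c "Suc m" x] dual_ladder_mult[of m] B(2) by simp
  from mat_mult_left_right_inverse[OF BW dual_ladder_carrier this]
  have "?L * (B * dual_window d f (Suc m)) = 1\<^sub>m (d + 1)" .
  from mat_inv_inverts[OF dual_ladder_carrier BW this]
  have inv: "mat_inv ?L \<in> carrier_mat (d + 1) (d + 1)" "?L * mat_inv ?L = 1\<^sub>m (d + 1)" by blast+
  show "mat_inv ?L \<in> carrier_mat (d + 1) (d + 1)" by (rule inv)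
  show "dual_window d f m * mat_inv ?L = dual_window d f (Suc m)"
    using assoc_mult_mat[OF dual_window_carrier dual_ladder_carrier inv(1), of f "Suc m" c "Suc m" x] dual_ladder_mult[of m] inv(2)
      right_mult_one_mat[OF dual_window_carrier[of d f "Suc m"]] by simp
qed

lemma dual_up_sum:
  assumes N: "N \<ge> 1" and i: "i \<le> d" and a: "a \<le> d"
  shows "(dual_window d f (N - 1) * mat_sum (d + 1) (\<lambda>j.
      mat_prod (d + 1) (map (\<lambda>n. mat_inv (dual_ladder d c n x)) [N..<N + j]) * diag_block A j (N - 1) d) K) $$ (a, i)
    = (\<Sum>j\<le>K. A (N - 1 + i) (N - 1 + i + j) * f a (N - 1 + i + j))"
proof -
  define m where "m = N - 1"
  have Nm: "N = Suc m" using N by (simp add: m_def)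
  define M where "M = (\<lambda>n. if n \<ge> 1 then mat_inv (dual_ladder d c n x) else 1\<^sub>m (d + 1))"
  have M: "M n \<in> carrier_mat (d + 1) (d + 1)" for n using dual_ladder_inverse(1)[of "n - 1"] by (cases n) (auto simp: M_def)
  have eq: "map (\<lambda>n. mat_inv (dual_ladder d c n x)) [N..<N + j] = map M [Suc m..<Suc m + j]" for j
    by (auto simp: M_def Nm)
  have shift: "dual_window d f m * mat_prod (d + 1) (map M [Suc m..<Suc m + j]) = dual_window d f (m + j)" for j
    by (rule shift_up_right[of M "d + 1" "dual_window d f", OF M dual_window_carrier])
       (use dual_ladder_inverse(2) in \<open>simp add: M_def\<close>)
  have car: "mat_prod (d + 1) (map M [Suc m..<Suc m + j]) \<in> carrier_mat (d + 1) (d + 1)" for j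
    by (rule mat_prod_carrier) (use M in auto)
  have entry: "(dual_window d f m * (mat_prod (d + 1) (map M [Suc m..<Suc m + j]) * diag_block A j m d)) $$ (a, i)
      = A (m + i) (m + i + j) * f a (m + i + j)" for j
    unfolding mult_diag_block[OF car dual_window_carrier a i] shift dual_window_entry[OF i a] by (simp add: add_ac)
  show ?thesis unfolding eq m_def[symmetric]
  proof (rule trans[OF mult_mat_sum sum.cong[OF refl]], goal_cases)
    case (1 j)
    show ?case by (rule mult_carrier_mat[OF car diag_block_carrier])
  next
    case 2
    show ?case by (rule dual_window_carrier)
  next
    case (5 j)
    show ?case by (rule entry)
  qed (use i a in auto)
qed

lemma dual_down_sum:
  assumes N: "N \<ge> K + 1" and i: "i \<le> d" and a: "a \<le> d"
  shows "(dual_window d f (N - 1) * mat_sum (d + 1) (\<lambda>j.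
      mat_prod (d + 1) (map (\<lambda>n. dual_ladder d c n x) (rev [N - j..<N])) * diag_block A j (N - 1 - j) d) K) $$ (a, i)
    = (\<Sum>j\<le>K. A (N - 1 + i - j) (N - 1 + i) * f a (N - 1 + i - j))"
proof -
  define L where "L = (\<lambda>n. dual_ladder d c n x)"
  have L: "L n \<in> carrier_mat (d + 1) (d + 1)" for n by (simp add: L_def)
  have shift: "dual_window d f (N - 1) * mat_prod (d + 1) (map L (rev [N - j..<N])) = dual_window d f (N - 1 - j)" if j: "j \<le> K" for j
  proof -
    have "Suc (N - 1 - j) = N - j" "N - j + j = N" using j N by auto
    \<comment> \<open>The index list is rewritten to start right after the target window;
      subtraction is exact since \<open>j \<le> K < N\<close>.\<close>
    then have e: "N - 1 = (N - 1 - j) + j" "[N - j..<N] = [Suc (N - 1 - j)..<Suc (N - 1 - j) + j]" using j N by simp_all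
    have "dual_window d f (N - 1 - j + j) * mat_prod (d + 1) (map L (rev [Suc (N - 1 - j)..<Suc (N - 1 - j) + j])) = dual_window d f (N - 1 - j)"
      by (rule shift_down_right[of L "d + 1" "dual_window d f", OF L dual_window_carrier])
         (use dual_ladder_mult in \<open>simp add: L_def\<close>)
    then show ?thesis unfolding e(2)[symmetric] e(1)[symmetric] .
  qed
  have car: "mat_prod (d + 1) (map L (rev [N - j..<N])) \<in> carrier_mat (d + 1) (d + 1)" for j
    by (rule mat_prod_carrier) (use L in auto)
  have entry: "(dual_window d f (N - 1) * (mat_prod (d + 1) (map L (rev [N - j..<N])) * diag_block A j (N - 1 - j) d)) $$ (a, i)
      = A (N - 1 + i - j) (N - 1 + i) * f a (N - 1 + i - j)" if j: "j \<le> K" for j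
  proof -
    have e: "N - 1 - j + i = N - 1 + i - j" "N - 1 + i - j + j = N - 1 + i" using j N by auto
    show ?thesis
      unfolding mult_diag_block[OF car dual_window_carrier a i] shift[OF j] dual_window_entry[OF i a] e by (simp only: mult.commute)
  qed
  show ?thesis unfolding L_def[symmetric]
  proof (rule trans[OF mult_mat_sum sum.cong[OF refl]], goal_cases)
    case (1 j)
    show ?case by (rule mult_carrier_mat[OF car diag_block_carrier])
  next
    case 2
    show ?case by (rule dual_window_carrier)
  next
    case (5 j)
    then show ?case by (intro entry) simp
  qed (use i a in auto)
qed

end

section \<open>Windows that follow the deformation\<close>

context banded_biorthogonal_family
begin

text \<open>By \<open>one_sided\<close> each deformation reaches to one side only, so its row sum
  collapses to a one-sided band: upwards at every index, downwards where the \<open>ey i\<close>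
  preceding indices exist.\<close>

lemma primal_windows:
  assumes c: "\<And>w n m. w \<in> D \<Longrightarrow> Q n m w = Q_mat d (c w) n m"
  obtains f where "\<And>a m. a \<le> d \<Longrightarrow> hol I D (f a m)"
    "\<And>w. w \<in> D \<Longrightarrow> ladder_windows d (\<lambda>a m. f a m w) (c w) x"
    "\<And>a i m w. a \<le> d \<Longrightarrow> i \<in> I \<Longrightarrow> w \<in> D \<Longrightarrow> ex i > 0 \<Longrightarrow>
      pd i (f a m) w = (\<Sum>j\<le>ex i. X i m (m + j) w * f a (m + j) w)"
    "\<And>a i m w. a \<le> d \<Longrightarrow> i \<in> I \<Longrightarrow> w \<in> D \<Longrightarrow> ey i > 0 \<Longrightarrow> m \<ge> ey i \<Longrightarrow>
      pd i (f a m) w = (\<Sum>j\<le>ey i. X i m (m - j) w * f a (m - j) w)"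
proof -
  interpret R: deformed_recursion I D d b "\<lambda>r k w. Q (r - 1 + d) (r - 1 + k) w - (if k = d then x else 0)" X ey
    by (rule primal_recursion)
  show ?thesis
  proof (rule R.solutions)
  fix f assume f: "\<And>a m. a \<le> d \<Longrightarrow> hol I D (f a m)"
    "\<And>a r w. a \<le> d \<Longrightarrow> r \<ge> 1 \<Longrightarrow> w \<in> D \<Longrightarrow>
      (\<Sum>k\<le>d + 1. (Q (r - 1 + d) (r - 1 + k) w - (if k = d then x else 0)) * f a (r - 1 + k) w) = 0"
    "\<And>a i m w. a \<le> d \<Longrightarrow> i \<in> I \<Longrightarrow> w \<in> D \<Longrightarrow> m \<ge> ey i \<Longrightarrow> pd i (f a m) w = (\<Sum>l\<le>m + b. X i m l w * f a l w)"
    "\<And>w N g a. w \<in> D \<Longrightarrow> (\<And>k. k \<le> d \<Longrightarrow> (\<Sum>a\<le>d. f a (N + k) w * g a) = 0) \<Longrightarrow> a \<le> d \<Longrightarrow> g a = 0"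
  show ?thesis
  proof (rule that[of f])
    show "ladder_windows d (\<lambda>a m. f a m w) (c w) x" if w: "w \<in> D" for w
    proof
      show "g a = 0" if "\<And>k. k \<le> d \<Longrightarrow> (\<Sum>a\<le>d. f a (N + k) w * g a) = 0" "a \<le> d" for N g a
        by (rule f(4)[OF w that])
      show "c w (-1) n \<noteq> 0" for n
        using Q_superdiagonal_nz[OF w, of n] by (simp add: c[OF w] Q_mat_def)
      show "(\<Sum>k\<le>d + 1. (Q_mat d (c w) (m + d) (m + k) - (if k = d then x else 0)) * f a (m + k) w) = 0" if "a \<le> d" for m a
        using f(2)[OF that _ w, of "Suc m"] unfolding c[OF w] by simp
    qed
    show "pd i (f a m) w = (\<Sum>j\<le>ex i. X i m (m + j) w * f a (m + j) w)"
      if "a \<le> d" "i \<in> I" "w \<in> D" "ex i > 0" for a i m w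
    proof -
      have ey: "ey i = 0" using one_sided[OF that(2)] that(4) by simp
      show ?thesis unfolding f(3)[OF that(1-3), of m, unfolded ey, OF le0]
        by (rule sum_window) (use X_lower[OF that(2,3)] X_upper[OF that(2,3)] ey exponents_le(1)[OF that(2)] in auto)
    qed
    show "pd i (f a m) w = (\<Sum>j\<le>ey i. X i m (m - j) w * f a (m - j) w)"
      if "a \<le> d" "i \<in> I" "w \<in> D" "ey i > 0" "m \<ge> ey i" for a i m w
    proof -
      have ex: "ex i = 0" using one_sided[OF that(2)] that(4) by simp
      show ?thesis unfolding f(3)[OF that(1-3,5)]
        by (rule sum_window_down) (use X_lower[OF that(2,3)] X_upper[OF that(2,3)] ex that(5) in auto)
    qed
  qed (rule f(1))
  qed
qed

text \<open>The transposed flow reverses the directions: deformations by powers of \<open>y\<close>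
  now reach upwards, those by powers of \<open>x\<close> downwards.\<close>

lemma dual_windows:
  assumes c: "\<And>w n m. w \<in> D \<Longrightarrow> Q n m w = Q_mat d (c w) n m"
  obtains f where "\<And>a m. a \<le> d \<Longrightarrow> hol I D (f a m)"
    "\<And>w. w \<in> D \<Longrightarrow> dual_ladder_windows d (\<lambda>a m. f a m w) (c w) x"
    "\<And>a i m w. a \<le> d \<Longrightarrow> i \<in> I \<Longrightarrow> w \<in> D \<Longrightarrow> ey i > 0 \<Longrightarrow>
      pd i (f a m) w = (\<Sum>j\<le>ey i. - X i (m + j) m w * f a (m + j) w)"
    "\<And>a i m w. a \<le> d \<Longrightarrow> i \<in> I \<Longrightarrow> w \<in> D \<Longrightarrow> ex i > 0 \<Longrightarrow> m \<ge> ex i \<Longrightarrow>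
      pd i (f a m) w = (\<Sum>j\<le>ex i. - X i (m - j) m w * f a (m - j) w)"
proof -
  interpret R: deformed_recursion I D d b "\<lambda>r k w. Q (r - 1 + k) r w - (if k = 1 then x else 0)" "\<lambda>i n m w. - X i m n w" ex
    by (rule dual_recursion)
  show ?thesis
  proof (rule R.solutions)
  fix f assume f: "\<And>a m. a \<le> d \<Longrightarrow> hol I D (f a m)"
    "\<And>a r w. a \<le> d \<Longrightarrow> r \<ge> 1 \<Longrightarrow> w \<in> D \<Longrightarrow>
      (\<Sum>k\<le>d + 1. (Q (r - 1 + k) r w - (if k = 1 then x else 0)) * f a (r - 1 + k) w) = 0"
    "\<And>a i m w. a \<le> d \<Longrightarrow> i \<in> I \<Longrightarrow> w \<in> D \<Longrightarrow> m \<ge> ex i \<Longrightarrow> pd i (f a m) w = (\<Sum>l\<le>m + b. - X i l m w * f a l w)"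
    "\<And>w N g a. w \<in> D \<Longrightarrow> (\<And>k. k \<le> d \<Longrightarrow> (\<Sum>a\<le>d. f a (N + k) w * g a) = 0) \<Longrightarrow> a \<le> d \<Longrightarrow> g a = 0"
  show ?thesis
  proof (rule that[of f])
    show "dual_ladder_windows d (\<lambda>a m. f a m w) (c w) x" if w: "w \<in> D" for w
    proof
      show "g a = 0" if "\<And>k. k \<le> d \<Longrightarrow> (\<Sum>a\<le>d. f a (N + k) w * g a) = 0" "a \<le> d" for N g a
        by (rule f(4)[OF w that])
      show "c w (-1) n \<noteq> 0" for n
        using Q_superdiagonal_nz[OF w, of n] by (simp add: c[OF w] Q_mat_def)
      show "(\<Sum>k\<le>d + 1. (Q_mat d (c w) (m + k) (Suc m) - (if k = 1 then x else 0)) * f a (m + k) w) = 0" if "a \<le> d" for m a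
        using f(2)[OF that _ w, of "Suc m"] unfolding c[OF w] by simp
    qed
    show "pd i (f a m) w = (\<Sum>j\<le>ey i. - X i (m + j) m w * f a (m + j) w)"
      if "a \<le> d" "i \<in> I" "w \<in> D" "ey i > 0" for a i m w
    proof -
      have ex: "ex i = 0" using one_sided[OF that(2)] that(4) by simp
      show ?thesis unfolding f(3)[OF that(1-3), of m, unfolded ex, OF le0]
        by (rule sum_window) (use X_lower[OF that(2,3)] X_upper[OF that(2,3)] ex exponents_le(2)[OF that(2)] in auto)
    qed
    show "pd i (f a m) w = (\<Sum>j\<le>ex i. - X i (m - j) m w * f a (m - j) w)"
      if "a \<le> d" "i \<in> I" "w \<in> D" "ex i > 0" "m \<ge> ex i" for a i m w
    proof -
      have ey: "ey i = 0" using one_sided[OF that(2)] that(4) by simp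
      show ?thesis unfolding f(3)[OF that(1-3,5)]
        by (rule sum_window_down) (use X_lower[OF that(2,3)] X_upper[OF that(2,3)] ey that(5) in auto)
    qed
  qed (rule f(1))
  qed
qed

end

context moments
begin

lemma enc_E: "w \<in> D \<Longrightarrow> enc w \<in> E"
  by (simp add: E_def)

lemma fundamentalI:
  assumes "\<And>i k. i \<le> d \<Longrightarrow> k \<le> d \<Longrightarrow> hol I E (\<phi> i k)"
    and "\<And>w i k. i \<le> d \<Longrightarrow> k \<le> d \<Longrightarrow> F w $$ (i, k) = \<phi> i k (enc w)"
    and "\<And>w. w \<in> D \<Longrightarrow> F w \<in> carrier_mat (d + 1) (d + 1) \<and> invertible_mat (F w)"
  shows "fundamental (d + 1) D F"
  unfolding fundamental_def
proof (intro conjI ballI allI impI)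
  fix i k assume "i < d + 1" "k < d + 1"
  then have ik: "i \<le> d" "k \<le> d" by auto
  have "continuous_on D (\<lambda>w. \<phi> i k (enc w))"
    by (rule continuous_on_compose2[OF hol_continuous[OF assms(1)[OF ik]] continuous_on_enc]) (use enc_E in auto)
  then show "continuous_on D (\<lambda>w. F w $$ (i, k))" by (simp add: assms(2)[OF ik])
qed (use assms(3) in auto)

text \<open>\<open>enc\<close> turns the update of one coefficient into the update of one
  coordinate, so \<open>pd\<close> yields the required entrywise derivative.\<close>

lemma u_partialI:
  assumes "\<And>i k. i \<le> d \<Longrightarrow> k \<le> d \<Longrightarrow> hol I E (\<phi> i k)"
    and "\<And>w i k. i \<le> d \<Longrightarrow> k \<le> d \<Longrightarrow> F w $$ (i, k) = \<phi> i k (enc w)"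
    and "w \<in> D" "K \<in> {1..d1 + 1}" "F' \<in> carrier_mat (d + 1) (d + 1)"
    and "\<And>i k. i \<le> d \<Longrightarrow> k \<le> d \<Longrightarrow> F' $$ (i, k) = pd (Inl K) (\<phi> i k) (enc w)"
  shows "has_u_partial (d + 1) F K w F'"
  unfolding has_u_partial_def
proof (intro conjI allI impI)
  fix i k assume "i < d + 1" "k < d + 1"
  then have ik: "i \<le> d" "k \<le> d" by auto
  have "Inl K \<in> I" using assms(4) unfolding coords_def by blast
  from hol_pd_DERIV[OF assms(1)[OF ik] enc_E[OF assms(3)] this]
  show "((\<lambda>z. F ((fst w)(K := z), snd w) $$ (i, k)) has_field_derivative F' $$ (i, k)) (at (fst w K))"
    by (simp add: assms(2)[OF ik] assms(6)[OF ik] enc_upd_u) (simp add: enc_def)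
qed (rule assms(5))

lemma v_partialI:
  assumes "\<And>i k. i \<le> d \<Longrightarrow> k \<le> d \<Longrightarrow> hol I E (\<phi> i k)"
    and "\<And>w i k. i \<le> d \<Longrightarrow> k \<le> d \<Longrightarrow> F w $$ (i, k) = \<phi> i k (enc w)"
    and "w \<in> D" "K \<in> {1..d2 + 1}" "F' \<in> carrier_mat (d + 1) (d + 1)"
    and "\<And>i k. i \<le> d \<Longrightarrow> k \<le> d \<Longrightarrow> F' $$ (i, k) = pd (Inr K) (\<phi> i k) (enc w)"
  shows "has_v_partial (d + 1) F K w F'"
  unfolding has_v_partial_def
proof (intro conjI allI impI)
  fix i k assume "i < d + 1" "k < d + 1"
  then have ik: "i \<le> d" "k \<le> d" by auto
  have "Inr K \<in> I" using assms(4) unfolding coords_def by blast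
  from hol_pd_DERIV[OF assms(1)[OF ik] enc_E[OF assms(3)] this]
  show "((\<lambda>z. F (fst w, (snd w)(K := z)) $$ (i, k)) has_field_derivative F' $$ (i, k)) (at (snd w K))"
    by (simp add: assms(2)[OF ik] assms(6)[OF ik] enc_upd_v) (simp add: enc_def)
qed (rule assms(5))

end

lemma uminus_mult_entry:
  fixes A B :: "complex mat"
  assumes "A \<in> carrier_mat n n" "B \<in> carrier_mat n n" "i < n" "k < n"
  shows "(- A * B) $$ (i, k) = - (A * B) $$ (i, k)"
  using assms by (simp add: mat_mult_entry sum_negf)

section \<open>The four systems\<close>

context two_matrix_model
begin

lemma coord_mem: "K \<in> {1..d1 + 1} \<Longrightarrow> Inl K \<in> I" "K \<in> {1..d2 + 1} \<Longrightarrow> Inr K \<in> I"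
  unfolding coords_def by blast+

lemma exps [simp]: "xexp (Inl K) = K" "xexp (Inr K) = 0" "yexp (Inl K) = 0" "yexp (Inr K) = K"
  by (simp_all add: xexp_def yexp_def)

text \<open>\<open>x\<close> is a fixed spectral value. The matrix of index \<open>N\<close> is the
  window starting at \<open>N - d2\<close>, which aligns the ladder of index \<open>N\<close> with
  row \<open>N\<close> of \<open>Q\<close>.\<close>

lemma case_Psi:
  "\<exists>\<Psi> :: nat \<Rightarrow> params \<Rightarrow> complex mat.
     (\<forall>N \<ge> d2 + 1. fundamental (d2 + 1) D (\<Psi> N)) \<and>
     (\<forall>w\<in>D. \<forall>N \<ge> d2 + 1.
        \<Psi> (N + 1) w = ladder d2 (\<alpha> w) N x * \<Psi> N w \<and>
        (\<forall>K\<in>{1..d1 + 1}.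
           has_u_partial (d2 + 1) (\<Psi> N) K w (U_Psi d1 d2 (\<alpha> w) (\<beta> w) K N x * \<Psi> N w)) \<and>
        (\<forall>J\<in>{1..d2 + 1}. N \<ge> d2 + J \<longrightarrow>
           has_v_partial (d2 + 1) (\<Psi> N) J w (- V_Psi d1 d2 (\<alpha> w) (\<beta> w) J N x * \<Psi> N w)))"
proof -
  interpret F: banded_biorthogonal_family I E J p s xexp yexp scale b d2 by (rule banded_x)
  have Q: "F.Q n m w = Q_mat d2 (\<alpha> (dec w)) n m" if "w \<in> E" for w n m using Q_x[OF that] by (simp add: F.Q_def)
  obtain f where f: "\<And>a m. a \<le> d2 \<Longrightarrow> hol I E (f a m)"
    "\<And>w. w \<in> E \<Longrightarrow> ladder_windows d2 (\<lambda>a m. f a m w) (\<alpha> (dec w)) x"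
    "\<And>a i m w. a \<le> d2 \<Longrightarrow> i \<in> I \<Longrightarrow> w \<in> E \<Longrightarrow> xexp i > 0 \<Longrightarrow>
      pd i (f a m) w = (\<Sum>j\<le>xexp i. F.X i m (m + j) w * f a (m + j) w)"
    "\<And>a i m w. a \<le> d2 \<Longrightarrow> i \<in> I \<Longrightarrow> w \<in> E \<Longrightarrow> yexp i > 0 \<Longrightarrow> m \<ge> yexp i \<Longrightarrow>
      pd i (f a m) w = (\<Sum>j\<le>yexp i. F.X i m (m - j) w * f a (m - j) w)"
    by (rule F.primal_windows[OF Q, where x = x]) (assumption, rule that)
  define \<Psi> where "\<Psi> = (\<lambda>N w. window d2 (\<lambda>a m. f a m (enc w)) (N - d2))"
  have hol: "hol I E (f k (N - d2 + i))" if "i \<le> d2" "k \<le> d2" for i k N by (rule f(1)) (use that in simp)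
  have entry: "\<Psi> N w $$ (i, k) = f k (N - d2 + i) (enc w)" if "i \<le> d2" "k \<le> d2" for i k N w
    unfolding \<Psi>_def window_entry[OF that] ..
  have car: "\<Psi> N w \<in> carrier_mat (d2 + 1) (d2 + 1)" for N w unfolding \<Psi>_def by (rule window_carrier)
  have L: "ladder_windows d2 (\<lambda>a m. f a m (enc w)) (\<alpha> w) x" if "w \<in> D" for w using f(2)[OF enc_E[OF that]] by simp
  show ?thesis
  proof (intro exI[of _ \<Psi>] conjI ballI allI impI)
    fix N assume "N \<ge> d2 + 1"
    show "fundamental (d2 + 1) D (\<Psi> N)"
    proof (rule fundamentalI[OF hol entry])
      fix w assume "w \<in> D"
      interpret W: ladder_windows d2 "\<lambda>a m. f a m (enc w)" "\<alpha> w" x by (rule L) fact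
      show "\<Psi> N w \<in> carrier_mat (d2 + 1) (d2 + 1) \<and> invertible_mat (\<Psi> N w)"
        using W.window_invertible car by (simp add: \<Psi>_def)
    qed
  next
    fix w N assume w: "w \<in> D" and N: "d2 + 1 \<le> N"
    interpret W: ladder_windows d2 "\<lambda>a m. f a m (enc w)" "\<alpha> w" x by (rule L[OF w])
    have N': "d2 \<le> N" using N by simp
    show "\<Psi> (N + 1) w = ladder d2 (\<alpha> w) N x * \<Psi> N w"
      using W.ladder_mult[of "N - d2"] N' by (simp add: \<Psi>_def Suc_diff_le)
    show "has_u_partial (d2 + 1) (\<Psi> N) K w (U_Psi d1 d2 (\<alpha> w) (\<beta> w) K N x * \<Psi> N w)" if K: "K \<in> {1..d1 + 1}" for K
    proof (rule u_partialI[OF hol entry w K])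
      have K0: "0 < xexp (Inl K)" "K \<ge> 1" using K by auto
      show "U_Psi d1 d2 (\<alpha> w) (\<beta> w) K N x * \<Psi> N w \<in> carrier_mat (d2 + 1) (d2 + 1)"
        unfolding U_Psi_def by (rule mult_carrier_mat[OF mat_sum_carrier car])
      fix i k assume i: "i \<le> d2" and k: "k \<le> d2"
      show "(U_Psi d1 d2 (\<alpha> w) (\<beta> w) K N x * \<Psi> N w) $$ (i, k) = pd (Inl K) (f k (N - d2 + i)) (enc w)"
        unfolding U_Psi_def \<Psi>_def W.up_sum[OF N' i k] f(3)[OF k coord_mem(1)[OF K] enc_E[OF w] K0(1)] exps
          X_x(1)[OF enc_E[OF w] K0(2)] dec_enc ..
    qed
    show "has_v_partial (d2 + 1) (\<Psi> N) K w (- V_Psi d1 d2 (\<alpha> w) (\<beta> w) K N x * \<Psi> N w)"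
      if K: "K \<in> {1..d2 + 1}" and NK: "N \<ge> d2 + K" for K
    proof (rule v_partialI[OF hol entry w K])
      have K0: "0 < yexp (Inr K)" "K \<ge> 1" using K by auto
      have V: "V_Psi d1 d2 (\<alpha> w) (\<beta> w) K N x \<in> carrier_mat (d2 + 1) (d2 + 1)"
        unfolding V_Psi_def by (rule mat_sum_carrier)
      show "- V_Psi d1 d2 (\<alpha> w) (\<beta> w) K N x * \<Psi> N w \<in> carrier_mat (d2 + 1) (d2 + 1)"
        by (rule mult_carrier_mat[OF uminus_carrier_mat[OF V] car])
      fix i k assume i: "i \<le> d2" and k: "k \<le> d2"
      \<comment> \<open>\<open>N \<ge> d2 + K\<close> keeps the reach of the deformation at
        nonnegative indices; the same bound makes all inverse ladders in \<open>V_Psi\<close>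
        available.\<close>
      have m: "yexp (Inr K) \<le> N - d2 + i" using NK by simp
      have "(- V_Psi d1 d2 (\<alpha> w) (\<beta> w) K N x * \<Psi> N w) $$ (i, k) = - (V_Psi d1 d2 (\<alpha> w) (\<beta> w) K N x * \<Psi> N w) $$ (i, k)"
        by (rule uminus_mult_entry[OF V car]) (use i k in auto)
      also have "\<dots> = pd (Inr K) (f k (N - d2 + i)) (enc w)"
        unfolding V_Psi_def \<Psi>_def W.down_sum[OF NK i k] f(4)[OF k coord_mem(2)[OF K] enc_E[OF w] K0(1) m] exps
          X_x(2)[OF enc_E[OF w]] dec_enc mult_minus_left sum_negf ..
      finally show "(- V_Psi d1 d2 (\<alpha> w) (\<beta> w) K N x * \<Psi> N w) $$ (i, k) = pd (Inr K) (f k (N - d2 + i)) (enc w)" .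
    qed
  qed
qed

text \<open>The exchanged pairing gives the same construction with \<open>\<beta>\<close> and
  \<open>d1\<close>; now the parameters \<open>v\<close> step up and the parameters \<open>u\<close>
  step down.\<close>

lemma case_Phi:
  "\<exists>\<Phi> :: nat \<Rightarrow> params \<Rightarrow> complex mat.
     (\<forall>N \<ge> d1 + 1. fundamental (d1 + 1) D (\<Phi> N)) \<and>
     (\<forall>w\<in>D. \<forall>N \<ge> d1 + 1.
        \<Phi> (N + 1) w = ladder d1 (\<beta> w) N y * \<Phi> N w \<and>
        (\<forall>K\<in>{1..d1 + 1}. N \<ge> d1 + K \<longrightarrow>
           has_u_partial (d1 + 1) (\<Phi> N) K w (- U_Phi d1 d2 (\<alpha> w) (\<beta> w) K N y * \<Phi> N w)) \<and>
        (\<forall>J\<in>{1..d2 + 1}.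
           has_v_partial (d1 + 1) (\<Phi> N) J w (V_Phi d1 d2 (\<alpha> w) (\<beta> w) J N y * \<Phi> N w)))"
proof -
  interpret F: banded_biorthogonal_family I E "\<lambda>w f g. J w g f" s p yexp xexp scale b d1 by (rule banded_y)
  have Q: "F.Q n m w = Q_mat d1 (\<beta> (dec w)) n m" if "w \<in> E" for w n m using Q_y[OF that] by (simp add: F.Q_def)
  obtain f where f: "\<And>a m. a \<le> d1 \<Longrightarrow> hol I E (f a m)"
    "\<And>w. w \<in> E \<Longrightarrow> ladder_windows d1 (\<lambda>a m. f a m w) (\<beta> (dec w)) y"
    "\<And>a i m w. a \<le> d1 \<Longrightarrow> i \<in> I \<Longrightarrow> w \<in> E \<Longrightarrow> yexp i > 0 \<Longrightarrow>
      pd i (f a m) w = (\<Sum>j\<le>yexp i. F.X i m (m + j) w * f a (m + j) w)"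
    "\<And>a i m w. a \<le> d1 \<Longrightarrow> i \<in> I \<Longrightarrow> w \<in> E \<Longrightarrow> xexp i > 0 \<Longrightarrow> m \<ge> xexp i \<Longrightarrow>
      pd i (f a m) w = (\<Sum>j\<le>xexp i. F.X i m (m - j) w * f a (m - j) w)"
    by (rule F.primal_windows[OF Q, where x = y]) (assumption, rule that)
  define \<Phi> where "\<Phi> = (\<lambda>N w. window d1 (\<lambda>a m. f a m (enc w)) (N - d1))"
  have hol: "hol I E (f k (N - d1 + i))" if "i \<le> d1" "k \<le> d1" for i k N by (rule f(1)) (use that in simp)
  have entry: "\<Phi> N w $$ (i, k) = f k (N - d1 + i) (enc w)" if "i \<le> d1" "k \<le> d1" for i k N w
    unfolding \<Phi>_def window_entry[OF that] ..
  have car: "\<Phi> N w \<in> carrier_mat (d1 + 1) (d1 + 1)" for N w unfolding \<Phi>_def by (rule window_carrier)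
  have L: "ladder_windows d1 (\<lambda>a m. f a m (enc w)) (\<beta> w) y" if "w \<in> D" for w using f(2)[OF enc_E[OF that]] by simp
  show ?thesis
  proof (intro exI[of _ \<Phi>] conjI ballI allI impI)
    fix N assume "N \<ge> d1 + 1"
    show "fundamental (d1 + 1) D (\<Phi> N)"
    proof (rule fundamentalI[OF hol entry])
      fix w assume "w \<in> D"
      interpret W: ladder_windows d1 "\<lambda>a m. f a m (enc w)" "\<beta> w" y by (rule L) fact
      show "\<Phi> N w \<in> carrier_mat (d1 + 1) (d1 + 1) \<and> invertible_mat (\<Phi> N w)"
        using W.window_invertible car by (simp add: \<Phi>_def)
    qed
  next
    fix w N assume w: "w \<in> D" and N: "d1 + 1 \<le> N"
    interpret W: ladder_windows d1 "\<lambda>a m. f a m (enc w)" "\<beta> w" y by (rule L[OF w])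
    have N': "d1 \<le> N" using N by simp
    show "\<Phi> (N + 1) w = ladder d1 (\<beta> w) N y * \<Phi> N w"
      using W.ladder_mult[of "N - d1"] N' by (simp add: \<Phi>_def Suc_diff_le)
    show "has_u_partial (d1 + 1) (\<Phi> N) K w (- U_Phi d1 d2 (\<alpha> w) (\<beta> w) K N y * \<Phi> N w)"
      if K: "K \<in> {1..d1 + 1}" and NK: "N \<ge> d1 + K" for K
    proof (rule u_partialI[OF hol entry w K])
      have K0: "0 < xexp (Inl K)" "K \<ge> 1" using K by auto
      have U: "U_Phi d1 d2 (\<alpha> w) (\<beta> w) K N y \<in> carrier_mat (d1 + 1) (d1 + 1)"
        unfolding U_Phi_def by (rule mat_sum_carrier)
      show "- U_Phi d1 d2 (\<alpha> w) (\<beta> w) K N y * \<Phi> N w \<in> carrier_mat (d1 + 1) (d1 + 1)"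
        by (rule mult_carrier_mat[OF uminus_carrier_mat[OF U] car])
      fix i k assume i: "i \<le> d1" and k: "k \<le> d1"
      have m: "xexp (Inl K) \<le> N - d1 + i" using NK by simp
      have e: "N - j - d1 = N - d1 - j" for j by simp
      have "(- U_Phi d1 d2 (\<alpha> w) (\<beta> w) K N y * \<Phi> N w) $$ (i, k) = - (U_Phi d1 d2 (\<alpha> w) (\<beta> w) K N y * \<Phi> N w) $$ (i, k)"
        by (rule uminus_mult_entry[OF U car]) (use i k in auto)
      also have "\<dots> = pd (Inl K) (f k (N - d1 + i)) (enc w)"
        unfolding U_Phi_def \<Phi>_def e W.down_sum[OF NK i k] f(4)[OF k coord_mem(1)[OF K] enc_E[OF w] K0(1) m] exps
          X_y(2)[OF enc_E[OF w]] dec_enc mult_minus_left sum_negf ..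
      finally show "(- U_Phi d1 d2 (\<alpha> w) (\<beta> w) K N y * \<Phi> N w) $$ (i, k) = pd (Inl K) (f k (N - d1 + i)) (enc w)" .
    qed
    show "has_v_partial (d1 + 1) (\<Phi> N) K w (V_Phi d1 d2 (\<alpha> w) (\<beta> w) K N y * \<Phi> N w)" if K: "K \<in> {1..d2 + 1}" for K
    proof (rule v_partialI[OF hol entry w K])
      have K0: "0 < yexp (Inr K)" "K \<ge> 1" using K by auto
      show "V_Phi d1 d2 (\<alpha> w) (\<beta> w) K N y * \<Phi> N w \<in> carrier_mat (d1 + 1) (d1 + 1)"
        unfolding V_Phi_def by (rule mult_carrier_mat[OF mat_sum_carrier car])
      fix i k assume i: "i \<le> d1" and k: "k \<le> d1"
      show "(V_Phi d1 d2 (\<alpha> w) (\<beta> w) K N y * \<Phi> N w) $$ (i, k) = pd (Inr K) (f k (N - d1 + i)) (enc w)"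
        unfolding V_Phi_def \<Phi>_def W.up_sum[OF N' i k] f(3)[OF k coord_mem(2)[OF K] enc_E[OF w] K0(1)] exps
          X_y(1)[OF enc_E[OF w] K0(2)] dec_enc ..
    qed
  qed
qed

text \<open>The first column relation already involves index 0, so dual windows exist at every
  index. On the dual side the parameters \<open>v\<close> step up.\<close>

lemma case_Phi_dual:
  "\<exists>\<Phi> :: nat \<Rightarrow> params \<Rightarrow> complex mat.
     (\<forall>n. fundamental (d2 + 1) D (\<Phi> n)) \<and>
     (\<forall>w\<in>D. \<forall>N \<ge> 1.
        \<Phi> (N - 1) w = \<Phi> N w * dual_ladder d2 (\<alpha> w) N x \<and>
        (\<forall>K\<in>{1..d1 + 1}. N \<ge> K + 1 \<longrightarrow>
           has_u_partial (d2 + 1) (\<Phi> (N - 1)) K w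
             (- (\<Phi> (N - 1) w * U_Phi_dual d1 d2 (\<alpha> w) (\<beta> w) K N x))) \<and>
        (\<forall>J\<in>{1..d2 + 1}.
           has_v_partial (d2 + 1) (\<Phi> (N - 1)) J w
             (\<Phi> (N - 1) w * V_Phi_dual d1 d2 (\<alpha> w) (\<beta> w) J N x)))"
proof -
  interpret F: banded_biorthogonal_family I E J p s xexp yexp scale b d2 by (rule banded_x)
  have Q: "F.Q n m w = Q_mat d2 (\<alpha> (dec w)) n m" if "w \<in> E" for w n m using Q_x[OF that] by (simp add: F.Q_def)
  obtain f where f: "\<And>a m. a \<le> d2 \<Longrightarrow> hol I E (f a m)"
    "\<And>w. w \<in> E \<Longrightarrow> dual_ladder_windows d2 (\<lambda>a m. f a m w) (\<alpha> (dec w)) x"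
    "\<And>a i m w. a \<le> d2 \<Longrightarrow> i \<in> I \<Longrightarrow> w \<in> E \<Longrightarrow> yexp i > 0 \<Longrightarrow>
      pd i (f a m) w = (\<Sum>j\<le>yexp i. - F.X i (m + j) m w * f a (m + j) w)"
    "\<And>a i m w. a \<le> d2 \<Longrightarrow> i \<in> I \<Longrightarrow> w \<in> E \<Longrightarrow> xexp i > 0 \<Longrightarrow> m \<ge> xexp i \<Longrightarrow>
      pd i (f a m) w = (\<Sum>j\<le>xexp i. - F.X i (m - j) m w * f a (m - j) w)"
    by (rule F.dual_windows[OF Q, where x = x]) (assumption, rule that)
  define \<Phi> where "\<Phi> = (\<lambda>N w. dual_window d2 (\<lambda>a m. f a m (enc w)) N)"
  have hol: "hol I E (f i (N + k))" if "i \<le> d2" "k \<le> d2" for i k N by (rule f(1)) (use that in simp)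
  have entry: "\<Phi> N w $$ (i, k) = f i (N + k) (enc w)" if "i \<le> d2" "k \<le> d2" for i k N w
    unfolding \<Phi>_def dual_window_entry[OF that(2,1)] ..
  have car: "\<Phi> N w \<in> carrier_mat (d2 + 1) (d2 + 1)" for N w unfolding \<Phi>_def by (rule dual_window_carrier)
  have L: "dual_ladder_windows d2 (\<lambda>a m. f a m (enc w)) (\<alpha> w) x" if "w \<in> D" for w using f(2)[OF enc_E[OF that]] by simp
  show ?thesis
  proof (intro exI[of _ \<Phi>] conjI ballI allI impI)
    fix N
    show "fundamental (d2 + 1) D (\<Phi> N)"
    proof (rule fundamentalI[OF hol entry])
      fix w assume "w \<in> D"
      interpret W: dual_ladder_windows d2 "\<lambda>a m. f a m (enc w)" "\<alpha> w" x by (rule L) fact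
      show "\<Phi> N w \<in> carrier_mat (d2 + 1) (d2 + 1) \<and> invertible_mat (\<Phi> N w)"
        using W.dual_window_invertible car by (simp add: \<Phi>_def)
    qed
  next
    fix w and N :: nat assume w: "w \<in> D" and N: "1 \<le> N"
    interpret W: dual_ladder_windows d2 "\<lambda>a m. f a m (enc w)" "\<alpha> w" x by (rule L[OF w])
    show "\<Phi> (N - 1) w = \<Phi> N w * dual_ladder d2 (\<alpha> w) N x"
      using W.dual_ladder_mult[of "N - 1"] N by (simp add: \<Phi>_def)
    show "has_v_partial (d2 + 1) (\<Phi> (N - 1)) K w (\<Phi> (N - 1) w * V_Phi_dual d1 d2 (\<alpha> w) (\<beta> w) K N x)" if K: "K \<in> {1..d2 + 1}" for K
    proof (rule v_partialI[OF hol entry w K])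
      have K0: "0 < yexp (Inr K)" using K by auto
      show "\<Phi> (N - 1) w * V_Phi_dual d1 d2 (\<alpha> w) (\<beta> w) K N x \<in> carrier_mat (d2 + 1) (d2 + 1)"
        unfolding V_Phi_dual_def by (rule mult_carrier_mat[OF car mat_sum_carrier])
      fix i k assume i: "i \<le> d2" and k: "k \<le> d2"
      show "(\<Phi> (N - 1) w * V_Phi_dual d1 d2 (\<alpha> w) (\<beta> w) K N x) $$ (i, k) = pd (Inr K) (f i (N - 1 + k)) (enc w)"
        unfolding V_Phi_dual_def \<Phi>_def W.dual_up_sum[OF N k i] f(3)[OF i coord_mem(2)[OF K] enc_E[OF w] K0] exps
          X_x(2)[OF enc_E[OF w]] dec_enc minus_minus ..
    qed
    show "has_u_partial (d2 + 1) (\<Phi> (N - 1)) K w (- (\<Phi> (N - 1) w * U_Phi_dual d1 d2 (\<alpha> w) (\<beta> w) K N x))"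
      if K: "K \<in> {1..d1 + 1}" and NK: "N \<ge> K + 1" for K
    proof (rule u_partialI[OF hol entry w K])
      have K0: "0 < xexp (Inl K)" "K \<ge> 1" using K by auto
      have P: "\<Phi> (N - 1) w * U_Phi_dual d1 d2 (\<alpha> w) (\<beta> w) K N x \<in> carrier_mat (d2 + 1) (d2 + 1)"
        unfolding U_Phi_dual_def by (rule mult_carrier_mat[OF car mat_sum_carrier])
      then show "- (\<Phi> (N - 1) w * U_Phi_dual d1 d2 (\<alpha> w) (\<beta> w) K N x) \<in> carrier_mat (d2 + 1) (d2 + 1)"
        by (rule uminus_carrier_mat)
      fix i k assume i: "i \<le> d2" and k: "k \<le> d2"
      have m: "xexp (Inl K) \<le> N - 1 + k" using NK by simp
      have "(- (\<Phi> (N - 1) w * U_Phi_dual d1 d2 (\<alpha> w) (\<beta> w) K N x)) $$ (i, k) = - (\<Phi> (N - 1) w * U_Phi_dual d1 d2 (\<alpha> w) (\<beta> w) K N x) $$ (i, k)"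
        by (rule index_uminus_mat) (use i k carrier_matD[OF P] in auto)
      also have "\<dots> = pd (Inl K) (f i (N - 1 + k)) (enc w)"
        unfolding U_Phi_dual_def \<Phi>_def W.dual_down_sum[OF NK k i] f(4)[OF i coord_mem(1)[OF K] enc_E[OF w] K0(1) m] exps
          X_x(1)[OF enc_E[OF w] K0(2)] dec_enc mult_minus_left sum_negf ..
      finally show "(- (\<Phi> (N - 1) w * U_Phi_dual d1 d2 (\<alpha> w) (\<beta> w) K N x)) $$ (i, k) = pd (Inl K) (f i (N - 1 + k)) (enc w)" .
    qed
  qed
qed

text \<open>Columns of the exchanged family: transposition and exchange each reverse the direction,
  so the parameters \<open>u\<close> step up again.\<close>

lemma case_Psi_dual:
  "\<exists>\<Psi> :: nat \<Rightarrow> params \<Rightarrow> complex mat.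
     (\<forall>n. fundamental (d1 + 1) D (\<Psi> n)) \<and>
     (\<forall>w\<in>D. \<forall>N \<ge> 1.
        \<Psi> (N - 1) w = \<Psi> N w * dual_ladder d1 (\<beta> w) N y \<and>
        (\<forall>K\<in>{1..d1 + 1}.
           has_u_partial (d1 + 1) (\<Psi> (N - 1)) K w
             (\<Psi> (N - 1) w * U_Psi_dual d1 d2 (\<alpha> w) (\<beta> w) K N y)) \<and>
        (\<forall>J\<in>{1..d2 + 1}. N \<ge> J + 1 \<longrightarrow>
           has_v_partial (d1 + 1) (\<Psi> (N - 1)) J w
             (- (\<Psi> (N - 1) w * V_Psi_dual d1 d2 (\<alpha> w) (\<beta> w) J N y))))"
proof -
  interpret F: banded_biorthogonal_family I E "\<lambda>w f g. J w g f" s p yexp xexp scale b d1 by (rule banded_y)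
  have Q: "F.Q n m w = Q_mat d1 (\<beta> (dec w)) n m" if "w \<in> E" for w n m using Q_y[OF that] by (simp add: F.Q_def)
  obtain f where f: "\<And>a m. a \<le> d1 \<Longrightarrow> hol I E (f a m)"
    "\<And>w. w \<in> E \<Longrightarrow> dual_ladder_windows d1 (\<lambda>a m. f a m w) (\<beta> (dec w)) y"
    "\<And>a i m w. a \<le> d1 \<Longrightarrow> i \<in> I \<Longrightarrow> w \<in> E \<Longrightarrow> xexp i > 0 \<Longrightarrow>
      pd i (f a m) w = (\<Sum>j\<le>xexp i. - F.X i (m + j) m w * f a (m + j) w)"
    "\<And>a i m w. a \<le> d1 \<Longrightarrow> i \<in> I \<Longrightarrow> w \<in> E \<Longrightarrow> yexp i > 0 \<Longrightarrow> m \<ge> yexp i \<Longrightarrow>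
      pd i (f a m) w = (\<Sum>j\<le>yexp i. - F.X i (m - j) m w * f a (m - j) w)"
    by (rule F.dual_windows[OF Q, where x = y]) (assumption, rule that)
  define \<Psi> where "\<Psi> = (\<lambda>N w. dual_window d1 (\<lambda>a m. f a m (enc w)) N)"
  have hol: "hol I E (f i (N + k))" if "i \<le> d1" "k \<le> d1" for i k N by (rule f(1)) (use that in simp)
  have entry: "\<Psi> N w $$ (i, k) = f i (N + k) (enc w)" if "i \<le> d1" "k \<le> d1" for i k N w
    unfolding \<Psi>_def dual_window_entry[OF that(2,1)] ..
  have car: "\<Psi> N w \<in> carrier_mat (d1 + 1) (d1 + 1)" for N w unfolding \<Psi>_def by (rule dual_window_carrier)
  have L: "dual_ladder_windows d1 (\<lambda>a m. f a m (enc w)) (\<beta> w) y" if "w \<in> D" for w using f(2)[OF enc_E[OF that]] by simp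
  show ?thesis
  proof (intro exI[of _ \<Psi>] conjI ballI allI impI)
    fix N
    show "fundamental (d1 + 1) D (\<Psi> N)"
    proof (rule fundamentalI[OF hol entry])
      fix w assume "w \<in> D"
      interpret W: dual_ladder_windows d1 "\<lambda>a m. f a m (enc w)" "\<beta> w" y by (rule L) fact
      show "\<Psi> N w \<in> carrier_mat (d1 + 1) (d1 + 1) \<and> invertible_mat (\<Psi> N w)"
        using W.dual_window_invertible car by (simp add: \<Psi>_def)
    qed
  next
    fix w and N :: nat assume w: "w \<in> D" and N: "1 \<le> N"
    interpret W: dual_ladder_windows d1 "\<lambda>a m. f a m (enc w)" "\<beta> w" y by (rule L[OF w])
    show "\<Psi> (N - 1) w = \<Psi> N w * dual_ladder d1 (\<beta> w) N y"
      using W.dual_ladder_mult[of "N - 1"] N by (simp add: \<Psi>_def)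
    show "has_u_partial (d1 + 1) (\<Psi> (N - 1)) K w (\<Psi> (N - 1) w * U_Psi_dual d1 d2 (\<alpha> w) (\<beta> w) K N y)" if K: "K \<in> {1..d1 + 1}" for K
    proof (rule u_partialI[OF hol entry w K])
      have K0: "0 < xexp (Inl K)" using K by auto
      show "\<Psi> (N - 1) w * U_Psi_dual d1 d2 (\<alpha> w) (\<beta> w) K N y \<in> carrier_mat (d1 + 1) (d1 + 1)"
        unfolding U_Psi_dual_def by (rule mult_carrier_mat[OF car mat_sum_carrier])
      fix i k assume i: "i \<le> d1" and k: "k \<le> d1"
      show "(\<Psi> (N - 1) w * U_Psi_dual d1 d2 (\<alpha> w) (\<beta> w) K N y) $$ (i, k) = pd (Inl K) (f i (N - 1 + k)) (enc w)"
        unfolding U_Psi_dual_def \<Psi>_def W.dual_up_sum[OF N k i] f(3)[OF i coord_mem(1)[OF K] enc_E[OF w] K0] exps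
          X_y(2)[OF enc_E[OF w]] dec_enc minus_minus ..
    qed
    show "has_v_partial (d1 + 1) (\<Psi> (N - 1)) K w (- (\<Psi> (N - 1) w * V_Psi_dual d1 d2 (\<alpha> w) (\<beta> w) K N y))"
      if K: "K \<in> {1..d2 + 1}" and NK: "N \<ge> K + 1" for K
    proof (rule v_partialI[OF hol entry w K])
      have K0: "0 < yexp (Inr K)" "K \<ge> 1" using K by auto
      have P: "\<Psi> (N - 1) w * V_Psi_dual d1 d2 (\<alpha> w) (\<beta> w) K N y \<in> carrier_mat (d1 + 1) (d1 + 1)"
        unfolding V_Psi_dual_def by (rule mult_carrier_mat[OF car mat_sum_carrier])
      then show "- (\<Psi> (N - 1) w * V_Psi_dual d1 d2 (\<alpha> w) (\<beta> w) K N y) \<in> carrier_mat (d1 + 1) (d1 + 1)"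
        by (rule uminus_carrier_mat)
      fix i k assume i: "i \<le> d1" and k: "k \<le> d1"
      have m: "yexp (Inr K) \<le> N - 1 + k" using NK by simp
      have "(- (\<Psi> (N - 1) w * V_Psi_dual d1 d2 (\<alpha> w) (\<beta> w) K N y)) $$ (i, k) = - (\<Psi> (N - 1) w * V_Psi_dual d1 d2 (\<alpha> w) (\<beta> w) K N y) $$ (i, k)"
        by (rule index_uminus_mat) (use i k carrier_matD[OF P] in auto)
      also have "\<dots> = pd (Inr K) (f i (N - 1 + k)) (enc w)"
        unfolding V_Psi_dual_def \<Psi>_def W.dual_down_sum[OF NK k i] f(4)[OF i coord_mem(2)[OF K] enc_E[OF w] K0(1) m] exps
          X_y(1)[OF enc_E[OF w] K0(2)] dec_enc mult_minus_left sum_negf ..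
      finally show "(- (\<Psi> (N - 1) w * V_Psi_dual d1 d2 (\<alpha> w) (\<beta> w) K N y)) $$ (i, k) = pd (Inr K) (f i (N - 1 + k)) (enc w)" .
    qed
  qed
qed

end

text \<open>Compatibility is expressed by simultaneous fundamental solutions for every fixed
  spectral value. The lower bounds on \<open>N\<close> in four of the equations are those under
  which every ladder matrix in them is defined.\<close>

theorem proposition3p2:
  fixes d1 d2 :: nat
    and \<Gamma>x \<Gamma>y :: "real \<Rightarrow> complex"
    and D :: "params set"
    and \<pi> \<sigma> :: "params \<Rightarrow> nat \<Rightarrow> complex poly"
    and h r :: "params \<Rightarrow> nat \<Rightarrow> complex"
    and \<alpha> \<beta> :: "params \<Rightarrow> int \<Rightarrow> nat \<Rightarrow> complex"
  assumes "d1 \<ge> 1" and "d2 \<ge> 1"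
    and "param_domain d1 d2 D"
    and "contour \<Gamma>x" and "contour \<Gamma>y"
    and "\<And>w. w \<in> D \<Longrightarrow> convergent_integrals d1 d2 \<Gamma>x \<Gamma>y w"
    and "\<And>w. w \<in> D \<Longrightarrow> no_boundary_terms d1 d2 \<Gamma>x \<Gamma>y w"
    and "\<And>w. w \<in> D \<Longrightarrow> monic_biorthogonal d1 d2 \<Gamma>x \<Gamma>y w (\<pi> w) (\<sigma> w) (h w)"
    and "\<And>w n. w \<in> D \<Longrightarrow> (r w n)\<^sup>2 = h w n"
    and "\<And>n. continuous_on D (\<lambda>w. r w n)"
    and "\<And>w. w \<in> D \<Longrightarrow> recursion_coeffs d1 d2 (quasi_poly d1 w (\<pi> w) (r w)) (r w) (\<alpha> w) (\<beta> w)"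
  shows
    "(\<forall>x. \<exists>\<Psi> :: nat \<Rightarrow> params \<Rightarrow> complex mat.
       (\<forall>N \<ge> d2 + 1. fundamental (d2 + 1) D (\<Psi> N)) \<and>
       (\<forall>w\<in>D. \<forall>N \<ge> d2 + 1.
          \<Psi> (N + 1) w = ladder d2 (\<alpha> w) N x * \<Psi> N w \<and>
          (\<forall>K\<in>{1..d1 + 1}.
             has_u_partial (d2 + 1) (\<Psi> N) K w (U_Psi d1 d2 (\<alpha> w) (\<beta> w) K N x * \<Psi> N w)) \<and>
          (\<forall>J\<in>{1..d2 + 1}. N \<ge> d2 + J \<longrightarrow>
             has_v_partial (d2 + 1) (\<Psi> N) J w (- V_Psi d1 d2 (\<alpha> w) (\<beta> w) J N x * \<Psi> N w)))) \<and>
     (\<forall>y. \<exists>\<Psi> :: nat \<Rightarrow> params \<Rightarrow> complex mat.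
       (\<forall>n. fundamental (d1 + 1) D (\<Psi> n)) \<and>
       (\<forall>w\<in>D. \<forall>N \<ge> 1.
          \<Psi> (N - 1) w = \<Psi> N w * dual_ladder d1 (\<beta> w) N y \<and>
          (\<forall>K\<in>{1..d1 + 1}.
             has_u_partial (d1 + 1) (\<Psi> (N - 1)) K w
               (\<Psi> (N - 1) w * U_Psi_dual d1 d2 (\<alpha> w) (\<beta> w) K N y)) \<and>
          (\<forall>J\<in>{1..d2 + 1}. N \<ge> J + 1 \<longrightarrow>
             has_v_partial (d1 + 1) (\<Psi> (N - 1)) J w
               (- (\<Psi> (N - 1) w * V_Psi_dual d1 d2 (\<alpha> w) (\<beta> w) J N y))))) \<and>
     (\<forall>y. \<exists>\<Phi> :: nat \<Rightarrow> params \<Rightarrow> complex mat.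
       (\<forall>N \<ge> d1 + 1. fundamental (d1 + 1) D (\<Phi> N)) \<and>
       (\<forall>w\<in>D. \<forall>N \<ge> d1 + 1.
          \<Phi> (N + 1) w = ladder d1 (\<beta> w) N y * \<Phi> N w \<and>
          (\<forall>K\<in>{1..d1 + 1}. N \<ge> d1 + K \<longrightarrow>
             has_u_partial (d1 + 1) (\<Phi> N) K w (- U_Phi d1 d2 (\<alpha> w) (\<beta> w) K N y * \<Phi> N w)) \<and>
          (\<forall>J\<in>{1..d2 + 1}.
             has_v_partial (d1 + 1) (\<Phi> N) J w (V_Phi d1 d2 (\<alpha> w) (\<beta> w) J N y * \<Phi> N w)))) \<and>
     (\<forall>x. \<exists>\<Phi> :: nat \<Rightarrow> params \<Rightarrow> complex mat.
       (\<forall>n. fundamental (d2 + 1) D (\<Phi> n)) \<and>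
       (\<forall>w\<in>D. \<forall>N \<ge> 1.
          \<Phi> (N - 1) w = \<Phi> N w * dual_ladder d2 (\<alpha> w) N x \<and>
          (\<forall>K\<in>{1..d1 + 1}. N \<ge> K + 1 \<longrightarrow>
             has_u_partial (d2 + 1) (\<Phi> (N - 1)) K w
               (- (\<Phi> (N - 1) w * U_Phi_dual d1 d2 (\<alpha> w) (\<beta> w) K N x))) \<and>
          (\<forall>J\<in>{1..d2 + 1}.
             has_v_partial (d2 + 1) (\<Phi> (N - 1)) J w
               (\<Phi> (N - 1) w * V_Phi_dual d1 d2 (\<alpha> w) (\<beta> w) J N x))))"
proof -
  interpret two_matrix_model d1 d2 \<Gamma>x \<Gamma>y D \<pi> \<sigma> h r \<alpha> \<beta>
    by unfold_locales (use assms in auto)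
  show ?thesis using case_Psi case_Psi_dual case_Phi case_Phi_dual by blast
qed

end
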